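(* Let $k\in\mathbb{N}_0$ and let $(X_t)_{t\in\Theta}$ be a measurable centred second-order random field with covariance kernel $\gamma_X\in C^{k,k}(\overline\Theta\times\overline\Theta)$. Let $\{(\lambda_{j,k},e_{j,k})\}_j$ denote the eigensystem of the associated kernel operator $T_{\gamma_X,k}\in N(H^k)$. Then $X=(X_t)_{t\in\Theta}$ is an $H^k(\Theta)$-valued random element and, for $|\alpha|\le k$, $$\lim_{m\to\infty}\ \sup_{t\in\Theta}\ \mathbb{E}\Big|X_t^{(\alpha)}-\sum_{j\le m}\langle X,e_{j,k}\rangle_{H^k}\,e_{j,k}^{[\alpha]}(t)\Big|^2=0.$$
   Context: $(\Omega,\mathcal{A},\mathbb{P})$ is a complete probability space; $d\in\mathbb{N}$ and $\Theta\subset\mathbb{R}^d$ is a bounded domain, meaning a bounded open subset. All functions are real-valued; $\alpha,\beta\in\mathbb{N}_0^d$ are multi-indices. $f^{(\alpha)}$ is the weak and $f^{[\alpha]}$ the classical derivative. $\partial^{[\alpha,\beta]}h$ is the classical mixed derivative of a kernel $h$ on $\Theta\times\Theta$, of order $\alpha$ in the first variable and $\beta$ in the second. $C^{k,k}(\overline\Theta\times\overline\Theta)$ is the class of uniformly continuous kernels $h\colon\Theta\times\Theta\to\mathbb{R}$ whose mixed partial derivatives $\partial^{[\alpha,\beta]}h$ exist and are uniformly continuous on $\Theta\times\Theta$ for $|\alpha|,|\beta|\le k$. $H^k(\Theta)$ is the $L^2$-based Sobolev space with inner product $\langle f,g\rangle_{H^k}=\sum_{|\alpha|\le k}\langle f^{(\alpha)},g^{(\alpha)}\rangle_{L^2}$.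 $N(H^k)$ denotes the nuclear operators on $H^k(\Theta)$. The kernel operator of order $k$ associated with $h\in C^{k,k}(\overline\Theta\times\overline\Theta)$ is $T_{h,k}\colon H^k(\Theta)\to H^k(\Theta)$, $$[T_{h,k}f](y)=\int_\Theta\sum_{|\alpha|\le k}\partial^{[\alpha,0]}h(x,y)\,f^{(\alpha)}(x)\,dx .$$ For positive definite $h$ (such as a covariance kernel) its eigensystem consists of the non-zero eigenvalues $\lambda_{j,k}$, counted with multiplicity and in descending order, with corresponding $H^k$-orthonormal eigenfunctions $e_{j,k}$, which have (and are identified with) representatives in $C^k(\Theta)$ with uniformly continuous derivatives of order $\le k$. The index $j$ runs over $\mathbb{N}$, or over $\{1,\dots,N\}$ if $N=\mathrm{rank}(T_{h,k})<\infty$. A random field $(X_t)_{t\in\Theta}$ is measurable if $(t,\omega)\mapsto X_t(\omega)$ is $\mathcal{B}(\Theta)\otimes\mathcal{A}$-measurable, second-order if $\mathrm{Var}(X_t)<\infty$ for all $t$, and centred if $\mathbb{E}[X_t]=0$ for all $t$; $\gamma_X(s,t)=\mathrm{Cov}(X_s,X_t)$. That $X=(X_t)_{t\in\Theta}$ is an $H^k(\Theta)$-valued random element means that almost all sample paths lie in $H^k(\Theta)$ and that $\omega\mapsto X(\omega)=(X_t(\omega))_{t\in\Theta}$ (suitably redefined on a null set) is $\mathcal{A}$-$\mathcal{B}(H^k)$-measurable. $(X_t^{(\alpha)})_{t\in\Theta}$, $|\alpha|\le k$, denotes the weak derivative process: a measurable process with sample paths in $L^2(\Theta)$ (after redefinition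 on the $\mathbb{P}$-null set where square-integrability fails) such that $\int_\Theta X_t\,\varphi^{[\alpha]}(t)\,dt=(-1)^{|\alpha|}\int_\Theta X_t^{(\alpha)}\varphi(t)\,dt$ a.s. for all $\varphi\in C_c^\infty(\Theta)$.
   Formalization: The weak derivative process is fixed by its definition only for almost every t, so the limit of the sup over all t can fail (alter it at one t). It is taken here to be its mean-square continuous version, which is proved to exist and to be X itself for α = 0. *)

theory Defs
  imports "HOL-Probability.Probability"
begin

text \<open>
  Functions on the domain \<open>S\<close> are total functions on \<open>real ^ 'n\<close>; only their values on \<open>S\<close> matter.
  Elements of \<open>L\<^sup>2(S)\<close> and \<open>H\<^sup>k(S)\<close> are represented by functions, and equality in these spaces is
  equality almost everywhere on \<open>S\<close> (equivalently, the norm of the difference vanishes).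
\<close>

type_synonym 'n multi_index = "'n \<Rightarrow> nat"

definition mi_order :: "'n::finite multi_index \<Rightarrow> nat" where
  "mi_order \<alpha> = (\<Sum>i\<in>UNIV. \<alpha> i)"

definition mi_zero :: "'n multi_index" where
  "mi_zero = (\<lambda>_. 0)"

definition mi_inc :: "'n \<Rightarrow> 'n multi_index \<Rightarrow> 'n multi_index" where
  "mi_inc i \<alpha> = \<alpha>(i := Suc (\<alpha> i))"

definition partial_deriv :: "'n::finite \<Rightarrow> (real ^ 'n \<Rightarrow> real) \<Rightarrow> real ^ 'n \<Rightarrow> real" where
  "partial_deriv i f x = deriv (\<lambda>s. f (x + s *\<^sub>R axis i 1)) 0"

text \<open>
  The index type carries no order, so iterated partial derivatives are taken along some fixed
  enumeration of the coordinates. The class definitions below demand that differentiating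
  \<open>cderiv \<alpha> f\<close> once more in direction \<open>i\<close> gives \<open>cderiv (mi_inc i \<alpha>) f\<close>, hence on these classes
  the choice of the enumeration is immaterial.
\<close>

definition coords :: "'n::finite list" where
  "coords = (SOME xs. distinct xs \<and> set xs = UNIV)"

definition cderiv :: "'n::finite multi_index \<Rightarrow> (real ^ 'n \<Rightarrow> real) \<Rightarrow> real ^ 'n \<Rightarrow> real" where
  "cderiv \<alpha> f = foldr (\<lambda>i. partial_deriv i ^^ \<alpha> i) coords f"

definition mixed_deriv ::
  "'n::finite multi_index \<Rightarrow> 'n multi_index \<Rightarrow> (real ^ 'n \<Rightarrow> real ^ 'n \<Rightarrow> real)
    \<Rightarrow> real ^ 'n \<Rightarrow> real ^ 'n \<Rightarrow> real" where
  "mixed_deriv \<alpha> \<beta> h x y = cderiv \<alpha> (\<lambda>x'. cderiv \<beta> (h x') y) x"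

definition has_cderivs :: "(real ^ 'n::finite) set \<Rightarrow> nat \<Rightarrow> (real ^ 'n \<Rightarrow> real) \<Rightarrow> bool" where
  "has_cderivs S k f \<longleftrightarrow>
    (\<forall>\<alpha> i. mi_order \<alpha> < k \<longrightarrow> (\<forall>x\<in>S.
      ((\<lambda>s. cderiv \<alpha> f (x + s *\<^sub>R axis i 1)) has_real_derivative cderiv (mi_inc i \<alpha>) f x) (at 0)))"

definition Ck_unif :: "(real ^ 'n::finite) set \<Rightarrow> nat \<Rightarrow> (real ^ 'n \<Rightarrow> real) \<Rightarrow> bool" where
  "Ck_unif S k f \<longleftrightarrow>
    has_cderivs S k f \<and> (\<forall>\<alpha>. mi_order \<alpha> \<le> k \<longrightarrow> uniformly_continuous_on S (cderiv \<alpha> f))"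

text \<open>
  Existence of the mixed derivatives is required for every order of differentiation; as all of them are
  continuous, this is no restriction. Uniform continuity encodes continuity up to the boundary.
\<close>

definition Ckk_unif ::
  "(real ^ 'n::finite) set \<Rightarrow> nat \<Rightarrow> (real ^ 'n \<Rightarrow> real ^ 'n \<Rightarrow> real) \<Rightarrow> bool" where
  "Ckk_unif S k h \<longleftrightarrow>
    (\<forall>\<alpha> \<beta> i. mi_order \<alpha> < k \<and> mi_order \<beta> \<le> k \<longrightarrow> (\<forall>x\<in>S. \<forall>y\<in>S.
      ((\<lambda>s. mixed_deriv \<alpha> \<beta> h (x + s *\<^sub>R axis i 1) y)
        has_real_derivative mixed_deriv (mi_inc i \<alpha>) \<beta> h x y) (at 0))) \<and>
    (\<forall>\<alpha> \<beta> i. mi_order \<alpha> \<le> k \<and> mi_order \<beta> < k \<longrightarrow> (\<forall>x\<in>S. \<forall>y\<in>S.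
      ((\<lambda>s. mixed_deriv \<alpha> \<beta> h x (y + s *\<^sub>R axis i 1))
        has_real_derivative mixed_deriv \<alpha> (mi_inc i \<beta>) h x y) (at 0))) \<and>
    (\<forall>\<alpha> \<beta>. mi_order \<alpha> \<le> k \<and> mi_order \<beta> \<le> k \<longrightarrow>
      uniformly_continuous_on (S \<times> S) (\<lambda>(x, y). mixed_deriv \<alpha> \<beta> h x y))"

definition test_fun :: "(real ^ 'n::finite) set \<Rightarrow> (real ^ 'n \<Rightarrow> real) \<Rightarrow> bool" where
  "test_fun S \<phi> \<longleftrightarrow>
    (\<forall>k. has_cderivs UNIV k \<phi>) \<and> (\<forall>\<alpha>. continuous_on UNIV (cderiv \<alpha> \<phi>)) \<and>
    compact (closure {x. \<phi> x \<noteq> 0}) \<and> closure {x. \<phi> x \<noteq> 0} \<subseteq> S"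

definition L2_fun :: "(real ^ 'n::finite) set \<Rightarrow> (real ^ 'n \<Rightarrow> real) \<Rightarrow> bool" where
  "L2_fun S f \<longleftrightarrow>
    f \<in> borel_measurable (lebesgue_on S) \<and> integrable (lebesgue_on S) (\<lambda>x. (f x)\<^sup>2)"

definition loc_integrable :: "(real ^ 'n::finite) set \<Rightarrow> (real ^ 'n \<Rightarrow> real) \<Rightarrow> bool" where
  "loc_integrable S f \<longleftrightarrow> (\<forall>K. compact K \<and> K \<subseteq> S \<longrightarrow> integrable (lebesgue_on K) f)"

definition has_weak_deriv ::
  "(real ^ 'n::finite) set \<Rightarrow> 'n multi_index \<Rightarrow> (real ^ 'n \<Rightarrow> real) \<Rightarrow> (real ^ 'n \<Rightarrow> real) \<Rightarrow> bool" where
  "has_weak_deriv S \<alpha> f g \<longleftrightarrow>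
    loc_integrable S f \<and> loc_integrable S g \<and>
    (\<forall>\<phi>. test_fun S \<phi> \<longrightarrow>
      (LINT x|lebesgue_on S. f x * cderiv \<alpha> \<phi> x) =
        (-1) ^ mi_order \<alpha> * (LINT x|lebesgue_on S. g x * \<phi> x))"

definition weak_deriv ::
  "(real ^ 'n::finite) set \<Rightarrow> 'n multi_index \<Rightarrow> (real ^ 'n \<Rightarrow> real) \<Rightarrow> real ^ 'n \<Rightarrow> real" where
  "weak_deriv S \<alpha> f = (SOME g. has_weak_deriv S \<alpha> f g)"

definition sobolev :: "(real ^ 'n::finite) set \<Rightarrow> nat \<Rightarrow> (real ^ 'n \<Rightarrow> real) set" where
  "sobolev S k =
    {f. L2_fun S f \<and> (\<forall>\<alpha>. mi_order \<alpha> \<le> k \<longrightarrow> (\<exists>g. has_weak_deriv S \<alpha> f g \<and> L2_fun S g))}"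

definition sob_inner ::
  "(real ^ 'n::finite) set \<Rightarrow> nat \<Rightarrow> (real ^ 'n \<Rightarrow> real) \<Rightarrow> (real ^ 'n \<Rightarrow> real) \<Rightarrow> real" where
  "sob_inner S k f g =
    (\<Sum>\<alpha> | mi_order \<alpha> \<le> k. LINT x|lebesgue_on S. weak_deriv S \<alpha> f x * weak_deriv S \<alpha> g x)"

definition sob_norm :: "(real ^ 'n::finite) set \<Rightarrow> nat \<Rightarrow> (real ^ 'n \<Rightarrow> real) \<Rightarrow> real" where
  "sob_norm S k f = sqrt (sob_inner S k f f)"

text \<open>
  The Borel \<open>\<sigma>\<close>-algebra of \<open>H\<^sup>k(S)\<close>. Sets that are open for the seminorm are saturated under equality
  almost everywhere, so this is the pullback of the Borel \<open>\<sigma>\<close>-algebra of the quotient space.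
\<close>

definition sob_borel :: "(real ^ 'n::finite) set \<Rightarrow> nat \<Rightarrow> (real ^ 'n \<Rightarrow> real) measure" where
  "sob_borel S k = sigma (sobolev S k)
    {U. U \<subseteq> sobolev S k \<and>
      (\<forall>f\<in>U. \<exists>\<epsilon>>0. \<forall>g\<in>sobolev S k. sob_norm S k (\<lambda>x. g x - f x) < \<epsilon> \<longrightarrow> g \<in> U)}"

definition kernel_op ::
  "(real ^ 'n::finite) set \<Rightarrow> nat \<Rightarrow> (real ^ 'n \<Rightarrow> real ^ 'n \<Rightarrow> real)
    \<Rightarrow> (real ^ 'n \<Rightarrow> real) \<Rightarrow> real ^ 'n \<Rightarrow> real" where
  "kernel_op S k h f y =
    (LINT x|lebesgue_on S. (\<Sum>\<alpha> | mi_order \<alpha> \<le> k. mixed_deriv \<alpha> mi_zero h x y * weak_deriv S \<alpha> f x))"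

definition nuclear_op ::
  "(real ^ 'n::finite) set \<Rightarrow> nat \<Rightarrow> ((real ^ 'n \<Rightarrow> real) \<Rightarrow> real ^ 'n \<Rightarrow> real) \<Rightarrow> bool" where
  "nuclear_op S k T \<longleftrightarrow>
    (\<forall>f\<in>sobolev S k. T f \<in> sobolev S k) \<and>
    (\<exists>a b :: nat \<Rightarrow> real ^ 'n \<Rightarrow> real.
      (\<forall>n. a n \<in> sobolev S k \<and> b n \<in> sobolev S k) \<and>
      summable (\<lambda>n. sob_norm S k (a n) * sob_norm S k (b n)) \<and>
      (\<forall>f\<in>sobolev S k.
        (\<lambda>N. sob_norm S k (\<lambda>x. T f x - (\<Sum>n<N. sob_inner S k f (a n) * b n x))) \<longlonglongrightarrow> 0))"

text \<open>
  The last clause says that the \<open>e j\<close> with \<open>lam j = \<mu>\<close> span the eigenspace of every \<open>\<mu> \<noteq> 0\<close>. As they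
  are orthonormal eigenfunctions, they form a basis of it: every non-zero eigenvalue is listed,
  and as often as its multiplicity.
\<close>

definition eigensystem ::
  "(real ^ 'n::finite) set \<Rightarrow> nat \<Rightarrow> ((real ^ 'n \<Rightarrow> real) \<Rightarrow> real ^ 'n \<Rightarrow> real)
    \<Rightarrow> nat set \<Rightarrow> (nat \<Rightarrow> real) \<Rightarrow> (nat \<Rightarrow> real ^ 'n \<Rightarrow> real) \<Rightarrow> bool" where
  "eigensystem S k T J lam e \<longleftrightarrow>
    (J = {1..} \<or> (\<exists>N. J = {1..N})) \<and>
    (\<forall>j\<in>J. lam j \<noteq> 0) \<and>
    (\<forall>i\<in>J. \<forall>j\<in>J. i \<le> j \<longrightarrow> lam j \<le> lam i) \<and>
    (\<forall>j\<in>J. e j \<in> sobolev S k \<and> Ck_unif S k (e j)) \<and>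
    (\<forall>i\<in>J. \<forall>j\<in>J. sob_inner S k (e i) (e j) = (if i = j then 1 else 0)) \<and>
    (\<forall>j\<in>J. AE x in lebesgue_on S. T (e j) x = lam j * e j x) \<and>
    (\<forall>\<mu>. \<forall>f\<in>sobolev S k. \<mu> \<noteq> 0 \<and> (AE x in lebesgue_on S. T f x = \<mu> * f x) \<longrightarrow>
      (\<exists>F c. finite F \<and> F \<subseteq> {j\<in>J. lam j = \<mu>} \<and>
        (AE x in lebesgue_on S. f x = (\<Sum>j\<in>F. c j * e j x))))"

definition measurable_field ::
  "(real ^ 'n::finite) set \<Rightarrow> 'w measure \<Rightarrow> (real ^ 'n \<Rightarrow> 'w \<Rightarrow> real) \<Rightarrow> bool" where
  "measurable_field S M X \<longleftrightarrow>
    (\<lambda>(t, \<omega>). X t \<omega>) \<in> borel_measurable (restrict_space borel S \<Otimes>\<^sub>M M)"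

definition second_order ::
  "(real ^ 'n::finite) set \<Rightarrow> 'w measure \<Rightarrow> (real ^ 'n \<Rightarrow> 'w \<Rightarrow> real) \<Rightarrow> bool" where
  "second_order S M X \<longleftrightarrow>
    (\<forall>t\<in>S. integrable M (X t) \<and> integrable M (\<lambda>\<omega>. (X t \<omega> - (LINT \<omega>'|M. X t \<omega>'))\<^sup>2))"

definition centred ::
  "(real ^ 'n::finite) set \<Rightarrow> 'w measure \<Rightarrow> (real ^ 'n \<Rightarrow> 'w \<Rightarrow> real) \<Rightarrow> bool" where
  "centred S M X \<longleftrightarrow> (\<forall>t\<in>S. (LINT \<omega>|M. X t \<omega>) = 0)"

definition cov_kernel ::
  "'w measure \<Rightarrow> (real ^ 'n::finite \<Rightarrow> 'w \<Rightarrow> real) \<Rightarrow> real ^ 'n \<Rightarrow> real ^ 'n \<Rightarrow> real" where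
  "cov_kernel M X s t =
    (LINT \<omega>|M. (X s \<omega> - (LINT \<omega>'|M. X s \<omega>')) * (X t \<omega> - (LINT \<omega>'|M. X t \<omega>')))"

text \<open>The sample path, redefined as \<open>0\<close> where it fails to lie in \<open>H\<^sup>k(S)\<close>.\<close>

definition sob_path ::
  "(real ^ 'n::finite) set \<Rightarrow> nat \<Rightarrow> (real ^ 'n \<Rightarrow> 'w \<Rightarrow> real) \<Rightarrow> 'w \<Rightarrow> real ^ 'n \<Rightarrow> real" where
  "sob_path S k X \<omega> = (if (\<lambda>t. X t \<omega>) \<in> sobolev S k then (\<lambda>t. X t \<omega>) else (\<lambda>_. 0))"

definition sob_random_element ::
  "(real ^ 'n::finite) set \<Rightarrow> nat \<Rightarrow> 'w measure \<Rightarrow> (real ^ 'n \<Rightarrow> 'w \<Rightarrow> real) \<Rightarrow> bool" where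
  "sob_random_element S k M X \<longleftrightarrow>
    (AE \<omega> in M. (\<lambda>t. X t \<omega>) \<in> sobolev S k) \<and> sob_path S k X \<in> M \<rightarrow>\<^sub>M sob_borel S k"

definition weak_deriv_process ::
  "(real ^ 'n::finite) set \<Rightarrow> 'w measure \<Rightarrow> 'n multi_index
    \<Rightarrow> (real ^ 'n \<Rightarrow> 'w \<Rightarrow> real) \<Rightarrow> (real ^ 'n \<Rightarrow> 'w \<Rightarrow> real) \<Rightarrow> bool" where
  "weak_deriv_process S M \<alpha> X Z \<longleftrightarrow>
    measurable_field S M Z \<and>
    (AE \<omega> in M. L2_fun S (\<lambda>t. Z t \<omega>)) \<and>
    (\<forall>\<phi>. test_fun S \<phi> \<longrightarrow>
      (AE \<omega> in M. (LINT t|lebesgue_on S. X t \<omega> * cderiv \<alpha> \<phi> t) =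
        (-1) ^ mi_order \<alpha> * (LINT t|lebesgue_on S. Z t \<omega> * \<phi> t)))"

text \<open>
  The defining property of a weak derivative process determines it only up to a Lebesgue null set
  of parameters \<open>t\<close>, whereas suprema over all \<open>t\<close> depend on its value at each \<open>t\<close>. Continuity in mean
  square selects a version that is unique, for every \<open>t\<close>, up to almost sure equality.
\<close>

definition ms_continuous ::
  "(real ^ 'n::finite) set \<Rightarrow> 'w measure \<Rightarrow> (real ^ 'n \<Rightarrow> 'w \<Rightarrow> real) \<Rightarrow> bool" where
  "ms_continuous S M Z \<longleftrightarrow>
    (\<forall>t\<in>S. integrable M (\<lambda>\<omega>. (Z t \<omega>)\<^sup>2) \<and>
      ((\<lambda>s. LINT \<omega>|M. (Z s \<omega> - Z t \<omega>)\<^sup>2) \<longlongrightarrow> 0) (at t within S))"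

definition ms_weak_deriv_process ::
  "(real ^ 'n::finite) set \<Rightarrow> 'w measure \<Rightarrow> 'n multi_index
    \<Rightarrow> (real ^ 'n \<Rightarrow> 'w \<Rightarrow> real) \<Rightarrow> (real ^ 'n \<Rightarrow> 'w \<Rightarrow> real) \<Rightarrow> bool" where
  "ms_weak_deriv_process S M \<alpha> X Z \<longleftrightarrow> weak_deriv_process S M \<alpha> X Z \<and> ms_continuous S M Z"

end

theory Submission
  imports Defs "HOL-Complex_Analysis.Great_Picard"
begin

text \<open>
  Collect the mean-square derivatives of the field into a single field \<open>Z\<close> indexed by the pairs \<open>(\<alpha>, t)\<close>
  with \<open>|\<alpha>| \<le> k\<close>. Its covariance kernel consists of the mixed derivatives of \<open>\<gamma>\<^sub>X\<close>, and the integral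
  operator with this kernel on \<open>L\<^sup>2\<close> of the product space extends \<open>T\<close>, because its range consists of derivative
  families of \<open>C\<^sup>k\<close> functions. Put \<open>\<xi>\<^sub>j = \<integral> Z\<^sub>p e\<^sub>j(p) dp\<close>; these are uncorrelated with variance \<open>\<lambda>\<^sub>j\<close>.
  The part of the kernel not captured by the eigensystem is orthogonal to all \<open>e\<^sub>j\<close>; were it non-zero, power
  iteration would produce a further eigenvector. Hence \<open>Z\<^sub>p - (\<Sum>j\<le>m. \<xi>\<^sub>j e\<^sub>j(p))\<close> tends to \<open>0\<close> in mean square for
  each \<open>p\<close>, and uniformly in \<open>p\<close> since \<open>{Z\<^sub>p}\<close> is totally bounded. A subsequence of the partial sums
  converges in \<open>H\<^sup>k\<close> along almost every path, which makes the paths Sobolev functions with weak derivatives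
  \<open>t \<mapsto> Z (\<alpha>, t)\<close> and identifies \<open>\<xi>\<^sub>j\<close> with \<open>\<langle>X, e\<^sub>j\<rangle>\<close>.
\<close>

subsection \<open>Square-integrable functions\<close>

text \<open>The eigenfunctions are orthonormal in \<open>H\<^sup>k\<close>, not in
  \<open>L\<^sup>2\<close>, and an expansion known only in \<open>L\<^sup>2\<close> could not be
  differentiated term by term. On pairs \<open>(\<alpha>, t)\<close> the \<open>H\<^sup>k\<close>
  inner product is an \<open>L\<^sup>2\<close> inner product and a derivative is just another point
  of the index set, so one Mercer argument treats all orders at once. The domain is not closed and
  its boundary is arbitrary; compactness enters only through uniform continuity of the kernel on a
  bounded set. Statements at every point rather than almost everywhere rest on two facts: functions
  of the form E(Y Z_p) are Lipschitz in \<open>p\<close> for the mean-square distance of the field,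
  and every ball of that distance has positive measure. The coefficients
  \<open>\<langle>X, e\<^sub>j\<rangle>\<close> have no meaning before the paths are known to be
  Sobolev functions, which is learned only from the expansion; defining \<open>\<xi>\<^sub>j\<close>
  through \<open>Z\<close> breaks this circle.\<close>

definition sq_integrable :: "'a measure \<Rightarrow> ('a \<Rightarrow> real) \<Rightarrow> bool" where
  "sq_integrable M f \<longleftrightarrow> f \<in> borel_measurable M \<and> integrable M (\<lambda>x. (f x)\<^sup>2)"

lemma sq_integrable_measurable [measurable_dest]: "sq_integrable M f \<Longrightarrow> f \<in> borel_measurable M"
  by (simp add: sq_integrable_def)

lemma sq_integrable_square: "sq_integrable M f \<Longrightarrow> integrable M (\<lambda>x. (f x)\<^sup>2)"
  by (simp add: sq_integrable_def)

lemma sq_integrable_mult: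
  assumes "sq_integrable M f" "sq_integrable M g"
  shows "integrable M (\<lambda>x. f x * g x)"
proof (rule Bochner_Integration.integrable_bound)
  show "integrable M (\<lambda>x. (f x)\<^sup>2 + (g x)\<^sup>2)"
    using assms by (simp add: sq_integrable_def)
  show "(\<lambda>x. f x * g x) \<in> borel_measurable M"
    using assms by (intro borel_measurable_times) (auto simp: sq_integrable_def)
  have "\<bar>a * b\<bar> \<le> a\<^sup>2 + b\<^sup>2" for a b :: real
    using sum_squares_bound[of a b] sum_squares_bound[of a "- b"] zero_le_power2[of a] zero_le_power2[of b]
    by (simp add: abs_le_iff del: zero_le_power2)
  then show "AE x in M. norm (f x * g x) \<le> norm ((f x)\<^sup>2 + (g x)\<^sup>2)"
    by (auto simp: abs_of_nonneg)
qed

lemma sq_integrable_add: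
  assumes "sq_integrable M f" "sq_integrable M g"
  shows "sq_integrable M (\<lambda>x. f x + g x)"
  using assms sq_integrable_mult[OF assms]
  by (auto simp: sq_integrable_def power2_sum mult.assoc)

lemma sq_integrable_scale: "sq_integrable M f \<Longrightarrow> sq_integrable M (\<lambda>x. c * f x)"
  by (auto simp: sq_integrable_def power_mult_distrib)

lemma sq_integrable_uminus: "sq_integrable M f \<Longrightarrow> sq_integrable M (\<lambda>x. - f x)"
  by (simp add: sq_integrable_def)

lemma sq_integrable_diff:
  assumes "sq_integrable M f" "sq_integrable M g"
  shows "sq_integrable M (\<lambda>x. f x - g x)"
  using sq_integrable_add[OF assms(1) sq_integrable_uminus[OF assms(2)]] by simp

lemma sq_integrable_zero: "sq_integrable M (\<lambda>x. 0)"
  by (simp add: sq_integrable_def)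

lemma sq_integrable_sum:
  "(\<And>i. i \<in> A \<Longrightarrow> sq_integrable M (f i)) \<Longrightarrow> sq_integrable M (\<lambda>x. \<Sum>i\<in>A. f i x)"
  by (induction A rule: infinite_finite_induct) (auto simp: sq_integrable_zero sq_integrable_add)

lemma sq_integrable_divide: "sq_integrable M f \<Longrightarrow> sq_integrable M (\<lambda>x. f x / c)"
  using sq_integrable_scale[of M f "inverse c"] by (simp add: field_simps)

lemmas sq_integrable_intros = sq_integrable_add sq_integrable_diff sq_integrable_scale
  sq_integrable_uminus sq_integrable_zero sq_integrable_sum sq_integrable_divide

lemma sq_integrable_cong_AE:
  assumes "sq_integrable M f" "g \<in> borel_measurable M" "AE x in M. f x = g x"
  shows "sq_integrable M g"
proof -
  have "integrable M (\<lambda>x. (g x)\<^sup>2) \<longleftrightarrow> integrable M (\<lambda>x. (f x)\<^sup>2)"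
    using assms by (intro integrable_cong_AE) (auto simp: sq_integrable_def)
  then show ?thesis using assms by (simp add: sq_integrable_def)
qed

lemma sq_integrable_cong:
  "(\<And>x. x \<in> space M \<Longrightarrow> f x = g x) \<Longrightarrow> sq_integrable M f = sq_integrable M g"
  unfolding sq_integrable_def
  by (intro conj_cong measurable_cong Bochner_Integration.integrable_cong) auto

lemma (in finite_measure) sq_integrable_bounded:
  assumes "f \<in> borel_measurable M" "\<And>x. x \<in> space M \<Longrightarrow> \<bar>f x\<bar> \<le> C"
  shows "sq_integrable M f"
  unfolding sq_integrable_def
proof
  show "integrable M (\<lambda>x. (f x)\<^sup>2)"
  proof (rule integrable_const_bound[of _ "C\<^sup>2"])
    show "AE x in M. norm ((f x)\<^sup>2) \<le> C\<^sup>2"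
      using assms(2) by (intro AE_I2) (metis abs_ge_zero norm_power power2_abs power_mono real_norm_def)
  qed (use assms in auto)
qed (use assms in auto)

lemma (in finite_measure) sq_integrable_integrable:
  assumes "sq_integrable M f"
  shows "integrable M f"
  using sq_integrable_mult[OF assms, of "\<lambda>_. 1"] by (simp add: sq_integrable_def)

text \<open>The integral of (f + t g)^2 is a quadratic in \<open>t\<close> that never becomes
  negative; its value at the minimiser \<open>- b / a\<close> is the claim.\<close>

lemma L2_Cauchy_Schwarz:
  assumes "sq_integrable M f" "sq_integrable M g"
  shows "(\<integral>x. f x * g x \<partial>M)\<^sup>2 \<le> (\<integral>x. (f x)\<^sup>2 \<partial>M) * (\<integral>x. (g x)\<^sup>2 \<partial>M)"
proof -
  define a b c where "a = (\<integral>x. (g x)\<^sup>2 \<partial>M)" and "b = (\<integral>x. f x * g x \<partial>M)" and "c = (\<integral>x. (f x)\<^sup>2 \<partial>M)"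
  have i: "integrable M (\<lambda>x. (f x)\<^sup>2)" "integrable M (\<lambda>x. (g x)\<^sup>2)" "integrable M (\<lambda>x. f x * g x)"
    using assms sq_integrable_mult[OF assms] by (auto simp: sq_integrable_def)
  have q: "0 \<le> c + 2 * t * b + t\<^sup>2 * a" for t
  proof -
    have "0 \<le> (\<integral>x. (f x + t * g x)\<^sup>2 \<partial>M)" by simp
    also have "(\<lambda>x. (f x + t * g x)\<^sup>2) = (\<lambda>x. (f x)\<^sup>2 + 2 * t * (f x * g x) + t\<^sup>2 * (g x)\<^sup>2)"
      by (auto simp: power2_eq_square algebra_simps)
    also have "(\<integral>x. (f x)\<^sup>2 + 2 * t * (f x * g x) + t\<^sup>2 * (g x)\<^sup>2 \<partial>M) = c + 2 * t * b + t\<^sup>2 * a"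
      using i by (simp add: a_def b_def c_def)
    finally show ?thesis .
  qed
  have a0: "0 \<le> a" by (simp add: a_def)
  have "b\<^sup>2 \<le> c * a"
  proof (cases "a = 0")
    case True
    have "b = 0"
    proof (rule ccontr)
      assume "b \<noteq> 0"
      \<comment> \<open>Without its quadratic term the polynomial is linear in \<open>t\<close>, and
        this \<open>t\<close> gives it the value -1.\<close>
      with q[of "- (c + 1) / (2 * b)"] True show False by (simp add: field_simps)
    qed
    then show ?thesis using True by simp
  next
    case False
    then have "a > 0" using a0 by simp
    have "c + 2 * (- b / a) * b + (- b / a)\<^sup>2 * a = c - b\<^sup>2 / a"
      using False by (simp add: power2_eq_square field_simps)
    with q[of "- b / a"] have "b\<^sup>2 / a \<le> c" by simp
    then show ?thesis using \<open>a > 0\<close> by (simp add: pos_divide_le_eq)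
  qed
  then show ?thesis by (simp add: a_def b_def c_def)
qed

definition L2_norm_on :: "'a measure \<Rightarrow> ('a \<Rightarrow> real) \<Rightarrow> real" where
  "L2_norm_on M f = sqrt (\<integral>x. (f x)\<^sup>2 \<partial>M)"

lemma L2_norm_on_nonneg [simp]: "0 \<le> L2_norm_on M f"
  by (simp add: L2_norm_on_def)

lemma L2_norm_on_power2: "(L2_norm_on M f)\<^sup>2 = (\<integral>x. (f x)\<^sup>2 \<partial>M)"
  by (simp add: L2_norm_on_def)

lemma L2_Cauchy_Schwarz_norm:
  assumes "sq_integrable M f" "sq_integrable M g"
  shows "\<bar>\<integral>x. f x * g x \<partial>M\<bar> \<le> L2_norm_on M f * L2_norm_on M g"
proof -
  have "\<bar>\<integral>x. f x * g x \<partial>M\<bar> = sqrt ((\<integral>x. f x * g x \<partial>M)\<^sup>2)" by simp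
  also have "\<dots> \<le> sqrt ((\<integral>x. (f x)\<^sup>2 \<partial>M) * (\<integral>x. (g x)\<^sup>2 \<partial>M))"
    using L2_Cauchy_Schwarz[OF assms] real_sqrt_le_mono by blast
  finally show ?thesis by (simp add: L2_norm_on_def real_sqrt_mult)
qed

lemma L2_inner_add_square:
  assumes "sq_integrable M f" "sq_integrable M g"
  shows "(\<integral>x. (f x + g x)\<^sup>2 \<partial>M) = (\<integral>x. (f x)\<^sup>2 \<partial>M) + 2 * (\<integral>x. f x * g x \<partial>M) + (\<integral>x. (g x)\<^sup>2 \<partial>M)"
proof -
  have i: "integrable M (\<lambda>x. (f x)\<^sup>2)" "integrable M (\<lambda>x. (g x)\<^sup>2)" "integrable M (\<lambda>x. f x * g x)"
    using assms sq_integrable_mult[OF assms] by (auto simp: sq_integrable_def)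
  have "(\<lambda>x. (f x + g x)\<^sup>2) = (\<lambda>x. (f x)\<^sup>2 + 2 * (f x * g x) + (g x)\<^sup>2)"
    by (auto simp: power2_eq_square algebra_simps)
  then show ?thesis using i by simp
qed

lemma L2_inner_diff_square:
  assumes "sq_integrable M f" "sq_integrable M g"
  shows "(\<integral>x. (f x - g x)\<^sup>2 \<partial>M) = (\<integral>x. (f x)\<^sup>2 \<partial>M) - 2 * (\<integral>x. f x * g x \<partial>M) + (\<integral>x. (g x)\<^sup>2 \<partial>M)"
  using L2_inner_add_square[OF assms(1) sq_integrable_uminus[OF assms(2)]] by simp

lemma L2_norm_on_triangle:
  assumes "sq_integrable M f" "sq_integrable M g"
  shows "L2_norm_on M (\<lambda>x. f x + g x) \<le> L2_norm_on M f + L2_norm_on M g"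
proof (rule power2_le_imp_le)
  have "(L2_norm_on M (\<lambda>x. f x + g x))\<^sup>2 = (L2_norm_on M f)\<^sup>2 + 2 * (\<integral>x. f x * g x \<partial>M) + (L2_norm_on M g)\<^sup>2"
    unfolding L2_norm_on_power2 by (rule L2_inner_add_square[OF assms])
  also have "\<dots> \<le> (L2_norm_on M f + L2_norm_on M g)\<^sup>2"
    using L2_Cauchy_Schwarz_norm[OF assms] by (simp add: power2_sum)
  finally show "(L2_norm_on M (\<lambda>x. f x + g x))\<^sup>2 \<le> (L2_norm_on M f + L2_norm_on M g)\<^sup>2" .
qed simp

lemma L2_norm_on_scale: "L2_norm_on M (\<lambda>x. c * f x) = \<bar>c\<bar> * L2_norm_on M f"
  by (simp add: L2_norm_on_def power_mult_distrib real_sqrt_mult)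

lemma L2_norm_on_minus_commute: "L2_norm_on M (\<lambda>x. f x - g x) = L2_norm_on M (\<lambda>x. g x - f x)"
  by (simp add: L2_norm_on_def power2_commute)

lemma L2_norm_on_triangle_diff:
  assumes "sq_integrable M f" "sq_integrable M g" "sq_integrable M h"
  shows "L2_norm_on M (\<lambda>x. f x - h x) \<le> L2_norm_on M (\<lambda>x. f x - g x) + L2_norm_on M (\<lambda>x. g x - h x)"
  using L2_norm_on_triangle[of M "\<lambda>x. f x - g x" "\<lambda>x. g x - h x"] assms
  by (simp add: sq_integrable_diff)

lemma square_sum_bound:
  assumes "sq_integrable M f" "sq_integrable M g"
  shows "(\<integral>x. (f x + g x)\<^sup>2 \<partial>M) \<le> 2 * (\<integral>x. (f x)\<^sup>2 \<partial>M) + 2 * (\<integral>x. (g x)\<^sup>2 \<partial>M)"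
proof -
  have "(\<integral>x. (f x + g x)\<^sup>2 \<partial>M) \<le> (\<integral>x. 2 * (f x)\<^sup>2 + 2 * (g x)\<^sup>2 \<partial>M)"
  proof (rule integral_mono)
    have "(a + b)\<^sup>2 \<le> 2 * a\<^sup>2 + 2 * b\<^sup>2" for a b :: real
      using sum_squares_bound[of a b] by (simp add: power2_sum)
    then show "\<And>x. (f x + g x)\<^sup>2 \<le> 2 * (f x)\<^sup>2 + 2 * (g x)\<^sup>2" .
  qed (use sq_integrable_add[OF assms] assms in \<open>auto simp: sq_integrable_def\<close>)
  then show ?thesis using assms by (simp add: sq_integrable_def)
qed

lemma square_integral_zero_AE:
  assumes "sq_integrable M f"
  shows "(\<integral>x. (f x)\<^sup>2 \<partial>M) = 0 \<longleftrightarrow> (AE x in M. f x = 0)"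
  using integral_nonneg_eq_0_iff_AE[OF sq_integrable_square[OF assms]] by simp

lemma (in finite_measure) L1_le_L2:
  assumes "sq_integrable M f"
  shows "(\<integral>x. \<bar>f x\<bar> \<partial>M) \<le> L2_norm_on M f * sqrt (measure M (space M))"
proof -
  have a: "sq_integrable M (\<lambda>x. \<bar>f x\<bar>)" using assms by (auto simp: sq_integrable_def)
  have o: "sq_integrable M (\<lambda>x. 1)" by (rule sq_integrable_bounded[where C=1]) auto
  show ?thesis using L2_Cauchy_Schwarz_norm[OF a o] by (simp add: L2_norm_on_def)
qed

lemma L2_tendsto_inner:
  assumes "\<And>n. sq_integrable M (f n)" "sq_integrable M h" "sq_integrable M g"
    and "((\<lambda>n. \<integral>x. (f n x - h x)\<^sup>2 \<partial>M) \<longlongrightarrow> 0) F"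
  shows "((\<lambda>n. \<integral>x. f n x * g x \<partial>M) \<longlongrightarrow> (\<integral>x. h x * g x \<partial>M)) F"
proof -
  have "((\<lambda>n. L2_norm_on M (\<lambda>x. f n x - h x) * L2_norm_on M g) \<longlongrightarrow> 0) F"
    using tendsto_mult_left_zero[OF tendsto_real_sqrt[OF assms(4), simplified]]
    by (simp add: L2_norm_on_def)
  then have "((\<lambda>n. (\<integral>x. f n x * g x \<partial>M) - (\<integral>x. h x * g x \<partial>M)) \<longlongrightarrow> 0) F"
  proof (rule Lim_null_comparison[rotated], intro always_eventually allI)
    fix n
    have "(\<integral>x. f n x * g x \<partial>M) - (\<integral>x. h x * g x \<partial>M) = (\<integral>x. (f n x - h x) * g x \<partial>M)"
      using sq_integrable_mult[OF assms(1,3)] sq_integrable_mult[OF assms(2,3)]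
      by (simp add: left_diff_distrib)
    then show "norm ((\<integral>x. f n x * g x \<partial>M) - (\<integral>x. h x * g x \<partial>M)) \<le> L2_norm_on M (\<lambda>x. f n x - h x) * L2_norm_on M g"
      using L2_Cauchy_Schwarz_norm[OF sq_integrable_diff[OF assms(1,2)] assms(3)] by simp
  qed
  then show ?thesis by (rule LIM_zero_cancel)
qed

lemma L2_tendsto_square:
  assumes "\<And>n. sq_integrable M (f n)" "sq_integrable M h"
    and "((\<lambda>n. \<integral>x. (f n x - h x)\<^sup>2 \<partial>M) \<longlongrightarrow> 0) F"
  shows "((\<lambda>n. \<integral>x. (f n x)\<^sup>2 \<partial>M) \<longlongrightarrow> (\<integral>x. (h x)\<^sup>2 \<partial>M)) F"
proof -
  have "(\<integral>x. (f n x)\<^sup>2 \<partial>M) = (\<integral>x. (f n x - h x)\<^sup>2 \<partial>M) + 2 * (\<integral>x. f n x * h x \<partial>M) - (\<integral>x. (h x)\<^sup>2 \<partial>M)" for n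
    using L2_inner_diff_square[OF assms(1,2)] by simp
  moreover have "((\<lambda>n. (\<integral>x. (f n x - h x)\<^sup>2 \<partial>M) + 2 * (\<integral>x. f n x * h x \<partial>M) - (\<integral>x. (h x)\<^sup>2 \<partial>M)) \<longlongrightarrow>
      0 + 2 * (\<integral>x. h x * h x \<partial>M) - (\<integral>x. (h x)\<^sup>2 \<partial>M)) F"
    by (intro tendsto_intros assms L2_tendsto_inner)
  ultimately show ?thesis by (simp add: power2_eq_square)
qed

text \<open>Completeness of \<open>L\<^sup>2\<close> for fast Cauchy sequences. The limit is taken pointwise, so that it
  inherits joint measurability from the sequence.\<close>

lemma (in prob_space) L2_fast_Cauchy:
  fixes q :: "nat \<Rightarrow> 'a \<Rightarrow> real"
  assumes sq: "\<And>n. sq_integrable M (q n)"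
    and fast: "\<And>n. n0 \<le> n \<Longrightarrow> (\<integral>x. (q (Suc n) x - q n x)\<^sup>2 \<partial>M) \<le> (1/4) ^ n"
  defines "z \<equiv> (\<lambda>x. lim (\<lambda>n. q n x))"
  shows "sq_integrable M z" "(\<lambda>n. \<integral>x. (q n x - z x)\<^sup>2 \<partial>M) \<longlonglongrightarrow> 0"
proof -
  have [measurable]: "\<And>n. q n \<in> borel_measurable M" using sq by (simp add: sq_integrable_def)
  have zm [measurable]: "z \<in> borel_measurable M" unfolding z_def by measurable
  have step: "L2_norm_on M (\<lambda>x. q (Suc n) x - q n x) \<le> (1/2) ^ n" if "n0 \<le> n" for n
  proof -
    have "L2_norm_on M (\<lambda>x. q (Suc n) x - q n x) \<le> sqrt ((1/4) ^ n)"
      using fast[OF that] unfolding L2_norm_on_def by simp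
    also have "(1/4::real) ^ n = ((1/2) ^ n)\<^sup>2" by (simp add: power2_eq_square flip: power_mult_distrib)
    finally show ?thesis by simp
  qed
  \<comment> \<open>On a probability space the \<open>L\<^sup>1\<close> norm is at most the
    \<open>L\<^sup>2\<close> norm, so the \<open>L\<^sup>1\<close> norms of the increments have a
    finite sum and the increments are absolutely summable almost everywhere. Only the tail from
    \<open>n0\<close> on is controlled, hence the shift.\<close>
  have AEc: "AE x in M. convergent (\<lambda>n. q n x)"
  proof -
    have "AE x in M. (\<Sum>n. ennreal \<bar>q (Suc (n + n0)) x - q (n + n0) x\<bar>) \<noteq> \<infinity>"
    proof (rule nn_integral_PInf_AE)
      have "(\<integral>\<^sup>+x. (\<Sum>n. ennreal \<bar>q (Suc (n + n0)) x - q (n + n0) x\<bar>) \<partial>M)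
        = (\<Sum>n. \<integral>\<^sup>+x. ennreal \<bar>q (Suc (n + n0)) x - q (n + n0) x\<bar> \<partial>M)"
        by (rule nn_integral_suminf) simp
      also have "\<dots> \<le> (\<Sum>n. ennreal ((1/2) ^ n))"
      proof (rule suminf_le)
        fix n
        have s: "sq_integrable M (\<lambda>x. q (Suc (n + n0)) x - q (n + n0) x)"
          by (intro sq_integrable_diff sq)
        have "(\<integral>\<^sup>+x. ennreal \<bar>q (Suc (n + n0)) x - q (n + n0) x\<bar> \<partial>M)
          = ennreal (\<integral>x. \<bar>q (Suc (n + n0)) x - q (n + n0) x\<bar> \<partial>M)"
          using sq_integrable_integrable[OF s] by (intro nn_integral_eq_integral) auto
        also have "\<dots> \<le> ennreal ((1/2) ^ (n + n0))"
          using L1_le_L2[OF s] step[of "n + n0"] by (intro ennreal_leI) (simp add: prob_space)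
        also have "\<dots> \<le> ennreal ((1/2) ^ n)"
          by (intro ennreal_leI power_decreasing) auto
        finally show "(\<integral>\<^sup>+x. ennreal \<bar>q (Suc (n + n0)) x - q (n + n0) x\<bar> \<partial>M) \<le> ennreal ((1/2) ^ n)" .
      qed auto
      also have "(\<Sum>n. ennreal ((1/2) ^ n)) = ennreal (\<Sum>n. (1/2) ^ n)"
        by (rule suminf_ennreal2) (simp_all add: summable_geometric)
      also have "\<dots> < \<infinity>" by simp
      finally show "(\<integral>\<^sup>+x. (\<Sum>n. ennreal \<bar>q (Suc (n + n0)) x - q (n + n0) x\<bar>) \<partial>M) \<noteq> \<infinity>" by simp
    qed simp
    then show ?thesis
    proof (eventually_elim)
      fix x assume "(\<Sum>n. ennreal \<bar>q (Suc (n + n0)) x - q (n + n0) x\<bar>) \<noteq> \<infinity>"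
      then have "summable (\<lambda>n. \<bar>q (Suc (n + n0)) x - q (n + n0) x\<bar>)"
        by (intro summable_suminf_not_top) auto
      then have "summable (\<lambda>n. q (Suc n + n0) x - q (n + n0) x)"
        by (auto intro: summable_rabs_cancel)
      then have "convergent (\<lambda>n. q (n + n0) x - q (0 + n0) x)"
        unfolding summable_iff_convergent sum_lessThan_telescope[of "\<lambda>n. q (n + n0) x"] .
      then have "convergent (\<lambda>n. q (n + n0) x)"
        using convergent_add_const_right_iff[of "\<lambda>n. q (n + n0) x" "- q (0 + n0) x"] by simp
      then show "convergent (\<lambda>n. q n x)"
        using convergent_ignore_initial_segment[of "\<lambda>n. q n x" n0] by simp
    qed
  qed
  \<comment> \<open>The subtracted term makes the induction close: adding the step
    \<open>(1/2) ^ (n + m)\<close> halves it.\<close>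
  have far: "L2_norm_on M (\<lambda>x. q (n + m) x - q n x) \<le> 2 * (1/2) ^ n - 2 * (1/2) ^ (n + m)" if "n0 \<le> n" for n m
  proof (induction m)
    case 0 then show ?case by (simp add: L2_norm_on_def)
  next
    case (Suc m)
    have "L2_norm_on M (\<lambda>x. q (Suc (n + m)) x - q n x)
      \<le> L2_norm_on M (\<lambda>x. q (Suc (n + m)) x - q (n + m) x) + L2_norm_on M (\<lambda>x. q (n + m) x - q n x)"
      by (intro L2_norm_on_triangle_diff sq)
    also have "\<dots> \<le> (1/2) ^ (n + m) + (2 * (1/2) ^ n - 2 * (1/2) ^ (n + m))"
      using step[of "n + m"] that Suc by simp
    finally show ?case by simp
  qed
  \<comment> \<open>Fatou's lemma carries the bound \<open>far\<close> over to the pointwise limit;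
    \<open>4 * (1/4) ^ n\<close> is the square of \<open>2 * (1/2) ^ n\<close>.\<close>
  have fat: "(\<integral>\<^sup>+x. ennreal ((q n x - z x)\<^sup>2) \<partial>M) \<le> ennreal (4 * (1/4) ^ n)" if "n0 \<le> n" for n
  proof -
    have "(\<integral>\<^sup>+x. ennreal ((q n x - z x)\<^sup>2) \<partial>M) = (\<integral>\<^sup>+x. liminf (\<lambda>m. ennreal ((q n x - q (n + m) x)\<^sup>2)) \<partial>M)"
    proof (rule nn_integral_cong_AE)
      show "AE x in M. ennreal ((q n x - z x)\<^sup>2) = liminf (\<lambda>m. ennreal ((q n x - q (n + m) x)\<^sup>2))"
        using AEc
      proof eventually_elim
        case (elim x)
        then have "(\<lambda>m. q m x) \<longlonglongrightarrow> z x" unfolding z_def by (simp add: convergent_LIMSEQ_iff)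
        then have "(\<lambda>m. q (n + m) x) \<longlonglongrightarrow> z x" by (subst add.commute) (rule LIMSEQ_ignore_initial_segment)
        then have "(\<lambda>m. ennreal ((q n x - q (n + m) x)\<^sup>2)) \<longlonglongrightarrow> ennreal ((q n x - z x)\<^sup>2)"
          by (intro tendsto_intros)
        then show ?case by (rule lim_imp_Liminf[symmetric, OF sequentially_bot])
      qed
    qed
    also have "\<dots> \<le> liminf (\<lambda>m. \<integral>\<^sup>+x. ennreal ((q n x - q (n + m) x)\<^sup>2) \<partial>M)"
      by (rule nn_integral_liminf) simp
    also have "\<dots> \<le> liminf (\<lambda>m::nat. ennreal (4 * (1/4) ^ n))"
    proof (rule Liminf_mono, intro always_eventually allI)
      fix m
      have s: "sq_integrable M (\<lambda>x. q (n + m) x - q n x)" by (intro sq_integrable_diff sq)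
      have "(\<integral>\<^sup>+x. ennreal ((q n x - q (n + m) x)\<^sup>2) \<partial>M) = ennreal (\<integral>x. (q (n + m) x - q n x)\<^sup>2 \<partial>M)"
        using sq_integrable_square[OF s] by (subst nn_integral_eq_integral[symmetric]) (auto simp: power2_commute)
      also have "(\<integral>x. (q (n + m) x - q n x)\<^sup>2 \<partial>M) \<le> 4 * (1/4) ^ n"
      proof -
        have "(L2_norm_on M (\<lambda>x. q (n + m) x - q n x))\<^sup>2 \<le> (2 * (1/2) ^ n)\<^sup>2"
          using far[OF that, of m] by (intro power_mono) (auto intro: order_trans)
        also have "\<dots> = 4 * (1/4) ^ n" by (simp add: power2_eq_square flip: power_mult_distrib)
        finally show ?thesis by (simp add: L2_norm_on_power2)
      qed
      finally show "(\<integral>\<^sup>+x. ennreal ((q n x - q (n + m) x)\<^sup>2) \<partial>M) \<le> ennreal (4 * (1/4) ^ n)"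
        by (simp add: ennreal_leI)
    qed
    also have "\<dots> = ennreal (4 * (1/4) ^ n)" by (simp add: Liminf_const)
    finally show ?thesis .
  qed
  have sqd: "sq_integrable M (\<lambda>x. q n x - z x)" if "n0 \<le> n" for n
    unfolding sq_integrable_def
  proof
    show "integrable M (\<lambda>x. (q n x - z x)\<^sup>2)"
      using fat[OF that] by (intro integrableI_bounded) (auto intro: order.strict_trans1)
  qed simp
  show "sq_integrable M z"
    using sq_integrable_diff[OF sq[of n0] sqd[of n0]] by simp
  have le: "(\<integral>x. (q n x - z x)\<^sup>2 \<partial>M) \<le> 4 * (1/4) ^ n" if "n0 \<le> n" for n
    using fat[OF that] nn_integral_eq_integral[OF sq_integrable_square[OF sqd[OF that]]] by simp
  have "(\<lambda>n. 4 * (1/4::real) ^ n) \<longlonglongrightarrow> 0"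
    by (intro tendsto_mult_right_zero LIMSEQ_power_zero) simp
  then show "(\<lambda>n. \<integral>x. (q n x - z x)\<^sup>2 \<partial>M) \<longlonglongrightarrow> 0"
  proof (rule Lim_null_comparison[rotated])
    show "\<forall>\<^sub>F n in sequentially. norm (\<integral>x. (q n x - z x)\<^sup>2 \<partial>M) \<le> 4 * (1/4) ^ n"
      using le by (intro eventually_sequentiallyI[of n0]) simp
  qed
qed

subsection \<open>Second-order fields on a finite measure space\<close>

text \<open>The index set carries no topology; its geometry is the mean-square distance of the
  field. \<open>totally_bounded\<close> stands in for compactness of the index set, and
  \<open>full_support\<close> says that no ball of this distance is null, which turns
  almost-everywhere identities between continuous functions into identities everywhere.\<close>

locale kl_field = N: finite_measure N + M: prob_space M
  for N :: "'p measure" and M :: "'w measure" +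
  fixes Z :: "'p \<Rightarrow> 'w \<Rightarrow> real" and B :: real
  assumes Z_measurable_pair [measurable]: "(\<lambda>(p, w). Z p w) \<in> borel_measurable (N \<Otimes>\<^sub>M M)"
    and Z_square_integrable: "p \<in> space N \<Longrightarrow> integrable M (\<lambda>w. (Z p w)\<^sup>2)"
    and Z_square_bound: "p \<in> space N \<Longrightarrow> (\<integral>w. (Z p w)\<^sup>2 \<partial>M) \<le> B"
    and totally_bounded: "0 < \<epsilon> \<Longrightarrow>
      \<exists>P. finite P \<and> P \<subseteq> space N \<and> (\<forall>p\<in>space N. \<exists>q\<in>P. (\<integral>w. (Z p w - Z q w)\<^sup>2 \<partial>M) < \<epsilon>)"
    and full_support: "p \<in> space N \<Longrightarrow> 0 < \<epsilon> \<Longrightarrow> \<not> (AE q in N. \<epsilon> \<le> (\<integral>w. (Z q w - Z p w)\<^sup>2 \<partial>M))"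
begin

sublocale NM: pair_sigma_finite N M
  by unfold_locales

definition ker :: "'p \<Rightarrow> 'p \<Rightarrow> real" where
  "ker p q = (\<integral>w. Z p w * Z q w \<partial>M)"

definition ker_op :: "('p \<Rightarrow> real) \<Rightarrow> 'p \<Rightarrow> real" where
  "ker_op f q = (\<integral>p. ker p q * f p \<partial>N)"

text \<open>This is an operator A from L2 of \<open>N\<close> to L2 of \<open>M\<close>; its adjoint
  sends \<open>Y\<close> to the function E(Y Z_p) of \<open>p\<close>. \<open>ker_op\<close> is A
  followed by its adjoint, and self-adjointness and all bounds for \<open>ker_op\<close> are read
  off from this factorisation.\<close>

definition coef :: "('p \<Rightarrow> real) \<Rightarrow> 'w \<Rightarrow> real" where
  "coef f w = (\<integral>p. Z p w * f p \<partial>N)"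

text \<open>The square of the canonical pseudometric of the field, hence
  \<open>sqrt (kdist p q)\<close> in every Lipschitz bound.\<close>

definition kdist :: "'p \<Rightarrow> 'p \<Rightarrow> real" where
  "kdist p q = (\<integral>w. (Z p w - Z q w)\<^sup>2 \<partial>M)"

lemma Z_measurable [measurable (raw)]: "p \<in> space N \<Longrightarrow> Z p \<in> borel_measurable M"
  using measurable_Pair2[OF Z_measurable_pair] by simp

lemma sq_Z: "p \<in> space N \<Longrightarrow> sq_integrable M (Z p)"
  by (simp add: sq_integrable_def Z_square_integrable Z_measurable)

lemma B_nonneg: "p \<in> space N \<Longrightarrow> 0 \<le> B"
  using order_trans[OF Bochner_Integration.integral_nonneg Z_square_bound[of p]] by simp

lemma L2_norm_Z: "p \<in> space N \<Longrightarrow> L2_norm_on M (Z p) \<le> sqrt B"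
  unfolding L2_norm_on_def using Z_square_bound by (intro real_sqrt_le_mono)

lemma ker_diag: "ker p p = (\<integral>w. (Z p w)\<^sup>2 \<partial>M)"
  by (simp add: ker_def power2_eq_square)

lemma ker_commute: "ker p q = ker q p"
  by (simp add: ker_def mult.commute)

lemma kdist_commute: "kdist p q = kdist q p"
  by (simp add: kdist_def power2_commute)

lemma cross_bound:
  assumes "sq_integrable M Y" "p \<in> space N"
  shows "\<bar>\<integral>w. Y w * Z p w \<partial>M\<bar> \<le> L2_norm_on M Y * sqrt B"
  using L2_Cauchy_Schwarz_norm[OF assms(1) sq_Z[OF assms(2)]] L2_norm_Z[OF assms(2)]
  by (meson L2_norm_on_nonneg mult_left_mono order_trans)

text \<open>Cauchy-Schwarz makes E(Y Z_p) Lipschitz in \<open>p\<close> with the norm of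
  \<open>Y\<close> as constant. This estimate supplies both the equicontinuity of the images of
  \<open>ker_op\<close> and the regularity of the residual kernel.\<close>

lemma cross_diff_bound:
  assumes "sq_integrable M Y" "p \<in> space N" "q \<in> space N"
  shows "\<bar>(\<integral>w. Y w * Z p w \<partial>M) - (\<integral>w. Y w * Z q w \<partial>M)\<bar> \<le> L2_norm_on M Y * sqrt (kdist p q)"
proof -
  have "(\<integral>w. Y w * Z p w \<partial>M) - (\<integral>w. Y w * Z q w \<partial>M) = (\<integral>w. Y w * (Z p w - Z q w) \<partial>M)"
    using sq_integrable_mult[OF assms(1) sq_Z] assms by (simp add: right_diff_distrib)
  then show ?thesis
    using L2_Cauchy_Schwarz_norm[OF assms(1) sq_integrable_diff[OF sq_Z sq_Z], of p q] assms
    by (simp add: kdist_def L2_norm_on_def)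
qed

lemma cross_measurable:
  assumes "sq_integrable M Y"
  shows "(\<lambda>p. \<integral>w. Y w * Z p w \<partial>M) \<in> borel_measurable N"
proof -
  have [measurable]: "Y \<in> borel_measurable M" using assms by (simp add: sq_integrable_def)
  show ?thesis by measurable
qed

lemma sq_cross:
  assumes "sq_integrable M Y"
  shows "sq_integrable N (\<lambda>p. \<integral>w. Y w * Z p w \<partial>M)"
  by (rule N.sq_integrable_bounded[OF cross_measurable[OF assms] cross_bound[OF assms]])

lemma ker_measurable_pair: "q \<in> space N \<Longrightarrow> (\<lambda>p. ker p q) \<in> borel_measurable N"
  using cross_measurable[OF sq_Z[of q]] by (simp add: ker_def mult.commute)

lemma sq_ker: "q \<in> space N \<Longrightarrow> sq_integrable N (\<lambda>p. ker p q)"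
  using sq_cross[OF sq_Z[of q]] by (simp add: ker_def mult.commute)

lemma integrable_Z_square: "integrable (N \<Otimes>\<^sub>M M) (\<lambda>(p, w). (Z p w)\<^sup>2)"
proof (rule NM.Fubini_integrable)
  show "(\<lambda>(p, w). (Z p w)\<^sup>2) \<in> borel_measurable (N \<Otimes>\<^sub>M M)" by measurable
  show "integrable N (\<lambda>p. \<integral>w. norm (case (p, w) of (p, w) \<Rightarrow> (Z p w)\<^sup>2) \<partial>M)"
  proof (rule N.integrable_const_bound[where B = B])
    show "AE p in N. norm (\<integral>w. norm (case (p, w) of (p, w) \<Rightarrow> (Z p w)\<^sup>2) \<partial>M) \<le> B"
      using Z_square_bound by (intro AE_I2) simp
    show "(\<lambda>p. \<integral>w. norm (case (p, w) of (p, w) \<Rightarrow> (Z p w)\<^sup>2) \<partial>M) \<in> borel_measurable N"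
      by measurable
  qed
  show "AE p in N. integrable M (\<lambda>w. case (p, w) of (p, w) \<Rightarrow> (Z p w)\<^sup>2)"
    using Z_square_integrable by (intro AE_I2) simp
qed

lemma integrable_Fubini:
  assumes "sq_integrable N f" "sq_integrable M Y"
  shows "integrable (N \<Otimes>\<^sub>M M) (\<lambda>(p, w). Y w * Z p w * f p)"
proof (rule NM.Fubini_integrable)
  have [measurable]: "Y \<in> borel_measurable M" "f \<in> borel_measurable N"
    using assms by (auto simp: sq_integrable_def)
  show "(\<lambda>(p, w). Y w * Z p w * f p) \<in> borel_measurable (N \<Otimes>\<^sub>M M)" by measurable
  have *: "integrable M (\<lambda>w. Y w * Z p w)" if "p \<in> space N" for p
    by (rule sq_integrable_mult[OF assms(2) sq_Z[OF that]])
  show "AE p in N. integrable M (\<lambda>w. case (p, w) of (p, w) \<Rightarrow> Y w * Z p w * f p)"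
    using * by (intro AE_I2) simp
  have aY: "sq_integrable M (\<lambda>w. \<bar>Y w\<bar>)" using assms(2) by (auto simp: sq_integrable_def)
  have aZ: "sq_integrable M (\<lambda>w. \<bar>Z p w\<bar>)" if "p \<in> space N" for p
    using sq_Z[OF that] by (auto simp: sq_integrable_def)
  show "integrable N (\<lambda>p. \<integral>w. norm (case (p, w) of (p, w) \<Rightarrow> Y w * Z p w * f p) \<partial>M)"
  proof (rule Bochner_Integration.integrable_bound)
    show "integrable N (\<lambda>p. L2_norm_on M Y * sqrt B * f p)"
      using N.sq_integrable_integrable[OF assms(1)] by simp
    show "AE p in N. norm (\<integral>w. norm (case (p, w) of (p, w) \<Rightarrow> Y w * Z p w * f p) \<partial>M)
      \<le> norm (L2_norm_on M Y * sqrt B * f p)"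
    proof (rule AE_I2)
      fix p assume p: "p \<in> space N"
      have "(\<integral>w. norm (case (p, w) of (p, w) \<Rightarrow> Y w * Z p w * f p) \<partial>M) = (\<integral>w. \<bar>Y w\<bar> * \<bar>Z p w\<bar> \<partial>M) * \<bar>f p\<bar>"
        by (simp add: abs_mult)
      moreover have "\<bar>\<integral>w. \<bar>Y w\<bar> * \<bar>Z p w\<bar> \<partial>M\<bar> \<le> L2_norm_on M Y * sqrt B"
        using L2_Cauchy_Schwarz_norm[OF aY aZ[OF p]] L2_norm_Z[OF p]
          mult_left_mono[OF L2_norm_Z[OF p] L2_norm_on_nonneg[of M Y]]
        by (simp add: L2_norm_on_def)
      ultimately show "norm (\<integral>w. norm (case (p, w) of (p, w) \<Rightarrow> Y w * Z p w * f p) \<partial>M)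
          \<le> norm (L2_norm_on M Y * sqrt B * f p)"
        using B_nonneg[OF p] by (simp add: abs_mult mult_right_mono)
    qed
  qed measurable
qed

lemma coef_measurable [measurable]:
  assumes [measurable]: "f \<in> borel_measurable N"
  shows "coef f \<in> borel_measurable M"
  unfolding coef_def by measurable

lemma AE_sq_Z: "AE w in M. sq_integrable N (\<lambda>p. Z p w)"
proof -
  have "AE w in M. integrable N (\<lambda>p. (Z p w)\<^sup>2)"
    using NM.AE_integrable_snd[OF integrable_Z_square] by simp
  then show ?thesis
  proof (rule AE_mp[OF _ AE_I2], intro impI)
    fix w assume "w \<in> space M" "integrable N (\<lambda>p. (Z p w)\<^sup>2)"
    then show "sq_integrable N (\<lambda>p. Z p w)"
      using measurable_Pair1[OF Z_measurable_pair] by (simp add: sq_integrable_def)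
  qed
qed

text \<open>Cauchy-Schwarz over \<open>N\<close> along almost every path gives a bound that is
  integrable because \<open>Z\<close> is square integrable on the product.\<close>

lemma sq_coef:
  assumes "sq_integrable N f"
  shows "sq_integrable M (coef f)"
  unfolding sq_integrable_def
proof
  have [measurable]: "f \<in> borel_measurable N" using assms by (simp add: sq_integrable_def)
  show m: "coef f \<in> borel_measurable M" by measurable
  show "integrable M (\<lambda>w. (coef f w)\<^sup>2)"
  proof (rule Bochner_Integration.integrable_bound)
    show "integrable M (\<lambda>w. (\<integral>p. (Z p w)\<^sup>2 \<partial>N) * (\<integral>p. (f p)\<^sup>2 \<partial>N))"
      using NM.integrable_snd[OF integrable_Z_square] by simp
    show "AE w in M. norm ((coef f w)\<^sup>2) \<le> norm ((\<integral>p. (Z p w)\<^sup>2 \<partial>N) * (\<integral>p. (f p)\<^sup>2 \<partial>N))"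
      using AE_sq_Z
    proof eventually_elim
      case (elim w)
      then show ?case using L2_Cauchy_Schwarz[OF elim assms]
        by (simp add: coef_def abs_mult)
    qed
  qed (use m in measurable)
qed

lemma cross_coef:
  assumes "sq_integrable N f" "sq_integrable M Y"
  shows "(\<integral>w. Y w * coef f w \<partial>M) = (\<integral>p. (\<integral>w. Y w * Z p w \<partial>M) * f p \<partial>N)"
proof -
  have "(\<integral>w. (\<integral>p. Y w * Z p w * f p \<partial>N) \<partial>M) = (\<integral>p. (\<integral>w. Y w * Z p w * f p \<partial>M) \<partial>N)"
    using NM.Fubini_integral[OF integrable_Fubini[OF assms]] .
  moreover have "(\<integral>p. Y w * Z p w * f p \<partial>N) = Y w * coef f w" for w
    by (simp add: coef_def mult.assoc)
  ultimately show ?thesis by simp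
qed

lemma Z_coef:
  assumes "sq_integrable N f" "q \<in> space N"
  shows "(\<integral>w. Z q w * coef f w \<partial>M) = ker_op f q"
  using cross_coef[OF assms(1) sq_Z[OF assms(2)]] by (simp add: ker_op_def ker_def mult.commute)

lemma ker_op_eq_cross:
  assumes "sq_integrable N f" "q \<in> space N"
  shows "ker_op f q = (\<integral>w. coef f w * Z q w \<partial>M)"
  using Z_coef[OF assms] by (simp add: mult.commute)

lemma sq_ker_op:
  assumes "sq_integrable N f"
  shows "sq_integrable N (ker_op f)"
  by (subst sq_integrable_cong[of N _ "\<lambda>q. \<integral>w. coef f w * Z q w \<partial>M"])
    (simp_all add: ker_op_eq_cross[OF assms] sq_cross[OF sq_coef[OF assms]])

lemma coef_inner:
  assumes "sq_integrable N f" "sq_integrable N g"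
  shows "(\<integral>w. coef f w * coef g w \<partial>M) = (\<integral>p. ker_op f p * g p \<partial>N)"
proof -
  have "(\<integral>w. coef f w * coef g w \<partial>M) = (\<integral>p. (\<integral>w. coef f w * Z p w \<partial>M) * g p \<partial>N)"
    by (rule cross_coef[OF assms(2) sq_coef[OF assms(1)]])
  also have "\<dots> = (\<integral>p. ker_op f p * g p \<partial>N)"
    using ker_op_eq_cross[OF assms(1)] by (intro Bochner_Integration.integral_cong) auto
  finally show ?thesis .
qed

lemma ker_op_selfadjoint:
  assumes "sq_integrable N f" "sq_integrable N g"
  shows "(\<integral>p. ker_op f p * g p \<partial>N) = (\<integral>p. f p * ker_op g p \<partial>N)"
  using coef_inner[OF assms] coef_inner[OF assms(2,1)] by (simp add: mult.commute)

text \<open>The adjoint relation bounds the squared norm of \<open>coef f\<close> by this norm times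
  a constant, and one factor cancels. The empty index space is split off because \<open>B\<close> is
  known to be nonnegative only if a point exists.\<close>

lemma coef_norm_bound:
  assumes "sq_integrable N f"
  shows "L2_norm_on M (coef f) \<le> sqrt (B * measure N (space N)) * L2_norm_on N f"
proof (cases "space N = {}")
  case True
  then have "coef f w = 0" for w
    unfolding coef_def by (simp add: Bochner_Integration.integral_empty)
  then show ?thesis using True by (simp add: L2_norm_on_def)
next
  case False
  then have B: "0 \<le> B" using B_nonneg by blast
  have "(\<integral>w. (coef f w)\<^sup>2 \<partial>M) = (\<integral>p. (\<integral>w. coef f w * Z p w \<partial>M) * f p \<partial>N)"
    using cross_coef[OF assms sq_coef[OF assms]] by (simp add: power2_eq_square)
  also have "\<dots> \<le> (\<integral>p. L2_norm_on M (coef f) * sqrt B * \<bar>f p\<bar> \<partial>N)"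
  proof (rule integral_mono)
    show "integrable N (\<lambda>p. (\<integral>w. coef f w * Z p w \<partial>M) * f p)"
      by (rule sq_integrable_mult[OF sq_cross[OF sq_coef[OF assms]] assms])
    show "integrable N (\<lambda>p. L2_norm_on M (coef f) * sqrt B * \<bar>f p\<bar>)"
      using N.sq_integrable_integrable[OF assms] by simp
    fix p assume "p \<in> space N"
    have "(\<integral>w. coef f w * Z p w \<partial>M) * f p \<le> \<bar>\<integral>w. coef f w * Z p w \<partial>M\<bar> * \<bar>f p\<bar>"
      by (metis abs_ge_self abs_mult)
    also have "\<dots> \<le> L2_norm_on M (coef f) * sqrt B * \<bar>f p\<bar>"
      by (rule mult_right_mono[OF cross_bound[OF sq_coef[OF assms] \<open>p \<in> space N\<close>]]) simp
    finally show "(\<integral>w. coef f w * Z p w \<partial>M) * f p \<le> L2_norm_on M (coef f) * sqrt B * \<bar>f p\<bar>" .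
  qed
  also have "\<dots> = L2_norm_on M (coef f) * sqrt B * (\<integral>p. \<bar>f p\<bar> \<partial>N)" by simp
  also have "\<dots> \<le> L2_norm_on M (coef f) * sqrt B * (L2_norm_on N f * sqrt (measure N (space N)))"
    using N.L1_le_L2[OF assms] B by (intro mult_left_mono) auto
  finally have "L2_norm_on M (coef f) * L2_norm_on M (coef f)
      \<le> L2_norm_on M (coef f) * (sqrt (B * measure N (space N)) * L2_norm_on N f)"
    unfolding L2_norm_on_power2[symmetric] by (simp add: power2_eq_square real_sqrt_mult mult_ac)
  moreover have "0 \<le> sqrt (B * measure N (space N)) * L2_norm_on N f"
    using B by (intro mult_nonneg_nonneg) auto
  ultimately show ?thesis
    using L2_norm_on_nonneg[of M "coef f"]
    by (cases "L2_norm_on M (coef f) = 0") (simp_all add: less_le)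
qed

lemma ker_op_bound:
  assumes "sq_integrable N f" "q \<in> space N"
  shows "\<bar>ker_op f q\<bar> \<le> B * sqrt (measure N (space N)) * L2_norm_on N f"
proof -
  have "\<bar>ker_op f q\<bar> \<le> L2_norm_on M (coef f) * sqrt B"
    using cross_bound[OF sq_coef[OF assms(1)] assms(2)] ker_op_eq_cross[OF assms] by simp
  also have "\<dots> \<le> sqrt (B * measure N (space N)) * L2_norm_on N f * sqrt B"
    using B_nonneg[OF assms(2)] by (intro mult_right_mono coef_norm_bound assms) auto
  also have "\<dots> = B * sqrt (measure N (space N)) * L2_norm_on N f"
    using B_nonneg[OF assms(2)] by (simp add: real_sqrt_mult mult_ac)
  finally show ?thesis .
qed

lemma ker_op_diff_bound:
  assumes "sq_integrable N f" "p \<in> space N" "q \<in> space N"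
  shows "\<bar>ker_op f p - ker_op f q\<bar> \<le> sqrt (B * measure N (space N)) * L2_norm_on N f * sqrt (kdist p q)"
proof -
  have "\<bar>ker_op f p - ker_op f q\<bar> \<le> L2_norm_on M (coef f) * sqrt (kdist p q)"
    using cross_diff_bound[OF sq_coef[OF assms(1)] assms(2,3)] ker_op_eq_cross assms by simp
  also have "\<dots> \<le> sqrt (B * measure N (space N)) * L2_norm_on N f * sqrt (kdist p q)"
    by (intro mult_right_mono coef_norm_bound assms) (simp add: kdist_def)
  finally show ?thesis .
qed

lemma integrable_ker_mult:
  assumes "sq_integrable N f" "q \<in> space N"
  shows "integrable N (\<lambda>p. ker p q * f p)"
  by (rule sq_integrable_mult[OF sq_ker[OF assms(2)] assms(1)])

lemma ker_op_add:
  assumes "sq_integrable N f" "sq_integrable N g" "q \<in> space N"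
  shows "ker_op (\<lambda>p. f p + g p) q = ker_op f q + ker_op g q"
  using integrable_ker_mult[OF assms(1,3)] integrable_ker_mult[OF assms(2,3)]
  by (simp add: ker_op_def distrib_left)

lemma ker_op_scale: "ker_op (\<lambda>p. c * f p) q = c * ker_op f q"
proof -
  have "ker_op (\<lambda>p. c * f p) q = (\<integral>p. c * (ker p q * f p) \<partial>N)" by (simp add: ker_op_def mult_ac)
  then show ?thesis by (simp add: ker_op_def)
qed

lemma ker_op_diff:
  assumes "sq_integrable N f" "sq_integrable N g" "q \<in> space N"
  shows "ker_op (\<lambda>p. f p - g p) q = ker_op f q - ker_op g q"
  using integrable_ker_mult[OF assms(1,3)] integrable_ker_mult[OF assms(2,3)]
  by (simp add: ker_op_def right_diff_distrib)

lemma ker_op_cong_AE: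
  assumes "sq_integrable N f" "sq_integrable N g" "AE p in N. f p = g p" "q \<in> space N"
  shows "ker_op f q = ker_op g q"
  unfolding ker_op_def
proof (rule integral_cong_AE)
  show "AE p in N. ker p q * f p = ker p q * g p" using assms(3) by eventually_elim simp
qed (use integrable_ker_mult assms in auto)

text \<open>Arzela-Ascoli for the canonical pseudometric: a subsequence converges on the countable
  union of finite nets, and the common Lipschitz constant from \<open>ker_op_diff_bound\<close>
  spreads this convergence uniformly over the index set.\<close>

lemma ker_op_compact:
  assumes sq: "\<And>n. sq_integrable N (g n)" and bd: "\<And>n. L2_norm_on N (g n) \<le> 1"
  obtains r u where "strict_mono (r :: nat \<Rightarrow> nat)"
    "uniform_limit (space N) (\<lambda>n. ker_op (g (r n))) u sequentially"
proof -
  have "\<forall>n::nat. \<exists>P. finite P \<and> P \<subseteq> space N \<and> (\<forall>p\<in>space N. \<exists>q\<in>P. kdist p q < (1 / real (Suc n))\<^sup>2)"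
    using totally_bounded by (simp add: kdist_def)
  from choice[OF this] obtain P where PP: "\<forall>n::nat. finite (P n) \<and> P n \<subseteq> space N \<and>
      (\<forall>p\<in>space N. \<exists>q\<in>P n. kdist p q < (1 / real (Suc n))\<^sup>2)" by blast
  have P: "\<And>n::nat. finite (P n)" "\<And>n. P n \<subseteq> space N"
      "\<And>n p. p \<in> space N \<Longrightarrow> \<exists>q\<in>P n. kdist p q < (1 / real (Suc n))\<^sup>2" using PP by blast+
  define D where "D = (\<Union>n. P n)"
  have D: "countable D" "D \<subseteq> space N"
    using P by (auto simp: D_def intro: countable_finite)
  define C where "C = \<bar>B\<bar> * sqrt (measure N (space N))"
  have pb: "norm (ker_op (g n) q) \<le> C" if "q \<in> D" for n q
  proof -
    have q: "q \<in> space N" using that D by auto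
    have "\<bar>ker_op (g n) q\<bar> \<le> B * sqrt (measure N (space N)) * L2_norm_on N (g n)"
      by (rule ker_op_bound[OF sq q])
    also have "\<dots> \<le> B * sqrt (measure N (space N)) * 1"
      using B_nonneg[OF q] by (intro mult_left_mono bd) auto
    finally show ?thesis using B_nonneg[OF q] by (simp add: C_def)
  qed
  have "\<exists>r::nat \<Rightarrow> nat. strict_mono r \<and> (\<forall>x\<in>D. \<exists>l. (\<lambda>n. ker_op (g (r n)) x) \<longlonglongrightarrow> l)"
    by (rule function_convergent_subsequence[where f = "\<lambda>n. ker_op (g n)" and S = D and M = C, OF D(1) pb]) blast+
  then obtain r where r: "strict_mono (r :: nat \<Rightarrow> nat)" "\<And>x. x \<in> D \<Longrightarrow> \<exists>l. (\<lambda>n. ker_op (g (r n)) x) \<longlonglongrightarrow> l"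
    by blast
  have "uniformly_Cauchy_on (space N) (\<lambda>n. ker_op (g (r n)))"
  proof (rule uniformly_Cauchy_onI)
    fix e :: real assume e: "0 < e"
    \<comment> \<open>\<open>L\<close> dominates the common Lipschitz constant; the added
      \<open>1\<close> keeps it positive even if \<open>N\<close> has mass zero. The radii of the
      nets are squared because \<open>kdist\<close> is a squared distance.\<close>
    define L where "L = sqrt (\<bar>B\<bar> * measure N (space N)) + 1"
    have L: "0 < L" by (simp add: L_def add_nonneg_pos)
    obtain n where n: "L / real (Suc n) < e / 3"
    proof -
      obtain n where "3 * L / e < real n" using reals_Archimedean2 by blast
      then have "3 * L < real n * e" using e by (simp only: pos_divide_less_eq)
      then have "L < e / 3 * real (Suc n)" using e by (simp add: distrib_left mult.commute)
      then have "L / real (Suc n) < e / 3" by (subst pos_divide_less_eq) simp_all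
      then show thesis by (rule that)
    qed
    have eq: "\<bar>ker_op (g m) p - ker_op (g m) q\<bar> \<le> e / 3"
      if "p \<in> space N" "q \<in> space N" "kdist p q < (1 / real (Suc n))\<^sup>2" for m p q
    proof -
      have kd: "sqrt (kdist p q) \<le> 1 / real (Suc n)"
        using that(3) by (intro real_le_lsqrt) (auto simp: kdist_def)
      have "\<bar>ker_op (g m) p - ker_op (g m) q\<bar> \<le> sqrt (B * measure N (space N)) * L2_norm_on N (g m) * sqrt (kdist p q)"
        by (rule ker_op_diff_bound[OF sq that(1,2)])
      also have "\<dots> \<le> L * 1 * (1 / real (Suc n))"
        using B_nonneg[OF that(1)] by (intro mult_mono kd bd) (auto simp: L_def kdist_def)
      also have "\<dots> = L / real (Suc n)" by simp
      finally show ?thesis using n by linarith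
    qed
    have "\<forall>q\<in>P n. \<exists>K. \<forall>i\<ge>K. \<forall>j\<ge>K. dist (ker_op (g (r i)) q) (ker_op (g (r j)) q) < e / 3"
    proof
      fix q assume "q \<in> P n"
      then have "q \<in> D" by (auto simp: D_def)
      then obtain l where "(\<lambda>n. ker_op (g (r n)) q) \<longlonglongrightarrow> l" using r(2) by blast
      then have c: "Cauchy (\<lambda>n. ker_op (g (r n)) q)" by (rule LIMSEQ_imp_Cauchy)
      have e3: "0 < e / 3" using e by simp
      show "\<exists>K. \<forall>i\<ge>K. \<forall>j\<ge>K. dist (ker_op (g (r i)) q) (ker_op (g (r j)) q) < e / 3"
        by (rule metric_CauchyD[OF c e3])
    qed
    from bchoice[OF this] obtain K where K: "\<And>q i j. q \<in> P n \<Longrightarrow> i \<ge> K q \<Longrightarrow> j \<ge> K q \<Longrightarrow>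
        dist (ker_op (g (r i)) q) (ker_op (g (r j)) q) < e / 3" by blast
    define K0 where "K0 = Max (insert 0 (K ` P n))"
    have K0: "K q \<le> K0" if "q \<in> P n" for q
      using that P(1)[of n] by (auto simp: K0_def)
    have "dist (ker_op (g (r i)) p) (ker_op (g (r j)) p) < e" if pN: "p \<in> space N" and "i \<ge> K0" "j \<ge> K0" for p i j
    proof -
      obtain q where q: "q \<in> P n" "kdist p q < (1 / real (Suc n))\<^sup>2" using P(3)[OF pN] by blast
      then have qN: "q \<in> space N" using P(2) by auto
      have "dist (ker_op (g (r i)) q) (ker_op (g (r j)) q) < e / 3"
        using K[OF q(1), of i j] K0[OF q(1)] that by linarith
      with eq[OF pN qN q(2), of "r i"] eq[OF pN qN q(2), of "r j"]
      show ?thesis unfolding dist_real_def by linarith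
    qed
    then show "\<exists>M. \<forall>x\<in>space N. \<forall>m\<ge>M. \<forall>n\<ge>M. dist (ker_op (g (r m)) x) (ker_op (g (r n)) x) < e"
      by blast
  qed
  then have "uniformly_convergent_on (space N) (\<lambda>n. ker_op (g (r n)))"
    by (rule Cauchy_uniformly_convergent)
  then obtain u where "uniform_limit (space N) (\<lambda>n. ker_op (g (r n))) u sequentially"
    unfolding uniformly_convergent_on_def by blast
  then show thesis by (rule that[OF r(1)])
qed

lemma ker_op_cong: "(\<And>p. p \<in> space N \<Longrightarrow> f p = g p) \<Longrightarrow> ker_op f q = ker_op g q"
  unfolding ker_op_def by (intro Bochner_Integration.integral_cong) auto

lemma square_integral_le:
  assumes "\<And>p. p \<in> space N \<Longrightarrow> \<bar>f p\<bar> \<le> C" "0 \<le> C"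
  shows "(\<integral>p. (f p)\<^sup>2 \<partial>N) \<le> C\<^sup>2 * measure N (space N)"
proof (cases "integrable N (\<lambda>p. (f p)\<^sup>2)")
  case True
  have "(\<integral>p. (f p)\<^sup>2 \<partial>N) \<le> (\<integral>p. C\<^sup>2 \<partial>N)"
  proof (rule integral_mono[OF True])
    show "(f p)\<^sup>2 \<le> C\<^sup>2" if "p \<in> space N" for p
      using assms(1)[OF that] assms(2) by (simp add: abs_le_square_iff[symmetric])
  qed simp
  then show ?thesis by (simp add: mult.commute)
next
  \<comment> \<open>The integral of a non-integrable function is \<open>0\<close>, which respects
    the bound.\<close>
  case False
  then show ?thesis by (simp add: not_integrable_integral_eq)
qed

lemma ker_op_L2_bound:
  assumes "sq_integrable N f"
  shows "L2_norm_on N (ker_op f) \<le> \<bar>B\<bar> * measure N (space N) * L2_norm_on N f"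
proof -
  define C where "C = \<bar>B\<bar> * sqrt (measure N (space N)) * L2_norm_on N f"
  have C: "0 \<le> C" by (simp add: C_def)
  have "(\<integral>p. (ker_op f p)\<^sup>2 \<partial>N) \<le> C\<^sup>2 * measure N (space N)"
  proof (rule square_integral_le)
    show "\<bar>ker_op f p\<bar> \<le> C" if "p \<in> space N" for p
      using ker_op_bound[OF assms that] B_nonneg[OF that] by (simp add: C_def)
  qed (rule C)
  then have "L2_norm_on N (ker_op f) \<le> sqrt (C\<^sup>2 * measure N (space N))"
    unfolding L2_norm_on_def by (rule real_sqrt_le_mono)
  also have "\<dots> = \<bar>B\<bar> * measure N (space N) * L2_norm_on N f"
    using C by (simp add: real_sqrt_mult) (simp add: C_def)
  finally show ?thesis .
qed

text \<open>Power iteration: \<open>T\<^sup>n f / \<parallel>T\<^sup>n f\<parallel>\<close> subconverges to an eigenvector of \<open>T\<^sup>2\<close>, since the ratios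
  \<open>\<parallel>T\<^sup>n\<^sup>+\<^sup>1 f\<parallel> / \<parallel>T\<^sup>n f\<parallel>\<close> increase; and all iterates stay orthogonal to the eigenvectors to which \<open>f\<close> is.\<close>

lemma eigenvector_exists:
  assumes f: "sq_integrable N f" and nz: "L2_norm_on N (ker_op f) \<noteq> 0"
  shows "\<exists>h mu. mu \<noteq> 0 \<and> sq_integrable N h \<and> L2_norm_on N h \<noteq> 0 \<and>
    (\<forall>p\<in>space N. ker_op h p = mu * h p) \<and>
    (\<forall>u l. sq_integrable N u \<and> (\<forall>p\<in>space N. ker_op u p = l * u p) \<and> (\<integral>p. f p * u p \<partial>N) = 0
      \<longrightarrow> (\<integral>p. h p * u p \<partial>N) = 0)"
proof -
  define F where "F n = (ker_op ^^ n) f" for n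
  define a where "a n = (\<integral>p. (F n p)\<^sup>2 \<partial>N)" for n
  define \<rho> where "\<rho> n = a (Suc n) / a n" for n
  define D where "D = (\<bar>B\<bar> * measure N (space N))\<^sup>2"
  have F_Suc: "F (Suc n) = ker_op (F n)" for n by (simp add: F_def)
  have sqF: "sq_integrable N (F n)" for n
    by (induction n) (simp_all add: F_Suc sq_ker_op, simp add: F_def f)
  have a_nn: "0 \<le> a n" for n by (simp add: a_def)
  have a_bd: "a (Suc n) \<le> D * a n" for n
    using power_mono[OF ker_op_L2_bound[OF sqF[of n]] L2_norm_on_nonneg, of 2]
    by (simp add: a_def D_def F_Suc L2_norm_on_power2 power_mult_distrib)
  \<comment> \<open>Self-adjointness writes the squared norm of the iterate \<open>Suc n\<close> as
    an inner product of the iterates \<open>n\<close> and \<open>Suc (Suc n)\<close>; Cauchy-Schwarz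
    then gives log-convexity, which is the monotonicity of the ratios \<open>\<rho>\<close>.\<close>
  have log_convex: "(a (Suc n))\<^sup>2 \<le> a n * a (Suc (Suc n))" for n
  proof -
    have "a (Suc n) = (\<integral>p. ker_op (F n) p * F (Suc n) p \<partial>N)"
      by (simp add: a_def F_Suc power2_eq_square)
    also have "\<dots> = (\<integral>p. F n p * F (Suc (Suc n)) p \<partial>N)"
      unfolding F_Suc[of "Suc n"] by (rule ker_op_selfadjoint[OF sqF sqF])
    finally show ?thesis
      using L2_Cauchy_Schwarz[OF sqF[of n] sqF[of "Suc (Suc n)"]] by (simp add: a_def)
  qed
  have a1: "0 < a (Suc 0)"
    using nz a_nn[of "Suc 0"] by (simp add: a_def F_def L2_norm_on_def less_le)
  have a_Suc: "0 < a (Suc n)" for n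
  proof (induction n)
    case (Suc n)
    have "0 < (a (Suc n))\<^sup>2" using Suc by simp
    also have "\<dots> \<le> a n * a (Suc (Suc n))" by (rule log_convex)
    finally have "a (Suc (Suc n)) \<noteq> 0" by auto
    then show ?case using a_nn[of "Suc (Suc n)"] by (simp add: less_le)
  qed (rule a1)
  have a0: "0 < a 0"
  proof -
    have "0 < D * a 0" using a_bd[of 0] a1 by linarith
    then have "a 0 \<noteq> 0" by auto
    then show ?thesis using a_nn[of 0] by (simp add: less_le)
  qed
  have a_pos: "0 < a n" for n
    using a0 a_Suc by (cases n) auto
  have \<rho>_inc: "incseq \<rho>"
  proof (rule incseq_SucI)
    fix n show "\<rho> n \<le> \<rho> (Suc n)"
      using log_convex[of n] a_pos[of n] a_pos[of "Suc n"]
      by (simp add: \<rho>_def divide_simps power2_eq_square mult_ac)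
  qed
  have \<rho>_bd: "\<rho> n \<le> D" for n
    using a_bd[of n] a_pos[of n] by (simp add: \<rho>_def pos_divide_le_eq)
  obtain \<rho>0 where \<rho>0: "\<rho> \<longlonglongrightarrow> \<rho>0" "\<And>n. \<rho> n \<le> \<rho>0"
    using incseq_convergent[OF \<rho>_inc, of D] \<rho>_bd by blast
  have \<rho>0_pos: "0 < \<rho>0"
  proof -
    have "0 < \<rho> 0" using a_pos by (simp add: \<rho>_def)
    then show ?thesis using \<rho>0(2)[of 0] by linarith
  qed
  define g where "g n p = (1 / sqrt (a n)) * F n p" for n p
  have sqg: "sq_integrable N (g n)" for n
    unfolding g_def by (intro sq_integrable_scale sqF)
  have sqKg: "sq_integrable N (ker_op (g n))" for n by (rule sq_ker_op[OF sqg])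
  have g1: "L2_norm_on N (g n) = 1" for n
    using a_pos[of n] unfolding g_def L2_norm_on_scale by (simp add: L2_norm_on_def a_def)
  have Kg: "ker_op (g n) p = (1 / sqrt (a n)) * F (Suc n) p" for n p
    unfolding g_def ker_op_scale F_Suc ..
  have KKg: "ker_op (ker_op (g n)) p = (1 / sqrt (a n)) * F (Suc (Suc n)) p" for n p
  proof -
    have "ker_op (g n) = (\<lambda>p. (1 / sqrt (a n)) * F (Suc n) p)" using Kg by blast
    then show ?thesis by (simp only: ker_op_scale F_Suc)
  qed
  \<comment> \<open>Since \<open>g n\<close> has norm one, the squared norm of T g and the inner
    product of T T g with g are both \<open>\<rho> n\<close>, while the squared norm of T T g is
    \<open>\<rho> (Suc n) * \<rho> n\<close>. The expanded square tends to
    \<open>\<rho>0\<^sup>2 - 2 * \<rho>0\<^sup>2 + \<rho>0\<^sup>2\<close>.\<close>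
  have near: "(\<lambda>n. \<integral>p. (ker_op (ker_op (g n)) p - \<rho>0 * g n p)\<^sup>2 \<partial>N) \<longlonglongrightarrow> 0"
  proof -
    have "(\<integral>p. (ker_op (ker_op (g n)) p - \<rho>0 * g n p)\<^sup>2 \<partial>N) = \<rho> (Suc n) * \<rho> n - 2 * \<rho>0 * \<rho> n + \<rho>0\<^sup>2" for n
    proof -
      have "(\<integral>p. (ker_op (ker_op (g n)) p - \<rho>0 * g n p)\<^sup>2 \<partial>N)
        = (\<integral>p. (ker_op (ker_op (g n)) p)\<^sup>2 \<partial>N) - 2 * (\<integral>p. ker_op (ker_op (g n)) p * (\<rho>0 * g n p) \<partial>N)
          + (\<integral>p. (\<rho>0 * g n p)\<^sup>2 \<partial>N)"
        by (rule L2_inner_diff_square[OF sq_ker_op[OF sqKg] sq_integrable_scale[OF sqg]])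
      also have "(\<integral>p. (ker_op (ker_op (g n)) p)\<^sup>2 \<partial>N) = \<rho> (Suc n) * \<rho> n"
        using a_pos[of n] a_pos[of "Suc n"] unfolding KKg power_mult_distrib
        by (simp add: \<rho>_def power_divide a_def)
      also have "(\<integral>p. ker_op (ker_op (g n)) p * (\<rho>0 * g n p) \<partial>N) = \<rho>0 * \<rho> n"
      proof -
        have "(\<integral>p. ker_op (ker_op (g n)) p * (\<rho>0 * g n p) \<partial>N) = \<rho>0 * (\<integral>p. ker_op (ker_op (g n)) p * g n p \<partial>N)"
          by (simp add: mult.left_commute)
        also have "(\<integral>p. ker_op (ker_op (g n)) p * g n p \<partial>N) = (\<integral>p. ker_op (g n) p * ker_op (g n) p \<partial>N)"
          by (rule ker_op_selfadjoint[OF sqKg sqg])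
        also have "\<dots> = (\<integral>p. (1 / sqrt (a n))\<^sup>2 * (F (Suc n) p)\<^sup>2 \<partial>N)"
          unfolding Kg by (simp add: power2_eq_square mult_ac)
        also have "\<dots> = \<rho> n"
          using a_pos[of n] by (simp add: \<rho>_def a_def power_divide)
        finally show ?thesis .
      qed
      also have "(\<integral>p. (\<rho>0 * g n p)\<^sup>2 \<partial>N) = \<rho>0\<^sup>2"
        using g1[of n] by (simp add: power_mult_distrib L2_norm_on_def)
      finally show ?thesis by simp
    qed
    moreover have "(\<lambda>n. \<rho> (Suc n) * \<rho> n - 2 * \<rho>0 * \<rho> n + \<rho>0\<^sup>2) \<longlonglongrightarrow> \<rho>0 * \<rho>0 - 2 * \<rho>0 * \<rho>0 + \<rho>0\<^sup>2"
      by (intro tendsto_intros \<rho>0(1) LIMSEQ_Suc)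
    ultimately show ?thesis by (simp add: power2_eq_square)
  qed
  have g1': "L2_norm_on N (g n) \<le> 1" for n using g1[of n] by simp
  obtain r u where r: "strict_mono (r :: nat \<Rightarrow> nat)"
    and u: "uniform_limit (space N) (\<lambda>n. ker_op (g (r n))) u sequentially"
    by (rule ker_op_compact[of g, OF sqg g1'])
  have u_lim: "(\<lambda>n. ker_op (g (r n)) p) \<longlonglongrightarrow> u p" if "p \<in> space N" for p
    by (rule tendsto_uniform_limitI[OF u that])
  have squ: "sq_integrable N u"
  proof (rule N.sq_integrable_bounded)
    show "u \<in> borel_measurable N"
      by (rule borel_measurable_LIMSEQ_real[where u = "\<lambda>n. ker_op (g (r n))", OF u_lim sq_integrable_measurable[OF sqKg]])
    fix p assume p: "p \<in> space N"
    show "\<bar>u p\<bar> \<le> B * sqrt (measure N (space N))"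
    proof (rule LIMSEQ_le_const2[OF tendsto_rabs[OF u_lim[OF p]]], intro exI allI impI)
      fix n show "\<bar>ker_op (g (r n)) p\<bar> \<le> B * sqrt (measure N (space N))"
        using ker_op_bound[OF sqg p, of "r n"] by (simp add: g1)
    qed
  qed
  have Kgu: "(\<lambda>n. \<integral>p. (ker_op (g (r n)) p - u p)\<^sup>2 \<partial>N) \<longlonglongrightarrow> 0"
  proof (rule tendstoI)
    fix \<epsilon> :: real assume \<epsilon>: "0 < \<epsilon>"
    define \<delta> where "\<delta> = sqrt (\<epsilon> / (measure N (space N) + 1))"
    have pos: "0 < measure N (space N) + 1" by (simp add: add_nonneg_pos)
    have \<delta>: "0 < \<delta>" "\<delta>\<^sup>2 * measure N (space N) < \<epsilon>"
    proof -
      show "0 < \<delta>" using \<epsilon> pos by (simp add: \<delta>_def)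
      have "\<delta>\<^sup>2 * measure N (space N) = \<epsilon> * measure N (space N) / (measure N (space N) + 1)"
        using \<epsilon> pos by (simp add: \<delta>_def)
      also have "\<dots> < \<epsilon>"
        using \<epsilon> pos by (simp add: pos_divide_less_eq distrib_left)
      finally show "\<delta>\<^sup>2 * measure N (space N) < \<epsilon>" .
    qed
    have "\<forall>\<^sub>F n in sequentially. \<forall>p\<in>space N. dist (ker_op (g (r n)) p) (u p) < \<delta>"
      using uniform_limitD[OF u \<delta>(1)] .
    then show "\<forall>\<^sub>F n in sequentially. dist (\<integral>p. (ker_op (g (r n)) p - u p)\<^sup>2 \<partial>N) 0 < \<epsilon>"
    proof eventually_elim
      case (elim n)
      have "(\<integral>p. (ker_op (g (r n)) p - u p)\<^sup>2 \<partial>N) \<le> \<delta>\<^sup>2 * measure N (space N)"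
        using elim \<delta>(1) by (intro square_integral_le) (auto simp: dist_real_def less_imp_le)
      then show ?case using \<delta>(2) by simp
    qed
  qed
  have KKgu: "(\<lambda>n. \<integral>p. (ker_op (ker_op (g (r n))) p - ker_op u p)\<^sup>2 \<partial>N) \<longlonglongrightarrow> 0"
  proof (rule Lim_null_comparison[OF _ tendsto_mult_right_zero[OF Kgu, of D]], intro always_eventually allI)
    fix n
    have s: "sq_integrable N (\<lambda>p. ker_op (g (r n)) p - u p)" by (intro sq_integrable_diff sqKg squ)
    have "(\<integral>p. (ker_op (ker_op (g (r n))) p - ker_op u p)\<^sup>2 \<partial>N)
        = (\<integral>p. (ker_op (\<lambda>p. ker_op (g (r n)) p - u p) p)\<^sup>2 \<partial>N)"
      using ker_op_diff[OF sqKg squ] by (intro Bochner_Integration.integral_cong) auto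
    also have "\<dots> \<le> D * (\<integral>p. (ker_op (g (r n)) p - u p)\<^sup>2 \<partial>N)"
      using power_mono[OF ker_op_L2_bound[OF s] L2_norm_on_nonneg, of 2]
      by (simp add: D_def L2_norm_on_power2 power_mult_distrib)
    finally show "norm (\<integral>p. (ker_op (ker_op (g (r n))) p - ker_op u p)\<^sup>2 \<partial>N) \<le> D * (\<integral>p. (ker_op (g (r n)) p - u p)\<^sup>2 \<partial>N)"
      by simp
  qed
  \<comment> \<open>T T g is close to \<open>\<rho>0 * g\<close> and converges to T u, so the limit
    of \<open>g\<close> can only be T u divided by \<open>\<rho>0\<close>. The formula fixes
    \<open>h0\<close> at every point, so that the eigenvalue equation will hold at every point
    too.\<close>
  define h0 where "h0 p = (1 / \<rho>0) * ker_op u p" for p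
  have sqh: "sq_integrable N h0" unfolding h0_def by (intro sq_integrable_scale sq_ker_op squ)
  have gh: "(\<lambda>n. \<integral>p. (g (r n) p - h0 p)\<^sup>2 \<partial>N) \<longlonglongrightarrow> 0"
  proof -
    have lim: "(\<lambda>n. (1 / \<rho>0\<^sup>2) * (2 * (\<integral>p. (ker_op (ker_op (g (r n))) p - \<rho>0 * g (r n) p)\<^sup>2 \<partial>N)
        + 2 * (\<integral>p. (ker_op (ker_op (g (r n))) p - ker_op u p)\<^sup>2 \<partial>N))) \<longlonglongrightarrow> (1 / \<rho>0\<^sup>2) * (2 * 0 + 2 * 0)"
      by (intro tendsto_intros KKgu LIMSEQ_subseq_LIMSEQ[OF near r, unfolded o_def])
    have lim0: "(\<lambda>n. (1 / \<rho>0\<^sup>2) * (2 * (\<integral>p. (ker_op (ker_op (g (r n))) p - \<rho>0 * g (r n) p)\<^sup>2 \<partial>N)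
        + 2 * (\<integral>p. (ker_op (ker_op (g (r n))) p - ker_op u p)\<^sup>2 \<partial>N))) \<longlonglongrightarrow> 0"
      using lim by simp
    show ?thesis
    proof (rule Lim_null_comparison[OF _ lim0], intro always_eventually allI)
      fix n
      have "(\<integral>p. (g (r n) p - h0 p)\<^sup>2 \<partial>N) = (\<integral>p. (1 / \<rho>0\<^sup>2) * ((\<rho>0 * g (r n) p - ker_op (ker_op (g (r n))) p)
          + (ker_op (ker_op (g (r n))) p - ker_op u p))\<^sup>2 \<partial>N)"
      proof (rule Bochner_Integration.integral_cong[OF refl])
        fix p
        have "g (r n) p - h0 p = (1 / \<rho>0) * (\<rho>0 * g (r n) p - ker_op u p)"
          using \<rho>0_pos by (simp add: h0_def right_diff_distrib)
        then show "(g (r n) p - h0 p)\<^sup>2 = (1 / \<rho>0\<^sup>2) * ((\<rho>0 * g (r n) p - ker_op (ker_op (g (r n))) p)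
          + (ker_op (ker_op (g (r n))) p - ker_op u p))\<^sup>2"
          by (simp add: power_mult_distrib power_divide)
      qed
      also have "\<dots> = (1 / \<rho>0\<^sup>2) * (\<integral>p. ((\<rho>0 * g (r n) p - ker_op (ker_op (g (r n))) p)
          + (ker_op (ker_op (g (r n))) p - ker_op u p))\<^sup>2 \<partial>N)" by simp
      also have "\<dots> \<le> (1 / \<rho>0\<^sup>2) * (2 * (\<integral>p. (\<rho>0 * g (r n) p - ker_op (ker_op (g (r n))) p)\<^sup>2 \<partial>N)
          + 2 * (\<integral>p. (ker_op (ker_op (g (r n))) p - ker_op u p)\<^sup>2 \<partial>N))"
        by (intro mult_left_mono square_sum_bound sq_integrable_diff sq_integrable_scale sq_ker_op sqg squ) simp
      finally show "norm (\<integral>p. (g (r n) p - h0 p)\<^sup>2 \<partial>N)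
        \<le> (1 / \<rho>0\<^sup>2) * (2 * (\<integral>p. (ker_op (ker_op (g (r n))) p - \<rho>0 * g (r n) p)\<^sup>2 \<partial>N)
          + 2 * (\<integral>p. (ker_op (ker_op (g (r n))) p - ker_op u p)\<^sup>2 \<partial>N))"
        by (simp add: power2_commute)
    qed
  qed
  have Kh0: "ker_op h0 p = u p" if p: "p \<in> space N" for p
  proof (rule LIMSEQ_unique[OF _ u_lim[OF p]])
    have "(\<lambda>n. B * sqrt (measure N (space N)) * L2_norm_on N (\<lambda>p. g (r n) p - h0 p)) \<longlonglongrightarrow> 0"
      using tendsto_mult_right_zero[OF tendsto_real_sqrt[OF gh, simplified]] unfolding L2_norm_on_def .
    then have "(\<lambda>n. ker_op (g (r n)) p - ker_op h0 p) \<longlonglongrightarrow> 0"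
    proof (rule Lim_null_comparison[rotated], intro always_eventually allI)
      fix n
      show "norm (ker_op (g (r n)) p - ker_op h0 p) \<le> B * sqrt (measure N (space N)) * L2_norm_on N (\<lambda>p. g (r n) p - h0 p)"
        using ker_op_bound[OF sq_integrable_diff[OF sqg sqh] p, of "r n"] ker_op_diff[OF sqg sqh p, of "r n"] by simp
    qed
    then show "(\<lambda>n. ker_op (g (r n)) p) \<longlonglongrightarrow> ker_op h0 p" by (rule LIM_zero_cancel)
  qed
  have KKh0: "ker_op (ker_op h0) p = \<rho>0 * h0 p" for p
    using ker_op_cong[of "ker_op h0" u p] Kh0 \<rho>0_pos by (simp add: h0_def)
  have h01: "(\<integral>p. (h0 p)\<^sup>2 \<partial>N) = 1"
  proof (rule LIMSEQ_unique[OF L2_tendsto_square[OF sqg sqh gh]])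
    have "(\<integral>p. (g (r n) p)\<^sup>2 \<partial>N) = 1" for n using g1[of "r n"] by (simp add: L2_norm_on_def)
    then show "(\<lambda>n. \<integral>p. (g (r n) p)\<^sup>2 \<partial>N) \<longlonglongrightarrow> 1" by simp
  qed
  have orth: "(\<integral>p. h0 p * v p \<partial>N) = 0"
    if v: "sq_integrable N v" "\<forall>p\<in>space N. ker_op v p = l * v p" "(\<integral>p. f p * v p \<partial>N) = 0" for v l
  proof -
    have "(\<integral>p. F n p * v p \<partial>N) = 0" for n
    proof (induction n)
      case (Suc n)
      have "(\<integral>p. F (Suc n) p * v p \<partial>N) = (\<integral>p. F n p * ker_op v p \<partial>N)"
        unfolding F_Suc by (rule ker_op_selfadjoint[OF sqF v(1)])
      also have "\<dots> = (\<integral>p. l * (F n p * v p) \<partial>N)"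
        using v(2) by (intro Bochner_Integration.integral_cong) auto
      finally show ?case using Suc by simp
    qed (simp add: F_def v)
    then have "(\<integral>p. g n p * v p \<partial>N) = 0" for n
      unfolding g_def by (simp add: mult.assoc)
    then show ?thesis
      using L2_tendsto_inner[OF sqg sqh v(1) gh] by (simp add: LIMSEQ_const_iff)
  qed
  have orthK: "(\<integral>p. ker_op h0 p * v p \<partial>N) = 0"
    if v: "sq_integrable N v" "\<forall>p\<in>space N. ker_op v p = l * v p" "(\<integral>p. f p * v p \<partial>N) = 0" for v l
  proof -
    have "(\<integral>p. ker_op h0 p * v p \<partial>N) = (\<integral>p. h0 p * ker_op v p \<partial>N)"
      by (rule ker_op_selfadjoint[OF sqh v(1)])
    also have "\<dots> = (\<integral>p. l * (h0 p * v p) \<partial>N)"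
      using v(2) by (intro Bochner_Integration.integral_cong) auto
    finally show ?thesis using orth[OF v] by simp
  qed
  \<comment> \<open>T T h0 = \<open>\<rho>0\<close> h0 factors as (T - s)(T + s) h0 = 0: either (T +
    s) h0 is an eigenvector for \<open>s\<close>, or it vanishes and \<open>h0\<close> is one for
    \<open>- s\<close>.\<close>
  define s where "s = sqrt \<rho>0"
  have s: "0 < s" "s * s = \<rho>0" using \<rho>0_pos by (auto simp: s_def)
  define h1 where "h1 p = ker_op h0 p + s * h0 p" for p
  have sqh1: "sq_integrable N h1" unfolding h1_def by (intro sq_integrable_intros sq_ker_op sqh)
  have Kh1: "ker_op h1 p = s * h1 p" if "p \<in> space N" for p
  proof -
    have "ker_op h1 p = ker_op (ker_op h0) p + ker_op (\<lambda>p. s * h0 p) p"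
      unfolding h1_def by (rule ker_op_add[OF sq_ker_op[OF sqh] sq_integrable_scale[OF sqh] that])
    then show ?thesis by (simp add: KKh0 ker_op_scale h1_def distrib_left s(2)[symmetric] mult.assoc)
  qed
  show ?thesis
  proof (cases "L2_norm_on N h1 = 0")
    case False
    have orth1: "(\<integral>p. h1 p * v p \<partial>N) = 0"
      if v: "sq_integrable N v" "\<forall>p\<in>space N. ker_op v p = l * v p" "(\<integral>p. f p * v p \<partial>N) = 0" for v l
      using orth[OF v] orthK[OF v] sq_integrable_mult[OF sq_ker_op[OF sqh] v(1)] sq_integrable_mult[OF sqh v(1)]
      by (simp add: h1_def distrib_right mult.assoc)
    show ?thesis
    proof (rule exI[of _ h1], rule exI[of _ s], intro conjI allI impI)
      fix u l assume "sq_integrable N u \<and> (\<forall>p\<in>space N. ker_op u p = l * u p) \<and> (\<integral>p. f p * u p \<partial>N) = 0"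
      then show "(\<integral>p. h1 p * u p \<partial>N) = 0" using orth1[of u l] by blast
    next
      show "s \<noteq> 0" using s(1) by blast
      show "sq_integrable N h1" by (rule sqh1)
      show "L2_norm_on N h1 \<noteq> 0" by (rule False)
      show "\<forall>p\<in>space N. ker_op h1 p = s * h1 p" by (rule ballI) (rule Kh1)
    qed
  next
    case True
    then have "AE p in N. h1 p = 0"
      using square_integral_zero_AE[OF sqh1] by (simp add: L2_norm_on_def)
    \<comment> \<open>Almost everywhere becomes everywhere: \<open>ker_op h1\<close> does not see
      null sets, so it is zero at every point, where it also equals \<open>s * h1\<close>.\<close>
    then have "s * h1 p = 0" if "p \<in> space N" for p
      using ker_op_cong_AE[OF sqh1 sq_integrable_zero _ that] Kh1[OF that] by (simp add: ker_op_def)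
    then have K: "\<forall>p\<in>space N. ker_op h0 p = - s * h0 p"
      using s(1) by (simp add: h1_def add_eq_0_iff)
    have nz0: "L2_norm_on N h0 \<noteq> 0" using h01 by (simp add: L2_norm_on_def)
    show ?thesis
    proof (rule exI[of _ h0], rule exI[of _ "- s"], intro conjI allI impI)
      fix u l assume "sq_integrable N u \<and> (\<forall>p\<in>space N. ker_op u p = l * u p) \<and> (\<integral>p. f p * u p \<partial>N) = 0"
      then show "(\<integral>p. h0 p * u p \<partial>N) = 0" using orth[of u l] by blast
    next
      show "- s \<noteq> 0" using s(1) by linarith
      show "sq_integrable N h0" by (rule sqh)
      show "L2_norm_on N h0 \<noteq> 0" by (rule nz0)
      show "\<forall>p\<in>space N. ker_op h0 p = - s * h0 p" by (rule K)
    qed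
  qed
qed

subsection \<open>Mercer expansion\<close>

text \<open>If \<open>f p\<close> were non-zero, the Lipschitz bound would keep \<open>f\<close>
  away from zero on a whole ball around \<open>p\<close>, and \<open>full_support\<close> forbids
  such a ball to be null. The squared radius is \<open>c\<close> in the proof; adding
  \<open>1\<close> to \<open>\<bar>L\<bar>\<close> avoids a division by zero.\<close>

lemma zero_by_full_support:
  assumes f: "\<And>q. q \<in> space N \<Longrightarrow> \<bar>f p - f q\<bar> \<le> L * sqrt (kdist p q)"
    and AE: "AE q in N. f q = 0" and p: "p \<in> space N"
  shows "f p = (0::real)"
proof (rule ccontr)
  assume nz: "f p \<noteq> 0"
  define c where "c = (\<bar>f p\<bar> / (\<bar>L\<bar> + 1))\<^sup>2"
  have L: "0 < \<bar>L\<bar> + 1" by simp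
  have c: "0 < c" using nz L by (simp add: c_def)
  have "AE q in N. c \<le> (\<integral>w. (Z q w - Z p w)\<^sup>2 \<partial>M)"
    using AE AE_space
  proof eventually_elim
    case (elim q)
    have k: "0 \<le> kdist p q" by (simp add: kdist_def)
    have "\<bar>f p\<bar> \<le> L * sqrt (kdist p q)" using f[OF elim(2)] elim(1) by simp
    also have "\<dots> \<le> (\<bar>L\<bar> + 1) * sqrt (kdist p q)" using k by (intro mult_right_mono) auto
    finally have "\<bar>f p\<bar> / (\<bar>L\<bar> + 1) \<le> sqrt (kdist p q)"
      using L by (simp only: pos_divide_le_eq mult.commute)
    then have "c \<le> (sqrt (kdist p q))\<^sup>2"
      unfolding c_def by (rule power_mono) simp
    then have "c \<le> kdist q p" using k by (simp add: kdist_commute)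
    then show ?case by (simp add: kdist_def)
  qed
  then show False using full_support[OF p c] by simp
qed

end

text \<open>Completeness of the system is phrased as the absence of an eigenvector for a non-zero
  eigenvalue that is orthogonal to all \<open>e j\<close>, because such an eigenvector is what power
  iteration would produce. The eigenvalue equation is demanded at every point, since the expansion
  is to hold at every point.\<close>

locale kl_system = kl_field N M Z B
  for N :: "'p measure" and M :: "'w measure" and Z B +
  fixes J :: "nat set" and lam :: "nat \<Rightarrow> real" and e :: "nat \<Rightarrow> 'p \<Rightarrow> real"
  assumes sq_e: "j \<in> J \<Longrightarrow> sq_integrable N (e j)"
    and eig: "j \<in> J \<Longrightarrow> p \<in> space N \<Longrightarrow> ker_op (e j) p = lam j * e j p"
    and lam_nz: "j \<in> J \<Longrightarrow> lam j \<noteq> 0"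
    and ortho: "i \<in> J \<Longrightarrow> j \<in> J \<Longrightarrow> (\<integral>p. e i p * e j p \<partial>N) = (if i = j then 1 else 0)"
    and complete: "mu \<noteq> 0 \<Longrightarrow> sq_integrable N h \<Longrightarrow> (\<And>p. p \<in> space N \<Longrightarrow> ker_op h p = mu * h p) \<Longrightarrow>
      (\<And>j. j \<in> J \<Longrightarrow> (\<integral>p. h p * e j p \<partial>N) = 0) \<Longrightarrow> L2_norm_on N h = 0"
begin

definition Jm :: "nat \<Rightarrow> nat set" where "Jm m = {j. j \<in> J \<and> j \<le> m}"

definition xi :: "nat \<Rightarrow> 'w \<Rightarrow> real" where "xi j = coef (e j)"

definition remainder :: "nat \<Rightarrow> 'p \<Rightarrow> 'w \<Rightarrow> real" where
  "remainder m p w = Z p w - (\<Sum>j\<in>Jm m. xi j w * e j p)"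

text \<open>The covariance kernel of the field \<open>remainder m\<close>, see
  \<open>remainder_inner\<close>; its diagonal is the mean-square error of the truncated
  expansion.\<close>

definition kres :: "nat \<Rightarrow> 'p \<Rightarrow> 'p \<Rightarrow> real" where
  "kres m p q = ker p q - (\<Sum>j\<in>Jm m. lam j * e j p * e j q)"

lemma Jm_finite [simp]: "finite (Jm m)" by (simp add: Jm_def)
lemma Jm_J: "j \<in> Jm m \<Longrightarrow> j \<in> J" by (simp add: Jm_def)

lemma sq_xi: "j \<in> J \<Longrightarrow> sq_integrable M (xi j)"
  unfolding xi_def by (intro sq_coef sq_e)

lemma xi_inner: "i \<in> J \<Longrightarrow> j \<in> J \<Longrightarrow> (\<integral>w. xi i w * xi j w \<partial>M) = (if i = j then lam i else 0)"
proof -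
  assume ij: "i \<in> J" "j \<in> J"
  have "(\<integral>w. xi i w * xi j w \<partial>M) = (\<integral>p. ker_op (e i) p * e j p \<partial>N)"
    unfolding xi_def by (rule coef_inner[OF sq_e[OF ij(1)] sq_e[OF ij(2)]])
  also have "\<dots> = (\<integral>p. lam i * (e i p * e j p) \<partial>N)"
    using eig[OF ij(1)] by (intro Bochner_Integration.integral_cong) auto
  finally show ?thesis using ortho[OF ij] by simp
qed

text \<open>\<open>lam j\<close> is the variance of \<open>xi j\<close>, and it is non-zero by
  assumption.\<close>

lemma lam_pos: "j \<in> J \<Longrightarrow> 0 < lam j"
proof -
  assume j: "j \<in> J"
  have "lam j = (\<integral>w. (xi j w)\<^sup>2 \<partial>M)" using xi_inner[OF j j] by (simp add: power2_eq_square)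
  then have "0 \<le> lam j" by simp
  then show ?thesis using lam_nz[OF j] by simp
qed

lemma Z_xi: "j \<in> J \<Longrightarrow> p \<in> space N \<Longrightarrow> (\<integral>w. Z p w * xi j w \<partial>M) = lam j * e j p"
  unfolding xi_def by (simp add: Z_coef sq_e eig)

lemma sq_part: "sq_integrable M (\<lambda>w. \<Sum>j\<in>Jm m. xi j w * e j p)"
  by (intro sq_integrable_sum, subst mult.commute) (auto intro: sq_integrable_scale sq_xi Jm_J)

lemma sq_remainder: "p \<in> space N \<Longrightarrow> sq_integrable M (remainder m p)"
  unfolding remainder_def by (intro sq_integrable_diff sq_Z sq_part)

text \<open>The sum in \<open>remainder\<close> is the orthogonal projection of \<open>Z p\<close>
  onto the span of the \<open>xi j\<close>: the projection coefficient E(Z_p xi_j) / E(xi_j^2) is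
  \<open>e j p\<close> by \<open>Z_xi\<close> and \<open>xi_inner\<close>.\<close>

lemma remainder_xi:
  assumes "p \<in> space N" "j \<in> Jm m"
  shows "(\<integral>w. remainder m p w * xi j w \<partial>M) = 0"
proof -
  have j: "j \<in> J" using assms(2) by (rule Jm_J)
  have i: "integrable M (\<lambda>w. xi i w * xi j w)" if "i \<in> Jm m" for i
    by (rule sq_integrable_mult[OF sq_xi[OF Jm_J[OF that]] sq_xi[OF j]])
  have "(\<integral>w. remainder m p w * xi j w \<partial>M)
      = (\<integral>w. Z p w * xi j w - (\<Sum>i\<in>Jm m. e i p * (xi i w * xi j w)) \<partial>M)"
    unfolding remainder_def left_diff_distrib sum_distrib_right
    by (intro Bochner_Integration.integral_cong refl arg_cong2[where f = minus] sum.cong) (simp only: mult_ac)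
  also have "\<dots> = lam j * e j p - (\<Sum>i\<in>Jm m. e i p * (\<integral>w. xi i w * xi j w \<partial>M))"
    using sq_integrable_mult[OF sq_Z[OF assms(1)] sq_xi[OF j]] i Z_xi[OF j assms(1)]
    by (subst Bochner_Integration.integral_diff) (auto intro!: Bochner_Integration.integrable_sum simp: Bochner_Integration.integral_sum)
  also have "(\<Sum>i\<in>Jm m. e i p * (\<integral>w. xi i w * xi j w \<partial>M)) = (\<Sum>i\<in>Jm m. if i = j then e i p * lam i else 0)"
    using j by (intro sum.cong) (auto simp: xi_inner Jm_J)
  also have "\<dots> = e j p * lam j" using assms(2) by simp
  finally show ?thesis by simp
qed

lemma remainder_Z:
  assumes "p \<in> space N" "q \<in> space N"
  shows "(\<integral>w. remainder m p w * Z q w \<partial>M) = kres m p q"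
proof -
  have i: "integrable M (\<lambda>w. Z q w * xi j w)" if "j \<in> Jm m" for j
    by (rule sq_integrable_mult[OF sq_Z[OF assms(2)] sq_xi[OF Jm_J[OF that]]])
  have "(\<integral>w. remainder m p w * Z q w \<partial>M) = (\<integral>w. Z p w * Z q w - (\<Sum>j\<in>Jm m. e j p * (Z q w * xi j w)) \<partial>M)"
    unfolding remainder_def left_diff_distrib sum_distrib_right
    by (intro Bochner_Integration.integral_cong refl arg_cong2[where f = minus] sum.cong) (simp only: mult_ac)
  also have "\<dots> = ker p q - (\<Sum>j\<in>Jm m. e j p * (\<integral>w. Z q w * xi j w \<partial>M))"
    using sq_integrable_mult[OF sq_Z[OF assms(1)] sq_Z[OF assms(2)]] i
    by (subst Bochner_Integration.integral_diff)
      (auto intro!: Bochner_Integration.integrable_sum simp: Bochner_Integration.integral_sum ker_def)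
  also have "(\<Sum>j\<in>Jm m. e j p * (\<integral>w. Z q w * xi j w \<partial>M)) = (\<Sum>j\<in>Jm m. lam j * e j p * e j q)"
    using assms(2) by (intro sum.cong) (auto simp: Z_xi Jm_J mult_ac)
  finally show ?thesis by (simp add: kres_def)
qed

lemma remainder_inner:
  assumes "p \<in> space N" "q \<in> space N"
  shows "(\<integral>w. remainder m p w * remainder m q w \<partial>M) = kres m p q"
proof -
  have i: "integrable M (\<lambda>w. remainder m p w * xi j w)" if "j \<in> Jm m" for j
    by (rule sq_integrable_mult[OF sq_remainder[OF assms(1)] sq_xi[OF Jm_J[OF that]]])
  have "(\<integral>w. remainder m p w * remainder m q w \<partial>M)
      = (\<integral>w. remainder m p w * Z q w - (\<Sum>j\<in>Jm m. e j q * (remainder m p w * xi j w)) \<partial>M)"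
    by (simp add: remainder_def[of m q] right_diff_distrib sum_distrib_left mult_ac)
  also have "\<dots> = kres m p q - (\<Sum>j\<in>Jm m. e j q * (\<integral>w. remainder m p w * xi j w \<partial>M))"
    using sq_integrable_mult[OF sq_remainder[OF assms(1)] sq_Z[OF assms(2)]] i remainder_Z[OF assms]
    by (subst Bochner_Integration.integral_diff)
      (auto intro!: Bochner_Integration.integrable_sum simp: Bochner_Integration.integral_sum)
  also have "(\<Sum>j\<in>Jm m. e j q * (\<integral>w. remainder m p w * xi j w \<partial>M)) = 0"
    using remainder_xi[OF assms(1)] by (intro sum.neutral) auto
  finally show ?thesis by simp
qed

lemma remainder_square: "p \<in> space N \<Longrightarrow> (\<integral>w. (remainder m p w)\<^sup>2 \<partial>M) = kres m p p"
  using remainder_inner[of p p m] by (simp add: power2_eq_square)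

lemma kres_diag_nonneg: "p \<in> space N \<Longrightarrow> 0 \<le> kres m p p"
  by (simp flip: remainder_square)

lemma kres_diag_le: "p \<in> space N \<Longrightarrow> kres m p p \<le> ker p p"
  unfolding kres_def by (auto intro!: sum_nonneg simp: mult.assoc less_imp_le[OF lam_pos] Jm_J)

lemma ker_diag_le: "p \<in> space N \<Longrightarrow> ker p p \<le> B"
  using Z_square_bound by (simp add: ker_diag)

lemma bessel: "p \<in> space N \<Longrightarrow> (\<Sum>j\<in>Jm m. lam j * (e j p)\<^sup>2) \<le> ker p p"
  using kres_diag_nonneg[of p m] by (simp add: kres_def power2_eq_square mult.assoc)

lemma kres_abs_le:
  assumes "p \<in> space N" "q \<in> space N"
  shows "\<bar>kres m p q\<bar> \<le> sqrt (kres m p p) * sqrt (kres m q q)"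
  using L2_Cauchy_Schwarz_norm[OF sq_remainder[OF assms(1)] sq_remainder[OF assms(2)], of m m]
    remainder_inner[OF assms] remainder_square assms by (simp add: L2_norm_on_def)

lemma kres_le_B:
  assumes "p \<in> space N" "q \<in> space N"
  shows "\<bar>kres m p q\<bar> \<le> B"
proof -
  have "\<bar>kres m p q\<bar> \<le> sqrt (kres m p p) * sqrt (kres m q q)" by (rule kres_abs_le[OF assms])
  also have "\<dots> \<le> sqrt B * sqrt B"
    using kres_diag_le ker_diag_le assms kres_diag_nonneg B_nonneg[OF assms(1)]
    by (intro mult_mono real_sqrt_le_mono) (auto intro: order_trans)
  finally show ?thesis using B_nonneg[OF assms(1)] by simp
qed

lemma kdist_ker:
  assumes "p \<in> space N" "q \<in> space N"
  shows "kdist p q = ker p p - 2 * ker p q + ker q q"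
  unfolding kdist_def ker_diag using L2_inner_diff_square[OF sq_Z[OF assms(1)] sq_Z[OF assms(2)]]
  by (simp add: ker_def)

text \<open>Subtracting a projection shrinks increments: the squared increment of the remainder is
  \<open>kdist p q\<close> minus the sum of the \<open>lam j * (e j p - e j q)\<^sup>2\<close>. The
  bound is uniform in \<open>m\<close>, so decay on a finite net will spread to all points.\<close>

lemma kres_diag_near:
  assumes "p \<in> space N" "q \<in> space N"
  shows "kres m p p \<le> 2 * kres m q q + 2 * kdist p q"
proof -
  have s: "sq_integrable M (\<lambda>w. remainder m p w - remainder m q w)"
    by (intro sq_integrable_diff sq_remainder assms)
  have "kres m p p = (\<integral>w. ((remainder m p w - remainder m q w) + remainder m q w)\<^sup>2 \<partial>M)"
    using remainder_square[OF assms(1)] by simp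
  also have "\<dots> \<le> 2 * (\<integral>w. (remainder m p w - remainder m q w)\<^sup>2 \<partial>M) + 2 * (\<integral>w. (remainder m q w)\<^sup>2 \<partial>M)"
    by (rule square_sum_bound[OF s sq_remainder[OF assms(2)]])
  also have "(\<integral>w. (remainder m p w - remainder m q w)\<^sup>2 \<partial>M) = kres m p p - 2 * kres m p q + kres m q q"
    using L2_inner_diff_square[OF sq_remainder[OF assms(1)] sq_remainder[OF assms(2)]]
      remainder_square remainder_inner assms by simp
  also have "\<dots> = kdist p q - (\<Sum>j\<in>Jm m. lam j * (e j p - e j q)\<^sup>2)"
    unfolding kdist_ker[OF assms] kres_def
    by (simp add: power2_eq_square algebra_simps sum.distrib sum_subtractf sum_distrib_left)
  also have "\<dots> \<le> kdist p q"
    by (auto intro!: sum_nonneg simp: less_imp_le[OF lam_pos] Jm_J)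
  finally show ?thesis using remainder_square[OF assms(2)] by simp
qed

lemma sq_kres: "p \<in> space N \<Longrightarrow> sq_integrable N (kres m p)"
proof (rule N.sq_integrable_bounded)
  assume p: "p \<in> space N"
  show "kres m p \<in> borel_measurable N"
    unfolding kres_def
    using ker_measurable_pair[OF p] sq_e Jm_J
    by (intro borel_measurable_diff borel_measurable_sum borel_measurable_times borel_measurable_const)
      (auto simp: ker_commute sq_integrable_def)
  show "\<bar>kres m p q\<bar> \<le> B" if "q \<in> space N" for q by (rule kres_le_B[OF p that])
qed

lemma kres_inner:
  assumes p: "p \<in> space N" and f: "sq_integrable N f"
  shows "(\<integral>q. kres m p q * f q \<partial>N) = ker_op f p - (\<Sum>j\<in>Jm m. lam j * e j p * (\<integral>q. f q * e j q \<partial>N))"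
proof -
  have i: "integrable N (\<lambda>q. f q * e j q)" if "j \<in> Jm m" for j
    by (rule sq_integrable_mult[OF f sq_e[OF Jm_J[OF that]]])
  have k: "integrable N (\<lambda>q. ker p q * f q)"
    using integrable_ker_mult[OF f p] by (simp add: ker_commute)
  have "(\<integral>q. kres m p q * f q \<partial>N) = (\<integral>q. ker p q * f q - (\<Sum>j\<in>Jm m. lam j * e j p * (f q * e j q)) \<partial>N)"
    unfolding kres_def left_diff_distrib sum_distrib_right
    by (intro Bochner_Integration.integral_cong refl arg_cong2[where f = minus] sum.cong) (simp only: mult_ac)
  also have "\<dots> = (\<integral>q. ker p q * f q \<partial>N) - (\<Sum>j\<in>Jm m. lam j * e j p * (\<integral>q. f q * e j q \<partial>N))"
    using i k by (subst Bochner_Integration.integral_diff)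
      (auto intro!: Bochner_Integration.integrable_sum simp: Bochner_Integration.integral_sum)
  also have "(\<integral>q. ker p q * f q \<partial>N) = ker_op f p" by (simp add: ker_op_def ker_commute)
  finally show ?thesis .
qed

lemma kres_e:
  assumes "p \<in> space N" "j \<in> Jm m"
  shows "(\<integral>q. kres m p q * e j q \<partial>N) = 0"
proof -
  have j: "j \<in> J" using assms(2) by (rule Jm_J)
  have "(\<Sum>i\<in>Jm m. lam i * e i p * (\<integral>q. e j q * e i q \<partial>N)) = (\<Sum>i\<in>Jm m. if i = j then lam i * e i p else 0)"
    using j by (intro sum.cong) (auto simp: ortho Jm_J)
  also have "\<dots> = lam j * e j p" using assms(2) by simp
  finally show ?thesis using kres_inner[OF assms(1) sq_e[OF j]] eig[OF j assms(1)] by simp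
qed

text \<open>Bounding a product by the sum of the two squares reduces the subtracted series to its
  values at \<open>(p, p)\<close> and \<open>(q, q)\<close>, and there Bessel's inequality bounds
  the partial sums.\<close>

lemma kres_convergent:
  assumes "p \<in> space N" "q \<in> space N"
  shows "convergent (\<lambda>m. kres m p q)"
proof -
  define s where "s j = (if j \<in> J then lam j * e j p * e j q else 0)" for j
  have sum_s: "(\<Sum>j\<in>Jm m. lam j * e j p * e j q) = (\<Sum>j\<le>m. s j)" for m
    unfolding s_def Jm_def by (subst sum.inter_filter[symmetric]) (auto intro: sum.cong)
  have abs_s: "\<bar>s j\<bar> = (if j \<in> J then lam j * (\<bar>e j p\<bar> * \<bar>e j q\<bar>) else 0)" for j
    by (simp add: s_def abs_mult less_imp_le[OF lam_pos] mult.assoc)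
  have "summable (\<lambda>j. \<bar>s j\<bar>)"
  proof (rule summableI_nonneg_bounded)
    fix n
    have "(\<Sum>j<n. \<bar>s j\<bar>) \<le> (\<Sum>j\<le>n. \<bar>s j\<bar>)" by (intro sum_mono2) auto
    also have "\<dots> = (\<Sum>j\<in>Jm n. lam j * (\<bar>e j p\<bar> * \<bar>e j q\<bar>))"
      unfolding abs_s Jm_def by (subst sum.inter_filter[symmetric]) (auto intro: sum.cong)
    also have "\<dots> \<le> (\<Sum>j\<in>Jm n. lam j * ((e j p)\<^sup>2 + (e j q)\<^sup>2))"
    proof (intro sum_mono mult_left_mono)
      fix j
      show "\<bar>e j p\<bar> * \<bar>e j q\<bar> \<le> (e j p)\<^sup>2 + (e j q)\<^sup>2"
        using sum_squares_bound[of "\<bar>e j p\<bar>" "\<bar>e j q\<bar>"] mult_nonneg_nonneg[OF abs_ge_zero abs_ge_zero, of "e j p" "e j q"]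
        unfolding power2_abs mult.assoc by linarith
    qed (auto simp: less_imp_le[OF lam_pos] Jm_J)
    also have "\<dots> \<le> ker p p + ker q q"
      using bessel[OF assms(1), of n] bessel[OF assms(2), of n] by (simp add: distrib_left sum.distrib)
    finally show "(\<Sum>j<n. \<bar>s j\<bar>) \<le> ker p p + ker q q" .
  qed simp
  then have "summable s" by (rule summable_rabs_cancel)
  then have "(\<lambda>m. \<Sum>j\<le>m. s j) \<longlonglongrightarrow> suminf s" by (rule summable_LIMSEQ')
  then have "(\<lambda>m. kres m p q) \<longlonglongrightarrow> ker p q - suminf s"
    unfolding kres_def sum_s by (intro tendsto_intros)
  then show ?thesis by (rule convergentI)
qed

text \<open>The limit \<open>f\<close> of row \<open>p\<close> of the residual kernel is orthogonal
  to all \<open>e j\<close>. If \<open>ker_op f\<close> were non-zero,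
  \<open>eigenvector_exists\<close> would yield an eigenvector orthogonal to all \<open>e j\<close>,
  against \<open>complete\<close>. So \<open>ker_op f\<close> vanishes almost everywhere and then at
  \<open>p\<close>; but its value at \<open>p\<close> is the squared norm of \<open>f\<close>. Hence
  \<open>f\<close> is zero almost everywhere, and by its Lipschitz bound also at
  \<open>p\<close>.\<close>

lemma kres_pointwise:
  assumes p: "p \<in> space N"
  shows "(\<lambda>m. kres m p p) \<longlonglongrightarrow> 0"
proof -
  define f where "f q = lim (\<lambda>m. kres m p q)" for q
  have f_lim: "(\<lambda>m. kres m p q) \<longlonglongrightarrow> f q" if "q \<in> space N" for q
    using kres_convergent[OF p that] unfolding f_def by (simp add: convergent_LIMSEQ_iff)
  have sqf: "sq_integrable N f"
  proof (rule N.sq_integrable_bounded)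
    show "f \<in> borel_measurable N"
      by (rule borel_measurable_LIMSEQ_real[where u = "\<lambda>m. kres m p", OF f_lim sq_integrable_measurable[OF sq_kres[OF p]]])
    show "\<bar>f q\<bar> \<le> B" if q: "q \<in> space N" for q
      by (rule LIMSEQ_le_const2[OF tendsto_rabs[OF f_lim[OF q]]]) (use kres_le_B[OF p q] in auto)
  qed
  have dc: "(\<lambda>m. \<integral>q. kres m p q * g q \<partial>N) \<longlonglongrightarrow> (\<integral>q. f q * g q \<partial>N)" if g: "sq_integrable N g" for g
  proof (rule integral_dominated_convergence[where w = "\<lambda>q. B * \<bar>g q\<bar>"])
    show "(\<lambda>q. f q * g q) \<in> borel_measurable N"
      using sq_integrable_mult[OF sqf g] by auto
    show "(\<lambda>q. kres m p q * g q) \<in> borel_measurable N" for m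
      using sq_integrable_mult[OF sq_kres[OF p] g] by auto
    show "integrable N (\<lambda>q. B * \<bar>g q\<bar>)" using N.sq_integrable_integrable[OF g] by simp
    show "AE q in N. (\<lambda>m. kres m p q * g q) \<longlonglongrightarrow> f q * g q"
      using f_lim by (intro AE_I2 tendsto_intros) auto
    show "AE q in N. norm (kres m p q * g q) \<le> B * \<bar>g q\<bar>" for m
      using kres_le_B[OF p] by (intro AE_I2) (simp add: abs_mult mult_right_mono)
  qed
  have orth: "(\<integral>q. f q * e j q \<partial>N) = 0" if j: "j \<in> J" for j
  proof (rule LIMSEQ_unique[OF dc[OF sq_e[OF j]]])
    have "\<forall>\<^sub>F m in sequentially. (\<integral>q. kres m p q * e j q \<partial>N) = 0"
      using kres_e[OF p] j by (intro eventually_sequentiallyI[of j]) (simp add: Jm_def)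
    then show "(\<lambda>m. \<integral>q. kres m p q * e j q \<partial>N) \<longlonglongrightarrow> 0" by (rule tendsto_eventually)
  qed
  \<comment> \<open>Orthogonality to the \<open>e j\<close> removes the finite sum in
    \<open>kres_inner\<close>, so the pairing of the row with \<open>f\<close> is
    \<open>ker_op f p\<close> for every \<open>m\<close>; dominated convergence evaluates the same
    pairing in the limit.\<close>
  have Kf: "ker_op f p = (\<integral>q. (f q)\<^sup>2 \<partial>N)"
  proof (rule LIMSEQ_unique[of "\<lambda>m. \<integral>q. kres m p q * f q \<partial>N"])
    have "(\<integral>q. kres m p q * f q \<partial>N) = ker_op f p" for m
      using kres_inner[OF p sqf, of m] orth Jm_J by simp
    then show "(\<lambda>m. \<integral>q. kres m p q * f q \<partial>N) \<longlonglongrightarrow> ker_op f p" by simp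
    show "(\<lambda>m. \<integral>q. kres m p q * f q \<partial>N) \<longlonglongrightarrow> (\<integral>q. (f q)\<^sup>2 \<partial>N)"
      using dc[OF sqf] by (simp add: power2_eq_square)
  qed
  have "(\<integral>q. (f q)\<^sup>2 \<partial>N) = 0"
  proof (cases "L2_norm_on N (ker_op f) = 0")
    case True
    then have "AE q in N. ker_op f q = 0"
      using square_integral_zero_AE[OF sq_ker_op[OF sqf]] by (simp add: L2_norm_on_def)
    then have "ker_op f p = 0"
      using zero_by_full_support[where f = "ker_op f" and p = p, OF ker_op_diff_bound[OF sqf p] _ p] by blast
    then show ?thesis using Kf by simp
  next
    case False
    from eigenvector_exists[OF sqf False] obtain h mu where h: "mu \<noteq> 0" "sq_integrable N h" "L2_norm_on N h \<noteq> 0"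
      "\<forall>p\<in>space N. ker_op h p = mu * h p"
      "\<And>u l. sq_integrable N u \<Longrightarrow> (\<forall>p\<in>space N. ker_op u p = l * u p) \<Longrightarrow> (\<integral>p. f p * u p \<partial>N) = 0
        \<Longrightarrow> (\<integral>p. h p * u p \<partial>N) = 0" by blast
    have "(\<integral>p. h p * e j p \<partial>N) = 0" if "j \<in> J" for j
      by (rule h(5)[OF sq_e[OF that] _ orth[OF that], of "lam j"]) (use eig[OF that] in auto)
    then have "L2_norm_on N h = 0" using complete[OF h(1,2)] h(4) by blast
    then show ?thesis using h(3) by simp
  qed
  then have "AE q in N. f q = 0" using square_integral_zero_AE[OF sqf] by simp
  then have "f p = 0"
  proof (rule zero_by_full_support[rotated, OF _ p])
    fix q assume q: "q \<in> space N"
    \<comment> \<open>The remainder has at most the norm of \<open>Z p\<close>, so all rows share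
      the Lipschitz constant \<open>sqrt B\<close>, which survives the limit in
      \<open>m\<close>.\<close>
    show "\<bar>f p - f q\<bar> \<le> sqrt B * sqrt (kdist p q)"
    proof (rule LIMSEQ_le_const2[OF tendsto_rabs[OF tendsto_diff[OF f_lim[OF p] f_lim[OF q]]]], intro exI allI impI)
      fix m
      have "\<bar>kres m p p - kres m p q\<bar> \<le> L2_norm_on M (remainder m p) * sqrt (kdist p q)"
        using cross_diff_bound[OF sq_remainder[OF p] p q] remainder_Z p q by simp
      also have "\<dots> \<le> sqrt B * sqrt (kdist p q)"
        using kres_diag_le[OF p, of m] ker_diag_le[OF p] remainder_square[OF p, of m]
        by (intro mult_right_mono) (auto simp: L2_norm_on_def kdist_def)
      finally show "\<bar>kres m p p - kres m p q\<bar> \<le> sqrt B * sqrt (kdist p q)" .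
    qed
  qed
  then show ?thesis using f_lim[OF p] by simp
qed

text \<open>Mercer's theorem. Total boundedness of the field in \<open>L\<^sup>2\<close> replaces Dini's theorem.\<close>

theorem kres_uniform:
  assumes \<epsilon>: "0 < \<epsilon>"
  shows "\<exists>m0. \<forall>m\<ge>m0. \<forall>p\<in>space N. kres m p p < \<epsilon>"
proof -
  \<comment> \<open>\<open>kres_diag_near\<close> doubles both the error at the net point and the
    squared distance to it, hence a quarter of \<open>\<epsilon>\<close> for each.\<close>
  obtain P where P: "finite P" "P \<subseteq> space N" "\<And>p. p \<in> space N \<Longrightarrow> \<exists>q\<in>P. kdist p q < \<epsilon> / 4"
    using totally_bounded[of "\<epsilon> / 4"] \<epsilon> by (auto simp: kdist_def)
  have "\<exists>m0. \<forall>m\<ge>m0. kres m q q < \<epsilon> / 4" if "q \<in> P" for q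
    using order_tendstoD(2)[OF kres_pointwise, of q "\<epsilon> / 4"] that P(2) \<epsilon> by (auto simp: eventually_sequentially)
  then obtain m0 where m0: "\<And>q m. q \<in> P \<Longrightarrow> m0 q \<le> m \<Longrightarrow> kres m q q < \<epsilon> / 4" by metis
  have "kres m p p < \<epsilon>" if m: "Max (insert 0 (m0 ` P)) \<le> m" and p: "p \<in> space N" for m p
  proof -
    obtain q where q: "q \<in> P" "kdist p q < \<epsilon> / 4" using P(3)[OF p] by blast
    have "m0 q \<le> Max (insert 0 (m0 ` P))" using q(1) P(1) by (intro Max_ge) auto
    then have "kres m q q < \<epsilon> / 4" using m0[OF q(1)] m by simp
    then show ?thesis using kres_diag_near[OF p, of q m] q P(2) by auto
  qed
  then show ?thesis by blast
qed

text \<open>Integrating Bessel's inequality over the diagonal compares the eigenvalues with the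
  trace of the kernel. This is the source of nuclearity.\<close>

lemma sum_lam_le: "(\<Sum>j\<in>Jm m. lam j) \<le> B * measure N (space N)"
proof -
  have i: "integrable N (\<lambda>p. (e j p)\<^sup>2)" if "j \<in> Jm m" for j
    using sq_integrable_square[OF sq_e[OF Jm_J[OF that]]] .
  have one: "(\<integral>p. (e j p)\<^sup>2 \<partial>N) = 1" if "j \<in> Jm m" for j
    using ortho[of j j] Jm_J[OF that] by (simp add: power2_eq_square)
  have "(\<Sum>j\<in>Jm m. lam j) = (\<integral>p. (\<Sum>j\<in>Jm m. lam j * (e j p)\<^sup>2) \<partial>N)"
    using i one by (subst Bochner_Integration.integral_sum) auto
  also have "\<dots> \<le> (\<integral>p. B \<partial>N)"
  proof (rule integral_mono)
    show "integrable N (\<lambda>p. \<Sum>j\<in>Jm m. lam j * (e j p)\<^sup>2)"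
      using i by (intro Bochner_Integration.integrable_sum) auto
    show "(\<Sum>j\<in>Jm m. lam j * (e j p)\<^sup>2) \<le> B" if "p \<in> space N" for p
      using bessel[OF that, of m] ker_diag_le[OF that] by linarith
  qed simp
  finally show ?thesis by (simp add: mult.commute)
qed

text \<open>The residual kernel is a covariance, so by Cauchy-Schwarz its off-diagonal values are
  controlled by the diagonal, and the smallness of the mean-square errors passes to the
  operator.\<close>

lemma ker_op_expansion_error:
  assumes f: "sq_integrable N f" and p: "p \<in> space N" and small: "\<And>q. q \<in> space N \<Longrightarrow> kres m q q \<le> \<epsilon>"
  shows "\<bar>ker_op f p - (\<Sum>j\<in>Jm m. lam j * (\<integral>q. f q * e j q \<partial>N) * e j p)\<bar> \<le> \<epsilon> * (\<integral>q. \<bar>f q\<bar> \<partial>N)"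
proof -
  have \<epsilon>: "0 \<le> \<epsilon>" using small[OF p] kres_diag_nonneg[OF p, of m] by linarith
  have "ker_op f p - (\<Sum>j\<in>Jm m. lam j * (\<integral>q. f q * e j q \<partial>N) * e j p) = (\<integral>q. kres m p q * f q \<partial>N)"
    using kres_inner[OF p f, of m] by (simp add: mult_ac)
  also have "\<bar>\<dots>\<bar> \<le> (\<integral>q. \<epsilon> * \<bar>f q\<bar> \<partial>N)"
  proof (rule order_trans[OF integral_abs_bound integral_mono])
    show "integrable N (\<lambda>q. \<bar>kres m p q * f q\<bar>)" using sq_integrable_mult[OF sq_kres[OF p] f] by simp
    show "integrable N (\<lambda>q. \<epsilon> * \<bar>f q\<bar>)" using N.sq_integrable_integrable[OF f] by simp
    fix q assume q: "q \<in> space N"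
    have "\<bar>kres m p q\<bar> \<le> sqrt (kres m p p) * sqrt (kres m q q)" by (rule kres_abs_le[OF p q])
    also have "\<dots> \<le> sqrt \<epsilon> * sqrt \<epsilon>"
      using small p q kres_diag_nonneg \<epsilon> by (intro mult_mono) auto
    finally show "\<bar>kres m p q * f q\<bar> \<le> \<epsilon> * \<bar>f q\<bar>" using \<epsilon> by (simp add: abs_mult mult_right_mono)
  qed
  finally show ?thesis by simp
qed

end

subsection \<open>Multi-indices and iterated partial derivatives\<close>

lemma coords_distinct_UNIV: "distinct (coords :: 'n::finite list) \<and> set (coords :: 'n list) = UNIV"
proof -
  obtain xs :: "'n list" where "set xs = UNIV" "distinct xs"
    using finite_distinct_list[of "UNIV :: 'n set"] by auto
  then have "\<exists>xs :: 'n list. distinct xs \<and> set xs = UNIV" by blast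
  then show ?thesis unfolding coords_def by (rule someI_ex)
qed

lemma mi_order_inc [simp]: "mi_order (mi_inc i \<alpha>) = Suc (mi_order \<alpha>)"
proof -
  have "mi_order (mi_inc i \<alpha>) = (\<Sum>j\<in>UNIV. \<alpha> j + (if j = i then 1 else 0))"
    unfolding mi_order_def mi_inc_def by (intro sum.cong) auto
  then show ?thesis by (simp add: sum.distrib mi_order_def)
qed

lemma mi_order_zero [simp]: "mi_order mi_zero = 0"
  by (simp add: mi_order_def mi_zero_def)

lemma cderiv_zero [simp]: "cderiv mi_zero f = f"
proof -
  have "foldr (\<lambda>i. partial_deriv i ^^ mi_zero i) xs f = f" for xs
    by (induction xs) (auto simp: mi_zero_def)
  then show ?thesis by (simp add: cderiv_def)
qed

lemma finite_mi_order_le: "finite {\<alpha> :: 'n::finite multi_index. mi_order \<alpha> \<le> k}"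
proof (rule finite_subset)
  have "\<alpha> x \<le> k" if "mi_order \<alpha> \<le> k" for \<alpha> :: "'n multi_index" and x
    using that member_le_sum[of x UNIV \<alpha>] by (simp add: mi_order_def)
  then show "{\<alpha> :: 'n multi_index. mi_order \<alpha> \<le> k} \<subseteq> {\<alpha>. \<forall>x. (x \<in> UNIV \<longrightarrow> \<alpha> x \<in> {..k}) \<and> (x \<notin> UNIV \<longrightarrow> \<alpha> x = 0)}"
    by auto
  show "finite {\<alpha> :: 'n multi_index. \<forall>x. (x \<in> UNIV \<longrightarrow> \<alpha> x \<in> {..k}) \<and> (x \<notin> UNIV \<longrightarrow> \<alpha> x = 0)}"
    by (rule finite_set_of_finite_funs) simp_all
qed

text \<open>\<open>foldr\<close> applies the head of the list last, so the outermost derivative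
  belongs to the first listed coordinate with a positive exponent; lowering this exponent by one
  peels it off.\<close>

lemma foldr_partial_split:
  assumes "distinct xs" "\<exists>i\<in>set xs. \<alpha> i > 0"
  shows "\<exists>i\<in>set xs. \<exists>\<alpha>'. \<alpha> = mi_inc i \<alpha>' \<and>
    (\<forall>f. foldr (\<lambda>i. partial_deriv i ^^ \<alpha> i) xs f = partial_deriv i (foldr (\<lambda>i. partial_deriv i ^^ \<alpha>' i) xs f))"
  using assms
proof (induction xs)
  case (Cons x ys)
  show ?case
  proof (cases "\<alpha> x > 0")
    case True
    define \<alpha>' where "\<alpha>' = \<alpha>(x := \<alpha> x - 1)"
    have inc: "\<alpha> = mi_inc x \<alpha>'" using True by (auto simp: \<alpha>'_def mi_inc_def)
    have eq: "foldr (\<lambda>i. partial_deriv i ^^ \<alpha> i) ys f = foldr (\<lambda>i. partial_deriv i ^^ \<alpha>' i) ys f" for f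
      using Cons.prems(1) by (intro foldr_cong) (auto simp: \<alpha>'_def)
    have "\<alpha> x = Suc (\<alpha>' x)" using True by (simp add: \<alpha>'_def)
    then have "\<forall>f. foldr (\<lambda>i. partial_deriv i ^^ \<alpha> i) (x # ys) f
        = partial_deriv x (foldr (\<lambda>i. partial_deriv i ^^ \<alpha>' i) (x # ys) f)"
      by (simp add: eq)
    with inc show ?thesis by (intro bexI[of _ x] exI[of _ \<alpha>'] conjI) simp_all
  next
    case False
    then obtain i \<alpha>' where i: "i \<in> set ys" "\<alpha> = mi_inc i \<alpha>'"
      "\<And>f. foldr (\<lambda>i. partial_deriv i ^^ \<alpha> i) ys f = partial_deriv i (foldr (\<lambda>i. partial_deriv i ^^ \<alpha>' i) ys f)"
      using Cons by auto
    have z: "\<alpha> x = 0" "\<alpha>' x = 0" using False i(1,2) Cons.prems(1) by (auto simp: mi_inc_def split: if_splits)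
    then have "\<forall>f. foldr (\<lambda>i. partial_deriv i ^^ \<alpha> i) (x # ys) f
        = partial_deriv i (foldr (\<lambda>i. partial_deriv i ^^ \<alpha>' i) (x # ys) f)"
      by (simp add: i(3))
    with i(1,2) show ?thesis by (intro bexI[of _ i] exI[of _ \<alpha>'] conjI) simp_all
  qed
qed simp

text \<open>Induction along the order in which \<open>cderiv\<close> differentiates, so that each
  step exposes the outermost derivative. Its direction is dictated by the enumeration of the
  coordinates; any other direction has to come from the class definitions.\<close>

lemma mi_induct [case_names zero inc]:
  fixes \<alpha> :: "'n::finite multi_index"
  assumes "P mi_zero"
    and "\<And>i \<alpha>. (\<And>f. cderiv (mi_inc i \<alpha>) f = partial_deriv i (cderiv \<alpha> f)) \<Longrightarrow> P \<alpha> \<Longrightarrow> P (mi_inc i \<alpha>)"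
  shows "P \<alpha>"
proof (induction "mi_order \<alpha>" arbitrary: \<alpha>)
  case 0
  then have "\<alpha> = mi_zero" by (auto simp: mi_order_def mi_zero_def)
  then show ?case using assms(1) by simp
next
  case (Suc n)
  have "\<exists>i\<in>set (coords :: 'n list). \<alpha> i > 0"
  proof (rule ccontr)
    assume "\<not> ?thesis"
    then have "\<alpha> i = 0" for i using coords_distinct_UNIV by auto
    then show False using Suc(2) by (simp add: mi_order_def)
  qed
  then obtain i \<alpha>' where i: "\<alpha> = mi_inc i \<alpha>'" "\<And>f. cderiv \<alpha> f = partial_deriv i (cderiv \<alpha>' f)"
    using foldr_partial_split[of coords \<alpha>] coords_distinct_UNIV unfolding cderiv_def by blast
  have "P \<alpha>'" using Suc(1)[of \<alpha>'] Suc(2) i(1) by simp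
  then show ?case using assms(2)[of i \<alpha>'] i by simp
qed

lemma line_eventually_in:
  fixes S :: "(real ^ 'n::finite) set"
  assumes "open S" "x \<in> S"
  shows "\<forall>\<^sub>F s in nhds 0. x + s *\<^sub>R axis i 1 \<in> S"
proof -
  have "((\<lambda>s. x + s *\<^sub>R axis i 1) \<longlongrightarrow> x + 0 *\<^sub>R axis i 1) (nhds (0::real))"
    by (intro tendsto_intros filterlim_ident)
  then show ?thesis using topological_tendstoD[of _ _ _ S] assms by simp
qed

lemma partial_deriv_cong:
  fixes S :: "(real ^ 'n::finite) set"
  assumes "open S" "\<And>y. y \<in> S \<Longrightarrow> f y = g y" "x \<in> S"
  shows "partial_deriv i f x = partial_deriv i g x"
  unfolding partial_deriv_def
proof (rule deriv_cong_ev)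
  show "\<forall>\<^sub>F s in nhds 0. f (x + s *\<^sub>R axis i 1) = g (x + s *\<^sub>R axis i 1)"
    using line_eventually_in[OF assms(1,3), of i] by eventually_elim (simp add: assms(2))
qed simp

lemma partial_derivI: "((\<lambda>s. f (x + s *\<^sub>R axis i 1)) has_real_derivative d) (at 0) \<Longrightarrow> partial_deriv i f x = d"
  unfolding partial_deriv_def by (rule DERIV_imp_deriv)

lemma partial_has_derivative_cong:
  fixes S :: "(real ^ 'n::finite) set"
  assumes "open S" "\<And>y. y \<in> S \<Longrightarrow> f y = g y" "x \<in> S"
  shows "((\<lambda>s. f (x + s *\<^sub>R axis i 1)) has_real_derivative d) (at 0)
    \<longleftrightarrow> ((\<lambda>s. g (x + s *\<^sub>R axis i 1)) has_real_derivative d) (at 0)"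
proof (rule DERIV_cong_ev)
  show "\<forall>\<^sub>F s in nhds 0. f (x + s *\<^sub>R axis i 1) = g (x + s *\<^sub>R axis i 1)"
    using line_eventually_in[OF assms(1,3), of i] by eventually_elim (simp add: assms(2))
qed simp_all

lemma cderiv_cong:
  fixes S :: "(real ^ 'n::finite) set"
  assumes "open S" "\<And>y. y \<in> S \<Longrightarrow> f y = g y"
  shows "x \<in> S \<Longrightarrow> cderiv \<alpha> f x = cderiv \<alpha> g x"
proof (induction \<alpha> arbitrary: x rule: mi_induct)
  case zero
  then show ?case by (simp add: assms(2))
next
  case (inc i \<alpha>)
  then show ?case using partial_deriv_cong[OF assms(1), of "cderiv \<alpha> f" "cderiv \<alpha> g"] by simp
qed

text \<open>Openness of \<open>S\<close> makes a derivative at a point of \<open>S\<close> depend on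
  values in \<open>S\<close> only, so the identity passes through every differentiation. Exhibiting
  a suitable family \<open>D\<close> is how derivatives of concrete functions are found
  below.\<close>

lemma cderiv_eq_family:
  fixes S :: "(real ^ 'n::finite) set"
  assumes "open S" "\<And>x. x \<in> S \<Longrightarrow> D mi_zero x = f x"
    and D: "\<And>\<alpha> i x. mi_order \<alpha> < k \<Longrightarrow> x \<in> S \<Longrightarrow>
      ((\<lambda>s. D \<alpha> (x + s *\<^sub>R axis i 1)) has_real_derivative D (mi_inc i \<alpha>) x) (at 0)"
  shows "mi_order \<alpha> \<le> k \<Longrightarrow> x \<in> S \<Longrightarrow> cderiv \<alpha> f x = D \<alpha> x"
proof (induction \<alpha> arbitrary: x rule: mi_induct)
  case zero
  then show ?case by (simp add: assms(2))
next
  case (inc i \<alpha>)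
  have "partial_deriv i (cderiv \<alpha> f) x = partial_deriv i (D \<alpha>) x"
    using inc by (intro partial_deriv_cong[OF assms(1)]) auto
  also have "\<dots> = D (mi_inc i \<alpha>) x"
    using inc by (intro partial_derivI D) auto
  finally show ?case using inc(1) by simp
qed

lemma has_cderivs_family:
  fixes S :: "(real ^ 'n::finite) set"
  assumes "open S" "\<And>x. x \<in> S \<Longrightarrow> D mi_zero x = f x"
    and D: "\<And>\<alpha> i x. mi_order \<alpha> < k \<Longrightarrow> x \<in> S \<Longrightarrow>
      ((\<lambda>s. D \<alpha> (x + s *\<^sub>R axis i 1)) has_real_derivative D (mi_inc i \<alpha>) x) (at 0)"
  shows "has_cderivs S k f"
  unfolding has_cderivs_def
proof (intro allI impI ballI)
  fix \<alpha> :: "'n multi_index" and i x assume \<alpha>: "mi_order \<alpha> < k" and x: "x \<in> S"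
  have "((\<lambda>s. cderiv \<alpha> f (x + s *\<^sub>R axis i 1)) has_real_derivative D (mi_inc i \<alpha>) x) (at 0)"
    using partial_has_derivative_cong[OF assms(1), of "cderiv \<alpha> f" "D \<alpha>" x i] D[OF \<alpha> x]
      cderiv_eq_family[OF assms(1,2) D, of k] \<alpha> x by simp
  then show "((\<lambda>s. cderiv \<alpha> f (x + s *\<^sub>R axis i 1)) has_real_derivative cderiv (mi_inc i \<alpha>) f x) (at 0)"
    using cderiv_eq_family[OF assms(1,2) D, of k "mi_inc i \<alpha>" x] \<alpha> x by simp
qed

lemma Ck_unif_family:
  fixes S :: "(real ^ 'n::finite) set"
  assumes "open S" "\<And>x. x \<in> S \<Longrightarrow> D mi_zero x = f x"
    and D: "\<And>\<alpha> i x. mi_order \<alpha> < k \<Longrightarrow> x \<in> S \<Longrightarrow>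
      ((\<lambda>s. D \<alpha> (x + s *\<^sub>R axis i 1)) has_real_derivative D (mi_inc i \<alpha>) x) (at 0)"
    and uc: "\<And>\<alpha>. mi_order \<alpha> \<le> k \<Longrightarrow> uniformly_continuous_on S (D \<alpha>)"
  shows "Ck_unif S k f"
  unfolding Ck_unif_def
proof (intro conjI allI impI)
  show "has_cderivs S k f" by (rule has_cderivs_family[OF assms(1,2) D])
  fix \<alpha> :: "'n multi_index" assume \<alpha>: "mi_order \<alpha> \<le> k"
  have "\<And>x. x \<in> S \<Longrightarrow> cderiv \<alpha> f x = D \<alpha> x"
    by (rule cderiv_eq_family[OF assms(1,2) D \<alpha>])
  then show "uniformly_continuous_on S (cderiv \<alpha> f)"
    using uc[OF \<alpha>] unfolding uniformly_continuous_on_def by simp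
qed

lemma Ck_unifD:
  assumes "Ck_unif S k f" "mi_order \<alpha> < k" "x \<in> S"
  shows "((\<lambda>s. cderiv \<alpha> f (x + s *\<^sub>R axis i 1)) has_real_derivative cderiv (mi_inc i \<alpha>) f x) (at 0)"
  using assms unfolding Ck_unif_def has_cderivs_def by blast

lemma Ck_unif_continuous:
  assumes "Ck_unif S k f" "mi_order \<alpha> \<le> k"
  shows "continuous_on S (cderiv \<alpha> f)"
  using assms unfolding Ck_unif_def by (blast intro: uniformly_continuous_imp_continuous)

text \<open>Keeping the summand \<open>c * g\<close> apart from the sum lets the same lemma serve
  scalings, finite sums and truncation errors of the kernel operator.\<close>

lemma Ck_unif_lin_comb:
  fixes S :: "(real ^ 'n::finite) set"
  assumes S: "open S" and g: "Ck_unif S k g" and f: "\<And>j. j \<in> A \<Longrightarrow> Ck_unif S k (f j)"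
  shows "Ck_unif S k (\<lambda>x. c * g x + (\<Sum>j\<in>A. a j * f j x))" (is ?C)
    and "\<And>\<alpha> x. mi_order \<alpha> \<le> k \<Longrightarrow> x \<in> S \<Longrightarrow>
      cderiv \<alpha> (\<lambda>x. c * g x + (\<Sum>j\<in>A. a j * f j x)) x = c * cderiv \<alpha> g x + (\<Sum>j\<in>A. a j * cderiv \<alpha> (f j) x)"
proof -
  define D where "D \<alpha> x = c * cderiv \<alpha> g x + (\<Sum>j\<in>A. a j * cderiv \<alpha> (f j) x)" for \<alpha> x
  have D0: "D mi_zero x = c * g x + (\<Sum>j\<in>A. a j * f j x)" for x by (simp add: D_def)
  have DD: "((\<lambda>s. D \<alpha> (x + s *\<^sub>R axis i 1)) has_real_derivative D (mi_inc i \<alpha>) x) (at 0)"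
    if "mi_order \<alpha> < k" "x \<in> S" for \<alpha> i x
    unfolding D_def by (intro DERIV_add DERIV_cmult DERIV_sum Ck_unifD[OF g that] Ck_unifD[OF f that])
  have uc: "uniformly_continuous_on S (D \<alpha>)" if "mi_order \<alpha> \<le> k" for \<alpha>
    unfolding D_def
    using g f that by (intro uniformly_continuous_on_add uniformly_continuous_on_sum bounded_linear.uniformly_continuous_on[OF bounded_linear_mult_right])
      (auto simp: Ck_unif_def)
  show ?C by (rule Ck_unif_family[where D = D, OF S D0 DD uc])
  show "cderiv \<alpha> (\<lambda>x. c * g x + (\<Sum>j\<in>A. a j * f j x)) x = c * cderiv \<alpha> g x + (\<Sum>j\<in>A. a j * cderiv \<alpha> (f j) x)"
    if "mi_order \<alpha> \<le> k" "x \<in> S" for \<alpha> x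
    using cderiv_eq_family[where D = D, OF S D0 DD that] by (simp add: D_def)
qed

subsection \<open>Smooth bump functions\<close>

text \<open>The polynomial in 1/x is carried along because differentiating exp(-1/x) produces such
  factors; with it the class is closed under differentiation.\<close>

definition flat_exp :: "real poly \<Rightarrow> real \<Rightarrow> real" where
  "flat_exp p x = (if 0 < x then poly p (1 / x) * exp (- (1 / x)) else 0)"

lemma tendsto_poly_exp: "((\<lambda>u. poly p u * exp (- u)) \<longlongrightarrow> (0::real)) at_top"
proof -
  have "((\<lambda>u. \<Sum>i\<le>degree p. coeff p i * (u ^ i / exp u)) \<longlongrightarrow> (\<Sum>i\<le>degree p. coeff p i * 0)) at_top"
    by (intro tendsto_sum tendsto_mult tendsto_const tendsto_power_div_exp_0)
  moreover have "poly p u * exp (- u) = (\<Sum>i\<le>degree p. coeff p i * (u ^ i / exp u))" for u :: real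
    by (simp add: poly_altdef exp_minus field_simps sum_divide_distrib)
  ultimately show ?thesis by simp
qed

lemma flat_exp_tendsto_0: "(flat_exp p \<longlongrightarrow> 0) (at 0)"
proof (rule filterlim_split_at)
  show "(flat_exp p \<longlongrightarrow> 0) (at_left 0)"
  proof (rule tendsto_eventually)
    show "\<forall>\<^sub>F x in at_left 0. flat_exp p x = 0"
      unfolding eventually_at_filter by (intro always_eventually) (auto simp: flat_exp_def)
  qed
  have "((\<lambda>x. poly p (inverse x) * exp (- inverse x)) \<longlongrightarrow> 0) (at_right (0::real))"
    by (rule filterlim_compose[OF tendsto_poly_exp filterlim_inverse_at_top_right])
  then show "(flat_exp p \<longlongrightarrow> 0) (at_right 0)"
  proof (rule Lim_transform_eventually)
    show "\<forall>\<^sub>F x in at_right 0. poly p (inverse x) * exp (- inverse x) = flat_exp p x"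
      unfolding eventually_at_filter by (intro always_eventually) (auto simp: flat_exp_def inverse_eq_divide)
  qed
qed

text \<open>With u = 1/x the derivative of p(u) exp(-u) in x is u^2 (p(u) - p'(u)) exp(-u), and
  \<open>[:0, 0, 1:]\<close> is u^2 as a polynomial in u.\<close>

lemma flat_exp_deriv:
  "(flat_exp p has_real_derivative flat_exp ([:0, 0, 1:] * (p - pderiv p)) x) (at x)"
proof -
  consider "x < 0" | "x = 0" | "0 < x" by linarith
  then show ?thesis
  proof cases
    case 1
    have "((\<lambda>x. 0) has_real_derivative 0) (at x)" by simp
    moreover have "\<forall>\<^sub>F y in nhds x. flat_exp p y = 0"
      using eventually_nhds_in_open[of "{..<0}" x] 1 by (auto simp: flat_exp_def elim!: eventually_mono)
    ultimately show ?thesis using 1 DERIV_cong_ev[of x x "flat_exp p" "\<lambda>x. 0" 0 0] by (simp add: flat_exp_def)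
  next
    case 2
    \<comment> \<open>At the origin the difference quotient is a function of the same kind: division
      by \<open>h\<close> multiplies the polynomial by u.\<close>
    have "((\<lambda>h. flat_exp ([:0, 1:] * p) h) \<longlongrightarrow> 0) (at 0)" by (rule flat_exp_tendsto_0)
    moreover have "flat_exp ([:0, 1:] * p) h = flat_exp p h / h" for h
      by (simp add: flat_exp_def)
    ultimately show ?thesis using 2 by (simp add: DERIV_def flat_exp_def[of _ 0])
  next
    case 3
    have "((\<lambda>x. poly p (1 / x) * exp (- (1 / x))) has_real_derivative
        poly ([:0, 0, 1:] * (p - pderiv p)) (1 / x) * exp (- (1 / x))) (at x)"
      using 3 by (auto intro!: derivative_eq_intros simp: field_simps power2_eq_square)
    moreover have "\<forall>\<^sub>F y in nhds x. flat_exp p y = poly p (1 / y) * exp (- (1 / y))"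
      using eventually_nhds_in_open[of "{0<..}" x] 3 by (auto simp: flat_exp_def elim!: eventually_mono)
    ultimately show ?thesis
      using 3 DERIV_cong_ev[of x x "flat_exp p" "\<lambda>x. poly p (1 / x) * exp (- (1 / x))"]
      by (simp add: flat_exp_def)
  qed
qed

text \<open>Spanned by products of a factor that is flat up to \<open>c\<close> and one that is flat
  from \<open>d\<close> on (for positive \<open>m\<close>). As the polynomials are free, the span is
  closed under differentiation, and smoothness follows by induction instead of a Leibniz formula for
  higher derivatives.\<close>

inductive bump_class :: "real \<Rightarrow> real \<Rightarrow> real \<Rightarrow> (real \<Rightarrow> real) \<Rightarrow> bool" for m c d where
  base: "bump_class m c d (\<lambda>s. flat_exp p (m * (s - c)) * flat_exp q (m * (d - s)))"
| add: "bump_class m c d f \<Longrightarrow> bump_class m c d g \<Longrightarrow> bump_class m c d (\<lambda>s. f s + g s)"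
| scale: "bump_class m c d f \<Longrightarrow> bump_class m c d (\<lambda>s. a * f s)"

lemma bump_class_deriv:
  "bump_class m c d f \<Longrightarrow> \<exists>f'. bump_class m c d f' \<and> (\<forall>x. (f has_real_derivative f' x) (at x))"
proof (induction rule: bump_class.induct)
  case (base p q)
  define P Q where "P = [:0, 0, 1:] * (p - pderiv p)" and "Q = [:0, 0, 1:] * (q - pderiv q)"
  define f' where "f' s = m * (flat_exp P (m * (s - c)) * flat_exp q (m * (d - s)))
      + (- m) * (flat_exp p (m * (s - c)) * flat_exp Q (m * (d - s)))" for s
  have "((\<lambda>s. flat_exp p (m * (s - c)) * flat_exp q (m * (d - s))) has_real_derivative f' x) (at x)" for x
  proof -
    have 1: "((\<lambda>s. flat_exp p (m * (s - c))) has_real_derivative flat_exp P (m * (x - c)) * m) (at x)"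
      unfolding P_def by (rule DERIV_chain'[OF _ flat_exp_deriv]) (auto intro!: derivative_eq_intros)
    have 2: "((\<lambda>s. flat_exp q (m * (d - s))) has_real_derivative flat_exp Q (m * (d - x)) * (- m)) (at x)"
      unfolding Q_def by (rule DERIV_chain'[OF _ flat_exp_deriv]) (auto intro!: derivative_eq_intros)
    show ?thesis using DERIV_mult[OF 1 2] by (simp add: f'_def algebra_simps)
  qed
  moreover have "bump_class m c d f'"
    unfolding f'_def by (intro bump_class.intros)
  ultimately show ?case by blast
next
  case (add f g)
  then obtain f' g' where "bump_class m c d f'" "bump_class m c d g'"
    "\<And>x. (f has_real_derivative f' x) (at x)" "\<And>x. (g has_real_derivative g' x) (at x)" by blast
  then show ?case by (intro exI[of _ "\<lambda>s. f' s + g' s"]) (simp add: bump_class.add DERIV_add)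
next
  case (scale f a)
  then obtain f' where "bump_class m c d f'" "\<And>x. (f has_real_derivative f' x) (at x)" by blast
  then show ?case by (intro exI[of _ "\<lambda>s. a * f' s"]) (simp add: bump_class.scale DERIV_cmult)
qed

definition smooth1 :: "(real \<Rightarrow> real) \<Rightarrow> bool" where
  "smooth1 f \<longleftrightarrow> (\<forall>n x. ((deriv ^^ n) f has_real_derivative (deriv ^^ Suc n) f x) (at x))"

lemma bump_class_smooth1:
  assumes "bump_class m c d f"
  shows "smooth1 f"
proof -
  have step: "bump_class m c d (deriv g) \<and> (\<forall>x. (g has_real_derivative deriv g x) (at x))" if g: "bump_class m c d g" for g
  proof -
    obtain g' where g': "bump_class m c d g'" "\<And>x. (g has_real_derivative g' x) (at x)"
      using bump_class_deriv[OF g] by blast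
    then have "deriv g = g'" by (intro ext DERIV_imp_deriv)
    then show ?thesis using g' by simp
  qed
  have "bump_class m c d ((deriv ^^ n) f)" for n
    by (induction n) (use assms step in auto)
  then show ?thesis unfolding smooth1_def using step by auto
qed

section \<open>Functions with separated variables and bumps on boxes\<close>

definition prod_fun :: "('n::finite \<Rightarrow> real \<Rightarrow> real) \<Rightarrow> real ^ 'n \<Rightarrow> real" where
  "prod_fun \<psi> x = (\<Prod>i\<in>UNIV. \<psi> i (x $ i))"

lemma prod_fun_deriv:
  assumes "(\<psi> i has_real_derivative d (x $ i)) (at (x $ i))"
  shows "((\<lambda>s. prod_fun \<psi> (x + s *\<^sub>R axis i 1)) has_real_derivative prod_fun (\<psi>(i := d)) x) (at 0)"
proof -
  have "prod_fun \<psi> (x + s *\<^sub>R axis i 1) = \<psi> i (x $ i + s) * (\<Prod>j\<in>UNIV - {i}. \<psi> j (x $ j))" for s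
    unfolding prod_fun_def by (subst prod.remove[of _ i]) (auto simp: axis_def intro!: prod.cong)
  moreover have "prod_fun (\<psi>(i := d)) x = d (x $ i) * (\<Prod>j\<in>UNIV - {i}. \<psi> j (x $ j))"
    unfolding prod_fun_def by (subst prod.remove[of _ i]) (auto intro!: prod.cong)
  moreover have "((\<lambda>s. \<psi> i (x $ i + s)) has_real_derivative d (x $ i)) (at 0)"
    using assms DERIV_shift[of "\<psi> i" "d (x $ i)" 0 "x $ i"] by (simp add: add.commute)
  ultimately show ?thesis by (simp add: DERIV_cmult_right)
qed


lemma partial_prod_fun:
  assumes "smooth1 (\<psi> i)"
  shows "(partial_deriv i ^^ n) (prod_fun \<psi>) = prod_fun (\<psi>(i := (deriv ^^ n) (\<psi> i)))"
proof (induction n)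
  case (Suc n)
  have "(partial_deriv i ^^ Suc n) (prod_fun \<psi>) = partial_deriv i (prod_fun (\<psi>(i := (deriv ^^ n) (\<psi> i))))"
    by (simp only: funpow.simps o_apply Suc)
  moreover have "partial_deriv i (prod_fun (\<psi>(i := (deriv ^^ n) (\<psi> i)))) x
      = prod_fun ((\<psi>(i := (deriv ^^ n) (\<psi> i)))(i := (deriv ^^ Suc n) (\<psi> i))) x" for x
    using assms by (intro partial_derivI prod_fun_deriv) (simp add: smooth1_def)
  ultimately show ?case by (simp only: fun_upd_upd fun_eq_iff) simp
qed simp

text \<open>Every coordinate occurs exactly once in the list, so each factor is differentiated
  independently and partial derivatives reduce to derivatives in one variable.\<close>

lemma cderiv_prod_fun:
  fixes \<psi> :: "'n::finite \<Rightarrow> real \<Rightarrow> real"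
  assumes "\<And>i. smooth1 (\<psi> i)"
  shows "cderiv \<alpha> (prod_fun \<psi>) = prod_fun (\<lambda>i. (deriv ^^ \<alpha> i) (\<psi> i))"
proof -
  have "distinct xs \<Longrightarrow> foldr (\<lambda>i. partial_deriv i ^^ \<alpha> i) xs (prod_fun \<psi>)
      = prod_fun (\<lambda>i. if i \<in> set xs then (deriv ^^ \<alpha> i) (\<psi> i) else \<psi> i)" for xs
  proof (induction xs)
    case (Cons x xs)
    have "(partial_deriv x ^^ \<alpha> x) (prod_fun (\<lambda>i. if i \<in> set xs then (deriv ^^ \<alpha> i) (\<psi> i) else \<psi> i))
      = prod_fun ((\<lambda>i. if i \<in> set xs then (deriv ^^ \<alpha> i) (\<psi> i) else \<psi> i)(x := (deriv ^^ \<alpha> x) (\<psi> x)))"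
      using Cons.prems assms by (subst partial_prod_fun) simp_all
    also have "(\<lambda>i. if i \<in> set xs then (deriv ^^ \<alpha> i) (\<psi> i) else \<psi> i)(x := (deriv ^^ \<alpha> x) (\<psi> x))
        = (\<lambda>i. if i \<in> set (x # xs) then (deriv ^^ \<alpha> i) (\<psi> i) else \<psi> i)" by auto
    finally show ?case using Cons by simp
  qed simp
  from this[of coords] show ?thesis using coords_distinct_UNIV[where ?'n = 'n] by (simp add: cderiv_def)
qed

text \<open>Scaling by \<open>Suc m\<close> drives \<open>flat_exp 1\<close> to 1 at positive
  arguments, so these bumps stay between 0 and 1 and converge to the indicator of
  \<open>box c d\<close>.\<close>

definition box_bump :: "real ^ 'n \<Rightarrow> real ^ 'n \<Rightarrow> nat \<Rightarrow> real ^ 'n::finite \<Rightarrow> real" where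
  "box_bump c d m = prod_fun (\<lambda>i s. flat_exp 1 (real (Suc m) * (s - c $ i)) * flat_exp 1 (real (Suc m) * (d $ i - s)))"

lemma flat_exp_1: "0 \<le> flat_exp 1 x" "flat_exp 1 x \<le> 1" "flat_exp 1 x = 0 \<longleftrightarrow> x \<le> 0"
  by (auto simp: flat_exp_def)

lemma box_bump_nonneg: "0 \<le> box_bump c d m x"
  unfolding box_bump_def prod_fun_def
  by (intro prod_nonneg mult_nonneg_nonneg flat_exp_1(1))

lemma box_bump_le_1: "box_bump c d m x \<le> 1"
  unfolding box_bump_def prod_fun_def
  by (intro prod_le_1 conjI mult_nonneg_nonneg mult_le_one flat_exp_1(1,2))

lemma box_bump_zero:
  assumes "x \<notin> box c d"
  shows "box_bump c d m x = 0"
proof -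
  obtain i where "x $ i - c $ i \<le> 0 \<or> d $ i - x $ i \<le> 0"
    using assms by (auto simp: mem_box_cart not_less)
  then have "flat_exp 1 (real (Suc m) * (x $ i - c $ i)) = 0 \<or> flat_exp 1 (real (Suc m) * (d $ i - x $ i)) = 0"
    unfolding flat_exp_1(3) by (meson mult_nonneg_nonpos of_nat_0_le_iff)
  then have "flat_exp 1 (real (Suc m) * (x $ i - c $ i)) * flat_exp 1 (real (Suc m) * (d $ i - x $ i)) = 0"
    by (simp only: mult_eq_0_iff)
  then show ?thesis
    unfolding box_bump_def prod_fun_def by (metis (mono_tags, lifting) UNIV_I finite prod_zero)
qed

lemma box_bump_support: "closure {x. box_bump c d m x \<noteq> 0} \<subseteq> cbox c d"
proof (rule closure_minimal)
  show "{x. box_bump c d m x \<noteq> 0} \<subseteq> cbox c d"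
  proof
    fix x assume A: "x \<in> {x. box_bump c d m x \<noteq> 0}"
    have "x \<in> box c d"
    proof (rule ccontr)
      assume "x \<notin> box c d"
      then have "box_bump c d m x = 0" by (rule box_bump_zero)
      with A show False by (simp only: mem_Collect_eq)
    qed
    then show "x \<in> cbox c d" using box_subset_cbox by (rule set_mp[rotated])
  qed
qed (rule closed_cbox)

lemma box_bump_tendsto: "x \<in> box c d \<Longrightarrow> (\<lambda>m. box_bump c d m x) \<longlonglongrightarrow> 1"
proof -
  assume x: "x \<in> box c d"
  have 1: "(\<lambda>m. flat_exp 1 (real (Suc m) * t)) \<longlonglongrightarrow> 1" if "0 < t" for t
  proof -
    have "(\<lambda>m. exp (- ((1 / t) * (1 / real (Suc m))))) \<longlonglongrightarrow> exp (- ((1 / t) * 0))"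
      by (intro tendsto_exp tendsto_minus tendsto_mult tendsto_const LIMSEQ_Suc lim_1_over_n)
    moreover have "flat_exp 1 (real (Suc m) * t) = exp (- ((1 / t) * (1 / real (Suc m))))" for m
      using that by (simp add: flat_exp_def zero_less_mult_iff mult.commute)
    ultimately show ?thesis by simp
  qed
  have "(\<lambda>m. box_bump c d m x) \<longlonglongrightarrow> (\<Prod>i\<in>(UNIV::'a set). 1 * 1)"
    unfolding box_bump_def prod_fun_def using x by (intro tendsto_prod tendsto_mult 1) (auto simp: mem_box_cart)
  then show ?thesis by simp
qed

lemma box_bump_test_fun:
  fixes c d :: "real ^ 'n::finite"
  assumes "cbox c d \<subseteq> S"
  shows "test_fun S (box_bump c d m)"
proof -
  define \<psi> where "\<psi> i s = flat_exp 1 (real (Suc m) * (s - c $ i)) * flat_exp 1 (real (Suc m) * (d $ i - s))" for i s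
  have b: "box_bump c d m = prod_fun \<psi>" by (simp only: box_bump_def \<psi>_def[abs_def])
  have sm: "smooth1 (\<psi> i)" for i
    unfolding \<psi>_def by (rule bump_class_smooth1[OF bump_class.base])
  have cd: "cderiv \<alpha> (prod_fun \<psi>) = prod_fun (\<lambda>i. (deriv ^^ \<alpha> i) (\<psi> i))" for \<alpha>
    by (rule cderiv_prod_fun[OF sm])
  have "has_cderivs UNIV k (prod_fun \<psi>)" for k
    unfolding has_cderivs_def cd
  proof (intro allI impI ballI)
    fix \<alpha> :: "'n multi_index" and i x
    have "((\<lambda>s. prod_fun (\<lambda>i. (deriv ^^ \<alpha> i) (\<psi> i)) (x + s *\<^sub>R axis i 1)) has_real_derivative
        prod_fun ((\<lambda>i. (deriv ^^ \<alpha> i) (\<psi> i))(i := (deriv ^^ Suc (\<alpha> i)) (\<psi> i))) x) (at 0)"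
      by (rule prod_fun_deriv) (use sm[of i] in \<open>simp add: smooth1_def\<close>)
    also have "(\<lambda>i. (deriv ^^ \<alpha> i) (\<psi> i))(i := (deriv ^^ Suc (\<alpha> i)) (\<psi> i)) = (\<lambda>j. (deriv ^^ mi_inc i \<alpha> j) (\<psi> j))"
      by (auto simp: mi_inc_def)
    finally show "((\<lambda>s. prod_fun (\<lambda>i. (deriv ^^ \<alpha> i) (\<psi> i)) (x + s *\<^sub>R axis i 1)) has_real_derivative
        prod_fun (\<lambda>j. (deriv ^^ mi_inc i \<alpha> j) (\<psi> j)) x) (at 0)" .
  qed
  moreover have "continuous_on UNIV (cderiv \<alpha> (prod_fun \<psi>))" for \<alpha>
  proof -
    have c: "continuous_on UNIV ((deriv ^^ \<alpha> i) (\<psi> i))" for i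
    proof (rule continuous_at_imp_continuous_on, rule ballI)
      fix s show "isCont ((deriv ^^ \<alpha> i) (\<psi> i)) s"
        by (rule DERIV_isCont[OF sm[of i, unfolded smooth1_def, rule_format]])
    qed
    show ?thesis unfolding cd prod_fun_def
      by (intro continuous_on_prod continuous_on_compose2[OF c] continuous_intros) auto
  qed
  moreover have "compact (closure {x. box_bump c d m x \<noteq> 0})"
    using box_bump_support by (intro compact_closure[THEN iffD2] bounded_subset[OF bounded_cbox[of c d]])
      (rule order_trans[OF closure_subset box_bump_support])
  ultimately show ?thesis
    using order_trans[OF box_bump_support[of c d m] assms] unfolding test_fun_def b by (intro conjI allI) assumption+
qed

subsection \<open>Integration by parts\<close>

text \<open>Moves compactly supported integrands from \<open>lebesgue_on S\<close> to
  \<open>lborel\<close>, where translation invariance is applied.\<close>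

lemma lebesgue_on_compact_support:
  fixes f :: "real ^ 'n::finite \<Rightarrow> real"
  assumes S: "S \<in> sets lebesgue" and K: "compact K" "K \<subseteq> S" and f: "continuous_on K f" "\<And>x. x \<in> S - K \<Longrightarrow> f x = 0"
  shows "integrable (lebesgue_on S) f"
    and "(LINT x|lebesgue_on S. f x) = (\<integral>x. indicator K x *\<^sub>R f x \<partial>lborel)"
proof -
  have i: "integrable lborel (\<lambda>x. indicator K x *\<^sub>R f x)" by (rule borel_integrable_compact[OF K(1) f(1)])
  then have m: "(\<lambda>x. indicator K x *\<^sub>R f x) \<in> borel_measurable lborel" by (rule borel_measurable_integrable)
  have e: "(\<lambda>x. indicator S x *\<^sub>R f x) = (\<lambda>x. indicator K x *\<^sub>R f x)"
  proof
    fix x show "indicator S x *\<^sub>R f x = indicator K x *\<^sub>R f x"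
      using f(2)[of x] K(2) by (cases "x \<in> K"; cases "x \<in> S") auto
  qed
  have S': "S \<inter> space lebesgue \<in> sets lebesgue" using S by simp
  show "integrable (lebesgue_on S) f"
    unfolding integrable_restrict_space[OF S'] e using integrable_completion[OF m] i by simp
  show "(LINT x|lebesgue_on S. f x) = (\<integral>x. indicator K x *\<^sub>R f x \<partial>lborel)"
    unfolding integral_restrict_space[OF S'] e by (rule integral_completion[OF m])
qed

lemma loc_integrable_continuous:
  fixes S :: "(real ^ 'n::finite) set"
  assumes "continuous_on S f"
  shows "loc_integrable S f"
  unfolding loc_integrable_def
proof (intro allI impI, elim conjE)
  fix K assume K: "compact K" "K \<subseteq> S"
  have "K \<in> sets lebesgue" using K(1) by (simp add: lmeasurable_compact fmeasurableD)
  then show "integrable (lebesgue_on K) f"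
    using lebesgue_on_compact_support(1)[of K K f] K continuous_on_subset[OF assms K(2)] by simp
qed

lemma line_deriv_shift:
  fixes g :: "real ^ 'n::finite \<Rightarrow> real"
  assumes "\<And>x. ((\<lambda>s. g (x + s *\<^sub>R axis i 1)) has_real_derivative g' x) (at 0)"
  shows "((\<lambda>s. g (x + s *\<^sub>R axis i 1)) has_real_derivative g' (x + t *\<^sub>R axis i 1)) (at t)"
proof -
  have "((\<lambda>s. g (x + (s + t) *\<^sub>R axis i 1)) has_real_derivative g' (x + t *\<^sub>R axis i 1)) (at 0)"
    using assms[of "x + t *\<^sub>R axis i 1"] by (simp add: scaleR_add_left add.assoc add.commute[of _ t])
  then show ?thesis
    using DERIV_shift[of "\<lambda>s. g (x + s *\<^sub>R axis i 1)" _ 0 t] by simp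
qed

lemma line_mvt:
  fixes f :: "real \<Rightarrow> real"
  assumes "h \<noteq> 0" "\<And>s. \<bar>s\<bar> \<le> \<bar>h\<bar> \<Longrightarrow> (f has_real_derivative f' s) (at s)"
  obtains s where "\<bar>s\<bar> \<le> \<bar>h\<bar>" "f h - f 0 = h * f' s"
proof (cases "0 < h")
  case True
  obtain z where "0 < z" "z < h" "f h - f 0 = (h - 0) * f' z"
    using MVT2[of 0 h f f'] True assms(2) by auto
  then show ?thesis using that[of z] by simp
next
  case False
  then have h: "h < 0" using assms(1) by simp
  obtain z where "h < z" "z < 0" "f 0 - f h = (0 - h) * f' z"
    using MVT2[of h 0 f f'] h assms(2) by auto
  then show ?thesis using that[of z] by simp
qed

text \<open>Translation invariance of Lebesgue measure makes the integral of every difference quotient vanish.\<close>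

lemma integral_partial_deriv_eq_0:
  fixes g :: "real ^ 'n::finite \<Rightarrow> real"
  assumes g: "integrable lborel g" and g'm: "g' \<in> borel_measurable lborel"
    and K: "compact K" "\<And>x. x \<notin> K \<Longrightarrow> g x = 0"
    and d: "\<And>x. ((\<lambda>s. g (x + s *\<^sub>R axis i 1)) has_real_derivative g' x) (at 0)"
    and C: "\<And>x. \<bar>g' x\<bar> \<le> C"
  shows "(\<integral>x. g' x \<partial>lborel) = 0"
proof -
  define e :: "real ^ 'n" where "e = axis i 1"
  define h where "h n = 1 / real (Suc n)" for n
  define q where "q n x = (g (x + h n *\<^sub>R e) - g x) / h n" for n x
  have h: "0 < h n" "h n \<le> 1" for n by (auto simp: h_def)
  have tr: "integrable lborel (\<lambda>x. g (x + c)) \<and> (\<integral>x. g (x + c) \<partial>lborel) = (\<integral>x. g x \<partial>lborel)" for c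
  proof -
    have gm: "g \<in> borel_measurable borel" using borel_measurable_integrable[OF g] by simp
    have cm: "(+) c \<in> borel_measurable lborel" by simp
    have "integrable (distr lborel borel ((+) c)) g" using g by (simp add: lborel_distr_plus)
    then have "integrable lborel (\<lambda>x. g (c + x))" using integrable_distr_eq[OF cm gm] by simp
    moreover have "(\<integral>x. g (c + x) \<partial>lborel) = (\<integral>x. g x \<partial>lborel)"
      using integral_distr[OF cm gm] by (simp add: lborel_distr_plus)
    ultimately show ?thesis by (simp add: add.commute)
  qed
  have int_q: "(\<integral>x. q n x \<partial>lborel) = 0" for n
    using tr[of "h n *\<^sub>R e"] g by (simp add: q_def)
  obtain R where R: "\<And>x. x \<in> K \<Longrightarrow> norm x \<le> R"
    using compact_imp_bounded[OF K(1)] unfolding bounded_iff by blast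
  have C0: "0 \<le> C" using C[of 0] by linarith
  \<comment> \<open>Inside the ball the mean value theorem bounds the quotient by \<open>C\<close>.
    Outside, both evaluation points miss \<open>K\<close>, because the step width is at most 1, and
    the quotient is zero.\<close>
  have bound: "\<bar>q n x\<bar> \<le> C * indicator (cball 0 (R + 1)) x" for n x
  proof (cases "x \<in> cball 0 (R + 1)")
    case True
    obtain s where "g (x + h n *\<^sub>R e) - g (x + 0 *\<^sub>R e) = h n * g' (x + s *\<^sub>R e)"
      using line_mvt[of "h n" "\<lambda>s. g (x + s *\<^sub>R e)" "\<lambda>s. g' (x + s *\<^sub>R e)"] h(1)[of n]
        line_deriv_shift[OF d] unfolding e_def by (metis less_irrefl)
    then have "q n x = g' (x + s *\<^sub>R e)" using h(1)[of n] by (simp add: q_def)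
    then show ?thesis using C True by simp
  next
    case False
    then have nx: "norm x > R + 1" by (simp add: dist_norm)
    have "norm x \<le> norm (x + h n *\<^sub>R e) + norm (h n *\<^sub>R e)"
      using norm_triangle_ineq4[of "x + h n *\<^sub>R e" "h n *\<^sub>R e"] by simp
    then have "norm (x + h n *\<^sub>R e) > R" using nx h[of n] by (simp add: e_def)
    then have "x + h n *\<^sub>R e \<notin> K" "x \<notin> K" using R[of x] R[of "x + h n *\<^sub>R e"] nx by auto
    then show ?thesis using K(2) C0 by (simp add: q_def)
  qed
  have lim: "(\<lambda>n. q n x) \<longlonglongrightarrow> g' x" for x
  proof -
    have "((\<lambda>t. (g (x + (0 + t) *\<^sub>R axis i 1) - g (x + 0 *\<^sub>R axis i 1)) / t) \<longlongrightarrow> g' x) (at 0)"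
      using d[of x] unfolding DERIV_def .
    moreover have "filterlim h (at 0) sequentially"
    proof (rule filterlim_atI)
      show "h \<longlonglongrightarrow> 0" unfolding h_def by (rule LIMSEQ_Suc[OF lim_1_over_n])
      show "\<forall>\<^sub>F n in sequentially. h n \<noteq> 0" using h(1) by (intro always_eventually allI) (metis less_irrefl)
    qed
    ultimately have "(\<lambda>n. (g (x + (0 + h n) *\<^sub>R axis i 1) - g (x + 0 *\<^sub>R axis i 1)) / h n) \<longlonglongrightarrow> g' x"
      by (rule filterlim_compose)
    then show ?thesis by (simp add: q_def e_def)
  qed
  have "(\<lambda>n. \<integral>x. q n x \<partial>lborel) \<longlonglongrightarrow> (\<integral>x. g' x \<partial>lborel)"
  proof (rule integral_dominated_convergence[where w = "\<lambda>x. C * indicator (cball 0 (R + 1)) x"])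
    show "q n \<in> borel_measurable lborel" for n
    proof -
      have "(\<lambda>x. g (x + h n *\<^sub>R e)) \<in> borel_measurable lborel" "g \<in> borel_measurable lborel"
        using tr g by (auto dest: borel_measurable_integrable)
      then show ?thesis unfolding q_def by (intro borel_measurable_divide borel_measurable_diff) simp_all
    qed
    have "integrable lborel (indicator (cball 0 (R + 1)) :: real ^ 'n \<Rightarrow> real)"
      using emeasure_bounded_finite[of "cball (0 :: real ^ 'n) (R + 1)"] by (intro integrable_real_indicator) auto
    then show "integrable lborel (\<lambda>x :: real ^ 'n. C * indicator (cball 0 (R + 1)) x)" by simp
    show "AE x in lborel. (\<lambda>n. q n x) \<longlonglongrightarrow> g' x" by (intro AE_I2 lim)
    show "AE x in lborel. norm (q n x) \<le> C * indicator (cball 0 (R + 1)) x" for n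
      by (intro AE_I2) (simp add: bound)
  qed (rule g'm)
  then show ?thesis by (simp add: int_q LIMSEQ_const_iff)
qed

text \<open>The product of \<open>u\<close> and \<open>\<psi>\<close>, continued by zero, is
  differentiable in direction \<open>i\<close> on the whole space: on \<open>S\<close> by the
  product rule, elsewhere because it vanishes on the open complement of \<open>K\<close>. The
  integral of its derivative is zero.\<close>

lemma integration_by_parts_partial:
  fixes S :: "(real ^ 'n::finite) set"
  assumes S: "open S" and u: "continuous_on S u" "continuous_on S u'"
      "\<And>x. x \<in> S \<Longrightarrow> ((\<lambda>s. u (x + s *\<^sub>R axis i 1)) has_real_derivative u' x) (at 0)"
    and \<psi>: "continuous_on UNIV \<psi>" "continuous_on UNIV \<psi>'"
      "\<And>x. ((\<lambda>s. \<psi> (x + s *\<^sub>R axis i 1)) has_real_derivative \<psi>' x) (at 0)"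
    and K: "compact K" "K \<subseteq> S" "\<And>x. x \<notin> K \<Longrightarrow> \<psi> x = 0"
  shows "(LINT x|lebesgue_on S. u x * \<psi>' x) = - (LINT x|lebesgue_on S. u' x * \<psi> x)"
proof -
  have Sm: "S \<in> sets lebesgue" using S by auto
  have oK: "open (- K)" using compact_imp_closed[OF K(1)] by (simp add: open_Compl)
  have \<psi>'0: "\<psi>' x = 0" if "x \<notin> K" for x
  proof -
    have "((\<lambda>s. (\<lambda>_. 0) (x + s *\<^sub>R axis i 1)) has_real_derivative \<psi>' x) (at 0)"
      using partial_has_derivative_cong[OF oK, of \<psi> "\<lambda>_. 0" x i] K(3) that \<psi>(3)[of x] by simp
    then show ?thesis using DERIV_unique[OF _ DERIV_const] by blast
  qed
  have cK: "continuous_on K u" "continuous_on K u'" "continuous_on K \<psi>" "continuous_on K \<psi>'"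
    using u \<psi> K(2) by (auto intro: continuous_on_subset)
  define g where "g x = indicator K x *\<^sub>R (u x * \<psi> x)" for x
  define g' where "g' x = indicator K x *\<^sub>R (u' x * \<psi> x + u x * \<psi>' x)" for x
  have ig: "integrable lborel g" unfolding g_def
    by (intro borel_integrable_compact K continuous_intros cK)
  have ig': "integrable lborel g'" unfolding g'_def
    by (intro borel_integrable_compact K continuous_intros cK)
  have "bounded ((\<lambda>x. u' x * \<psi> x + u x * \<psi>' x) ` K)"
    by (intro compact_imp_bounded compact_continuous_image K continuous_intros cK)
  then obtain C where C: "\<And>x. x \<in> K \<Longrightarrow> \<bar>u' x * \<psi> x + u x * \<psi>' x\<bar> \<le> C" "0 < C"
    unfolding bounded_pos by auto
  have "(\<integral>x. g' x \<partial>lborel) = 0"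
  proof (rule integral_partial_deriv_eq_0[OF ig borel_measurable_integrable[OF ig'] K(1)])
    show "g x = 0" if "x \<notin> K" for x using that by (simp add: g_def)
    show "\<bar>g' x\<bar> \<le> C" for x using C by (cases "x \<in> K") (auto simp: g'_def)
    fix x
    show "((\<lambda>s. g (x + s *\<^sub>R axis i 1)) has_real_derivative g' x) (at 0)"
    proof (cases "x \<in> S")
      case True
      have "((\<lambda>s. u (x + s *\<^sub>R axis i 1) * \<psi> (x + s *\<^sub>R axis i 1)) has_real_derivative
          u' x * \<psi> (x + 0 *\<^sub>R axis i 1) + \<psi>' x * u (x + 0 *\<^sub>R axis i 1)) (at 0)"
        by (rule DERIV_mult[OF u(3)[OF True] \<psi>(3)])
      then have "((\<lambda>s. (\<lambda>y. u y * \<psi> y) (x + s *\<^sub>R axis i 1)) has_real_derivative u' x * \<psi> x + u x * \<psi>' x) (at 0)"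
        by (simp add: mult.commute)
      moreover have "g' x = u' x * \<psi> x + u x * \<psi>' x"
        using K(3) \<psi>'0 by (cases "x \<in> K") (auto simp: g'_def)
      moreover have "g y = u y * \<psi> y" for y using K(3) by (cases "y \<in> K") (auto simp: g_def)
      ultimately show ?thesis by simp
    next
      case False
      then have x: "x \<in> - K" using K(2) by auto
      then have "g' x = 0" by (simp add: g'_def)
      then show ?thesis
        using partial_has_derivative_cong[OF oK, of g "\<lambda>_. 0" x i 0] x by (simp add: g_def)
    qed
  qed
  moreover have "(LINT x|lebesgue_on S. u' x * \<psi> x + u x * \<psi>' x) = (\<integral>x. g' x \<partial>lborel)"
    unfolding g'_def using K(3) \<psi>'0
    by (intro lebesgue_on_compact_support(2) Sm K continuous_intros cK) auto
  moreover have "(LINT x|lebesgue_on S. u' x * \<psi> x + u x * \<psi>' x)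
      = (LINT x|lebesgue_on S. u' x * \<psi> x) + (LINT x|lebesgue_on S. u x * \<psi>' x)"
    using K(3) \<psi>'0
    by (intro Bochner_Integration.integral_add lebesgue_on_compact_support(1)[OF Sm K(1,2)] continuous_intros cK) auto
  ultimately show ?thesis by simp
qed

lemma cderiv_outside_support:
  fixes \<phi> :: "real ^ 'n::finite \<Rightarrow> real"
  assumes "x \<notin> closure {x. \<phi> x \<noteq> 0}"
  shows "cderiv \<alpha> \<phi> x = 0"
proof -
  have o: "open (- closure {x. \<phi> x \<noteq> 0})" by (simp add: open_Compl)
  have z: "\<phi> y = 0" if "y \<in> - closure {x. \<phi> x \<noteq> 0}" for y
    using that closure_subset[of "{x. \<phi> x \<noteq> 0}"] by auto
  show ?thesis
  proof (rule cderiv_eq_family[where D = "\<lambda>_ _. 0" and k = "mi_order \<alpha>", OF o])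
    show "0 = \<phi> y" if "y \<in> - closure {x. \<phi> x \<noteq> 0}" for y using z[OF that] by (rule sym)
    show "x \<in> - closure {x. \<phi> x \<noteq> 0}" using assms by (simp only: Compl_iff simp_thms)
  qed (rule DERIV_const, rule order_refl)
qed

lemma test_funD:
  assumes "test_fun S \<phi>"
  shows "compact (closure {x. \<phi> x \<noteq> 0})" "closure {x. \<phi> x \<noteq> 0} \<subseteq> S" "continuous_on UNIV (cderiv \<alpha> \<phi>)"
    "((\<lambda>s. cderiv \<alpha> \<phi> (x + s *\<^sub>R axis i 1)) has_real_derivative cderiv (mi_inc i \<alpha>) \<phi> x) (at 0)"
proof -
  show "compact (closure {x. \<phi> x \<noteq> 0})" "closure {x. \<phi> x \<noteq> 0} \<subseteq> S" "continuous_on UNIV (cderiv \<alpha> \<phi>)"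
    using assms by (auto simp: test_fun_def)
  have "has_cderivs UNIV (Suc (mi_order \<alpha>)) \<phi>" using assms by (simp add: test_fun_def)
  then show "((\<lambda>s. cderiv \<alpha> \<phi> (x + s *\<^sub>R axis i 1)) has_real_derivative cderiv (mi_inc i \<alpha>) \<phi> x) (at 0)"
    unfolding has_cderivs_def by simp
qed

lemma test_fun_bounded:
  assumes "test_fun S \<phi>"
  obtains C where "0 < C" "\<And>x. \<bar>cderiv \<alpha> \<phi> x\<bar> \<le> C"
proof -
  have "bounded (cderiv \<alpha> \<phi> ` closure {x. \<phi> x \<noteq> 0})"
    using test_funD[OF assms] by (intro compact_imp_bounded compact_continuous_image) (auto intro: continuous_on_subset)
  then obtain C where C: "0 < C" "\<And>x. x \<in> closure {x. \<phi> x \<noteq> 0} \<Longrightarrow> \<bar>cderiv \<alpha> \<phi> x\<bar> \<le> C"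
    unfolding bounded_pos by auto
  have "\<bar>cderiv \<alpha> \<phi> x\<bar> \<le> C" for x
    using C cderiv_outside_support[of x \<phi> \<alpha>] by (cases "x \<in> closure {x. \<phi> x \<noteq> 0}") auto
  then show thesis using that C(1) by blast
qed

lemma mi_zero_add: "(\<lambda>i. mi_zero i + \<beta> i) = \<beta>" and add_mi_zero: "(\<lambda>i. \<beta> i + mi_zero i) = \<beta>"
  by (simp_all add: mi_zero_def)

text \<open>Each step takes the outermost derivative off the test function and puts it on
  \<open>cderiv \<beta> f\<close>, so \<open>\<beta>\<close> has to vary in the induction.
  \<open>Ck_unif\<close> supplies the derivative of \<open>cderiv \<beta> f\<close> in whichever
  direction comes up.\<close>

lemma integral_by_parts_test_fun:
  fixes S :: "(real ^ 'n::finite) set"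
  assumes S: "open S" and f: "Ck_unif S k f" and \<phi>: "test_fun S \<phi>"
  shows "mi_order \<alpha> + mi_order \<beta> \<le> k \<Longrightarrow> (LINT x|lebesgue_on S. cderiv \<beta> f x * cderiv \<alpha> \<phi> x)
    = (-1) ^ mi_order \<alpha> * (LINT x|lebesgue_on S. cderiv (\<lambda>i. \<alpha> i + \<beta> i) f x * \<phi> x)"
proof (induction \<alpha> arbitrary: \<beta> rule: mi_induct)
  case zero
  then show ?case by (simp add: mi_zero_add)
next
  case (inc i \<alpha>)
  have b: "mi_order \<beta> < k" "mi_order \<beta> \<le> k" "mi_order (mi_inc i \<beta>) \<le> k" using inc.prems by auto
  have "(LINT x|lebesgue_on S. cderiv \<beta> f x * cderiv (mi_inc i \<alpha>) \<phi> x)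
      = - (LINT x|lebesgue_on S. cderiv (mi_inc i \<beta>) f x * cderiv \<alpha> \<phi> x)"
    by (rule integration_by_parts_partial[OF S Ck_unif_continuous[OF f b(2)] Ck_unif_continuous[OF f b(3)]
        Ck_unifD[OF f b(1)] test_funD(3)[OF \<phi>] test_funD(3)[OF \<phi>] test_funD(4)[OF \<phi>] test_funD(1,2)[OF \<phi>]
        cderiv_outside_support])
  also have "(LINT x|lebesgue_on S. cderiv (mi_inc i \<beta>) f x * cderiv \<alpha> \<phi> x)
      = (-1) ^ mi_order \<alpha> * (LINT x|lebesgue_on S. cderiv (\<lambda>j. \<alpha> j + mi_inc i \<beta> j) f x * \<phi> x)"
    using inc by simp
  also have "(\<lambda>j. \<alpha> j + mi_inc i \<beta> j) = (\<lambda>j. mi_inc i \<alpha> j + \<beta> j)" by (auto simp: mi_inc_def)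
  finally show ?case by simp
qed

lemma Ck_unif_has_weak_deriv:
  fixes S :: "(real ^ 'n::finite) set"
  assumes S: "open S" and f: "Ck_unif S k f" and \<alpha>: "mi_order \<alpha> \<le> k"
  shows "has_weak_deriv S \<alpha> f (cderiv \<alpha> f)"
  unfolding has_weak_deriv_def
proof (intro conjI allI impI)
  show "loc_integrable S f"
    using Ck_unif_continuous[OF f, of mi_zero] by (intro loc_integrable_continuous) simp
  show "loc_integrable S (cderiv \<alpha> f)"
    by (intro loc_integrable_continuous Ck_unif_continuous[OF f \<alpha>])
  fix \<phi> assume "test_fun S \<phi>"
  from integral_by_parts_test_fun[OF S f this, of \<alpha> mi_zero] \<alpha>
  show "(LINT x|lebesgue_on S. f x * cderiv \<alpha> \<phi> x) = (-1) ^ mi_order \<alpha> * (LINT x|lebesgue_on S. cderiv \<alpha> f x * \<phi> x)"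
    by (simp add: add_mi_zero)
qed

subsection \<open>The fundamental lemma and weak derivatives\<close>

lemma loc_integrableD: "loc_integrable S f \<Longrightarrow> compact K \<Longrightarrow> K \<subseteq> S \<Longrightarrow> integrable (lebesgue_on K) f"
  by (simp add: loc_integrable_def)

lemma loc_integrable_mult_test:
  fixes S :: "(real ^ 'n::finite) set"
  assumes S: "open S" and g: "loc_integrable S g" and \<phi>: "test_fun S \<phi>"
  shows "integrable (lebesgue_on S) (\<lambda>x. g x * \<phi> x)"
proof -
  define K where "K = closure {x. \<phi> x \<noteq> 0}"
  have K: "compact K" "K \<subseteq> S" using test_funD[OF \<phi>] by (simp_all add: K_def)
  have z: "\<phi> x = 0" if "x \<notin> K" for x
    using cderiv_outside_support[of x \<phi> mi_zero] that by (simp add: K_def)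
  obtain C where C: "0 < C" "\<And>x. \<bar>cderiv mi_zero \<phi> x\<bar> \<le> C" using test_fun_bounded[OF \<phi>] by blast
  have Km: "K \<in> sets lebesgue" using K(1) by (simp add: lmeasurable_compact fmeasurableD)
  have gK: "integrable (lebesgue_on K) g" by (rule loc_integrableD[OF g K])
  have "continuous_on UNIV \<phi>" using test_funD(3)[OF \<phi>, of mi_zero] by simp
  then have \<phi>m: "\<phi> \<in> borel_measurable (lebesgue_on K)"
    by (intro continuous_imp_measurable_on_sets_lebesgue Km) (auto intro: continuous_on_subset)
  have "integrable (lebesgue_on K) (\<lambda>x. g x * \<phi> x)"
  proof (rule Bochner_Integration.integrable_bound)
    show "integrable (lebesgue_on K) (\<lambda>x. C * g x)" using gK by simp
    show "(\<lambda>x. g x * \<phi> x) \<in> borel_measurable (lebesgue_on K)"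
      using gK \<phi>m by (intro borel_measurable_times) auto
    show "AE x in lebesgue_on K. norm (g x * \<phi> x) \<le> norm (C * g x)"
      using C by (intro AE_I2) (simp add: abs_mult mult.commute mult_right_mono)
  qed
  then have "integrable lebesgue (\<lambda>x. indicator K x *\<^sub>R (g x * \<phi> x))"
    using Km by (simp add: integrable_restrict_space)
  moreover have "(\<lambda>x. indicator K x *\<^sub>R (g x * \<phi> x)) = (\<lambda>x. indicator S x *\<^sub>R (g x * \<phi> x))"
  proof
    fix x show "indicator K x *\<^sub>R (g x * \<phi> x) = indicator S x *\<^sub>R (g x * \<phi> x)"
      using z[of x] K(2) by (cases "x \<in> K"; cases "x \<in> S") auto
  qed
  ultimately show ?thesis
    using S by (subst integrable_restrict_space) auto
qed

text \<open>The bumps on the box are admissible test functions and converge to its indicator,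
  dominated by the restriction of \<open>g\<close> to the closed box.\<close>

lemma box_integral_eq_0:
  fixes S :: "(real ^ 'n::finite) set"
  assumes S: "open S" and g: "loc_integrable S g"
    and test: "\<And>\<phi>. test_fun S \<phi> \<Longrightarrow> (LINT x|lebesgue_on S. g x * \<phi> x) = 0"
    and cd: "cbox c d \<subseteq> S"
  shows "(\<integral>x. indicator (box c d) x * g x \<partial>lebesgue) = 0"
proof -
  have gK: "integrable (lebesgue_on (cbox c d)) g" by (rule loc_integrableD[OF g compact_cbox cd])
  have iG: "integrable lebesgue (\<lambda>x. indicator (cbox c d) x * g x)"
    using gK by (simp add: integrable_restrict_space)
  have "(\<lambda>m. \<integral>x. g x * box_bump c d m x * indicator S x \<partial>lebesgue) \<longlonglongrightarrow> (\<integral>x. indicator (box c d) x * g x \<partial>lebesgue)"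
  proof (rule integral_dominated_convergence[where w = "\<lambda>x. \<bar>indicator (cbox c d) x * g x\<bar>"])
    show "integrable lebesgue (\<lambda>x. \<bar>indicator (cbox c d) x * g x\<bar>)" using iG by simp
    have "(\<lambda>x. indicator (box c d) x * g x) = (\<lambda>x. indicator (box c d) x * (indicator (cbox c d) x * g x))"
      using box_subset_cbox[of c d] by (auto simp: indicator_def fun_eq_iff)
    moreover have "integrable lebesgue (\<lambda>x. indicator (box c d) x *\<^sub>R (indicator (cbox c d) x * g x))"
      by (rule integrable_mult_indicator[OF _ iG]) simp
    ultimately have "integrable lebesgue (\<lambda>x. indicator (box c d) x * g x)" by simp
    then show "(\<lambda>x. indicator (box c d) x * g x) \<in> borel_measurable lebesgue" by (rule borel_measurable_integrable)
    fix m
    have i: "integrable (lebesgue_on S) (\<lambda>x. g x * box_bump c d m x)"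
      by (rule loc_integrable_mult_test[OF S g box_bump_test_fun[OF cd]])
    then have "integrable lebesgue (\<lambda>x. indicator S x *\<^sub>R (g x * box_bump c d m x))"
      using S by (subst (asm) integrable_restrict_space) auto
    then have "integrable lebesgue (\<lambda>x. g x * box_bump c d m x * indicator S x)"
      by (simp add: mult.commute)
    then show "(\<lambda>x. g x * box_bump c d m x * indicator S x) \<in> borel_measurable lebesgue"
      by (rule borel_measurable_integrable)
    show "AE x in lebesgue. norm (g x * box_bump c d m x * indicator S x) \<le> \<bar>indicator (cbox c d) x * g x\<bar>"
    proof (rule AE_I2)
      fix x
      show "norm (g x * box_bump c d m x * indicator S x) \<le> \<bar>indicator (cbox c d) x * g x\<bar>"
      proof (cases "x \<in> box c d")
        case True
        then have "x \<in> cbox c d" "x \<in> S" using box_subset_cbox cd by blast+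
        then show ?thesis
          using mult_left_mono[OF box_bump_le_1[of c d m x] abs_ge_zero[of "g x"]] box_bump_nonneg[of c d m x]
          by (simp add: abs_mult)
      qed (simp add: box_bump_zero)
    qed
  next
    show "AE x in lebesgue. (\<lambda>m. g x * box_bump c d m x * indicator S x) \<longlonglongrightarrow> indicator (box c d) x * g x"
    proof (rule AE_I2)
      fix x
      show "(\<lambda>m. g x * box_bump c d m x * indicator S x) \<longlonglongrightarrow> indicator (box c d) x * g x"
      proof (cases "x \<in> box c d")
        case True
        then have "x \<in> S" using box_subset_cbox cd by blast
        have "(\<lambda>m. g x * box_bump c d m x * indicator S x) \<longlonglongrightarrow> g x * 1 * indicator S x"
          by (intro tendsto_mult tendsto_const box_bump_tendsto True)
        then show ?thesis using True \<open>x \<in> S\<close> by simp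
      qed (simp add: box_bump_zero)
    qed
  qed
  moreover have "(\<integral>x. g x * box_bump c d m x * indicator S x \<partial>lebesgue) = 0" for m
  proof -
    have "(\<integral>x. g x * box_bump c d m x * indicator S x \<partial>lebesgue) = (LINT x|lebesgue_on S. g x * box_bump c d m x)"
      using S by (subst integral_restrict_space) (auto simp: mult.commute)
    then show ?thesis using test[OF box_bump_test_fun[OF cd]] by simp
  qed
  ultimately show ?thesis by (simp add: LIMSEQ_const_iff)
qed

text \<open>Dynkin's theorem: boxes are closed under intersection and generate the Borel sets, so
  the integral of \<open>h\<close> vanishes over every Borel set. \<open>tot\<close> is there for
  complements, as the whole space is not a box.\<close>

lemma AE_zero_if_box_integrals_zero:
  fixes h :: "real ^ 'n::finite \<Rightarrow> real"
  assumes h: "integrable lborel h" and box: "\<And>c d. (\<integral>x. indicator (box c d) x * h x \<partial>lborel) = 0"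
    and tot: "(\<integral>x. h x \<partial>lborel) = 0"
  shows "AE x in lborel. h x = 0"
proof -
  have hI: "integrable lborel (\<lambda>x. indicator A x *\<^sub>R h x)" if "A \<in> sets borel" for A
    using that h by (intro integrable_mult_indicator) simp_all
  have stable: "Int_stable (range (\<lambda>(a, b). box a b :: (real ^ 'n) set))"
  proof (rule Int_stableI)
    fix a b assume "a \<in> range (\<lambda>(a, b). box a b :: (real ^ 'n) set)" "b \<in> range (\<lambda>(a, b). box a b :: (real ^ 'n) set)"
    then obtain p q r s where pq: "a = box p q" "b = box r s" by auto
    obtain c d :: "real ^ 'n" where "box p q \<inter> box r s = box c d" by (simp add: box_Int_box)
    then show "a \<inter> b \<in> range (\<lambda>(a, b). box a b)" unfolding pq by (intro range_eqI[of _ _ "(c, d)"]) simp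
  qed
  have subset_Pow_UNIV: "range (\<lambda>(a, b). box a b :: (real ^ 'n) set) \<subseteq> Pow UNIV" by simp
  have zero: "(\<integral>x. indicator A x *\<^sub>R h x \<partial>lborel) = 0" if "A \<in> sets borel" for A
  proof -
    have "A \<in> sigma_sets UNIV (range (\<lambda>(a, b). box a b :: (real ^ 'n) set))"
      using that by (subst (asm) borel_eq_box) simp
    then have "A \<in> sets borel \<and> (\<integral>x. indicator A x *\<^sub>R h x \<partial>lborel) = 0"
    proof (induction rule: sigma_sets_induct_disjoint[OF stable subset_Pow_UNIV, consumes 1, case_names basic empty compl union])
      case (basic A)
      then obtain c d where "A = box c d" by auto
      then show ?case using box[of c d] by simp
    next
      case empty
      then show ?case by simp
    next
      case (compl A)
      have "(\<integral>x. indicator (UNIV - A) x *\<^sub>R h x \<partial>lborel) = (\<integral>x. h x - indicator A x *\<^sub>R h x \<partial>lborel)"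
        by (intro Bochner_Integration.integral_cong) (auto simp: indicator_def)
      also have "\<dots> = 0" using compl h hI[of A] tot by simp
      finally show ?case using compl by auto
    next
      case (union A)
      have m: "A i \<in> sets borel" for i using union by blast
      have U: "(\<Union>i. A i) \<in> sets borel" using m by (intro sets.countable_UN) blast
      have "(LINT x:(\<Union>i. A i)|lborel. h x) = (\<Sum>i. (LINT x:(A i)|lborel. h x))"
      proof (rule lebesgue_integral_countable_add)
        show "A i \<inter> A j = {}" if "i \<noteq> j" for i j
          using union(1) that unfolding disjoint_family_on_def by blast
        show "set_integrable lborel (\<Union>i. A i) h" unfolding set_integrable_def by (rule hI[OF U])
        show "A i \<in> sets lborel" for i using m by simp
      qed
      also have "\<dots> = 0"
      proof -
        have "(LINT x:(A i)|lborel. h x) = 0" for i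
          using union(3)[of i] unfolding set_lebesgue_integral_def by blast
        then show ?thesis by simp
      qed
      finally show ?case unfolding set_lebesgue_integral_def by (rule conjI[OF U])
    qed
    then show ?thesis by blast
  qed
  show ?thesis
  proof (rule density_unique_real[OF h])
    show "(LINT x:A|lborel. h x) = (LINT x:A|lborel. 0)" if "A \<in> sets lborel" for A
    proof -
      have "(LINT x:A|lborel. h x) = 0" unfolding set_lebesgue_integral_def by (rule zero) (use that in simp)
      then show ?thesis by (simp add: set_lebesgue_integral_def)
    qed
  qed simp
qed

text \<open>Since \<open>g\<close> is only locally integrable, the argument runs on one closed box
  inside \<open>S\<close> at a time, where the cut-off \<open>G\<close> is integrable; countably
  many such boxes fill \<open>S\<close>.\<close>

lemma fundamental_lemma:
  fixes S :: "(real ^ 'n::finite) set"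
  assumes S: "open S" and g: "loc_integrable S g"
    and test: "\<And>\<phi>. test_fun S \<phi> \<Longrightarrow> (LINT x|lebesgue_on S. g x * \<phi> x) = 0"
  shows "AE x in lebesgue_on S. g x = 0"
proof -
  have loc: "AE x in lebesgue. x \<in> cbox a b \<longrightarrow> g x = 0" if ab: "cbox a b \<subseteq> S" for a b
  proof -
    define G where "G x = indicator (box a b) x * g x" for x
    have "integrable (lebesgue_on (cbox a b)) g" by (rule loc_integrableD[OF g compact_cbox ab])
    then have iG0: "integrable lebesgue (\<lambda>x. indicator (cbox a b) x *\<^sub>R g x)"
      by (simp add: integrable_restrict_space)
    have "integrable lebesgue (\<lambda>x. indicator (box a b) x *\<^sub>R (indicator (cbox a b) x *\<^sub>R g x))"
      by (rule integrable_mult_indicator[OF _ iG0]) simp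
    moreover have "(\<lambda>x. indicator (box a b) x *\<^sub>R (indicator (cbox a b) x *\<^sub>R g x)) = G"
      using box_subset_cbox[of a b] by (auto simp: G_def indicator_def fun_eq_iff)
    ultimately have iG: "integrable lebesgue G" by simp
    have GI: "(\<integral>x. indicator (box c d) x * G x \<partial>lebesgue) = 0" for c d
    proof -
      obtain c' d' where cd: "box c d \<inter> box a b = box c' d'" by (simp add: box_Int_box)
      have eq: "(\<lambda>x. indicator (box c d) x * G x) = (\<lambda>x. indicator (box c' d') x * g x)"
        using cd by (auto simp: G_def indicator_def fun_eq_iff)
      show ?thesis
      \<comment> \<open>The corners of an empty intersection say nothing about
        \<open>cbox c' d'\<close>, which need not lie in \<open>S\<close>; a non-empty open box has
        the closed box as its closure.\<close>
      proof (cases "box c' d' = {}")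
        case True
        then show ?thesis by (simp add: eq)
      next
        case False
        have "box c' d' \<subseteq> cbox a b" using cd box_subset_cbox by blast
        then have "closure (box c' d') \<subseteq> cbox a b" by (intro closure_minimal closed_cbox)
        then have cS: "cbox c' d' \<subseteq> S" using ab closure_box[OF False] by simp
        show ?thesis unfolding eq by (rule box_integral_eq_0[OF S g _ cS]) (rule test)
      qed
    qed
    have Gtot: "(\<integral>x. G x \<partial>lebesgue) = 0"
      using GI[of a b] by (simp add: G_def mult.assoc[symmetric] indicator_inter_arith[symmetric])
    \<comment> \<open>The argument with boxes takes place on \<open>lborel\<close>, so the Lebesgue
      measurable \<open>G\<close> is replaced by a Borel version.\<close>
    obtain h where h: "h \<in> borel_measurable lborel" "AE x in lborel. G x = h x"
      using completion_ex_borel_measurable_real[OF borel_measurable_integrable[OF iG]] by blast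
    have hG: "AE x in lebesgue. G x = h x" by (rule AE_completion[OF h(2)])
    have hm: "h \<in> borel_measurable lebesgue" using h(1) by (rule measurable_completion)
    have "integrable lebesgue h"
      using iG integrable_cong_AE[OF borel_measurable_integrable[OF iG] hm hG] by simp
    then have ih: "integrable lborel h" using integrable_completion[OF h(1)] by simp
    have eqI: "(\<integral>x. indicator A x * h x \<partial>lborel) = (\<integral>x. indicator A x * G x \<partial>lebesgue)" if A: "A \<in> sets borel" for A
    proof -
      have m1: "(\<lambda>x. indicator A x * h x) \<in> borel_measurable lborel"
        using A h(1) by (intro borel_measurable_times borel_measurable_indicator) auto
      have m2: "(\<lambda>x. indicator A x * G x) \<in> borel_measurable lebesgue"
        using A iG by (intro borel_measurable_times borel_measurable_indicator) auto
      have "(\<integral>x. indicator A x * h x \<partial>lborel) = (\<integral>x. indicator A x * h x \<partial>lebesgue)"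
        by (rule integral_completion[OF m1, symmetric])
      also have "\<dots> = (\<integral>x. indicator A x * G x \<partial>lebesgue)"
      proof (rule integral_cong_AE[OF measurable_completion[OF m1] m2])
        show "AE x in lebesgue. indicator A x * h x = indicator A x * G x" using hG by eventually_elim simp
      qed
      finally show ?thesis .
    qed
    have "AE x in lborel. h x = 0"
    proof (rule AE_zero_if_box_integrals_zero[OF ih])
      show "(\<integral>x. indicator (box c d) x * h x \<partial>lborel) = 0" for c d
        using eqI[of "box c d"] GI by simp
      show "(\<integral>x. h x \<partial>lborel) = 0" using eqI[of UNIV] Gtot by simp
    qed
    then have "AE x in lebesgue. h x = 0" by (rule AE_completion)
    \<comment> \<open>\<open>G\<close> only knows the open box, while the claim is about the closed
      one; the faces in between are null.\<close>
    moreover have "AE x in lebesgue. x \<notin> cbox a b - box a b"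
      using negligible_frontier_interval[of a b] by (intro AE_not_in) (simp add: negligible_iff_null_sets)
    ultimately show ?thesis using hG
    proof eventually_elim
      case (elim x)
      then show ?case by (cases "x \<in> box a b") (auto simp: G_def)
    qed
  qed
  obtain D where D: "countable D" "D \<subseteq> Pow S" "\<And>X. X \<in> D \<Longrightarrow> \<exists>a b. X = cbox a b" "\<Union>D = S"
    using open_countable_Union_open_cbox[OF S] by blast
  have "AE x in lebesgue. \<forall>X\<in>D. x \<in> X \<longrightarrow> g x = 0"
    unfolding AE_ball_countable[OF D(1)]
  proof
    fix X assume X: "X \<in> D"
    then obtain a b where "X = cbox a b" using D(3) by blast
    then show "AE x in lebesgue. x \<in> X \<longrightarrow> g x = 0" using loc[of a b] X D(2) by auto
  qed
  then have "AE x in lebesgue. x \<in> S \<longrightarrow> g x = 0"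
  proof eventually_elim
    case (elim x)
    show ?case
    proof
      assume "x \<in> S"
      then obtain X where X: "X \<in> D" "x \<in> X" unfolding D(4)[symmetric] by (rule UnionE)
      show "g x = 0" using bspec[OF elim X(1)] X(2) by (rule mp)
    qed
  qed
  then show ?thesis using S by (subst AE_restrict_space_iff) auto
qed

lemma loc_integrable_diff:
  assumes "loc_integrable S f" "loc_integrable S g"
  shows "loc_integrable S (\<lambda>x. f x - g x)"
  unfolding loc_integrable_def
proof (intro allI impI, elim conjE)
  fix K assume "compact K" "K \<subseteq> S"
  then show "integrable (lebesgue_on K) (\<lambda>x. f x - g x)"
    by (intro Bochner_Integration.integrable_diff loc_integrableD[OF assms(1)] loc_integrableD[OF assms(2)])
qed

lemma has_weak_derivD:
  assumes "has_weak_deriv S \<alpha> f g"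
  shows "loc_integrable S f" "loc_integrable S g"
    "test_fun S \<phi> \<Longrightarrow> (LINT x|lebesgue_on S. f x * cderiv \<alpha> \<phi> x) = (-1) ^ mi_order \<alpha> * (LINT x|lebesgue_on S. g x * \<phi> x)"
proof -
  note d = assms[unfolded has_weak_deriv_def]
  show "loc_integrable S f" by (rule conjunct1[OF d])
  show "loc_integrable S g" by (rule conjunct1[OF conjunct2[OF d]])
  show "test_fun S \<phi> \<Longrightarrow> (LINT x|lebesgue_on S. f x * cderiv \<alpha> \<phi> x) = (-1) ^ mi_order \<alpha> * (LINT x|lebesgue_on S. g x * \<phi> x)"
    by (rule conjunct2[OF conjunct2[OF d], rule_format])
qed

lemma has_weak_deriv_unique:
  fixes S :: "(real ^ 'n::finite) set"
  assumes S: "open S" and g: "has_weak_deriv S \<alpha> f g" and h: "has_weak_deriv S \<alpha> f h"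
  shows "AE x in lebesgue_on S. g x = h x"
proof -
  note l = has_weak_derivD(2)[OF g] has_weak_derivD(2)[OF h]
  have "AE x in lebesgue_on S. g x - h x = 0"
  proof (rule fundamental_lemma[OF S loc_integrable_diff[OF l]])
    fix \<phi> assume \<phi>: "test_fun S \<phi>"
    have "(-1) ^ mi_order \<alpha> * (LINT x|lebesgue_on S. g x * \<phi> x) = (-1) ^ mi_order \<alpha> * (LINT x|lebesgue_on S. h x * \<phi> x)"
      by (rule trans[OF has_weak_derivD(3)[OF g \<phi>, symmetric] has_weak_derivD(3)[OF h \<phi>]])
    then have "(LINT x|lebesgue_on S. g x * \<phi> x) = (LINT x|lebesgue_on S. h x * \<phi> x)" by simp
    then show "(LINT x|lebesgue_on S. (g x - h x) * \<phi> x) = 0"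
      using loc_integrable_mult_test[OF S l(1) \<phi>] loc_integrable_mult_test[OF S l(2) \<phi>]
      by (simp add: left_diff_distrib)
  qed
  then show ?thesis by eventually_elim simp
qed

text \<open>The set where \<open>f\<close> is non-zero is open, and a null open set is
  empty.\<close>

lemma AE_zero_continuous:
  fixes S :: "(real ^ 'n::finite) set"
  assumes S: "open S" and f: "continuous_on S f" and AE: "AE x in lebesgue_on S. f x = (0::real)" and x: "x \<in> S"
  shows "f x = 0"
proof (rule ccontr)
  assume nz: "f x \<noteq> 0"
  define U where "U = {y \<in> S. f y \<noteq> 0}"
  have "open U"
  proof -
    have "U = S \<inter> f -` (- {0})" by (auto simp: U_def)
    then show ?thesis using continuous_openin_preimage_gen[OF f, of "- {0}"] S by (simp add: open_Compl openin_open_eq)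
  qed
  have S': "S \<inter> space lebesgue \<in> sets lebesgue" using S by auto
  have "AE y in lebesgue. y \<in> S \<longrightarrow> f y = 0"
    by (rule iffD1[OF AE_restrict_space_iff[OF S'] AE])
  then have "AE y in lebesgue. y \<in> - U" by eventually_elim (simp add: U_def)
  then have "x \<in> - U" by (rule mem_closed_if_AE_lebesgue[rotated]) (use \<open>open U\<close> in \<open>simp add: closed_Compl\<close>)
  then show False using nz x by (simp add: U_def)
qed

section \<open>Sobolev functions and representatives of their weak derivatives\<close>

lemma L2_fun_sq: "L2_fun S f = sq_integrable (lebesgue_on S) f"
  by (simp add: L2_fun_def sq_integrable_def)

lemma borel_measurable_lebesgue_on_AE:
  fixes f g :: "real ^ 'n::finite \<Rightarrow> real"
  assumes f: "f \<in> borel_measurable (lebesgue_on S)" and S: "S \<in> sets lebesgue" and AE: "AE x in lebesgue_on S. f x = g x"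
  shows "g \<in> borel_measurable (lebesgue_on S)"
proof -
  have S': "S \<inter> space lebesgue \<in> sets lebesgue" using S by simp
  have "(\<lambda>x. indicator S x *\<^sub>R f x) \<in> borel_measurable lebesgue"
    using f borel_measurable_restrict_space_iff[OF S'] by blast
  moreover have "AE x in lebesgue. indicator S x *\<^sub>R f x = indicator S x *\<^sub>R g x"
  proof -
    have "AE x in lebesgue. x \<in> S \<longrightarrow> f x = g x" by (rule iffD1[OF AE_restrict_space_iff[OF S'] AE])
    then show ?thesis by eventually_elim (simp add: indicator_def)
  qed
  ultimately have "(\<lambda>x. indicator S x *\<^sub>R g x) \<in> borel_measurable lebesgue"
    by (rule borel_measurable_AE)
  then show ?thesis
    by (rule iffD2[OF borel_measurable_restrict_space_iff[OF S']])
qed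

lemma weak_deriv_has_weak_deriv: "has_weak_deriv S \<alpha> f g \<Longrightarrow> has_weak_deriv S \<alpha> f (weak_deriv S \<alpha> f)"
  unfolding weak_deriv_def by (rule someI[where P = "has_weak_deriv S \<alpha> f"])

lemma weak_deriv_AE:
  fixes S :: "(real ^ 'n::finite) set"
  assumes "open S" "has_weak_deriv S \<alpha> f g"
  shows "AE x in lebesgue_on S. weak_deriv S \<alpha> f x = g x"
  by (rule has_weak_deriv_unique[OF assms(1) weak_deriv_has_weak_deriv[OF assms(2)] assms(2)])

lemma weak_deriv_L2:
  fixes S :: "(real ^ 'n::finite) set"
  assumes "open S" "has_weak_deriv S \<alpha> f g" "sq_integrable (lebesgue_on S) g"
  shows "sq_integrable (lebesgue_on S) (weak_deriv S \<alpha> f)"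
proof -
  have ae: "AE x in lebesgue_on S. g x = weak_deriv S \<alpha> f x"
    using weak_deriv_AE[OF assms(1,2)] by eventually_elim simp
  have S: "S \<in> sets lebesgue" using assms(1) by auto
  show ?thesis
    by (rule sq_integrable_cong_AE[OF assms(3)
        borel_measurable_lebesgue_on_AE[OF sq_integrable_measurable[OF assms(3)] S ae] ae])
qed

lemma sobolevD:
  fixes S :: "(real ^ 'n::finite) set"
  assumes "open S" "f \<in> sobolev S k" "mi_order \<alpha> \<le> k"
  shows "has_weak_deriv S \<alpha> f (weak_deriv S \<alpha> f)" "sq_integrable (lebesgue_on S) (weak_deriv S \<alpha> f)"
proof -
  have "f \<in> {f. L2_fun S f \<and> (\<forall>\<alpha>. mi_order \<alpha> \<le> k \<longrightarrow> (\<exists>g. has_weak_deriv S \<alpha> f g \<and> L2_fun S g))}"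
    using assms(2) unfolding sobolev_def .
  then have "L2_fun S f \<and> (\<forall>\<alpha>. mi_order \<alpha> \<le> k \<longrightarrow> (\<exists>g. has_weak_deriv S \<alpha> f g \<and> L2_fun S g))" by (rule CollectD)
  from conjunct2[OF this, rule_format, OF assms(3)] have "\<exists>g. has_weak_deriv S \<alpha> f g \<and> sq_integrable (lebesgue_on S) g"
    unfolding L2_fun_sq .
  then obtain g where g: "has_weak_deriv S \<alpha> f g" "sq_integrable (lebesgue_on S) g" by (elim exE conjE)
  show "has_weak_deriv S \<alpha> f (weak_deriv S \<alpha> f)" by (rule weak_deriv_has_weak_deriv[OF g(1)])
  show "sq_integrable (lebesgue_on S) (weak_deriv S \<alpha> f)" by (rule weak_deriv_L2[OF assms(1) g])
qed

lemma sobolevI: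
  assumes "sq_integrable (lebesgue_on S) f"
    and "\<And>\<alpha>. mi_order \<alpha> \<le> k \<Longrightarrow> has_weak_deriv S \<alpha> f (g \<alpha>) \<and> sq_integrable (lebesgue_on S) (g \<alpha>)"
  shows "f \<in> sobolev S k"
  unfolding sobolev_def L2_fun_sq mem_Collect_eq
proof (intro conjI allI impI)
  show "sq_integrable (lebesgue_on S) f" by (rule assms(1))
  fix \<alpha> :: "'a multi_index" assume "mi_order \<alpha> \<le> k"
  then show "\<exists>g. has_weak_deriv S \<alpha> f g \<and> sq_integrable (lebesgue_on S) g"
    by (intro exI[of _ "g \<alpha>"] assms(2))
qed

lemma finite_measure_lebesgue_on_bounded:
  fixes S :: "(real ^ 'n::finite) set"
  assumes "open S" "bounded S"
  shows "finite_measure (lebesgue_on S)"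
  by (intro finite_measure_lebesgue_on lmeasurable_open assms)

lemma continuous_measurable_lebesgue_on:
  fixes S :: "(real ^ 'n::finite) set"
  assumes "open S" "continuous_on S f"
  shows "f \<in> borel_measurable (lebesgue_on S)"
  using assms by (intro continuous_imp_measurable_on_sets_lebesgue) auto

lemma uniformly_continuous_bounded_on:
  fixes f :: "'a::euclidean_space \<Rightarrow> real"
  assumes "uniformly_continuous_on S f" "bounded S"
  obtains C where "0 < C" "\<And>x. x \<in> S \<Longrightarrow> \<bar>f x\<bar> \<le> C"
  using bounded_uniformly_continuous_image[OF assms] unfolding bounded_pos by auto

lemma Ck_unif_sq_integrable:
  fixes S :: "(real ^ 'n::finite) set"
  assumes "open S" "bounded S" "Ck_unif S k f" "mi_order \<alpha> \<le> k"
  shows "sq_integrable (lebesgue_on S) (cderiv \<alpha> f)"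
proof -
  interpret finite_measure "lebesgue_on S" by (rule finite_measure_lebesgue_on_bounded[OF assms(1,2)])
  have "uniformly_continuous_on S (cderiv \<alpha> f)" using assms(3,4) by (simp add: Ck_unif_def)
  then obtain C where C: "\<And>x. x \<in> S \<Longrightarrow> \<bar>cderiv \<alpha> f x\<bar> \<le> C" using uniformly_continuous_bounded_on[OF _ assms(2)] by blast
  show ?thesis
    by (rule sq_integrable_bounded[OF continuous_measurable_lebesgue_on[OF assms(1) Ck_unif_continuous[OF assms(3,4)]]])
      (use C in auto)
qed

lemma Ck_unif_sobolev:
  fixes S :: "(real ^ 'n::finite) set"
  assumes "open S" "bounded S" "Ck_unif S k f"
  shows "f \<in> sobolev S k"
  using Ck_unif_sq_integrable[OF assms, of mi_zero] Ck_unif_sq_integrable[OF assms]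
    Ck_unif_has_weak_deriv[OF assms(1,3)]
  by (intro sobolevI[where g = "\<lambda>\<alpha>. cderiv \<alpha> f"]) simp_all

lemma integrable_lebesgue_on_subset:
  assumes "integrable (lebesgue_on S) (f :: _ \<Rightarrow> real)" "K \<subseteq> S" "K \<in> sets lebesgue" "S \<in> sets lebesgue"
  shows "integrable (lebesgue_on K) f"
proof -
  have "integrable lebesgue (\<lambda>x. indicator S x *\<^sub>R f x)"
    using assms(1,4) by (subst (asm) integrable_restrict_space) auto
  then have "integrable lebesgue (\<lambda>x. indicator K x *\<^sub>R (indicator S x *\<^sub>R f x))"
    by (rule integrable_mult_indicator[OF assms(3)])
  moreover have "(\<lambda>x. indicator K x *\<^sub>R (indicator S x *\<^sub>R f x)) = (\<lambda>x. indicator K x *\<^sub>R f x)"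
    using assms(2) by (auto simp: indicator_def fun_eq_iff)
  ultimately show ?thesis using assms(3) by (subst integrable_restrict_space) auto
qed

lemma sq_integrable_loc_integrable:
  fixes S :: "(real ^ 'n::finite) set"
  assumes "open S" "bounded S" "sq_integrable (lebesgue_on S) f"
  shows "loc_integrable S f"
  unfolding loc_integrable_def
proof (intro allI impI, elim conjE)
  interpret finite_measure "lebesgue_on S" by (rule finite_measure_lebesgue_on_bounded[OF assms(1,2)])
  fix K assume K: "compact K" "K \<subseteq> S"
  have S: "S \<in> sets lebesgue" using assms(1) by auto
  have Km: "K \<in> sets lebesgue" using K(1) by (simp add: lmeasurable_compact fmeasurableD)
  show "integrable (lebesgue_on K) f"
    by (rule integrable_lebesgue_on_subset[OF sq_integrable_integrable[OF assms(3)] K(2) Km S])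
qed

lemma sq_integrable_test_fun:
  fixes S :: "(real ^ 'n::finite) set"
  assumes "open S" "bounded S" "test_fun S \<phi>"
  shows "sq_integrable (lebesgue_on S) (cderiv \<alpha> \<phi>)"
proof -
  interpret finite_measure "lebesgue_on S" by (rule finite_measure_lebesgue_on_bounded[OF assms(1,2)])
  obtain C where C: "\<And>x. \<bar>cderiv \<alpha> \<phi> x\<bar> \<le> C" using test_fun_bounded[OF assms(3)] by blast
  show ?thesis
    by (rule sq_integrable_bounded[OF continuous_measurable_lebesgue_on[OF assms(1)
        continuous_on_subset[OF test_funD(3)[OF assms(3)] subset_UNIV]] C])
qed

text \<open>Both sides of the defining identity are inner products with fixed square-integrable
  functions and pass to the limit: weak differentiation is a closed operator.\<close>

lemma has_weak_deriv_L2_limit: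
  fixes S :: "(real ^ 'n::finite) set"
  assumes S: "open S" "bounded S"
    and wd: "\<And>n::nat. has_weak_deriv S \<alpha> (f n) (g n)"
    and sq: "\<And>n. sq_integrable (lebesgue_on S) (f n)" "\<And>n. sq_integrable (lebesgue_on S) (g n)"
      "sq_integrable (lebesgue_on S) F" "sq_integrable (lebesgue_on S) G"
    and lim: "(\<lambda>n. LINT x|lebesgue_on S. (f n x - F x)\<^sup>2) \<longlonglongrightarrow> 0" "(\<lambda>n. LINT x|lebesgue_on S. (g n x - G x)\<^sup>2) \<longlonglongrightarrow> 0"
  shows "has_weak_deriv S \<alpha> F G"
  unfolding has_weak_deriv_def
proof (intro conjI allI impI sq_integrable_loc_integrable[OF S] sq(3,4))
  fix \<phi> assume \<phi>: "test_fun S \<phi>"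
  have "(\<lambda>n. (-1) ^ mi_order \<alpha> * (LINT x|lebesgue_on S. g n x * cderiv mi_zero \<phi> x))
      \<longlonglongrightarrow> (-1) ^ mi_order \<alpha> * (LINT x|lebesgue_on S. G x * cderiv mi_zero \<phi> x)"
    by (intro tendsto_mult tendsto_const L2_tendsto_inner sq lim sq_integrable_test_fun[OF S \<phi>])
  moreover have "(\<lambda>n. LINT x|lebesgue_on S. f n x * cderiv \<alpha> \<phi> x) \<longlonglongrightarrow> (LINT x|lebesgue_on S. F x * cderiv \<alpha> \<phi> x)"
    by (intro L2_tendsto_inner sq lim sq_integrable_test_fun[OF S \<phi>])
  moreover have "(LINT x|lebesgue_on S. f n x * cderiv \<alpha> \<phi> x) = (-1) ^ mi_order \<alpha> * (LINT x|lebesgue_on S. g n x * cderiv mi_zero \<phi> x)" for n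
    using has_weak_derivD(3)[OF wd \<phi>] by simp
  ultimately have "(-1) ^ mi_order \<alpha> * (LINT x|lebesgue_on S. G x * cderiv mi_zero \<phi> x) = (LINT x|lebesgue_on S. F x * cderiv \<alpha> \<phi> x)"
    by (simp only: LIMSEQ_unique)
  then show "(LINT x|lebesgue_on S. F x * cderiv \<alpha> \<phi> x) = (-1) ^ mi_order \<alpha> * (LINT x|lebesgue_on S. G x * \<phi> x)"
    by simp
qed

subsection \<open>Mean-square derivatives\<close>

lemma line_deriv_shift_at:
  fixes g :: "real ^ 'n::finite \<Rightarrow> real"
  assumes "((\<lambda>s. g ((x + t *\<^sub>R axis i 1) + s *\<^sub>R axis i 1)) has_real_derivative d) (at 0)"
  shows "((\<lambda>s. g (x + s *\<^sub>R axis i 1)) has_real_derivative d) (at t)"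
proof -
  have "((\<lambda>s. g (x + (s + t) *\<^sub>R axis i 1)) has_real_derivative d) (at 0)"
    using assms by (simp add: scaleR_add_left add.assoc add.commute[of _ t])
  then show ?thesis
    using DERIV_shift[of "\<lambda>s. g (x + s *\<^sub>R axis i 1)" _ 0 t] by simp
qed

lemma space_mvt:
  fixes g :: "real ^ 'n::finite \<Rightarrow> real"
  assumes "h \<noteq> 0" "ball x r \<subseteq> S" "\<bar>h\<bar> < r"
    and "\<And>y. y \<in> S \<Longrightarrow> ((\<lambda>s. g (y + s *\<^sub>R axis i 1)) has_real_derivative g' y) (at 0)"
  obtains s where "\<bar>s\<bar> \<le> \<bar>h\<bar>" "g (x + h *\<^sub>R axis i 1) - g x = h * g' (x + s *\<^sub>R axis i 1)"
proof -
  have inS: "x + s *\<^sub>R axis i 1 \<in> S" if "\<bar>s\<bar> \<le> \<bar>h\<bar>" for s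
    using that assms(2,3) by (intro subsetD[OF assms(2)]) (simp add: dist_norm)
  obtain s where s: "\<bar>s\<bar> \<le> \<bar>h\<bar>" "g (x + h *\<^sub>R axis i 1) - g (x + 0 *\<^sub>R axis i 1) = h * g' (x + s *\<^sub>R axis i 1)"
  proof (rule line_mvt[of h "\<lambda>s. g (x + s *\<^sub>R axis i 1)" "\<lambda>s. g' (x + s *\<^sub>R axis i 1)", OF assms(1)])
    show "((\<lambda>s. g (x + s *\<^sub>R axis i 1)) has_real_derivative g' (x + s *\<^sub>R axis i 1)) (at s)" if "\<bar>s\<bar> \<le> \<bar>h\<bar>" for s
      by (rule line_deriv_shift_at[OF assms(4)[OF inS[OF that]]])
  qed
  then show thesis using that[OF s(1)] by simp
qed

text \<open>Two mean value theorems: in the first variable for the increment of \<open>G\<close> in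
  the second one, and then in the second variable for \<open>G1\<close>.\<close>

lemma double_difference:
  fixes G :: "real ^ 'n::finite \<Rightarrow> real ^ 'n \<Rightarrow> real"
  assumes r: "ball t r \<subseteq> S" "h \<noteq> 0" "h' \<noteq> 0" "\<bar>h\<bar> < r" "\<bar>h'\<bar> < r"
    and G1: "\<And>x y. x \<in> S \<Longrightarrow> y \<in> S \<Longrightarrow> ((\<lambda>s. G (x + s *\<^sub>R axis i 1) y) has_real_derivative G1 x y) (at 0)"
    and H: "\<And>x y. x \<in> S \<Longrightarrow> y \<in> S \<Longrightarrow> ((\<lambda>s. G1 x (y + s *\<^sub>R axis i 1)) has_real_derivative H x y) (at 0)"
  obtains s s' where "\<bar>s\<bar> \<le> \<bar>h\<bar>" "\<bar>s'\<bar> \<le> \<bar>h'\<bar>"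
    "G (t + h *\<^sub>R axis i 1) (t + h' *\<^sub>R axis i 1) - G (t + h *\<^sub>R axis i 1) t - G t (t + h' *\<^sub>R axis i 1) + G t t
      = h * h' * H (t + s *\<^sub>R axis i 1) (t + s' *\<^sub>R axis i 1)"
proof -
  have inS: "t + s *\<^sub>R axis i 1 \<in> S" if "\<bar>s\<bar> < r" for s
    using that by (intro subsetD[OF r(1)]) (simp add: dist_norm)
  have t: "t \<in> S" using inS[of 0] r(4) by simp
  have t': "t + h' *\<^sub>R axis i 1 \<in> S" by (rule inS[OF r(5)])
  obtain s where s: "\<bar>s\<bar> \<le> \<bar>h\<bar>"
    "(G (t + h *\<^sub>R axis i 1) (t + h' *\<^sub>R axis i 1) - G (t + h *\<^sub>R axis i 1) t) - (G t (t + h' *\<^sub>R axis i 1) - G t t)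
      = h * (G1 (t + s *\<^sub>R axis i 1) (t + h' *\<^sub>R axis i 1) - G1 (t + s *\<^sub>R axis i 1) t)"
  proof (rule space_mvt[of h t r S "\<lambda>x. G x (t + h' *\<^sub>R axis i 1) - G x t" i
        "\<lambda>x. G1 x (t + h' *\<^sub>R axis i 1) - G1 x t", OF r(2,1,4)])
    show "((\<lambda>s. G (y + s *\<^sub>R axis i 1) (t + h' *\<^sub>R axis i 1) - G (y + s *\<^sub>R axis i 1) t)
        has_real_derivative G1 y (t + h' *\<^sub>R axis i 1) - G1 y t) (at 0)" if "y \<in> S" for y
      by (rule DERIV_diff[OF G1[OF that t'] G1[OF that t]])
  qed
  have st: "t + s *\<^sub>R axis i 1 \<in> S" using s(1) r(4) by (intro inS) linarith
  obtain s' where s': "\<bar>s'\<bar> \<le> \<bar>h'\<bar>"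
    "G1 (t + s *\<^sub>R axis i 1) (t + h' *\<^sub>R axis i 1) - G1 (t + s *\<^sub>R axis i 1) t = h' * H (t + s *\<^sub>R axis i 1) (t + s' *\<^sub>R axis i 1)"
    by (rule space_mvt[of h' t r S "G1 (t + s *\<^sub>R axis i 1)" i "H (t + s *\<^sub>R axis i 1)", OF r(3,1,5) H[OF st]])
  show thesis
    by (rule that[OF s(1) s'(1)]) (use s(2) s'(2) in \<open>simp add: algebra_simps\<close>)
qed

lemma uniformly_continuous_diagonal:
  fixes H :: "'a::metric_space \<Rightarrow> 'a \<Rightarrow> real"
  assumes "uniformly_continuous_on (S \<times> S) (\<lambda>(x, y). H x y)" "0 < \<epsilon>"
  shows "\<exists>\<delta>>0. \<forall>x\<in>S. \<forall>y\<in>S. \<forall>x'\<in>S. \<forall>y'\<in>S. dist x x' < \<delta> \<and> dist y y' < \<delta> \<longrightarrow> \<bar>H x y - H x' y'\<bar> < \<epsilon>"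
proof -
  obtain \<delta> where \<delta>: "0 < \<delta>" "\<forall>p\<in>S \<times> S. \<forall>p'\<in>S \<times> S. dist p' p < \<delta> \<longrightarrow>
      dist (case p' of (x, y) \<Rightarrow> H x y) (case p of (x, y) \<Rightarrow> H x y) < \<epsilon>"
    using assms(1)[unfolded uniformly_continuous_on_def, rule_format, OF assms(2)] by (elim exE conjE)
  show ?thesis
  proof (intro exI[of _ "\<delta> / 2"] conjI ballI impI)
    show "0 < \<delta> / 2" using \<delta>(1) by simp
    fix x y x' y' assume xy: "x \<in> S" "y \<in> S" "x' \<in> S" "y' \<in> S" "dist x x' < \<delta> / 2 \<and> dist y y' < \<delta> / 2"
    have "dist (x, y) (x', y') \<le> dist x x' + dist y y'"
      unfolding dist_Pair_Pair by (rule sqrt_sum_squares_le_sum) simp_all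
    then have "dist (x, y) (x', y') < \<delta>" using xy(5) by linarith
    moreover have "(x, y) \<in> S \<times> S" "(x', y') \<in> S \<times> S" using xy by simp_all
    ultimately have "dist (case (x, y) of (x, y) \<Rightarrow> H x y) (case (x', y') of (x, y) \<Rightarrow> H x y) < \<epsilon>"
      using \<delta>(2) by blast
    then show "\<bar>H x y - H x' y'\<bar> < \<epsilon>"
      by (simp add: dist_real_def)
  qed
qed

text \<open>The inner product of two difference quotients is a double difference of the covariance,
  hence a value of \<open>H\<close> near the diagonal point; so the quotients are Cauchy in mean
  square, at a rate uniform in \<open>t\<close>. The derivative must be a jointly measurable field,
  and for this reason it is built as a pointwise limit along one sequence of step widths common to
  all \<open>t\<close>.\<close>

lemma (in prob_space) L2_derivative_exists:
  fixes Z :: "real ^ 'n::finite \<Rightarrow> 'a \<Rightarrow> real"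
  assumes S: "open S" and Zm: "measurable_field S M Z" and sq: "\<And>t. t \<in> S \<Longrightarrow> sq_integrable M (Z t)"
    and G: "\<And>s t. s \<in> S \<Longrightarrow> t \<in> S \<Longrightarrow> (\<integral>w. Z s w * Z t w \<partial>M) = G s t"
    and G1: "\<And>x y. x \<in> S \<Longrightarrow> y \<in> S \<Longrightarrow> ((\<lambda>s. G (x + s *\<^sub>R axis i 1) y) has_real_derivative G1 x y) (at 0)"
    and H: "\<And>x y. x \<in> S \<Longrightarrow> y \<in> S \<Longrightarrow> ((\<lambda>s. G1 x (y + s *\<^sub>R axis i 1)) has_real_derivative H x y) (at 0)"
    and uc: "uniformly_continuous_on (S \<times> S) (\<lambda>(x, y). H x y)"
  shows "\<exists>D. measurable_field S M D \<and> (\<forall>t\<in>S. sq_integrable M (D t)) \<and>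
    (\<forall>Y t. sq_integrable M Y \<and> t \<in> S \<longrightarrow>
      ((\<lambda>h. \<integral>w. Y w * Z (t + h *\<^sub>R axis i 1) w \<partial>M) has_real_derivative (\<integral>w. Y w * D t w \<partial>M)) (at 0))"
proof -
  define e :: "real ^ 'n" where "e = axis i 1"
  define Q where "Q h t w = (Z (t + h *\<^sub>R e) w - Z t w) / h" for h t w
  have e1: "norm e = 1" by (simp add: e_def)
  have inS: "t + s *\<^sub>R e \<in> S" if "ball t r \<subseteq> S" "\<bar>s\<bar> < r" for t r s
    using that(2) e1 by (intro subsetD[OF that(1)]) (simp add: dist_norm)
  have sqQ: "sq_integrable M (Q h t)" if "t \<in> S" "t + h *\<^sub>R e \<in> S" for h t
    unfolding Q_def by (intro sq_integrable_divide sq_integrable_diff sq that)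
  have Q_inner: "\<exists>s s'. \<bar>s\<bar> \<le> \<bar>h\<bar> \<and> \<bar>s'\<bar> \<le> \<bar>h'\<bar> \<and> (\<integral>w. Q h t w * Q h' t w \<partial>M) = H (t + s *\<^sub>R e) (t + s' *\<^sub>R e)"
    if t: "ball t r \<subseteq> S" "h \<noteq> 0" "h' \<noteq> 0" "\<bar>h\<bar> < r" "\<bar>h'\<bar> < r" for t r h h'
  proof -
    have tS: "t \<in> S" using inS[OF t(1), of 0] t(4) by simp
    note ins = inS[OF t(1) t(4)] inS[OF t(1) t(5)] tS
    note ii = sq_integrable_mult[OF sq sq]
    have "(\<integral>w. Q h t w * Q h' t w \<partial>M) = (\<integral>w. (1 / (h * h')) * (Z (t + h *\<^sub>R e) w * Z (t + h' *\<^sub>R e) w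
        - Z (t + h *\<^sub>R e) w * Z t w - Z t w * Z (t + h' *\<^sub>R e) w + Z t w * Z t w) \<partial>M)"
      by (intro Bochner_Integration.integral_cong refl) (simp add: Q_def algebra_simps diff_divide_distrib add_divide_distrib)
    also have "\<dots> = (1 / (h * h')) * (G (t + h *\<^sub>R e) (t + h' *\<^sub>R e) - G (t + h *\<^sub>R e) t - G t (t + h' *\<^sub>R e) + G t t)"
      using ii ins by (simp add: G)
    finally have eq: "(\<integral>w. Q h t w * Q h' t w \<partial>M)
      = (1 / (h * h')) * (G (t + h *\<^sub>R e) (t + h' *\<^sub>R e) - G (t + h *\<^sub>R e) t - G t (t + h' *\<^sub>R e) + G t t)" .
    obtain s s' where s: "\<bar>s\<bar> \<le> \<bar>h\<bar>" "\<bar>s'\<bar> \<le> \<bar>h'\<bar>"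
      "G (t + h *\<^sub>R e) (t + h' *\<^sub>R e) - G (t + h *\<^sub>R e) t - G t (t + h' *\<^sub>R e) + G t t
        = h * h' * H (t + s *\<^sub>R e) (t + s' *\<^sub>R e)"
      unfolding e_def by (rule double_difference[OF t(1,2,3,4,5) G1 H])
    have "(\<integral>w. Q h t w * Q h' t w \<partial>M) = H (t + s *\<^sub>R e) (t + s' *\<^sub>R e)"
      unfolding eq s(3) using t(2,3) by simp
    with s(1,2) show ?thesis by (intro exI[of _ s] exI[of _ s'] conjI)
  qed
  define close where "close \<epsilon> \<delta> \<longleftrightarrow> (\<forall>t r h h'. ball t r \<subseteq> S \<and> h \<noteq> 0 \<and> h' \<noteq> 0 \<and> \<bar>h\<bar> < r \<and> \<bar>h'\<bar> < r \<and> \<bar>h\<bar> < \<delta> \<and> \<bar>h'\<bar> < \<delta>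
      \<longrightarrow> (\<integral>w. (Q h t w - Q h' t w)\<^sup>2 \<partial>M) \<le> \<epsilon>)" for \<epsilon> \<delta> :: real
  have "\<forall>\<epsilon>\<in>{0<..}. \<exists>\<delta>. 0 < \<delta> \<and> close \<epsilon> \<delta>"
  proof
    fix \<epsilon> :: real assume "\<epsilon> \<in> {0<..}"
    then have \<epsilon>: "0 < \<epsilon> / 4" by simp
    obtain \<delta> where \<delta>0: "0 < \<delta>" "\<forall>x\<in>S. \<forall>y\<in>S. \<forall>x'\<in>S. \<forall>y'\<in>S. dist x x' < \<delta> \<and> dist y y' < \<delta> \<longrightarrow> \<bar>H x y - H x' y'\<bar> < \<epsilon> / 4"
      using uniformly_continuous_diagonal[OF uc \<epsilon>] by (elim exE conjE)
    note \<delta> = \<delta>0(1) \<delta>0(2)[rule_format, OF _ _ _ _ conjI]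
    show "\<exists>\<delta>. 0 < \<delta> \<and> close \<epsilon> \<delta>"
      unfolding close_def
    proof (intro exI[of _ \<delta>] conjI allI impI \<delta>(1), elim conjE)
      fix t r h h' assume a: "ball t r \<subseteq> S" "h \<noteq> 0" "h' \<noteq> 0" "\<bar>h\<bar> < r" "\<bar>h'\<bar> < r" "\<bar>h\<bar> < \<delta>" "\<bar>h'\<bar> < \<delta>"
      have tS: "t \<in> S" using inS[OF a(1), of 0] a(4) by simp
      have near: "\<bar>(\<integral>w. Q k t w * Q k' t w \<partial>M) - H t t\<bar> < \<epsilon> / 4"
        if k: "k \<noteq> 0" "k' \<noteq> 0" "\<bar>k\<bar> < r" "\<bar>k'\<bar> < r" "\<bar>k\<bar> < \<delta>" "\<bar>k'\<bar> < \<delta>" for k k'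
      proof -
        obtain s s' where s: "\<bar>s\<bar> \<le> \<bar>k\<bar>" "\<bar>s'\<bar> \<le> \<bar>k'\<bar>" "(\<integral>w. Q k t w * Q k' t w \<partial>M) = H (t + s *\<^sub>R e) (t + s' *\<^sub>R e)"
          using Q_inner[OF a(1) k(1-4)] by (elim exE conjE)
        have i: "t + s *\<^sub>R e \<in> S" "t + s' *\<^sub>R e \<in> S"
          using s(1,2) k(3,4) by (intro inS[OF a(1)]; linarith)+
        have "dist (t + s *\<^sub>R e) t < \<delta>" "dist (t + s' *\<^sub>R e) t < \<delta>"
          using s(1,2) k(5,6) e1 by (simp_all add: dist_norm)
        then show ?thesis unfolding s(3) by (rule \<delta>(2)[OF i tS tS])
      qed
      \<comment> \<open>Each of the three inner products is within \<open>\<epsilon> / 4\<close> of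
        \<open>H t t\<close>. With the weights 1, -2, 1 the main terms cancel and the errors add up
        to at most \<open>\<epsilon>\<close>.\<close>
      have "(\<integral>w. (Q h t w - Q h' t w)\<^sup>2 \<partial>M)
          = (\<integral>w. Q h t w * Q h t w \<partial>M) - 2 * (\<integral>w. Q h t w * Q h' t w \<partial>M) + (\<integral>w. Q h' t w * Q h' t w \<partial>M)"
        using L2_inner_diff_square[OF sqQ[OF tS inS[OF a(1,4)]] sqQ[OF tS inS[OF a(1,5)]]]
        by (simp add: power2_eq_square)
      then show "(\<integral>w. (Q h t w - Q h' t w)\<^sup>2 \<partial>M) \<le> \<epsilon>"
        using near[OF a(2,2,4,4,6,6)] near[OF a(2,3,4,5,6,7)] near[OF a(3,3,5,5,7,7)]
        unfolding abs_less_iff by linarith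
    qed
  qed
  from bchoice[OF this] obtain \<delta> where \<delta>0: "\<forall>\<epsilon>\<in>{0<..}. 0 < \<delta> \<epsilon> \<and> close \<epsilon> (\<delta> \<epsilon>)" by (elim exE)
  have \<delta>: "0 < \<delta> \<epsilon>" if "0 < \<epsilon>" for \<epsilon> using \<delta>0 that by simp
  have \<delta>close: "(\<integral>w. (Q h t w - Q h' t w)\<^sup>2 \<partial>M) \<le> \<epsilon>"
    if "0 < \<epsilon>" "ball t r \<subseteq> S" "h \<noteq> 0" "h' \<noteq> 0" "\<bar>h\<bar> < r" "\<bar>h'\<bar> < r" "\<bar>h\<bar> < \<delta> \<epsilon>" "\<bar>h'\<bar> < \<delta> \<epsilon>" for \<epsilon> t r h h'
  proof -
    have c: "close \<epsilon> (\<delta> \<epsilon>)" using \<delta>0 that(1) by simp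
    show ?thesis by (rule c[unfolded close_def, rule_format, of t r]) (intro conjI that)
  qed
  \<comment> \<open>Staying below \<open>\<delta> ((1/4) ^ j)\<close> for all
    \<open>j \<le> n\<close> puts both \<open>\<eta> n\<close> and \<open>\<eta> (Suc n)\<close>
    below \<open>\<delta> ((1/4) ^ n)\<close>, as \<open>L2_fast_Cauchy\<close> requires; the first
    entry forces convergence to zero, and halving makes the inequalities strict.\<close>
  define \<eta> where "\<eta> n = Min (insert (1 / real (Suc n)) ((\<lambda>j. \<delta> ((1/4) ^ j)) ` {..n})) / 2" for n
  have \<eta>0: "0 < \<eta> n" for n
    using \<delta> unfolding \<eta>_def by (subst half_gt_zero_iff, subst Min_gr_iff) auto
  have \<eta>\<delta>: "\<eta> n < \<delta> ((1/4) ^ j)" if "j \<le> n" for n j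
  proof -
    have "Min (insert (1 / real (Suc n)) ((\<lambda>j. \<delta> ((1/4) ^ j)) ` {..n})) \<le> \<delta> ((1/4) ^ j)"
      using that by (intro Min_le) auto
    then show ?thesis using \<delta>[of "(1/4) ^ j"] unfolding \<eta>_def by simp
  qed
  have \<eta>n: "\<eta> n < 1 / real (Suc n)" for n
  proof -
    have "Min (insert (1 / real (Suc n)) ((\<lambda>j. \<delta> ((1/4) ^ j)) ` {..n})) \<le> 1 / real (Suc n)"
      by (intro Min_le) auto
    moreover have "0 < 1 / real (Suc n)" by simp
    ultimately show ?thesis unfolding \<eta>_def by linarith
  qed
  have \<eta>lim: "\<eta> \<longlonglongrightarrow> 0"
  proof (rule Lim_null_comparison[OF _ LIMSEQ_Suc[OF lim_1_over_n]], intro always_eventually allI)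
    show "norm (\<eta> n) \<le> 1 / real (Suc n)" for n using \<eta>n[of n] \<eta>0[of n] by simp
  qed
  \<comment> \<open>Near the boundary the shifted point may leave \<open>S\<close>; the quotient
    \<open>q\<close> is then \<open>0\<close>. For a fixed \<open>t\<close> this ends as soon as
    \<open>\<eta> n\<close> is below the radius of a ball around \<open>t\<close> in
    \<open>S\<close>, and the case distinction keeps \<open>q\<close> jointly measurable.\<close>
  define \<tau> where "\<tau> n t = (if t + \<eta> n *\<^sub>R e \<in> S then t + \<eta> n *\<^sub>R e else t)" for n t
  define q where "q n t w = (Z (\<tau> n t) w - Z t w) / \<eta> n" for n t w
  define D where "D t w = lim (\<lambda>n. q n t w)" for t w
  have \<tau>S: "\<tau> n t \<in> S" if "t \<in> S" for n t using that by (simp add: \<tau>_def)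
  have sqq: "sq_integrable M (q n t)" if "t \<in> S" for n t
    unfolding q_def by (intro sq_integrable_divide sq_integrable_diff sq \<tau>S that)
  have far: "\<exists>n0. \<forall>n\<ge>n0. \<eta> n < r" if "0 < r" for r
    using order_tendstoD(2)[OF \<eta>lim that] by (simp add: eventually_sequentially)
  have qQ: "q n t = Q (\<eta> n) t" if "ball t r \<subseteq> S" "\<eta> n < r" for n t r
  proof -
    have "t + \<eta> n *\<^sub>R e \<in> S" using that \<eta>0[of n] by (intro inS) auto
    then show ?thesis by (simp add: q_def Q_def \<tau>_def fun_eq_iff)
  qed
  have conv: "sq_integrable M (D t) \<and> (\<lambda>n. \<integral>w. (q n t w - D t w)\<^sup>2 \<partial>M) \<longlonglongrightarrow> 0" if t: "t \<in> S" for t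
  proof -
    obtain r where r: "0 < r" "ball t r \<subseteq> S" using S t open_contains_ball by blast
    obtain n0 where n0: "\<And>n. n0 \<le> n \<Longrightarrow> \<eta> n < r" using far[OF r(1)] by blast
    have fast: "(\<integral>w. (q (Suc n) t w - q n t w)\<^sup>2 \<partial>M) \<le> (1/4) ^ n" if n: "n0 \<le> n" for n
    proof -
      have a: "\<eta> (Suc n) \<noteq> 0" "\<eta> n \<noteq> 0" "\<bar>\<eta> (Suc n)\<bar> < r" "\<bar>\<eta> n\<bar> < r"
        "\<bar>\<eta> (Suc n)\<bar> < \<delta> ((1/4) ^ n)" "\<bar>\<eta> n\<bar> < \<delta> ((1/4) ^ n)"
        using \<eta>0[of "Suc n"] \<eta>0[of n] n0[of "Suc n"] n0[of n] n \<eta>\<delta>[of n n] \<eta>\<delta>[of n "Suc n"] by simp_all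
      show ?thesis
        unfolding qQ[OF r(2) n0[OF n]] qQ[OF r(2) n0[OF le_SucI[OF n]]]
        by (rule \<delta>close[OF _ r(2) a]) simp
    qed
    show ?thesis
      using L2_fast_Cauchy[of "\<lambda>n. q n t" n0, OF sqq[OF t] fast] unfolding D_def by blast
  qed
  have Dm: "measurable_field S M D"
  proof -
    have Zm': "(\<lambda>(t, w). Z t w) \<in> borel_measurable (restrict_space borel S \<Otimes>\<^sub>M M)"
      using Zm by (simp add: measurable_field_def)
    have \<tau>m: "\<tau> n \<in> restrict_space borel S \<rightarrow>\<^sub>M restrict_space borel S" for n
    proof (rule measurable_restrict_space2)
      show "\<tau> n \<in> space (restrict_space borel S) \<rightarrow> S" using \<tau>S by (auto simp: space_restrict_space)
      have "{t. t + \<eta> n *\<^sub>R e \<in> S} \<in> sets borel"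
      proof -
        have "{t. t + \<eta> n *\<^sub>R e \<in> S} = (\<lambda>t. t + \<eta> n *\<^sub>R e) -` S" by auto
        then show ?thesis using S by (auto intro!: borel_open open_vimage continuous_intros)
      qed
      then have "\<tau> n \<in> borel_measurable borel"
        unfolding \<tau>_def by (intro measurable_If) simp_all
      then show "\<tau> n \<in> restrict_space borel S \<rightarrow>\<^sub>M borel" by (rule measurable_restrict_space1)
    qed
    have "(\<lambda>p. q n (fst p) (snd p)) \<in> borel_measurable (restrict_space borel S \<Otimes>\<^sub>M M)" for n
    proof -
      have "(\<lambda>p. (\<tau> n (fst p), snd p)) \<in> restrict_space borel S \<Otimes>\<^sub>M M \<rightarrow>\<^sub>M restrict_space borel S \<Otimes>\<^sub>M M"
        by (intro measurable_Pair measurable_compose[OF measurable_fst \<tau>m] measurable_snd)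
      from measurable_compose[OF this Zm']
      have "(\<lambda>p. Z (\<tau> n (fst p)) (snd p)) \<in> borel_measurable (restrict_space borel S \<Otimes>\<^sub>M M)" by simp
      then show ?thesis
        using Zm' unfolding q_def by (intro borel_measurable_divide borel_measurable_diff) (simp_all add: case_prod_beta')
    qed
    then have "(\<lambda>p. D (fst p) (snd p)) \<in> borel_measurable (restrict_space borel S \<Otimes>\<^sub>M M)"
      unfolding D_def by (rule borel_measurable_lim_metric)
    then show ?thesis by (simp add: measurable_field_def case_prod_beta')
  qed
  \<comment> \<open>Convergence is known along \<open>\<eta>\<close> only; comparison with one late
    quotient \<open>q n t\<close> extends it to all small \<open>h\<close>.
    \<open>square_sum_bound\<close> doubles both errors, hence the quarters.\<close>
  have QD: "\<exists>\<rho>>0. \<forall>h. h \<noteq> 0 \<and> \<bar>h\<bar> < \<rho> \<longrightarrow> t + h *\<^sub>R e \<in> S \<and> (\<integral>w. (Q h t w - D t w)\<^sup>2 \<partial>M) \<le> \<epsilon>"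
    if t: "t \<in> S" and \<epsilon>: "0 < \<epsilon>" for t \<epsilon>
  proof -
    obtain r where r: "0 < r" "ball t r \<subseteq> S" using S t open_contains_ball by blast
    have \<epsilon>4: "0 < \<epsilon> / 4" using \<epsilon> by simp
    have "\<forall>\<^sub>F n in sequentially. (\<integral>w. (q n t w - D t w)\<^sup>2 \<partial>M) < \<epsilon> / 4"
      by (rule order_tendstoD(2)[OF conjunct2[OF conv[OF t]] \<epsilon>4])
    moreover have "\<forall>\<^sub>F n in sequentially. \<eta> n < min r (\<delta> (\<epsilon> / 4))"
      using order_tendstoD(2)[OF \<eta>lim, of "min r (\<delta> (\<epsilon> / 4))"] r(1) \<delta>[OF \<epsilon>4] by simp
    ultimately have "\<forall>\<^sub>F n in sequentially. (\<integral>w. (q n t w - D t w)\<^sup>2 \<partial>M) < \<epsilon> / 4 \<and> \<eta> n < min r (\<delta> (\<epsilon> / 4))"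
      by (rule eventually_conj)
    then obtain n where n: "(\<integral>w. (q n t w - D t w)\<^sup>2 \<partial>M) < \<epsilon> / 4" "\<eta> n < r" "\<eta> n < \<delta> (\<epsilon> / 4)"
      unfolding eventually_sequentially by auto
    show ?thesis
    proof (intro exI[of _ "min r (\<delta> (\<epsilon> / 4))"] conjI allI impI; (elim conjE)?)
      show "0 < min r (\<delta> (\<epsilon> / 4))" using r(1) \<delta>[OF \<epsilon>4] by simp
      fix h assume h: "h \<noteq> 0" "\<bar>h\<bar> < min r (\<delta> (\<epsilon> / 4))"
      show hS: "t + h *\<^sub>R e \<in> S" using h(2) by (intro inS[OF r(2)]) simp
      have s1: "sq_integrable M (\<lambda>w. Q h t w - q n t w)"
        by (intro sq_integrable_diff sqQ sqq t hS)
      have s2: "sq_integrable M (\<lambda>w. q n t w - D t w)"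
        by (intro sq_integrable_diff sqq t conjunct1[OF conv[OF t]])
      have "(\<integral>w. (Q h t w - D t w)\<^sup>2 \<partial>M) = (\<integral>w. ((Q h t w - q n t w) + (q n t w - D t w))\<^sup>2 \<partial>M)" by simp
      also have "\<dots> \<le> 2 * (\<integral>w. (Q h t w - q n t w)\<^sup>2 \<partial>M) + 2 * (\<integral>w. (q n t w - D t w)\<^sup>2 \<partial>M)"
        by (rule square_sum_bound[OF s1 s2])
      also have "(\<integral>w. (Q h t w - q n t w)\<^sup>2 \<partial>M) \<le> \<epsilon> / 4"
        unfolding qQ[OF r(2) n(2)] using h n(2,3) \<eta>0[of n] by (intro \<delta>close[OF \<epsilon>4 r(2)]) simp_all
      finally show "(\<integral>w. (Q h t w - D t w)\<^sup>2 \<partial>M) \<le> \<epsilon>" using n(1) by simp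
    qed
  qed
  have deriv: "((\<lambda>h. \<integral>w. Y w * Z (t + h *\<^sub>R e) w \<partial>M) has_real_derivative (\<integral>w. Y w * D t w \<partial>M)) (at 0)"
    if Y: "sq_integrable M Y" and t: "t \<in> S" for Y t
    unfolding DERIV_def
  proof (rule LIM_I)
    fix \<epsilon> :: real assume \<epsilon>: "0 < \<epsilon>"
    define L where "L = L2_norm_on M Y + 1"
    have L: "0 < L" by (simp add: L_def add_nonneg_pos)
    \<comment> \<open>\<open>L\<close> exceeds the norm of \<open>Y\<close>, so a norm of at most
      \<open>\<epsilon> / (2 * L)\<close> leaves half of \<open>\<epsilon>\<close>; it is squared
      because \<open>QD\<close> bounds squared norms.\<close>
    define \<epsilon>' where "\<epsilon>' = (\<epsilon> / (2 * L))\<^sup>2"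
    have \<epsilon>': "0 < \<epsilon>'" using \<epsilon> L by (simp add: \<epsilon>'_def)
    obtain \<rho> where \<rho>: "0 < \<rho>" "\<And>h. h \<noteq> 0 \<Longrightarrow> \<bar>h\<bar> < \<rho> \<Longrightarrow> t + h *\<^sub>R e \<in> S"
      "\<And>h. h \<noteq> 0 \<Longrightarrow> \<bar>h\<bar> < \<rho> \<Longrightarrow> (\<integral>w. (Q h t w - D t w)\<^sup>2 \<partial>M) \<le> \<epsilon>'"
      using QD[OF t \<epsilon>'] by blast
    show "\<exists>s>0. \<forall>x. x \<noteq> 0 \<and> norm (x - 0) < s \<longrightarrow>
        norm (((\<integral>w. Y w * Z (t + (0 + x) *\<^sub>R e) w \<partial>M) - (\<integral>w. Y w * Z (t + 0 *\<^sub>R e) w \<partial>M)) / x - (\<integral>w. Y w * D t w \<partial>M)) < \<epsilon>"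
    proof (intro exI[of _ \<rho>] conjI allI impI \<rho>(1), elim conjE)
      fix h :: real assume h: "h \<noteq> 0" "norm (h - 0) < \<rho>"
      have hS: "t + h *\<^sub>R e \<in> S" using \<rho>(2) h by simp
      have i: "integrable M (\<lambda>w. Y w * Z (t + h *\<^sub>R e) w)" "integrable M (\<lambda>w. Y w * Z t w)" "integrable M (\<lambda>w. Y w * D t w)"
        by (intro sq_integrable_mult Y sq hS t conjunct1[OF conv[OF t]])+
      have "((\<integral>w. Y w * Z (t + h *\<^sub>R e) w \<partial>M) - (\<integral>w. Y w * Z t w \<partial>M)) / h - (\<integral>w. Y w * D t w \<partial>M)
          = (\<integral>w. (Y w * Z (t + h *\<^sub>R e) w - Y w * Z t w) / h - Y w * D t w \<partial>M)"
        using i by simp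
      also have "\<dots> = (\<integral>w. Y w * (Q h t w - D t w) \<partial>M)"
        by (intro Bochner_Integration.integral_cong refl) (simp add: Q_def right_diff_distrib)
      finally have eq: "((\<integral>w. Y w * Z (t + h *\<^sub>R e) w \<partial>M) - (\<integral>w. Y w * Z t w \<partial>M)) / h - (\<integral>w. Y w * D t w \<partial>M)
          = (\<integral>w. Y w * (Q h t w - D t w) \<partial>M)" .
      have s: "sq_integrable M (\<lambda>w. Q h t w - D t w)"
        by (intro sq_integrable_diff sqQ t hS conjunct1[OF conv[OF t]])
      have "L2_norm_on M (\<lambda>w. Q h t w - D t w) \<le> sqrt \<epsilon>'"
        unfolding L2_norm_on_def using \<rho>(3)[OF h(1)] h(2) by (intro real_sqrt_le_mono) simp
      also have "sqrt \<epsilon>' = \<epsilon> / (2 * L)" using \<epsilon> L by (simp add: \<epsilon>'_def)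
      finally have n: "L2_norm_on M (\<lambda>w. Q h t w - D t w) \<le> \<epsilon> / (2 * L)" .
      have "\<bar>\<integral>w. Y w * (Q h t w - D t w) \<partial>M\<bar> \<le> L2_norm_on M Y * L2_norm_on M (\<lambda>w. Q h t w - D t w)"
        by (rule L2_Cauchy_Schwarz_norm[OF Y s])
      also have "\<dots> \<le> L * (\<epsilon> / (2 * L))"
        using L n by (intro mult_mono) (simp_all add: L_def)
      also have "\<dots> < \<epsilon>" using L \<epsilon> by simp
      finally show "norm (((\<integral>w. Y w * Z (t + (0 + h) *\<^sub>R e) w \<partial>M) - (\<integral>w. Y w * Z (t + 0 *\<^sub>R e) w \<partial>M)) / h - (\<integral>w. Y w * D t w \<partial>M)) < \<epsilon>"
        using eq by simp
    qed
  qed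
  show ?thesis
  proof (intro exI[of _ D] conjI ballI allI impI)
    show "measurable_field S M D" by (rule Dm)
    show "sq_integrable M (D t)" if "t \<in> S" for t using conv[OF that] by (rule conjunct1)
    fix Y t assume "sq_integrable M Y \<and> t \<in> S"
    then show "((\<lambda>h. \<integral>w. Y w * Z (t + h *\<^sub>R axis i 1) w \<partial>M) has_real_derivative (\<integral>w. Y w * D t w \<partial>M)) (at 0)"
      using deriv[unfolded e_def] by (elim conjE)
  qed
qed

section \<open>Derivative fields of a random field with smooth covariance\<close>

locale ck_field = prob_space M for M :: "'w measure" +
  fixes \<Theta> :: "(real ^ 'n::finite) set" and X :: "real ^ 'n \<Rightarrow> 'w \<Rightarrow> real" and k :: nat
  assumes open_Theta: "open \<Theta>" and bounded_Theta: "bounded \<Theta>"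
    and X_measurable: "measurable_field \<Theta> M X" and X_second: "second_order \<Theta> M X" and X_centred: "centred \<Theta> M X"
    and cov_Ckk: "Ckk_unif \<Theta> k (cov_kernel M X)"
begin

abbreviation "cov \<equiv> cov_kernel M X"

abbreviation "dcov \<alpha> \<beta> \<equiv> mixed_deriv \<alpha> \<beta> cov"

lemma sq_X: "t \<in> \<Theta> \<Longrightarrow> sq_integrable M (X t)"
proof -
  assume t: "t \<in> \<Theta>"
  have "integrable M (X t)" "integrable M (\<lambda>\<omega>. (X t \<omega> - (LINT \<omega>'|M. X t \<omega>'))\<^sup>2)"
    using X_second t by (simp_all add: second_order_def)
  moreover have "(LINT \<omega>'|M. X t \<omega>') = 0" using X_centred t by (simp add: centred_def)
  ultimately show ?thesis by (simp add: sq_integrable_def)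
qed

lemma cov_eq: "s \<in> \<Theta> \<Longrightarrow> t \<in> \<Theta> \<Longrightarrow> cov s t = (\<integral>w. X s w * X t w \<partial>M)"
  using X_centred by (simp add: cov_kernel_def centred_def)

lemma dcov_deriv1:
  assumes "mi_order \<alpha> < k" "mi_order \<beta> \<le> k" "x \<in> \<Theta>" "y \<in> \<Theta>"
  shows "((\<lambda>s. dcov \<alpha> \<beta> (x + s *\<^sub>R axis i 1) y) has_real_derivative dcov (mi_inc i \<alpha>) \<beta> x y) (at 0)"
  using conjunct1[OF cov_Ckk[unfolded Ckk_unif_def], rule_format, OF conjI[OF assms(1,2)] assms(3,4)] .

lemma dcov_deriv2:
  assumes "mi_order \<alpha> \<le> k" "mi_order \<beta> < k" "x \<in> \<Theta>" "y \<in> \<Theta>"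
  shows "((\<lambda>s. dcov \<alpha> \<beta> x (y + s *\<^sub>R axis i 1)) has_real_derivative dcov \<alpha> (mi_inc i \<beta>) x y) (at 0)"
  using conjunct1[OF conjunct2[OF cov_Ckk[unfolded Ckk_unif_def]], rule_format, OF conjI[OF assms(1,2)] assms(3,4)] .

lemma dcov_uniformly_continuous:
  assumes "mi_order \<alpha> \<le> k" "mi_order \<beta> \<le> k"
  shows "uniformly_continuous_on (\<Theta> \<times> \<Theta>) (\<lambda>(x, y). dcov \<alpha> \<beta> x y)"
  using conjunct2[OF conjunct2[OF cov_Ckk[unfolded Ckk_unif_def]], rule_format, OF conjI[OF assms]] .

text \<open>Characterises the mean-square derivative weakly, by testing with every square-integrable
  \<open>Y\<close>. This reduces calculus with values in \<open>L\<^sup>2\<close> to classical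
  derivatives of real functions, and it determines \<open>Z t\<close> up to almost sure
  equality.\<close>

definition is_der :: "'n multi_index \<Rightarrow> (real ^ 'n \<Rightarrow> 'w \<Rightarrow> real) \<Rightarrow> bool" where
  "is_der \<alpha> Z \<longleftrightarrow> measurable_field \<Theta> M Z \<and> (\<forall>t\<in>\<Theta>. sq_integrable M (Z t)) \<and>
    (\<forall>Y t. sq_integrable M Y \<and> t \<in> \<Theta> \<longrightarrow> (\<integral>w. Y w * Z t w \<partial>M) = cderiv \<alpha> (\<lambda>s. \<integral>w. Y w * X s w \<partial>M) t)"

lemma is_derD:
  assumes "is_der \<alpha> Z"
  shows "measurable_field \<Theta> M Z" "t \<in> \<Theta> \<Longrightarrow> sq_integrable M (Z t)"
    "sq_integrable M Y \<Longrightarrow> t \<in> \<Theta> \<Longrightarrow> (\<integral>w. Y w * Z t w \<partial>M) = cderiv \<alpha> (\<lambda>s. \<integral>w. Y w * X s w \<partial>M) t"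
proof -
  note d = assms[unfolded is_der_def]
  show "measurable_field \<Theta> M Z" by (rule conjunct1[OF d])
  show "t \<in> \<Theta> \<Longrightarrow> sq_integrable M (Z t)" by (rule conjunct1[OF conjunct2[OF d], rule_format])
  show "(\<integral>w. Y w * Z t w \<partial>M) = cderiv \<alpha> (\<lambda>s. \<integral>w. Y w * X s w \<partial>M) t" if "sq_integrable M Y" "t \<in> \<Theta>"
    by (rule conjunct2[OF conjunct2[OF d], rule_format, OF conjI[OF that]])
qed

lemma is_der_X: "is_der mi_zero X"
  by (simp add: is_der_def X_measurable sq_X)

text \<open>Test twice: first with \<open>W t\<close>, which leaves covariances of
  \<open>W t\<close> with \<open>X\<close>, then with \<open>X s'\<close>. The order of the two
  differentiations is the one in \<open>mixed_deriv\<close>.\<close>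

lemma is_der_inner:
  assumes Z: "is_der \<alpha> Z" and W: "is_der \<beta> W" and s: "s \<in> \<Theta>" and t: "t \<in> \<Theta>"
  shows "(\<integral>w. Z s w * W t w \<partial>M) = dcov \<alpha> \<beta> s t"
proof -
  have inner: "(\<integral>w. W t w * X s' w \<partial>M) = cderiv \<beta> (cov s') t" if "s' \<in> \<Theta>" for s'
  proof -
    have "(\<integral>w. W t w * X s' w \<partial>M) = (\<integral>w. X s' w * W t w \<partial>M)" by (simp only: mult.commute)
    also have "\<dots> = cderiv \<beta> (\<lambda>t'. \<integral>w. X s' w * X t' w \<partial>M) t" by (rule is_derD(3)[OF W sq_X[OF that] t])
    also have "\<dots> = cderiv \<beta> (cov s') t"
      by (rule cderiv_cong[OF open_Theta _ t]) (rule cov_eq[OF that, symmetric])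
    finally show ?thesis .
  qed
  have "(\<integral>w. Z s w * W t w \<partial>M) = (\<integral>w. W t w * Z s w \<partial>M)" by (simp only: mult.commute)
  also have "\<dots> = cderiv \<alpha> (\<lambda>s'. \<integral>w. W t w * X s' w \<partial>M) s" by (rule is_derD(3)[OF Z is_derD(2)[OF W t] s])
  also have "\<dots> = cderiv \<alpha> (\<lambda>s'. cderiv \<beta> (cov s') t) s"
    by (rule cderiv_cong[OF open_Theta _ s]) (rule inner)
  finally show ?thesis by (simp only: mixed_deriv_def)
qed

lemma is_der_step:
  assumes Z: "is_der \<alpha> Z" and \<alpha>: "mi_order \<alpha> < k"
  shows "\<exists>D. measurable_field \<Theta> M D \<and> (\<forall>t\<in>\<Theta>. sq_integrable M (D t)) \<and>
    (\<forall>Y t. sq_integrable M Y \<and> t \<in> \<Theta> \<longrightarrow>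
      ((\<lambda>h. \<integral>w. Y w * Z (t + h *\<^sub>R axis i 1) w \<partial>M) has_real_derivative (\<integral>w. Y w * D t w \<partial>M)) (at 0))"
proof -
  have le: "mi_order \<alpha> \<le> k" "mi_order (mi_inc i \<alpha>) \<le> k" using \<alpha> by simp_all
  show ?thesis
    by (rule L2_derivative_exists[OF open_Theta is_derD(1)[OF Z] is_derD(2)[OF Z] is_der_inner[OF Z Z]
        dcov_deriv1[OF \<alpha> le(1)] dcov_deriv2[OF le(2) \<alpha>] dcov_uniformly_continuous[OF le(2,2)]])
qed

lemma is_der_exists: "mi_order \<alpha> \<le> k \<Longrightarrow> \<exists>Z. is_der \<alpha> Z"
proof (induction \<alpha> rule: mi_induct)
  case zero
  show ?case by (rule exI[of _ X], rule is_der_X)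
next
  case (inc i \<alpha>)
  have \<alpha>: "mi_order \<alpha> < k" using inc.prems by simp
  then obtain Z where Z: "is_der \<alpha> Z" using inc by auto
  obtain D where D: "measurable_field \<Theta> M D" "\<forall>t\<in>\<Theta>. sq_integrable M (D t)"
    "\<forall>Y t. sq_integrable M Y \<and> t \<in> \<Theta> \<longrightarrow>
      ((\<lambda>h. \<integral>w. Y w * Z (t + h *\<^sub>R axis i 1) w \<partial>M) has_real_derivative (\<integral>w. Y w * D t w \<partial>M)) (at 0)"
    using is_der_step[OF Z \<alpha>, of i] by (elim exE conjE)
  have "is_der (mi_inc i \<alpha>) D"
    unfolding is_der_def
  proof (intro conjI D(1,2) allI impI, elim conjE)
    fix Y t assume Y: "sq_integrable M Y" and t: "t \<in> \<Theta>"
    have "(\<integral>w. Y w * D t w \<partial>M) = partial_deriv i (\<lambda>s. \<integral>w. Y w * Z s w \<partial>M) t"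
      by (rule partial_derivI[symmetric, OF D(3)[rule_format, OF conjI[OF Y t]]])
    also have "\<dots> = partial_deriv i (cderiv \<alpha> (\<lambda>s. \<integral>w. Y w * X s w \<partial>M)) t"
      by (rule partial_deriv_cong[OF open_Theta is_derD(3)[OF Z Y] t])
    finally show "(\<integral>w. Y w * D t w \<partial>M) = cderiv (mi_inc i \<alpha>) (\<lambda>s. \<integral>w. Y w * X s w \<partial>M) t"
      unfolding inc.hyps .
  qed
  then show ?case by (rule exI[of _ D])
qed

text \<open>Induction on multi-indices builds a derivative field only along the direction that
  \<open>cderiv\<close> takes last, whereas here \<open>i\<close> is arbitrary. The field
  \<open>W\<close> and the derivative \<open>D\<close> of \<open>Z\<close> in direction
  \<open>i\<close> are compared in mean square: their inner products with themselves and each other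
  all equal the same mixed derivative, so their difference is zero.\<close>

lemma is_der_deriv:
  assumes Z: "is_der \<alpha> Z" and W: "is_der (mi_inc i \<alpha>) W" and \<alpha>: "mi_order \<alpha> < k"
    and Y: "sq_integrable M Y" and t: "t \<in> \<Theta>"
  shows "((\<lambda>h. \<integral>w. Y w * Z (t + h *\<^sub>R axis i 1) w \<partial>M) has_real_derivative (\<integral>w. Y w * W t w \<partial>M)) (at 0)"
proof -
  have le: "mi_order \<alpha> \<le> k" "mi_order (mi_inc i \<alpha>) \<le> k" using \<alpha> by simp_all
  obtain D where D: "measurable_field \<Theta> M D" "\<forall>t\<in>\<Theta>. sq_integrable M (D t)"
    "\<forall>Y t. sq_integrable M Y \<and> t \<in> \<Theta> \<longrightarrow>
      ((\<lambda>h. \<integral>w. Y w * Z (t + h *\<^sub>R axis i 1) w \<partial>M) has_real_derivative (\<integral>w. Y w * D t w \<partial>M)) (at 0)"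
    using is_der_step[OF Z \<alpha>, of i] by (elim exE conjE)
  note Dd = D(3)[rule_format, OF conjI]
  have sqD: "sq_integrable M (D t)" using D(2) t by (rule bspec)
  have sqW: "sq_integrable M (W t)" by (rule is_derD(2)[OF W t])
  \<comment> \<open>The inner product of \<open>V\<close> with \<open>D t\<close> is the derivative
    of that of \<open>V\<close> with \<open>Z\<close>, and the hypothesis on \<open>V\<close>
    identifies this function. It is used for \<open>W t\<close> and for \<open>D t\<close>
    itself.\<close>
  have limD: "(\<integral>w. V w * D t w \<partial>M) = dcov (mi_inc i \<alpha>) (mi_inc i \<alpha>) t t"
    if V: "sq_integrable M V" and VZ: "\<And>s. s \<in> \<Theta> \<Longrightarrow> (\<integral>w. V w * Z s w \<partial>M) = dcov \<alpha> (mi_inc i \<alpha>) s t" for V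
  proof (rule DERIV_unique[OF Dd[OF V t]])
    show "((\<lambda>h. \<integral>w. V w * Z (t + h *\<^sub>R axis i 1) w \<partial>M) has_real_derivative dcov (mi_inc i \<alpha>) (mi_inc i \<alpha>) t t) (at 0)"
      by (rule iffD2[OF partial_has_derivative_cong[OF open_Theta VZ t] dcov_deriv1[OF \<alpha> le(2) t t]])
  qed
  have WD: "(\<integral>w. W t w * D t w \<partial>M) = dcov (mi_inc i \<alpha>) (mi_inc i \<alpha>) t t"
  proof (rule limD[OF sqW])
    fix s assume s: "s \<in> \<Theta>"
    show "(\<integral>w. W t w * Z s w \<partial>M) = dcov \<alpha> (mi_inc i \<alpha>) s t"
      using is_der_inner[OF Z W s t] by (simp only: mult.commute)
  qed
  have DD: "(\<integral>w. D t w * D t w \<partial>M) = dcov (mi_inc i \<alpha>) (mi_inc i \<alpha>) t t"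
  proof (rule limD[OF sqD])
    fix s assume s: "s \<in> \<Theta>"
    have "(\<integral>w. Z s w * D t w \<partial>M) = dcov \<alpha> (mi_inc i \<alpha>) s t"
    proof (rule DERIV_unique[OF Dd[OF is_derD(2)[OF Z s] t]])
      show "((\<lambda>h. \<integral>w. Z s w * Z (t + h *\<^sub>R axis i 1) w \<partial>M) has_real_derivative dcov \<alpha> (mi_inc i \<alpha>) s t) (at 0)"
        by (rule iffD2[OF partial_has_derivative_cong[OF open_Theta is_der_inner[OF Z Z s] t] dcov_deriv2[OF le(1) \<alpha> s t]])
    qed
    then show "(\<integral>w. D t w * Z s w \<partial>M) = dcov \<alpha> (mi_inc i \<alpha>) s t" by (simp only: mult.commute)
  qed
  have WW: "(\<integral>w. W t w * W t w \<partial>M) = dcov (mi_inc i \<alpha>) (mi_inc i \<alpha>) t t"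
    by (rule is_der_inner[OF W W t t])
  have "(\<integral>w. (W t w - D t w)\<^sup>2 \<partial>M) = 0"
    using L2_inner_diff_square[OF sqW sqD] WW DD WD by (simp add: power2_eq_square)
  then have ae: "AE w in M. W t w - D t w = 0"
    by (rule iffD1[OF square_integral_zero_AE[OF sq_integrable_diff[OF sqW sqD]]])
  have "(\<integral>w. Y w * W t w \<partial>M) = (\<integral>w. Y w * D t w \<partial>M)"
  proof (rule integral_cong_AE)
    show "(\<lambda>w. Y w * W t w) \<in> borel_measurable M" by (rule borel_measurable_integrable[OF sq_integrable_mult[OF Y sqW]])
    show "(\<lambda>w. Y w * D t w) \<in> borel_measurable M" by (rule borel_measurable_integrable[OF sq_integrable_mult[OF Y sqD]])
    show "AE w in M. Y w * W t w = Y w * D t w" using ae by eventually_elim simp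
  qed
  then show ?thesis using Dd[OF Y t] by simp
qed

text \<open>Two choices agree almost surely at each point of the domain, but for order zero it has
  to be \<open>X\<close> itself, since the paths in the theorem are those of
  \<open>X\<close>.\<close>

definition der :: "'n multi_index \<Rightarrow> real ^ 'n \<Rightarrow> 'w \<Rightarrow> real" where
  "der \<alpha> = (if \<alpha> = mi_zero then X else (SOME Z. is_der \<alpha> Z))"

lemma der_zero [simp]: "der mi_zero = X"
  by (simp add: der_def)

lemma is_der_der: "mi_order \<alpha> \<le> k \<Longrightarrow> is_der \<alpha> (der \<alpha>)"
  unfolding der_def using is_der_X someI_ex[OF is_der_exists, of \<alpha>] by simp

lemmas der_measurable = is_derD(1)[OF is_der_der]
lemmas sq_der = is_derD(2)[OF is_der_der]
lemmas der_cross = is_derD(3)[OF is_der_der]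
lemmas der_inner = is_der_inner[OF is_der_der is_der_der]

lemma der_diff_square:
  assumes "mi_order \<alpha> \<le> k" "s \<in> \<Theta>" "t \<in> \<Theta>"
  shows "(\<integral>w. (der \<alpha> s w - der \<alpha> t w)\<^sup>2 \<partial>M) = (dcov \<alpha> \<alpha> s s - dcov \<alpha> \<alpha> s t) + (dcov \<alpha> \<alpha> t t - dcov \<alpha> \<alpha> s t)"
  using L2_inner_diff_square[OF sq_der[OF assms(1,2)] sq_der[OF assms(1,3)]]
    der_inner[OF assms(1,1,2,3)] der_inner[OF assms(1,1,2,2)] der_inner[OF assms(1,1,3,3)]
  by (simp add: power2_eq_square)

lemma der_uniformly_ms_continuous:
  assumes \<alpha>: "mi_order \<alpha> \<le> k" and \<epsilon>: "0 < \<epsilon>"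
  shows "\<exists>\<delta>>0. \<forall>s\<in>\<Theta>. \<forall>t\<in>\<Theta>. dist s t < \<delta> \<longrightarrow> (\<integral>w. (der \<alpha> s w - der \<alpha> t w)\<^sup>2 \<partial>M) < \<epsilon>"
proof -
  have "0 < \<epsilon> / 2" using \<epsilon> by simp
  from uniformly_continuous_diagonal[OF dcov_uniformly_continuous[OF \<alpha> \<alpha>] this]
  obtain \<delta> where \<delta>: "0 < \<delta>" "\<forall>x\<in>\<Theta>. \<forall>y\<in>\<Theta>. \<forall>x'\<in>\<Theta>. \<forall>y'\<in>\<Theta>. dist x x' < \<delta> \<and> dist y y' < \<delta> \<longrightarrow>
      \<bar>dcov \<alpha> \<alpha> x y - dcov \<alpha> \<alpha> x' y'\<bar> < \<epsilon> / 2" by (elim exE conjE)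
  show ?thesis
  proof (intro exI[of _ \<delta>] conjI ballI impI \<delta>(1))
    fix s t assume st: "s \<in> \<Theta>" "t \<in> \<Theta>" "dist s t < \<delta>"
    have "\<bar>dcov \<alpha> \<alpha> s s - dcov \<alpha> \<alpha> s t\<bar> < \<epsilon> / 2"
      by (rule \<delta>(2)[rule_format, OF st(1,1,1,2)]) (use st(3) \<delta>(1) in simp)
    moreover have "\<bar>dcov \<alpha> \<alpha> t t - dcov \<alpha> \<alpha> s t\<bar> < \<epsilon> / 2"
      by (rule \<delta>(2)[rule_format, OF st(2,2,1,2)]) (use st(3) \<delta>(1) in \<open>simp add: dist_commute\<close>)
    ultimately show "(\<integral>w. (der \<alpha> s w - der \<alpha> t w)\<^sup>2 \<partial>M) < \<epsilon>"
      unfolding der_diff_square[OF \<alpha> st(1,2)] by linarith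
  qed
qed

text \<open>The derivative family consists of the covariances of \<open>Y\<close> with the
  derivative fields, and mean-square continuity of these fields gives its uniform continuity by
  Cauchy-Schwarz. Images under the kernel operator are of this form, which is why they are
  smooth.\<close>

lemma cross_Ck_unif:
  assumes Y: "sq_integrable M Y"
  shows "Ck_unif \<Theta> k (\<lambda>t. \<integral>w. Y w * X t w \<partial>M)"
proof (rule Ck_unif_family[where D = "\<lambda>\<alpha> t. \<integral>w. Y w * der \<alpha> t w \<partial>M", OF open_Theta])
  show "(\<integral>w. Y w * der mi_zero t w \<partial>M) = (\<integral>w. Y w * X t w \<partial>M)" for t by simp
  show "((\<lambda>s. \<integral>w. Y w * der \<alpha> (x + s *\<^sub>R axis i 1) w \<partial>M) has_real_derivative (\<integral>w. Y w * der (mi_inc i \<alpha>) x w \<partial>M)) (at 0)"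
    if "mi_order \<alpha> < k" "x \<in> \<Theta>" for \<alpha> i x
    by (rule is_der_deriv[OF is_der_der is_der_der that(1) Y that(2)]) (use that(1) in simp_all)
  fix \<alpha> :: "'n multi_index" assume \<alpha>: "mi_order \<alpha> \<le> k"
  show "uniformly_continuous_on \<Theta> (\<lambda>t. \<integral>w. Y w * der \<alpha> t w \<partial>M)"
    unfolding uniformly_continuous_on_def
  proof (intro allI impI)
    fix \<epsilon> :: real assume \<epsilon>: "0 < \<epsilon>"
    define L where "L = L2_norm_on M Y + 1"
    have L: "0 < L" by (simp add: L_def add_nonneg_pos)
    have "0 < (\<epsilon> / L)\<^sup>2" using \<epsilon> L by simp
    from der_uniformly_ms_continuous[OF \<alpha> this]
    obtain \<delta> where \<delta>: "0 < \<delta>" "\<forall>s\<in>\<Theta>. \<forall>t\<in>\<Theta>. dist s t < \<delta> \<longrightarrow> (\<integral>w. (der \<alpha> s w - der \<alpha> t w)\<^sup>2 \<partial>M) < (\<epsilon> / L)\<^sup>2"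
      by (elim exE conjE)
    show "\<exists>d>0. \<forall>x\<in>\<Theta>. \<forall>x'\<in>\<Theta>. dist x' x < d \<longrightarrow>
        dist (\<integral>w. Y w * der \<alpha> x' w \<partial>M) (\<integral>w. Y w * der \<alpha> x w \<partial>M) < \<epsilon>"
    proof (intro exI[of _ \<delta>] conjI ballI impI \<delta>(1))
      fix x x' assume x: "x \<in> \<Theta>" "x' \<in> \<Theta>" "dist x' x < \<delta>"
      have "(\<integral>w. (der \<alpha> x' w - der \<alpha> x w)\<^sup>2 \<partial>M) < (\<epsilon> / L)\<^sup>2" by (rule \<delta>(2)[rule_format, OF x(2,1,3)])
      then have n: "L2_norm_on M (\<lambda>w. der \<alpha> x' w - der \<alpha> x w) < \<epsilon> / L"
        unfolding L2_norm_on_def using \<epsilon> L by (intro real_less_lsqrt) simp_all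
      have "(\<integral>w. Y w * der \<alpha> x' w \<partial>M) - (\<integral>w. Y w * der \<alpha> x w \<partial>M) = (\<integral>w. Y w * (der \<alpha> x' w - der \<alpha> x w) \<partial>M)"
        using sq_integrable_mult[OF Y sq_der[OF \<alpha> x(1)]] sq_integrable_mult[OF Y sq_der[OF \<alpha> x(2)]]
        by (simp add: right_diff_distrib)
      then have "dist (\<integral>w. Y w * der \<alpha> x' w \<partial>M) (\<integral>w. Y w * der \<alpha> x w \<partial>M)
          \<le> L2_norm_on M Y * L2_norm_on M (\<lambda>w. der \<alpha> x' w - der \<alpha> x w)"
        using L2_Cauchy_Schwarz_norm[OF Y sq_integrable_diff[OF sq_der[OF \<alpha> x(2)] sq_der[OF \<alpha> x(1)]]]
        by (simp add: dist_real_def)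
      also have "\<dots> \<le> L * L2_norm_on M (\<lambda>w. der \<alpha> x' w - der \<alpha> x w)"
        by (intro mult_right_mono) (simp_all add: L_def)
      also have "\<dots> < L * (\<epsilon> / L)" by (rule mult_strict_left_mono[OF n L])
      finally show "dist (\<integral>w. Y w * der \<alpha> x' w \<partial>M) (\<integral>w. Y w * der \<alpha> x w \<partial>M) < \<epsilon>" using L by simp
    qed
  qed
qed

lemma der_second_moment_bounded: "\<exists>B. \<forall>(\<alpha> :: 'n multi_index) t. mi_order \<alpha> \<le> k \<and> t \<in> \<Theta> \<longrightarrow> (\<integral>w. (der \<alpha> t w)\<^sup>2 \<partial>M) \<le> B"
proof -
  have "\<exists>C. \<forall>t\<in>\<Theta>. (\<integral>w. (der \<alpha> t w)\<^sup>2 \<partial>M) \<le> C" if \<alpha>: "mi_order \<alpha> \<le> k" for \<alpha> :: "'n multi_index"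
  proof -
    have "bounded ((\<lambda>(x, y). dcov \<alpha> \<alpha> x y) ` (\<Theta> \<times> \<Theta>))"
      by (rule bounded_uniformly_continuous_image[OF dcov_uniformly_continuous[OF \<alpha> \<alpha>] bounded_Times[OF bounded_Theta bounded_Theta]])
    then obtain C where C: "\<forall>x\<in>(\<lambda>(x, y). dcov \<alpha> \<alpha> x y) ` (\<Theta> \<times> \<Theta>). norm x \<le> C" unfolding bounded_iff by (elim exE)
    have "(\<integral>w. (der \<alpha> t w)\<^sup>2 \<partial>M) \<le> C" if t: "t \<in> \<Theta>" for t
    proof -
      have "(\<integral>w. (der \<alpha> t w)\<^sup>2 \<partial>M) = dcov \<alpha> \<alpha> t t" using der_inner[OF \<alpha> \<alpha> t t] by (simp add: power2_eq_square)
      moreover have "norm (dcov \<alpha> \<alpha> t t) \<le> C" by (rule bspec[OF C]) (use t in \<open>auto intro!: image_eqI[of _ _ "(t, t)"]\<close>)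
      ultimately show ?thesis by simp
    qed
    then show ?thesis by (intro exI[of _ C] ballI)
  qed
  then have "\<forall>\<alpha>\<in>{\<alpha> :: 'n multi_index. mi_order \<alpha> \<le> k}. \<exists>C. \<forall>t\<in>\<Theta>. (\<integral>w. (der \<alpha> t w)\<^sup>2 \<partial>M) \<le> C" by simp
  from bchoice[OF this] obtain C where C: "\<forall>\<alpha>\<in>{\<alpha>. mi_order \<alpha> \<le> k}. \<forall>t\<in>\<Theta>. (\<integral>w. (der \<alpha> t w)\<^sup>2 \<partial>M) \<le> C \<alpha>" by (elim exE)
  show ?thesis
  proof (intro exI[of _ "Max (C ` {\<alpha>. mi_order \<alpha> \<le> k})"] allI impI, elim conjE)
    fix \<alpha> :: "'n multi_index" and t assume a: "mi_order \<alpha> \<le> k" "t \<in> \<Theta>"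
    have "(\<integral>w. (der \<alpha> t w)\<^sup>2 \<partial>M) \<le> C \<alpha>" using C a by simp
    also have "\<dots> \<le> Max (C ` {\<alpha>. mi_order \<alpha> \<le> k})" using a by (intro Max_ge finite_imageI finite_mi_order_le) simp
    finally show "(\<integral>w. (der \<alpha> t w)\<^sup>2 \<partial>M) \<le> Max (C ` {\<alpha>. mi_order \<alpha> \<le> k})" .
  qed
qed

end

subsection \<open>The field of all derivatives as one field on a product space\<close>

lemma count_pair_measurable:
  assumes "finite A" "\<And>a. a \<in> A \<Longrightarrow> (\<lambda>x. f (a, x)) \<in> borel_measurable L"
  shows "f \<in> borel_measurable (count_space A \<Otimes>\<^sub>M L)"
  by (rule measurable_pair_measure_countable1[OF countable_finite[OF assms(1)] assms(2)])

lemma count_pair_section: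
  assumes "f \<in> borel_measurable (count_space A \<Otimes>\<^sub>M L)" "a \<in> A"
  shows "(\<lambda>x. f (a, x)) \<in> borel_measurable L"
  using measurable_Pair2[OF assms(1), of a] assms(2) by simp

lemma count_pair_sigma_finite:
  assumes "finite A" "finite_measure L"
  shows "pair_sigma_finite (count_space A) L"
  using assms by (simp add: pair_sigma_finite_def sigma_finite_measure_count_space_finite finite_measure.sigma_finite_measure)

lemma count_pair_integrable:
  fixes f :: "'a \<times> 'b \<Rightarrow> real"
  assumes A: "finite A" "finite_measure L" and f: "f \<in> borel_measurable (count_space A \<Otimes>\<^sub>M L)"
  shows "integrable (count_space A \<Otimes>\<^sub>M L) f \<longleftrightarrow> (\<forall>a\<in>A. integrable L (\<lambda>x. f (a, x)))"
proof
  interpret pair_sigma_finite "count_space A" L by (rule count_pair_sigma_finite[OF A])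
  show "\<forall>a\<in>A. integrable L (\<lambda>x. f (a, x))" if "integrable (count_space A \<Otimes>\<^sub>M L) f"
    using AE_integrable_fst'[OF that] unfolding AE_count_space .
  show "integrable (count_space A \<Otimes>\<^sub>M L) f" if "\<forall>a\<in>A. integrable L (\<lambda>x. f (a, x))"
  proof (rule Fubini_integrable[OF f])
    show "integrable (count_space A) (\<lambda>a. \<integral>x. norm (f (a, x)) \<partial>L)" by (rule integrable_count_space[OF A(1)])
    show "AE a in count_space A. integrable L (\<lambda>x. f (a, x))" unfolding AE_count_space by (rule that)
  qed
qed

lemma count_pair_integral:
  fixes f :: "'a \<times> 'b \<Rightarrow> real"
  assumes A: "finite A" "finite_measure L" and f: "integrable (count_space A \<Otimes>\<^sub>M L) f"
  shows "(\<integral>p. f p \<partial>(count_space A \<Otimes>\<^sub>M L)) = (\<Sum>a\<in>A. \<integral>x. f (a, x) \<partial>L)"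
proof -
  interpret pair_sigma_finite "count_space A" L by (rule count_pair_sigma_finite[OF A])
  show ?thesis
    using integral_fst'[OF f] unfolding lebesgue_integral_count_space_finite[OF A(1)] by (rule sym)
qed

lemma count_pair_sq_integrable:
  assumes A: "finite A" "finite_measure L" and f: "\<And>a. a \<in> A \<Longrightarrow> sq_integrable L (\<lambda>x. f (a, x))"
  shows "sq_integrable (count_space A \<Otimes>\<^sub>M L) f"
  unfolding sq_integrable_def
proof
  show m: "f \<in> borel_measurable (count_space A \<Otimes>\<^sub>M L)"
    by (rule count_pair_measurable[OF A(1) sq_integrable_measurable[OF f]])
  show "integrable (count_space A \<Otimes>\<^sub>M L) (\<lambda>p. (f p)\<^sup>2)"
  proof (rule iffD2[OF count_pair_integrable[OF A]])
    show "(\<lambda>p. (f p)\<^sup>2) \<in> borel_measurable (count_space A \<Otimes>\<^sub>M L)" by (rule borel_measurable_power[OF m])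
    show "\<forall>a\<in>A. integrable L (\<lambda>x. (f (a, x))\<^sup>2)" by (intro ballI sq_integrable_square[OF f])
  qed
qed

lemma count_pair_sq_integrableD:
  assumes A: "finite A" "finite_measure L" and f: "sq_integrable (count_space A \<Otimes>\<^sub>M L) f" and a: "a \<in> A"
  shows "sq_integrable L (\<lambda>x. f (a, x))"
  unfolding sq_integrable_def
proof
  show "(\<lambda>x. f (a, x)) \<in> borel_measurable L" by (rule count_pair_section[OF sq_integrable_measurable[OF f] a])
  have i: "integrable (count_space A \<Otimes>\<^sub>M L) (\<lambda>p. (f p)\<^sup>2)" by (rule sq_integrable_square[OF f])
  show "integrable L (\<lambda>x. (f (a, x))\<^sup>2)"
    by (rule bspec[OF iffD1[OF count_pair_integrable[OF A borel_measurable_integrable[OF i]] i] a])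
qed

lemma count_pair_inner:
  assumes A: "finite A" "finite_measure L"
    and f: "sq_integrable (count_space A \<Otimes>\<^sub>M L) f" and g: "sq_integrable (count_space A \<Otimes>\<^sub>M L) g"
  shows "(\<integral>p. f p * g p \<partial>(count_space A \<Otimes>\<^sub>M L)) = (\<Sum>a\<in>A. \<integral>x. f (a, x) * g (a, x) \<partial>L)"
  by (rule count_pair_integral[OF A sq_integrable_mult[OF f g]])

lemma count_pair_AE:
  fixes f g :: "'a \<times> 'b \<Rightarrow> real"
  assumes A: "finite A" "finite_measure L" and f: "f \<in> borel_measurable (count_space A \<Otimes>\<^sub>M L)"
    and g: "g \<in> borel_measurable (count_space A \<Otimes>\<^sub>M L)" and AE: "\<And>a. a \<in> A \<Longrightarrow> AE x in L. f (a, x) = g (a, x)"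
  shows "AE p in count_space A \<Otimes>\<^sub>M L. f p = g p"
proof -
  interpret pair_sigma_finite "count_space A" L by (rule count_pair_sigma_finite[OF A])
  show ?thesis
  proof (rule AE_pair_measure)
    have "{x \<in> space (count_space A \<Otimes>\<^sub>M L). f x - g x = 0} \<in> sets (count_space A \<Otimes>\<^sub>M L)"
      using f g by measurable
    then show "{x \<in> space (count_space A \<Otimes>\<^sub>M L). f x = g x} \<in> sets (count_space A \<Otimes>\<^sub>M L)" by simp
    show "AE a in count_space A. AE x in L. f (a, x) = g (a, x)" unfolding AE_count_space using AE by (rule ballI)
  qed
qed

lemma bounded_finite_net:
  fixes S :: "'a::euclidean_space set"
  assumes "bounded S" "0 < \<delta>"
  shows "\<exists>F. finite F \<and> F \<subseteq> S \<and> (\<forall>t\<in>S. \<exists>s\<in>F. dist t s < \<delta>)"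
proof -
  have "compact (closure S)" using assms(1) by (simp add: compact_closure)
  moreover have "closure S \<subseteq> (\<Union>x\<in>S. ball x \<delta>)"
  proof
    fix y assume "y \<in> closure S"
    then obtain x where "x \<in> S" "dist x y < \<delta>" using assms(2) unfolding closure_approachable by blast
    then show "y \<in> (\<Union>x\<in>S. ball x \<delta>)" by auto
  qed
  ultimately obtain F where F: "F \<subseteq> S" "finite F" "closure S \<subseteq> (\<Union>x\<in>F. ball x \<delta>)"
    using compactE_image[of "closure S" S "\<lambda>x. ball x \<delta>"] by blast
  show ?thesis
  proof (intro exI[of _ F] conjI ballI F)
    fix t assume "t \<in> S"
    then have "t \<in> closure S" using closure_subset by blast
    then have "t \<in> (\<Union>x\<in>F. ball x \<delta>)" using F(3) by blast
    then obtain s where "s \<in> F" "t \<in> ball s \<delta>" by (rule UN_E)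
    then show "\<exists>s\<in>F. dist t s < \<delta>" by (intro bexI[of _ s]) (simp_all add: dist_commute)
  qed
qed

lemma Ck_unif_cong:
  fixes S :: "(real ^ 'n::finite) set"
  assumes S: "open S" and f: "Ck_unif S k f" and eq: "\<And>x. x \<in> S \<Longrightarrow> f x = g x"
  shows "Ck_unif S k g"
proof (rule Ck_unif_family[where D = "\<lambda>\<alpha>. cderiv \<alpha> f", OF S])
  show "cderiv mi_zero f x = g x" if "x \<in> S" for x using eq[OF that] by simp
  show "((\<lambda>s. cderiv \<alpha> f (x + s *\<^sub>R axis i 1)) has_real_derivative cderiv (mi_inc i \<alpha>) f x) (at 0)"
    if "mi_order \<alpha> < k" "x \<in> S" for \<alpha> i x by (rule Ck_unifD[OF f that])
  show "uniformly_continuous_on S (cderiv \<alpha> f)" if "mi_order \<alpha> \<le> k" for \<alpha>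
    using f that by (simp add: Ck_unif_def)
qed

context ck_field
begin

definition Idx :: "'n multi_index set" where "Idx = {\<alpha>. mi_order \<alpha> \<le> k}"

text \<open>The counting factor reproduces the sum over derivatives in the Sobolev inner product, so
  mapping a function to the family of its weak derivatives preserves inner products; see
  \<open>sob_inner_eq\<close>.\<close>

definition idx_measure :: "('n multi_index \<times> (real ^ 'n)) measure" where
  "idx_measure = count_space Idx \<Otimes>\<^sub>M lebesgue_on \<Theta>"

definition Zp :: "'n multi_index \<times> (real ^ 'n) \<Rightarrow> 'w \<Rightarrow> real" where
  "Zp p w = der (fst p) (snd p) w"

definition Bnd :: real where
  "Bnd = (SOME B. \<forall>(\<alpha> :: 'n multi_index) t. mi_order \<alpha> \<le> k \<and> t \<in> \<Theta> \<longrightarrow> (\<integral>w. (der \<alpha> t w)\<^sup>2 \<partial>M) \<le> B)"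

lemma Idx_finite [simp]: "finite Idx" by (simp add: Idx_def finite_mi_order_le)

lemma finite_measure_Theta: "finite_measure (lebesgue_on \<Theta>)"
  by (rule finite_measure_lebesgue_on_bounded[OF open_Theta bounded_Theta])

lemma space_idx [simp]: "space idx_measure = Idx \<times> \<Theta>"
  by (simp add: idx_measure_def space_pair_measure)

lemmas idx_integral = count_pair_integral[OF Idx_finite finite_measure_Theta, folded idx_measure_def]
lemmas idx_integrable = count_pair_integrable[OF Idx_finite finite_measure_Theta, folded idx_measure_def]
lemmas sq_idx = count_pair_sq_integrable[OF Idx_finite finite_measure_Theta, folded idx_measure_def]
lemmas sq_idxD = count_pair_sq_integrableD[OF Idx_finite finite_measure_Theta, folded idx_measure_def]
lemmas idx_inner = count_pair_inner[OF Idx_finite finite_measure_Theta, folded idx_measure_def]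
lemmas AE_idx = count_pair_AE[OF Idx_finite finite_measure_Theta, folded idx_measure_def]

text \<open>Fields are jointly measurable for the Borel sets of the domain, Sobolev functions live
  on its Lebesgue sets; this map mediates between the two.\<close>

lemma lebesgue_on_to_borel: "(\<lambda>x. x) \<in> lebesgue_on \<Theta> \<rightarrow>\<^sub>M restrict_space borel \<Theta>"
  by (intro measurable_restrict_space3) (auto intro: measurable_completion)

lemma field_measurable_lebesgue:
  assumes "measurable_field \<Theta> M Z"
  shows "(\<lambda>(t, w). Z t w) \<in> borel_measurable (lebesgue_on \<Theta> \<Otimes>\<^sub>M M)"
proof -
  have "(\<lambda>p. (fst p, snd p)) \<in> lebesgue_on \<Theta> \<Otimes>\<^sub>M M \<rightarrow>\<^sub>M restrict_space borel \<Theta> \<Otimes>\<^sub>M M"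
    by (intro measurable_Pair measurable_snd measurable_compose[OF measurable_fst lebesgue_on_to_borel])
  from measurable_compose[OF this assms[unfolded measurable_field_def]] show ?thesis
    by (simp add: case_prod_beta')
qed

text \<open>Uniform mean-square continuity turns finite nets of the bounded domain, one for each
  multi-index, into a net of the field. Full support holds because a non-empty open set is not
  Lebesgue null, and the counting factor charges every multi-index.\<close>

lemma idx_kl_field: "kl_field idx_measure M Zp Bnd"
proof -
  interpret L: finite_measure "lebesgue_on \<Theta>" by (rule finite_measure_Theta)
  interpret C: finite_measure "count_space Idx" by (rule finite_measure_count_space[OF Idx_finite])
  interpret P: pair_sigma_finite "count_space Idx" "lebesgue_on \<Theta>" by (rule count_pair_sigma_finite[OF Idx_finite finite_measure_Theta])
  have fin: "finite_measure idx_measure"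
    unfolding idx_measure_def by (rule finite_measure_pair_measure[OF L.finite_measure_axioms C.finite_measure_axioms])
  show ?thesis
  proof (rule kl_field.intro[OF fin prob_space_axioms], unfold_locales)
    have "(\<lambda>q. (fst (fst q), (snd (fst q), snd q))) \<in> idx_measure \<Otimes>\<^sub>M M \<rightarrow>\<^sub>M count_space Idx \<Otimes>\<^sub>M (lebesgue_on \<Theta> \<Otimes>\<^sub>M M)"
      unfolding idx_measure_def
      by (intro measurable_Pair measurable_snd measurable_compose[OF measurable_fst measurable_fst] measurable_compose[OF measurable_fst measurable_snd])
    moreover have "(\<lambda>q. der (fst q) (fst (snd q)) (snd (snd q))) \<in> borel_measurable (count_space Idx \<Otimes>\<^sub>M (lebesgue_on \<Theta> \<Otimes>\<^sub>M M))"
    proof (rule measurable_pair_measure_countable1[OF countable_finite[OF Idx_finite]])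
      fix \<alpha> assume "\<alpha> \<in> Idx"
      then have "mi_order \<alpha> \<le> k" by (simp add: Idx_def)
      from field_measurable_lebesgue[OF der_measurable[OF this]]
      show "(\<lambda>y. der (fst (\<alpha>, y)) (fst (snd (\<alpha>, y))) (snd (snd (\<alpha>, y)))) \<in> borel_measurable (lebesgue_on \<Theta> \<Otimes>\<^sub>M M)"
        by (simp add: case_prod_beta')
    qed
    ultimately show "(\<lambda>(p, w). Zp p w) \<in> borel_measurable (idx_measure \<Otimes>\<^sub>M M)"
      by (drule_tac measurable_compose) (assumption, simp add: Zp_def case_prod_beta')
  next
    fix p assume "p \<in> space idx_measure"
    then have p: "mi_order (fst p) \<le> k" "snd p \<in> \<Theta>" by (auto simp: Idx_def)
    show "integrable M (\<lambda>w. (Zp p w)\<^sup>2)" unfolding Zp_def by (rule sq_integrable_square[OF sq_der[OF p]])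
    have "\<forall>(\<alpha> :: 'n multi_index) t. mi_order \<alpha> \<le> k \<and> t \<in> \<Theta> \<longrightarrow> (\<integral>w. (der \<alpha> t w)\<^sup>2 \<partial>M) \<le> Bnd"
      unfolding Bnd_def by (rule someI_ex[OF der_second_moment_bounded])
    from this[rule_format, OF conjI[OF p]] show "(\<integral>w. (Zp p w)\<^sup>2 \<partial>M) \<le> Bnd" unfolding Zp_def .
  next
    fix \<epsilon> :: real assume \<epsilon>: "0 < \<epsilon>"
    have "\<forall>\<alpha>\<in>Idx. \<exists>F. finite F \<and> F \<subseteq> \<Theta> \<and> (\<forall>t\<in>\<Theta>. \<exists>s\<in>F. (\<integral>w. (der \<alpha> t w - der \<alpha> s w)\<^sup>2 \<partial>M) < \<epsilon>)"
    proof
      fix \<alpha> assume "\<alpha> \<in> Idx"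
      then have \<alpha>: "mi_order \<alpha> \<le> k" by (simp add: Idx_def)
      obtain \<delta> where \<delta>: "0 < \<delta>" "\<forall>s\<in>\<Theta>. \<forall>t\<in>\<Theta>. dist s t < \<delta> \<longrightarrow> (\<integral>w. (der \<alpha> s w - der \<alpha> t w)\<^sup>2 \<partial>M) < \<epsilon>"
        using der_uniformly_ms_continuous[OF \<alpha> \<epsilon>] by (elim exE conjE)
      obtain F where F: "finite F" "F \<subseteq> \<Theta>" "\<forall>t\<in>\<Theta>. \<exists>s\<in>F. dist t s < \<delta>"
        using bounded_finite_net[OF bounded_Theta \<delta>(1)] by (elim exE conjE)
      show "\<exists>F. finite F \<and> F \<subseteq> \<Theta> \<and> (\<forall>t\<in>\<Theta>. \<exists>s\<in>F. (\<integral>w. (der \<alpha> t w - der \<alpha> s w)\<^sup>2 \<partial>M) < \<epsilon>)"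
      proof (intro exI[of _ F] conjI F ballI)
        fix t assume t: "t \<in> \<Theta>"
        then obtain s where s: "s \<in> F" "dist t s < \<delta>" using F(3) by blast
        then have "s \<in> \<Theta>" using F(2) by blast
        then show "\<exists>s\<in>F. (\<integral>w. (der \<alpha> t w - der \<alpha> s w)\<^sup>2 \<partial>M) < \<epsilon>"
          using \<delta>(2)[rule_format, OF t _ s(2)] s(1) by (intro bexI[of _ s])
      qed
    qed
    from bchoice[OF this] obtain F where F: "\<forall>\<alpha>\<in>Idx. finite (F \<alpha>) \<and> F \<alpha> \<subseteq> \<Theta> \<and>
        (\<forall>t\<in>\<Theta>. \<exists>s\<in>F \<alpha>. (\<integral>w. (der \<alpha> t w - der \<alpha> s w)\<^sup>2 \<partial>M) < \<epsilon>)" by (elim exE)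
    show "\<exists>P. finite P \<and> P \<subseteq> space idx_measure \<and> (\<forall>p\<in>space idx_measure. \<exists>q\<in>P. (\<integral>w. (Zp p w - Zp q w)\<^sup>2 \<partial>M) < \<epsilon>)"
    proof (intro exI[of _ "SIGMA \<alpha>:Idx. F \<alpha>"] conjI ballI)
      show "finite (SIGMA \<alpha>:Idx. F \<alpha>)" using F by (intro finite_SigmaI) auto
      show "(SIGMA \<alpha>:Idx. F \<alpha>) \<subseteq> space idx_measure" using F by auto
      fix p assume "p \<in> space idx_measure"
      then have p: "fst p \<in> Idx" "snd p \<in> \<Theta>" by auto
      have "\<forall>t\<in>\<Theta>. \<exists>s\<in>F (fst p). (\<integral>w. (der (fst p) t w - der (fst p) s w)\<^sup>2 \<partial>M) < \<epsilon>"
        using bspec[OF F p(1)] by (elim conjE)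
      from bspec[OF this p(2)] obtain s where s: "s \<in> F (fst p)" "(\<integral>w. (der (fst p) (snd p) w - der (fst p) s w)\<^sup>2 \<partial>M) < \<epsilon>"
        by (elim bexE)
      show "\<exists>q\<in>SIGMA \<alpha>:Idx. F \<alpha>. (\<integral>w. (Zp p w - Zp q w)\<^sup>2 \<partial>M) < \<epsilon>"
        by (rule bexI[of _ "(fst p, s)"]) (use s p(1) in \<open>simp_all add: Zp_def\<close>)
    qed
  next
    fix p and \<epsilon> :: real assume "p \<in> space idx_measure" and \<epsilon>: "0 < \<epsilon>"
    then have p: "fst p \<in> Idx" "mi_order (fst p) \<le> k" "snd p \<in> \<Theta>" by (auto simp: Idx_def)
    obtain \<delta> where \<delta>: "0 < \<delta>" "\<forall>s\<in>\<Theta>. \<forall>t\<in>\<Theta>. dist s t < \<delta> \<longrightarrow> (\<integral>w. (der (fst p) s w - der (fst p) t w)\<^sup>2 \<partial>M) < \<epsilon>"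
      using der_uniformly_ms_continuous[OF p(2) \<epsilon>] by (elim exE conjE)
    show "\<not> (AE q in idx_measure. \<epsilon> \<le> (\<integral>w. (Zp q w - Zp p w)\<^sup>2 \<partial>M))"
    proof
      assume "AE q in idx_measure. \<epsilon> \<le> (\<integral>w. (Zp q w - Zp p w)\<^sup>2 \<partial>M)"
      from P.AE_pair[OF this[unfolded idx_measure_def]]
      have "AE x in lebesgue_on \<Theta>. \<epsilon> \<le> (\<integral>w. (Zp (fst p, x) w - Zp p w)\<^sup>2 \<partial>M)"
        unfolding AE_count_space using p(1) by (rule bspec)
      then have "AE x in lebesgue. x \<in> \<Theta> \<longrightarrow> \<epsilon> \<le> (\<integral>w. (Zp (fst p, x) w - Zp p w)\<^sup>2 \<partial>M)"
        using AE_restrict_space_iff[of \<Theta> lebesgue] open_Theta by simp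
      then have "AE x in lebesgue. x \<in> - (\<Theta> \<inter> ball (snd p) \<delta>)"
      proof eventually_elim
        case (elim x)
        show ?case
        proof (rule ComplI, elim IntE)
          assume x: "x \<in> \<Theta>" "x \<in> ball (snd p) \<delta>"
          then have "(\<integral>w. (der (fst p) x w - der (fst p) (snd p) w)\<^sup>2 \<partial>M) < \<epsilon>"
            by (intro \<delta>(2)[rule_format] p(3)) (simp_all add: dist_commute)
          then show False using elim x(1) by (simp add: Zp_def)
        qed
      qed
      then have "snd p \<in> - (\<Theta> \<inter> ball (snd p) \<delta>)"
        by (rule mem_closed_if_AE_lebesgue[OF closed_Compl[OF open_Int[OF open_Theta open_ball]]])
      then show False using p(3) \<delta>(1) by simp
    qed
  qed
qed

end

sublocale ck_field \<subseteq> kl: kl_field idx_measure M Zp Bnd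
  by (rule idx_kl_field)

context ck_field
begin

lemma Idx_iff: "\<alpha> \<in> Idx \<longleftrightarrow> mi_order \<alpha> \<le> k" by (simp add: Idx_def)

lemma zero_Idx [simp]: "mi_zero \<in> Idx" by (simp add: Idx_def)

lemma ker_eq:
  assumes "\<alpha> \<in> Idx" "\<beta> \<in> Idx" "s \<in> \<Theta>" "t \<in> \<Theta>"
  shows "kl.ker (\<alpha>, s) (\<beta>, t) = dcov \<alpha> \<beta> s t"
  unfolding kl.ker_def Zp_def fst_conv snd_conv using assms by (intro der_inner) (simp_all add: Idx_iff)

text \<open>\<open>ker_op F\<close> at \<open>(\<beta>, y)\<close> is the covariance of
  \<open>coef F\<close> with the derivative field of order \<open>\<beta>\<close>, and testing a
  derivative field with a square-integrable variable is what \<open>is_der\<close>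
  evaluates.\<close>

lemma ker_op_cderiv:
  assumes F: "sq_integrable idx_measure F"
  shows "Ck_unif \<Theta> k (\<lambda>y. kl.ker_op F (mi_zero, y))"
    and "\<And>\<beta> y. \<beta> \<in> Idx \<Longrightarrow> y \<in> \<Theta> \<Longrightarrow> cderiv \<beta> (\<lambda>y. kl.ker_op F (mi_zero, y)) y = kl.ker_op F (\<beta>, y)"
proof -
  note sqc = kl.sq_coef[OF F]
  have eq: "kl.ker_op F (\<beta>, y) = (\<integral>w. kl.coef F w * der \<beta> y w \<partial>M)" if "\<beta> \<in> Idx" "y \<in> \<Theta>" for \<beta> y
    using kl.ker_op_eq_cross[OF F, of "(\<beta>, y)"] that by (simp add: Zp_def)
  have eq0: "(\<integral>w. kl.coef F w * X y w \<partial>M) = kl.ker_op F (mi_zero, y)" if "y \<in> \<Theta>" for y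
    using eq[OF zero_Idx that] by simp
  show "Ck_unif \<Theta> k (\<lambda>y. kl.ker_op F (mi_zero, y))"
    by (rule Ck_unif_cong[OF open_Theta cross_Ck_unif[OF sqc] eq0])
  show "cderiv \<beta> (\<lambda>y. kl.ker_op F (mi_zero, y)) y = kl.ker_op F (\<beta>, y)" if b: "\<beta> \<in> Idx" and y: "y \<in> \<Theta>" for \<beta> y
  proof -
    have "cderiv \<beta> (\<lambda>y. kl.ker_op F (mi_zero, y)) y = cderiv \<beta> (\<lambda>s. \<integral>w. kl.coef F w * X s w \<partial>M) y"
      by (rule cderiv_cong[OF open_Theta _ y]) (rule eq0[symmetric])
    also have "\<dots> = (\<integral>w. kl.coef F w * der \<beta> y w \<partial>M)"
      using b by (intro der_cross[symmetric] sqc y) (simp add: Idx_iff)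
    finally show ?thesis using eq[OF b y] by simp
  qed
qed

text \<open>Built from chosen representatives, \<open>wder f\<close> is determined up to null sets
  only, in contrast to the classical family \<open>cder f\<close>; \<open>AE_wder_cder\<close> links
  the two.\<close>

definition wder :: "(real ^ 'n \<Rightarrow> real) \<Rightarrow> 'n multi_index \<times> (real ^ 'n) \<Rightarrow> real" where
  "wder f p = weak_deriv \<Theta> (fst p) f (snd p)"

definition cder :: "(real ^ 'n \<Rightarrow> real) \<Rightarrow> 'n multi_index \<times> (real ^ 'n) \<Rightarrow> real" where
  "cder f p = cderiv (fst p) f (snd p)"

lemma sq_wder: "f \<in> sobolev \<Theta> k \<Longrightarrow> sq_integrable idx_measure (wder f)"
  by (rule sq_idx) (simp add: wder_def Idx_iff sobolevD(2)[OF open_Theta])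

lemma sq_cder: "Ck_unif \<Theta> k f \<Longrightarrow> sq_integrable idx_measure (cder f)"
  by (rule sq_idx) (simp add: cder_def Idx_iff Ck_unif_sq_integrable[OF open_Theta bounded_Theta])

lemma AE_wder:
  assumes f: "f \<in> sobolev \<Theta> k" and g: "sq_integrable idx_measure g"
    and wd: "\<And>\<alpha>. \<alpha> \<in> Idx \<Longrightarrow> has_weak_deriv \<Theta> \<alpha> f (\<lambda>x. g (\<alpha>, x))"
  shows "AE p in idx_measure. wder f p = g p"
proof (rule AE_idx[OF sq_integrable_measurable[OF sq_wder[OF f]] sq_integrable_measurable[OF g]])
  show "AE x in lebesgue_on \<Theta>. wder f (\<alpha>, x) = g (\<alpha>, x)" if "\<alpha> \<in> Idx" for \<alpha>
    using weak_deriv_AE[OF open_Theta wd[OF that]] by (simp add: wder_def)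
qed

lemma AE_wder_cder: "Ck_unif \<Theta> k f \<Longrightarrow> AE p in idx_measure. wder f p = cder f p"
  by (intro AE_wder Ck_unif_sobolev[OF open_Theta bounded_Theta] sq_cder)
    (simp_all add: cder_def Idx_iff Ck_unif_has_weak_deriv[OF open_Theta])

lemma sob_inner_eq:
  assumes "f \<in> sobolev \<Theta> k" "g \<in> sobolev \<Theta> k"
  shows "sob_inner \<Theta> k f g = (\<integral>p. wder f p * wder g p \<partial>idx_measure)"
  unfolding idx_inner[OF sq_wder[OF assms(1)] sq_wder[OF assms(2)]] sob_inner_def Idx_def[symmetric]
  by (simp add: wder_def)

lemma kernel_op_eq:
  assumes f: "f \<in> sobolev \<Theta> k" and y: "y \<in> \<Theta>"
  shows "kernel_op \<Theta> k cov f y = kl.ker_op (wder f) (mi_zero, y)"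
proof -
  have q: "(mi_zero, y) \<in> space idx_measure" using y by simp
  have i: "integrable idx_measure (\<lambda>p. kl.ker p (mi_zero, y) * wder f p)"
    by (rule kl.integrable_ker_mult[OF sq_wder[OF f] q])
  have ii: "integrable (lebesgue_on \<Theta>) (\<lambda>x. kl.ker (\<alpha>, x) (mi_zero, y) * wder f (\<alpha>, x))" if "\<alpha> \<in> Idx" for \<alpha>
    using iffD1[OF idx_integrable[OF borel_measurable_integrable[OF i]] i] that by (rule bspec)
  have "kernel_op \<Theta> k cov f y = (\<integral>x. (\<Sum>\<alpha>\<in>Idx. kl.ker (\<alpha>, x) (mi_zero, y) * wder f (\<alpha>, x)) \<partial>lebesgue_on \<Theta>)"
    unfolding kernel_op_def Idx_def[symmetric]
    by (intro Bochner_Integration.integral_cong refl sum.cong) (simp add: ker_eq y wder_def)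
  also have "\<dots> = (\<Sum>\<alpha>\<in>Idx. \<integral>x. kl.ker (\<alpha>, x) (mi_zero, y) * wder f (\<alpha>, x) \<partial>lebesgue_on \<Theta>)"
    by (rule Bochner_Integration.integral_sum) (rule ii)
  also have "\<dots> = kl.ker_op (wder f) (mi_zero, y)"
    unfolding kl.ker_op_def by (rule idx_integral[OF i, symmetric])
  finally show ?thesis .
qed

end

subsection \<open>The kernel operator\<close>

lemma L2_inner_cong_AE:
  assumes "sq_integrable N f" "sq_integrable N f'" "sq_integrable N g" "sq_integrable N g'"
    and "AE p in N. f p = f' p" "AE p in N. g p = g' p"
  shows "(\<integral>p. f p * g p \<partial>N) = (\<integral>p. f' p * g' p \<partial>N)"
proof (rule integral_cong_AE)
  show "(\<lambda>p. f p * g p) \<in> borel_measurable N" by (rule borel_measurable_integrable[OF sq_integrable_mult[OF assms(1,3)]])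
  show "(\<lambda>p. f' p * g' p) \<in> borel_measurable N" by (rule borel_measurable_integrable[OF sq_integrable_mult[OF assms(2,4)]])
  show "AE p in N. f p * g p = f' p * g' p" using assms(5,6) by eventually_elim simp
qed

lemma L2_norm_cong_AE:
  assumes "sq_integrable N f" "sq_integrable N g" "AE p in N. f p = g p"
  shows "L2_norm_on N f = L2_norm_on N g"
  using L2_inner_cong_AE[OF assms(1,2,1,2,3,3)] by (simp add: L2_norm_on_def power2_eq_square)

lemma Ck_unif_zero:
  assumes S: "open S"
  shows "Ck_unif S k (\<lambda>_ :: real ^ 'n::finite. 0)"
  by (rule Ck_unif_family[where D = "\<lambda>_ _. 0", OF S refl DERIV_const uniformly_continuous_on_const])

lemma Ck_unif_scale:
  fixes S :: "(real ^ 'n::finite) set"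
  assumes "open S" "Ck_unif S k g"
  shows "Ck_unif S k (\<lambda>x. c * g x)"
  using Ck_unif_lin_comb(1)[where A = "{} :: nat set" and c = c, OF assms] by simp

lemma cderiv_scale:
  fixes S :: "(real ^ 'n::finite) set"
  assumes "open S" "Ck_unif S k g" "mi_order \<alpha> \<le> k" "x \<in> S"
  shows "cderiv \<alpha> (\<lambda>x. c * g x) x = c * cderiv \<alpha> g x"
  using Ck_unif_lin_comb(2)[where A = "{} :: nat set" and c = c, OF assms(1,2) _ assms(3,4)] by simp

lemma Ck_unif_sum:
  fixes S :: "(real ^ 'n::finite) set"
  assumes S: "open S" and f: "\<And>j. j \<in> A \<Longrightarrow> Ck_unif S k (f j)"
  shows "Ck_unif S k (\<lambda>x. \<Sum>j\<in>A. a j * f j x)"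
  using Ck_unif_lin_comb(1)[where c = 0 and g = "\<lambda>_. 0", OF S Ck_unif_zero[OF S] f] by simp

lemma cderiv_sum:
  fixes S :: "(real ^ 'n::finite) set"
  assumes S: "open S" and f: "\<And>j. j \<in> A \<Longrightarrow> Ck_unif S k (f j)" and "mi_order \<alpha> \<le> k" "x \<in> S"
  shows "cderiv \<alpha> (\<lambda>x. \<Sum>j\<in>A. a j * f j x) x = (\<Sum>j\<in>A. a j * cderiv \<alpha> (f j) x)"
  using Ck_unif_lin_comb(2)[where c = 0 and g = "\<lambda>_. 0", OF S Ck_unif_zero[OF S] f assms(3,4)] by simp

section \<open>The eigensystem on the product space and nuclearity\<close>

locale ck_eigen = ck_field M \<Theta> X k
  for M :: "'w measure" and \<Theta> :: "(real ^ 'n::finite) set" and X k +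
  fixes J :: "nat set" and lam :: "nat \<Rightarrow> real" and e :: "nat \<Rightarrow> real ^ 'n \<Rightarrow> real"
  assumes eigsys: "eigensystem \<Theta> k (kernel_op \<Theta> k (cov_kernel M X)) J lam e"
begin

lemma
  shows J_cases: "J = {1..} \<or> (\<exists>N. J = {1..N})"
    and lam_nonzero: "j \<in> J \<Longrightarrow> lam j \<noteq> 0"
    and e_sobolev: "j \<in> J \<Longrightarrow> e j \<in> sobolev \<Theta> k"
    and e_Ck: "j \<in> J \<Longrightarrow> Ck_unif \<Theta> k (e j)"
    and e_ortho: "i \<in> J \<Longrightarrow> j \<in> J \<Longrightarrow> sob_inner \<Theta> k (e i) (e j) = (if i = j then 1 else 0)"
    and e_eigen: "j \<in> J \<Longrightarrow> AE x in lebesgue_on \<Theta>. kernel_op \<Theta> k cov (e j) x = lam j * e j x"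
    and e_complete: "f \<in> sobolev \<Theta> k \<Longrightarrow> \<mu> \<noteq> 0 \<Longrightarrow> AE x in lebesgue_on \<Theta>. kernel_op \<Theta> k cov f x = \<mu> * f x \<Longrightarrow>
      \<exists>F c. finite F \<and> F \<subseteq> {j\<in>J. lam j = \<mu>} \<and> (AE x in lebesgue_on \<Theta>. f x = (\<Sum>j\<in>F. c j * e j x))"
proof -
  note d = eigsys[unfolded eigensystem_def]
  show "J = {1..} \<or> (\<exists>N. J = {1..N})" by (rule conjunct1[OF d])
  note d = conjunct2[OF d]
  show "j \<in> J \<Longrightarrow> lam j \<noteq> 0" by (rule conjunct1[OF d, rule_format])
  note d = conjunct2[OF conjunct2[OF d]]
  show "j \<in> J \<Longrightarrow> e j \<in> sobolev \<Theta> k" by (rule conjunct1[OF bspec[OF conjunct1[OF d]]])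
  show "j \<in> J \<Longrightarrow> Ck_unif \<Theta> k (e j)" by (rule conjunct2[OF bspec[OF conjunct1[OF d]]])
  note d = conjunct2[OF d]
  show "i \<in> J \<Longrightarrow> j \<in> J \<Longrightarrow> sob_inner \<Theta> k (e i) (e j) = (if i = j then 1 else 0)"
    by (rule bspec[OF bspec[OF conjunct1[OF d]]])
  note d = conjunct2[OF d]
  show "j \<in> J \<Longrightarrow> AE x in lebesgue_on \<Theta>. kernel_op \<Theta> k cov (e j) x = lam j * e j x" by (rule bspec[OF conjunct1[OF d]])
  note d = conjunct2[OF d]
  show "\<exists>F c. finite F \<and> F \<subseteq> {j\<in>J. lam j = \<mu>} \<and> (AE x in lebesgue_on \<Theta>. f x = (\<Sum>j\<in>F. c j * e j x))"
    if "f \<in> sobolev \<Theta> k" "\<mu> \<noteq> 0" "AE x in lebesgue_on \<Theta>. kernel_op \<Theta> k cov f x = \<mu> * f x"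
    by (rule mp[OF bspec[OF spec[OF d] that(1)] conjI[OF that(2,3)]])
qed

lemma kernel_op_Ck:
  assumes f: "Ck_unif \<Theta> k f" and y: "y \<in> \<Theta>"
  shows "kernel_op \<Theta> k cov f y = kl.ker_op (cder f) (mi_zero, y)"
proof -
  have s: "f \<in> sobolev \<Theta> k" by (rule Ck_unif_sobolev[OF open_Theta bounded_Theta f])
  show ?thesis
    unfolding kernel_op_eq[OF s y]
    by (rule kl.ker_op_cong_AE[OF sq_wder[OF s] sq_cder[OF f] AE_wder_cder[OF f]]) (simp add: y)
qed

text \<open>The eigenvalue equation is given almost everywhere and for the function itself.
  Continuity extends it to every point of the domain, and differentiation to the other
  components.\<close>

lemma e_ker_op:
  assumes j: "j \<in> J" and p: "p \<in> space idx_measure"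
  shows "kl.ker_op (cder (e j)) p = lam j * cder (e j) p"
proof -
  obtain \<beta> y where py: "p = (\<beta>, y)" "\<beta> \<in> Idx" "y \<in> \<Theta>" using p by auto
  note C = e_Ck[OF j]
  note Kc = ker_op_cderiv[OF sq_cder[OF C]]
  have eq: "kl.ker_op (cder (e j)) (mi_zero, x) = lam j * e j x" if x: "x \<in> \<Theta>" for x
  proof -
    have "kl.ker_op (cder (e j)) (mi_zero, x) - lam j * e j x = 0"
    proof (rule AE_zero_continuous[OF open_Theta _ _ x, where f = "\<lambda>x. kl.ker_op (cder (e j)) (mi_zero, x) - lam j * e j x"])
      have "continuous_on \<Theta> (\<lambda>x. kl.ker_op (cder (e j)) (mi_zero, x))" "continuous_on \<Theta> (e j)"
        using Ck_unif_continuous[OF Kc(1), of mi_zero] Ck_unif_continuous[OF C, of mi_zero] by simp_all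
      then show "continuous_on \<Theta> (\<lambda>x. kl.ker_op (cder (e j)) (mi_zero, x) - lam j * e j x)"
        by (intro continuous_on_diff continuous_on_mult continuous_on_const)
      show "AE x in lebesgue_on \<Theta>. kl.ker_op (cder (e j)) (mi_zero, x) - lam j * e j x = 0"
        using e_eigen[OF j] AE_space
      proof eventually_elim
        case (elim x)
        then show ?case using kernel_op_Ck[OF C, of x] by simp
      qed
    qed
    then show ?thesis by simp
  qed
  have "kl.ker_op (cder (e j)) (\<beta>, y) = cderiv \<beta> (\<lambda>x. kl.ker_op (cder (e j)) (mi_zero, x)) y"
    by (rule Kc(2)[OF py(2,3), symmetric])
  also have "\<dots> = cderiv \<beta> (\<lambda>x. lam j * e j x) y" by (rule cderiv_cong[OF open_Theta eq py(3)])
  also have "\<dots> = lam j * cderiv \<beta> (e j) y"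
    using py(2) by (intro cderiv_scale[OF open_Theta C _ py(3)]) (simp add: Idx_iff)
  finally show ?thesis by (simp add: py(1) cder_def)
qed

lemma sob_inner_Ck:
  assumes f: "f \<in> sobolev \<Theta> k" and g: "Ck_unif \<Theta> k g"
  shows "sob_inner \<Theta> k f g = (\<integral>p. wder f p * cder g p \<partial>idx_measure)"
proof -
  have s: "g \<in> sobolev \<Theta> k" by (rule Ck_unif_sobolev[OF open_Theta bounded_Theta g])
  show ?thesis
    unfolding sob_inner_eq[OF f s]
    by (rule L2_inner_cong_AE[OF sq_wder[OF f] sq_wder[OF f] sq_wder[OF s] sq_cder[OF g] _ AE_wder_cder[OF g]]) simp
qed

lemma sob_inner_CkCk:
  assumes f: "Ck_unif \<Theta> k f" and g: "Ck_unif \<Theta> k g"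
  shows "sob_inner \<Theta> k f g = (\<integral>p. cder f p * cder g p \<partial>idx_measure)"
proof -
  have s: "f \<in> sobolev \<Theta> k" by (rule Ck_unif_sobolev[OF open_Theta bounded_Theta f])
  show ?thesis
    unfolding sob_inner_Ck[OF s g]
    by (rule L2_inner_cong_AE[OF sq_wder[OF s] sq_cder[OF f] sq_cder[OF g] sq_cder[OF g] AE_wder_cder[OF f]]) simp
qed

lemma sob_norm_Ck: "Ck_unif \<Theta> k f \<Longrightarrow> sob_norm \<Theta> k f = L2_norm_on idx_measure (cder f)"
  by (simp add: sob_norm_def sob_inner_CkCk L2_norm_on_def power2_eq_square)

text \<open>An eigenvector of the extended operator on the product space consists of the derivatives of a classical eigenfunction.\<close>

lemma ker_op_eigen_complete:
  assumes mu: "mu \<noteq> 0" and h: "sq_integrable idx_measure h" and Kh: "\<And>p. p \<in> space idx_measure \<Longrightarrow> kl.ker_op h p = mu * h p"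
    and orth: "\<And>j. j \<in> J \<Longrightarrow> (\<integral>p. h p * cder (e j) p \<partial>idx_measure) = 0"
  shows "L2_norm_on idx_measure h = 0"
proof -
  \<comment> \<open>The order-zero component of \<open>h\<close>, written through the eigenvalue
    equation: as an image of \<open>ker_op\<close> it is smooth, although \<open>h\<close> is merely
    square integrable.\<close>
  define g where "g y = (1 / mu) * kl.ker_op h (mi_zero, y)" for y
  note Kc = ker_op_cderiv[OF h]
  have gC: "Ck_unif \<Theta> k g" unfolding g_def by (rule Ck_unif_scale[OF open_Theta Kc(1)])
  have gS: "g \<in> sobolev \<Theta> k" by (rule Ck_unif_sobolev[OF open_Theta bounded_Theta gC])
  have gh: "cder g p = h p" if p: "p \<in> space idx_measure" for p
  proof -
    obtain \<beta> y where py: "p = (\<beta>, y)" "\<beta> \<in> Idx" "y \<in> \<Theta>" using p by auto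
    have "cderiv \<beta> g y = (1 / mu) * cderiv \<beta> (\<lambda>y. kl.ker_op h (mi_zero, y)) y"
      unfolding g_def using py(2) by (intro cderiv_scale[OF open_Theta Kc(1) _ py(3)]) (simp add: Idx_iff)
    also have "\<dots> = (1 / mu) * kl.ker_op h p" using Kc(2)[OF py(2,3)] by (simp add: py(1))
    also have "\<dots> = h p" using Kh[OF p] mu by simp
    finally show ?thesis by (simp add: py(1) cder_def)
  qed
  have Tg: "kernel_op \<Theta> k cov g y = mu * g y" if y: "y \<in> \<Theta>" for y
  proof -
    have "kernel_op \<Theta> k cov g y = kl.ker_op (cder g) (mi_zero, y)" by (rule kernel_op_Ck[OF gC y])
    also have "\<dots> = kl.ker_op h (mi_zero, y)" by (rule kl.ker_op_cong) (rule gh)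
    also have "\<dots> = mu * g y" using mu by (simp add: g_def)
    finally show ?thesis .
  qed
  have "AE x in lebesgue_on \<Theta>. kernel_op \<Theta> k cov g x = mu * g x"
    by (rule AE_I2) (simp add: Tg)
  from e_complete[OF gS mu this] obtain F c where F: "finite F" "F \<subseteq> {j\<in>J. lam j = mu}"
    "AE x in lebesgue_on \<Theta>. g x = (\<Sum>j\<in>F. c j * e j x)" by (elim exE conjE)
  have FJ: "j \<in> J" if "j \<in> F" for j using F(2) that by auto
  have ec: "continuous_on \<Theta> (e j)" if "j \<in> F" for j
    using Ck_unif_continuous[OF e_Ck[OF FJ[OF that]], of mi_zero] by simp
  have gc: "continuous_on \<Theta> g" using Ck_unif_continuous[OF gC, of mi_zero] by simp
  have gsum: "g x = (\<Sum>j\<in>F. c j * e j x)" if x: "x \<in> \<Theta>" for x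
  proof -
    have "g x - (\<Sum>j\<in>F. c j * e j x) = 0"
    proof (rule AE_zero_continuous[OF open_Theta _ _ x, where f = "\<lambda>x. g x - (\<Sum>j\<in>F. c j * e j x)"])
      show "continuous_on \<Theta> (\<lambda>x. g x - (\<Sum>j\<in>F. c j * e j x))"
        by (intro continuous_on_diff continuous_on_sum continuous_on_mult continuous_on_const gc ec)
      show "AE x in lebesgue_on \<Theta>. g x - (\<Sum>j\<in>F. c j * e j x) = 0" using F(3) by eventually_elim simp
    qed
    then show ?thesis by simp
  qed
  have hsum: "h p = (\<Sum>j\<in>F. c j * cder (e j) p)" if p: "p \<in> space idx_measure" for p
  proof -
    obtain \<beta> y where py: "p = (\<beta>, y)" "\<beta> \<in> Idx" "y \<in> \<Theta>" using p by auto
    have "h p = cderiv \<beta> g y" using gh[OF p] by (simp add: py(1) cder_def)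
    also have "\<dots> = cderiv \<beta> (\<lambda>x. \<Sum>j\<in>F. c j * e j x) y" by (rule cderiv_cong[OF open_Theta gsum py(3)])
    also have "\<dots> = (\<Sum>j\<in>F. c j * cderiv \<beta> (e j) y)"
      using py(2) by (intro cderiv_sum[OF open_Theta e_Ck[OF FJ] _ py(3)]) (simp_all add: Idx_iff)
    finally show ?thesis by (simp add: py(1) cder_def)
  qed
  \<comment> \<open>\<open>h\<close> is a combination of the \<open>cder (e j)\<close> and
    orthogonal to each of them.\<close>
  have "(\<integral>p. (h p)\<^sup>2 \<partial>idx_measure) = (\<integral>p. (\<Sum>j\<in>F. c j * (h p * cder (e j) p)) \<partial>idx_measure)"
  proof (rule Bochner_Integration.integral_cong[OF refl])
    fix p assume p: "p \<in> space idx_measure"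
    have "(h p)\<^sup>2 = h p * (\<Sum>j\<in>F. c j * cder (e j) p)" using hsum[OF p] by (simp add: power2_eq_square)
    then show "(h p)\<^sup>2 = (\<Sum>j\<in>F. c j * (h p * cder (e j) p))" by (simp add: sum_distrib_left mult.left_commute)
  qed
  also have "\<dots> = (\<Sum>j\<in>F. c j * (\<integral>p. h p * cder (e j) p \<partial>idx_measure))"
    using sq_integrable_mult[OF h sq_cder[OF e_Ck[OF FJ]]] by (subst Bochner_Integration.integral_sum) simp_all
  also have "\<dots> = 0" using orth[OF FJ] by simp
  finally show ?thesis by (simp add: L2_norm_on_def)
qed

lemma idx_kl_system: "kl_system idx_measure M Zp Bnd J lam (\<lambda>j. cder (e j))"
proof (rule kl_system.intro[OF idx_kl_field], unfold_locales)
  show "sq_integrable idx_measure (cder (e j))" if "j \<in> J" for j by (rule sq_cder[OF e_Ck[OF that]])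
  show "kl.ker_op (cder (e j)) p = lam j * cder (e j) p" if "j \<in> J" "p \<in> space idx_measure" for j p
    by (rule e_ker_op[OF that])
  show "lam j \<noteq> 0" if "j \<in> J" for j by (rule lam_nonzero[OF that])
  show "(\<integral>p. cder (e i) p * cder (e j) p \<partial>idx_measure) = (if i = j then 1 else 0)" if "i \<in> J" "j \<in> J" for i j
    using e_ortho[OF that] sob_inner_CkCk[OF e_Ck[OF that(1)] e_Ck[OF that(2)]] by simp
  show "L2_norm_on idx_measure h = 0"
    if "mu \<noteq> 0" "sq_integrable idx_measure h" "\<And>p. p \<in> space idx_measure \<Longrightarrow> kl.ker_op h p = mu * h p"
      "\<And>j. j \<in> J \<Longrightarrow> (\<integral>p. h p * cder (e j) p \<partial>idx_measure) = 0" for mu h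
    by (rule ker_op_eigen_complete[OF that])
qed

end

sublocale ck_eigen \<subseteq> kls: kl_system idx_measure M Zp Bnd J lam "\<lambda>j. cder (e j)"
  by (rule idx_kl_system)

context ck_eigen
begin

lemma kernel_op_maps_Ck:
  assumes f: "f \<in> sobolev \<Theta> k"
  shows "Ck_unif \<Theta> k (kernel_op \<Theta> k cov f)"
  by (rule Ck_unif_cong[OF open_Theta ker_op_cderiv(1)[OF sq_wder[OF f]]]) (simp add: kernel_op_eq[OF f])

lemma cder_kernel_op:
  assumes f: "f \<in> sobolev \<Theta> k" and p: "p \<in> space idx_measure"
  shows "cder (kernel_op \<Theta> k cov f) p = kl.ker_op (wder f) p"
proof -
  obtain \<beta> y where py: "p = (\<beta>, y)" "\<beta> \<in> Idx" "y \<in> \<Theta>" using p by auto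
  have "cderiv \<beta> (kernel_op \<Theta> k cov f) y = cderiv \<beta> (\<lambda>y. kl.ker_op (wder f) (mi_zero, y)) y"
    by (rule cderiv_cong[OF open_Theta kernel_op_eq[OF f] py(3)])
  also have "\<dots> = kl.ker_op (wder f) (\<beta>, y)" by (rule ker_op_cderiv(2)[OF sq_wder[OF f] py(2,3)])
  finally show ?thesis by (simp add: py(1) cder_def)
qed

lemma sob_norm_e: "j \<in> J \<Longrightarrow> sob_norm \<Theta> k (e j) = 1"
  using e_ortho[of j j] by (simp add: sob_norm_def)

lemma sob_norm_scale_e: "j \<in> J \<Longrightarrow> sob_norm \<Theta> k (\<lambda>x. lam j * e j x) = lam j"
proof -
  assume j: "j \<in> J"
  have "sob_norm \<Theta> k (\<lambda>x. lam j * e j x) = L2_norm_on idx_measure (cder (\<lambda>x. lam j * e j x))"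
    by (rule sob_norm_Ck[OF Ck_unif_scale[OF open_Theta e_Ck[OF j]]])
  also have "\<dots> = L2_norm_on idx_measure (\<lambda>p. lam j * cder (e j) p)"
    unfolding L2_norm_on_def
    by (intro arg_cong[where f = sqrt] Bochner_Integration.integral_cong refl)
      (auto simp: cder_def Idx_iff cderiv_scale[OF open_Theta e_Ck[OF j]])
  also have "\<dots> = lam j"
    using sob_norm_Ck[OF e_Ck[OF j]] sob_norm_e[OF j] kls.lam_pos[OF j] by (simp add: L2_norm_on_scale)
  finally show ?thesis .
qed

text \<open>\<open>a n\<close> carries the eigenvalue and \<open>b n\<close> the eigenfunction, so
  their norms multiply to \<open>lam n\<close> and \<open>sum_lam_le\<close> gives summability. The
  truncation error is uniformly small on the product space, which has finite mass, hence small in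
  the Sobolev norm.\<close>

theorem kernel_op_nuclear: "nuclear_op \<Theta> k (kernel_op \<Theta> k cov)"
proof -
  define a where "a n = (if n \<in> J then (\<lambda>x. lam n * e n x) else (\<lambda>_. 0))" for n
  define b where "b n = (if n \<in> J then e n else (\<lambda>_. 0))" for n
  have aC: "Ck_unif \<Theta> k (a n)" for n
    unfolding a_def using Ck_unif_scale[OF open_Theta e_Ck] Ck_unif_zero[OF open_Theta] by simp
  have bC: "Ck_unif \<Theta> k (b n)" for n
    unfolding b_def using e_Ck Ck_unif_zero[OF open_Theta] by simp
  note sob = Ck_unif_sobolev[OF open_Theta bounded_Theta]
  have ab: "sob_norm \<Theta> k (a n) * sob_norm \<Theta> k (b n) = (if n \<in> J then lam n else 0)" for n
  proof (cases "n \<in> J")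
    case True
    then show ?thesis by (simp add: a_def b_def sob_norm_e sob_norm_scale_e)
  next
    case False
    have z: "(cder (\<lambda>_. 0) p)\<^sup>2 = 0" if "p \<in> space idx_measure" for p
      using cderiv_sum[where A = "{} :: nat set" and k = k, OF open_Theta] that by (auto simp: cder_def Idx_iff)
    have "(\<integral>p. (cder (\<lambda>_. 0) p)\<^sup>2 \<partial>idx_measure) = (\<integral>p. 0 \<partial>idx_measure)"
      by (rule Bochner_Integration.integral_cong[OF refl z])
    then have "L2_norm_on idx_measure (cder (\<lambda>_. 0)) = 0"
      unfolding L2_norm_on_def by simp
    then show ?thesis using False sob_norm_Ck[OF Ck_unif_zero[OF open_Theta]] by (simp add: a_def)
  qed
  have sm: "summable (\<lambda>n. sob_norm \<Theta> k (a n) * sob_norm \<Theta> k (b n))"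
    unfolding ab
  proof (rule summableI_nonneg_bounded)
    show "0 \<le> (if n \<in> J then lam n else 0)" for n using kls.lam_pos by (simp add: less_imp_le)
    fix n
    have "(\<Sum>i<n. if i \<in> J then lam i else 0) = (\<Sum>i\<in>{i \<in> {..<n}. i \<in> J}. lam i)" by (subst sum.inter_filter) simp_all
    also have "\<dots> \<le> (\<Sum>i\<in>kls.Jm n. lam i)"
      by (rule sum_mono2) (auto simp: kls.Jm_def less_imp_le[OF kls.lam_pos])
    also have "\<dots> \<le> Bnd * measure idx_measure (space idx_measure)" by (rule kls.sum_lam_le)
    finally show "(\<Sum>i<n. if i \<in> J then lam i else 0) \<le> Bnd * measure idx_measure (space idx_measure)" .
  qed
  have conv: "(\<lambda>N. sob_norm \<Theta> k (\<lambda>x. kernel_op \<Theta> k cov f x - (\<Sum>n<N. sob_inner \<Theta> k f (a n) * b n x))) \<longlonglongrightarrow> 0"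
    if f: "f \<in> sobolev \<Theta> k" for f
  proof -
    define W where "W = wder f"
    have sqW: "sq_integrable idx_measure W" unfolding W_def by (rule sq_wder[OF f])
    define g where "g N x = kernel_op \<Theta> k cov f x - (\<Sum>n<N. sob_inner \<Theta> k f (a n) * b n x)" for N :: nat and x
    have geq: "g N = (\<lambda>x. 1 * kernel_op \<Theta> k cov f x + (\<Sum>n<N. (- sob_inner \<Theta> k f (a n)) * b n x))" for N
      by (rule ext) (simp add: g_def sum_negf)
    have gC: "Ck_unif \<Theta> k (g N)" for N
      unfolding geq by (rule Ck_unif_lin_comb(1)[OF open_Theta kernel_op_maps_Ck[OF f] bC])
    have inner_a: "sob_inner \<Theta> k f (a n) = lam n * (\<integral>p. W p * cder (e n) p \<partial>idx_measure)" if n: "n \<in> J" for n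
    proof -
      have "sob_inner \<Theta> k f (a n) = (\<integral>p. W p * cder (a n) p \<partial>idx_measure)"
        unfolding W_def by (rule sob_inner_Ck[OF f aC])
      also have "\<dots> = (\<integral>p. lam n * (W p * cder (e n) p) \<partial>idx_measure)"
        using n by (intro Bochner_Integration.integral_cong refl)
          (auto simp: a_def cder_def Idx_iff cderiv_scale[OF open_Theta e_Ck])
      finally show ?thesis by simp
    qed
    \<comment> \<open>\<open>n < Suc N\<close> matches \<open>j \<le> N\<close> in
      \<open>kls.Jm N\<close>; indices outside \<open>J\<close>, among them \<open>0\<close>,
      contribute zero.\<close>
    have gder: "cder (g (Suc N)) p = kl.ker_op W p - (\<Sum>j\<in>kls.Jm N. lam j * (\<integral>q. W q * cder (e j) q \<partial>idx_measure) * cder (e j) p)"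
      if p: "p \<in> space idx_measure" for N p
    proof -
      obtain \<beta> y where py: "p = (\<beta>, y)" "\<beta> \<in> Idx" "y \<in> \<Theta>" using p by auto
      have \<beta>: "mi_order \<beta> \<le> k" using py(2) by (simp add: Idx_iff)
      have z: "cderiv \<beta> (\<lambda>_. 0) y = 0"
        using cderiv_sum[where A = "{} :: nat set" and k = k, OF open_Theta _ \<beta> py(3)] by simp
      have "cder (g (Suc N)) p = 1 * cderiv \<beta> (kernel_op \<Theta> k cov f) y + (\<Sum>n<Suc N. (- sob_inner \<Theta> k f (a n)) * cderiv \<beta> (b n) y)"
        unfolding geq cder_def py(1) fst_conv snd_conv
        by (rule Ck_unif_lin_comb(2)[OF open_Theta kernel_op_maps_Ck[OF f] bC \<beta> py(3)])
      also have "cderiv \<beta> (kernel_op \<Theta> k cov f) y = kl.ker_op W p"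
        using cder_kernel_op[OF f p] by (simp add: W_def cder_def py(1))
      also have "(\<Sum>n<Suc N. (- sob_inner \<Theta> k f (a n)) * cderiv \<beta> (b n) y)
          = (\<Sum>n<Suc N. if n \<in> J then - (lam n * (\<integral>q. W q * cder (e n) q \<partial>idx_measure) * cder (e n) p) else 0)"
        by (intro sum.cong refl) (simp add: b_def inner_a z cder_def py(1))
      also have "\<dots> = (\<Sum>n\<in>{n \<in> {..<Suc N}. n \<in> J}. - (lam n * (\<integral>q. W q * cder (e n) q \<partial>idx_measure) * cder (e n) p))"
        by (subst sum.inter_filter) simp_all
      also have "{n \<in> {..<Suc N}. n \<in> J} = kls.Jm N" by (auto simp: kls.Jm_def)
      finally show ?thesis by (simp add: sum_negf)
    qed
    \<comment> \<open>The pointwise error is at most \<open>\<epsilon>\<close> times the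
      \<open>L\<^sup>1\<close> norm of \<open>W\<close>, and passing to the \<open>L\<^sup>2\<close>
      norm costs the square root of the total mass.\<close>
    define K where "K = (\<integral>q. \<bar>W q\<bar> \<partial>idx_measure) * sqrt (measure idx_measure (space idx_measure))"
    have K: "0 \<le> K" by (simp add: K_def)
    show ?thesis
      unfolding g_def[symmetric]
    proof (rule LIMSEQ_I)
      fix r :: real assume r: "0 < r"
      define \<epsilon> where "\<epsilon> = r / (K + 1)"
      have \<epsilon>: "0 < \<epsilon>" using r K by (simp add: \<epsilon>_def)
      obtain m0 where m0: "\<forall>m\<ge>m0. \<forall>p\<in>space idx_measure. kls.kres m p p < \<epsilon>"
        using kls.kres_uniform[OF \<epsilon>] by (elim exE)
      have "norm (sob_norm \<Theta> k (g N) - 0) < r" if N: "Suc m0 \<le> N" for N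
      proof -
        obtain N' where N': "N = Suc N'" "m0 \<le> N'" using N by (cases N) auto
        define C where "C = \<epsilon> * (\<integral>q. \<bar>W q\<bar> \<partial>idx_measure)"
        have C: "0 \<le> C" using \<epsilon> by (simp add: C_def)
        have "\<bar>cder (g N) p\<bar> \<le> C" if p: "p \<in> space idx_measure" for p
          unfolding N'(1) gder[OF p] C_def
          by (rule kls.ker_op_expansion_error[OF sqW p]) (rule less_imp_le, rule m0[rule_format, OF N'(2)])
        then have "(\<integral>p. (cder (g N) p)\<^sup>2 \<partial>idx_measure) \<le> C\<^sup>2 * measure idx_measure (space idx_measure)"
          by (rule kl.square_integral_le[OF _ C])
        then have "sob_norm \<Theta> k (g N) \<le> sqrt (C\<^sup>2 * measure idx_measure (space idx_measure))"
          unfolding sob_norm_Ck[OF gC] L2_norm_on_def by (rule real_sqrt_le_mono)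
        also have "\<dots> = \<epsilon> * K" using C by (simp only: real_sqrt_mult real_sqrt_abs abs_of_nonneg) (simp add: C_def K_def)
        also have "\<epsilon> * K < r" using r K by (simp add: \<epsilon>_def pos_divide_less_eq distrib_left)
        finally show ?thesis using sob_norm_Ck[OF gC, of N] by simp
      qed
      then show "\<exists>no. \<forall>n\<ge>no. norm (sob_norm \<Theta> k (g n) - 0) < r" by (intro exI[of _ "Suc m0"] allI impI)
    qed
  qed
  show ?thesis
    unfolding nuclear_op_def
  proof (rule conjI, rule ballI, rule sob, rule kernel_op_maps_Ck, assumption,
      rule exI[of _ a], rule exI[of _ b], intro conjI ballI allI)
    show "a n \<in> sobolev \<Theta> k" "b n \<in> sobolev \<Theta> k" for n by (rule sob[OF aC], rule sob[OF bC])
    show "summable (\<lambda>n. sob_norm \<Theta> k (a n) * sob_norm \<Theta> k (b n))" by (rule sm)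
    show "(\<lambda>N. sob_norm \<Theta> k (\<lambda>x. kernel_op \<Theta> k cov f x - (\<Sum>n<N. sob_inner \<Theta> k f (a n) * b n x))) \<longlonglongrightarrow> 0"
      if "f \<in> sobolev \<Theta> k" for f by (rule conv[OF that])
  qed
qed

end

section \<open>Distances in the Sobolev seminorm\<close>

lemma L2_norm_on_sum_le:
  assumes "finite A" "\<And>j. j \<in> A \<Longrightarrow> sq_integrable N (f j)"
  shows "L2_norm_on N (\<lambda>p. \<Sum>j\<in>A. a j * f j p) \<le> (\<Sum>j\<in>A. \<bar>a j\<bar> * L2_norm_on N (f j))"
  using assms
proof (induction A)
  case empty
  then show ?case by (simp add: L2_norm_on_def)
next
  case (insert i A)
  have "L2_norm_on N (\<lambda>p. a i * f i p + (\<Sum>j\<in>A. a j * f j p))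
      \<le> L2_norm_on N (\<lambda>p. a i * f i p) + L2_norm_on N (\<lambda>p. \<Sum>j\<in>A. a j * f j p)"
    by (intro L2_norm_on_triangle sq_integrable_scale sq_integrable_sum insert.prems) simp_all
  also have "\<dots> \<le> \<bar>a i\<bar> * L2_norm_on N (f i) + (\<Sum>j\<in>A. \<bar>a j\<bar> * L2_norm_on N (f j))"
    using insert.IH insert.prems by (simp add: L2_norm_on_scale)
  finally show ?case using insert.hyps by simp
qed

lemma has_weak_deriv_diff:
  fixes S :: "(real ^ 'n::finite) set"
  assumes S: "open S" "bounded S" and f: "has_weak_deriv S \<alpha> f f'" and g: "has_weak_deriv S \<alpha> g g'"
    and sq: "sq_integrable (lebesgue_on S) f" "sq_integrable (lebesgue_on S) f'"
      "sq_integrable (lebesgue_on S) g" "sq_integrable (lebesgue_on S) g'"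
  shows "has_weak_deriv S \<alpha> (\<lambda>x. f x - g x) (\<lambda>x. f' x - g' x)"
  unfolding has_weak_deriv_def
proof (intro conjI allI impI sq_integrable_loc_integrable[OF S] sq_integrable_diff sq)
  fix \<phi> assume \<phi>: "test_fun S \<phi>"
  note i = sq_integrable_mult[OF _ sq_integrable_test_fun[OF S \<phi>]]
  have d: "(LINT x|lebesgue_on S. (u x - v x) * cderiv \<beta> \<phi> x)
      = (LINT x|lebesgue_on S. u x * cderiv \<beta> \<phi> x) - (LINT x|lebesgue_on S. v x * cderiv \<beta> \<phi> x)"
    if "sq_integrable (lebesgue_on S) u" "sq_integrable (lebesgue_on S) v" for u v \<beta>
    using i[OF that(1)] i[OF that(2)] by (simp add: left_diff_distrib)
  show "(LINT x|lebesgue_on S. (f x - g x) * cderiv \<alpha> \<phi> x) = (-1) ^ mi_order \<alpha> * (LINT x|lebesgue_on S. (f' x - g' x) * \<phi> x)"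
    using d[OF sq(1,3), of \<alpha>] d[OF sq(2,4), of mi_zero] has_weak_derivD(3)[OF f \<phi>] has_weak_derivD(3)[OF g \<phi>]
    by (simp add: right_diff_distrib)
qed

context ck_eigen
begin

lemma sobolev_sq: "f \<in> sobolev \<Theta> k \<Longrightarrow> sq_integrable (lebesgue_on \<Theta>) f"
  by (simp add: sobolev_def L2_fun_sq)

text \<open>\<open>weak_deriv\<close> chooses a representative for each function separately, so it
  is compatible with differences only up to null sets; the choice-free \<open>has_weak_deriv\<close>
  is used to compare.\<close>

lemma sobolev_diff:
  assumes f: "f \<in> sobolev \<Theta> k" and g: "g \<in> sobolev \<Theta> k"
  shows "(\<lambda>x. f x - g x) \<in> sobolev \<Theta> k"
    and "AE p in idx_measure. wder (\<lambda>x. f x - g x) p = wder f p - wder g p"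
proof -
  have wd: "has_weak_deriv \<Theta> \<alpha> (\<lambda>x. f x - g x) (\<lambda>x. weak_deriv \<Theta> \<alpha> f x - weak_deriv \<Theta> \<alpha> g x)" if "mi_order \<alpha> \<le> k" for \<alpha>
    by (rule has_weak_deriv_diff[OF open_Theta bounded_Theta sobolevD(1)[OF open_Theta f that] sobolevD(1)[OF open_Theta g that]
        sobolev_sq[OF f] sobolevD(2)[OF open_Theta f that] sobolev_sq[OF g] sobolevD(2)[OF open_Theta g that]])
  show s: "(\<lambda>x. f x - g x) \<in> sobolev \<Theta> k"
    by (rule sobolevI[where g = "\<lambda>\<alpha> x. weak_deriv \<Theta> \<alpha> f x - weak_deriv \<Theta> \<alpha> g x",
          OF sq_integrable_diff[OF sobolev_sq[OF f] sobolev_sq[OF g]]])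
      (intro conjI wd sq_integrable_diff sobolevD(2)[OF open_Theta f] sobolevD(2)[OF open_Theta g])
  show "AE p in idx_measure. wder (\<lambda>x. f x - g x) p = wder f p - wder g p"
    by (rule AE_wder[OF s sq_integrable_diff[OF sq_wder[OF f] sq_wder[OF g]]])
      (simp add: wder_def Idx_iff wd)
qed

lemma sob_norm_eq: "f \<in> sobolev \<Theta> k \<Longrightarrow> sob_norm \<Theta> k f = L2_norm_on idx_measure (wder f)"
  by (simp add: sob_norm_def sob_inner_eq L2_norm_on_def power2_eq_square)

lemma sob_dist_eq:
  assumes f: "f \<in> sobolev \<Theta> k" and g: "g \<in> sobolev \<Theta> k"
    and F: "sq_integrable idx_measure F" "AE p in idx_measure. wder f p = F p"
    and G: "sq_integrable idx_measure G" "AE p in idx_measure. wder g p = G p"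
  shows "sob_norm \<Theta> k (\<lambda>x. f x - g x) = L2_norm_on idx_measure (\<lambda>p. F p - G p)"
  unfolding sob_norm_eq[OF sobolev_diff(1)[OF f g]]
proof (rule L2_norm_cong_AE[OF sq_wder[OF sobolev_diff(1)[OF f g]] sq_integrable_diff[OF F(1) G(1)]])
  show "AE p in idx_measure. wder (\<lambda>x. f x - g x) p = F p - G p"
    using sobolev_diff(2)[OF f g] F(2) G(2) by eventually_elim simp
qed

lemma sob_norm_triangle:
  assumes "f \<in> sobolev \<Theta> k" "g \<in> sobolev \<Theta> k" "h \<in> sobolev \<Theta> k"
  shows "sob_norm \<Theta> k (\<lambda>x. f x - h x) \<le> sob_norm \<Theta> k (\<lambda>x. f x - g x) + sob_norm \<Theta> k (\<lambda>x. g x - h x)"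
proof -
  have d: "sob_norm \<Theta> k (\<lambda>x. u x - v x) = L2_norm_on idx_measure (\<lambda>p. wder u p - wder v p)"
    if "u \<in> sobolev \<Theta> k" "v \<in> sobolev \<Theta> k" for u v
    by (rule sob_dist_eq[OF that sq_wder[OF that(1)] _ sq_wder[OF that(2)]]) simp_all
  show ?thesis
    unfolding d[OF assms(1,3)] d[OF assms(1,2)] d[OF assms(2,3)]
    by (rule L2_norm_on_triangle_diff[OF sq_wder[OF assms(1)] sq_wder[OF assms(2)] sq_wder[OF assms(3)]])
qed

subsection \<open>Sample paths\<close>

definition partial_path :: "nat \<Rightarrow> 'w \<Rightarrow> real ^ 'n \<Rightarrow> real" where
  "partial_path m w x = (\<Sum>j\<in>kls.Jm m. kls.xi j w * e j x)"

lemma e_Ck_Jm: "j \<in> kls.Jm m \<Longrightarrow> Ck_unif \<Theta> k (e j)"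
  by (rule e_Ck[OF kls.Jm_J])

lemma partial_path_Ck: "Ck_unif \<Theta> k (partial_path m w)"
  unfolding partial_path_def by (rule Ck_unif_sum[OF open_Theta e_Ck_Jm])

lemma cder_partial_path:
  assumes "p \<in> space idx_measure"
  shows "cder (partial_path m w) p = (\<Sum>j\<in>kls.Jm m. kls.xi j w * cder (e j) p)"
  unfolding partial_path_def cder_def using assms
  by (intro cderiv_sum[OF open_Theta e_Ck_Jm]) (auto simp: Idx_iff)

text \<open>The squared \<open>H\<^sup>k\<close> distance between a path and its partial sum,
  written with \<open>Z\<close> so that it makes sense before the path is known to be a Sobolev
  function.\<close>

definition sq_error :: "nat \<Rightarrow> 'w \<Rightarrow> real" where
  "sq_error m w = (\<integral>p. (kls.remainder m p w)\<^sup>2 \<partial>idx_measure)"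

lemma remainder_measurable_pair:
  "(\<lambda>(p, w). kls.remainder m p w) \<in> borel_measurable (idx_measure \<Otimes>\<^sub>M M)"
proof -
  have "(\<lambda>q. Zp (fst q) (snd q) - (\<Sum>j\<in>kls.Jm m. kls.xi j (snd q) * cder (e j) (fst q))) \<in> borel_measurable (idx_measure \<Otimes>\<^sub>M M)"
  proof (intro borel_measurable_diff borel_measurable_sum borel_measurable_times)
    show "(\<lambda>q. Zp (fst q) (snd q)) \<in> borel_measurable (idx_measure \<Otimes>\<^sub>M M)"
      using kl.Z_measurable_pair by (simp add: case_prod_beta')
    fix j assume "j \<in> kls.Jm m"
    then have j: "j \<in> J" by (rule kls.Jm_J)
    show "(\<lambda>q. kls.xi j (snd q)) \<in> borel_measurable (idx_measure \<Otimes>\<^sub>M M)"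
      by (rule measurable_compose[OF measurable_snd sq_integrable_measurable[OF kls.sq_xi[OF j]]])
    show "(\<lambda>q. cder (e j) (fst q)) \<in> borel_measurable (idx_measure \<Otimes>\<^sub>M M)"
      by (rule measurable_compose[OF measurable_fst sq_integrable_measurable[OF sq_cder[OF e_Ck[OF j]]]])
  qed
  then show ?thesis by (simp add: kls.remainder_def case_prod_beta')
qed

lemma remainder_square_integrable: "integrable (idx_measure \<Otimes>\<^sub>M M) (\<lambda>(p, w). (kls.remainder m p w)\<^sup>2)"
proof (rule kl.NM.Fubini_integrable)
  show m: "(\<lambda>(p, w). (kls.remainder m p w)\<^sup>2) \<in> borel_measurable (idx_measure \<Otimes>\<^sub>M M)"
    using borel_measurable_power[OF remainder_measurable_pair, of m 2] by (simp add: case_prod_beta')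
  show "AE p in idx_measure. integrable M (\<lambda>w. case (p, w) of (p, w) \<Rightarrow> (kls.remainder m p w)\<^sup>2)"
    by (rule AE_I2) (simp add: sq_integrable_square[OF kls.sq_remainder] del: space_idx)
  show "integrable idx_measure (\<lambda>p. \<integral>w. norm (case (p, w) of (p, w) \<Rightarrow> (kls.remainder m p w)\<^sup>2) \<partial>M)"
  proof (rule kl.N.integrable_const_bound[where B = Bnd])
    show "AE p in idx_measure. norm (\<integral>w. norm (case (p, w) of (p, w) \<Rightarrow> (kls.remainder m p w)\<^sup>2) \<partial>M) \<le> Bnd"
    proof (rule AE_I2)
      fix p assume p: "p \<in> space idx_measure"
      have "(\<integral>w. norm (case (p, w) of (p, w) \<Rightarrow> (kls.remainder m p w)\<^sup>2) \<partial>M) = kls.kres m p p"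
        using kls.remainder_square[OF p] by simp
      then show "norm (\<integral>w. norm (case (p, w) of (p, w) \<Rightarrow> (kls.remainder m p w)\<^sup>2) \<partial>M) \<le> Bnd"
        using kls.kres_le_B[OF p p, of m] by simp
    qed
    show "(\<lambda>p. \<integral>w. norm (case (p, w) of (p, w) \<Rightarrow> (kls.remainder m p w)\<^sup>2) \<partial>M) \<in> borel_measurable idx_measure"
      using borel_measurable_lebesgue_integral[OF m] by simp
  qed
qed

lemma sq_error_integrable: "integrable M (sq_error m)"
  unfolding sq_error_def using kl.NM.integrable_snd[OF remainder_square_integrable] by simp

lemma sq_error_nonneg: "0 \<le> sq_error m w"
  by (simp add: sq_error_def)

lemma sq_error_mean: "(\<integral>w. sq_error m w \<partial>M) = (\<integral>p. kls.kres m p p \<partial>idx_measure)"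
proof -
  have "(\<integral>w. sq_error m w \<partial>M) = (\<integral>p. (\<integral>w. (kls.remainder m p w)\<^sup>2 \<partial>M) \<partial>idx_measure)"
    unfolding sq_error_def using kl.NM.Fubini_integral[OF remainder_square_integrable] by simp
  also have "\<dots> = (\<integral>p. kls.kres m p p \<partial>idx_measure)"
    by (rule Bochner_Integration.integral_cong[OF refl kls.remainder_square])
  finally show ?thesis .
qed

lemma sq_error_mean_tendsto: "(\<lambda>m. \<integral>w. norm (sq_error m w) \<partial>M) \<longlonglongrightarrow> 0"
proof (rule LIMSEQ_I)
  fix r :: real assume r: "0 < r"
  define \<mu> where "\<mu> = measure idx_measure (space idx_measure)"
  have \<mu>: "0 \<le> \<mu>" by (simp add: \<mu>_def)
  define \<epsilon> where "\<epsilon> = r / (\<mu> + 1)"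
  have \<epsilon>: "0 < \<epsilon>" using r \<mu> by (simp add: \<epsilon>_def)
  obtain m0 where m0: "\<forall>m\<ge>m0. \<forall>p\<in>space idx_measure. kls.kres m p p < \<epsilon>"
    using kls.kres_uniform[OF \<epsilon>] by (elim exE)
  have "norm ((\<integral>w. norm (sq_error m w) \<partial>M) - 0) < r" if m: "m0 \<le> m" for m
  proof -
    have "(\<integral>w. norm (sq_error m w) \<partial>M) = (\<integral>p. kls.kres m p p \<partial>idx_measure)"
      using sq_error_mean[of m] by (simp add: sq_error_nonneg)
    also have "\<dots> \<le> (\<integral>p. \<epsilon> \<partial>idx_measure)"
    proof (rule integral_mono)
      have "integrable idx_measure (\<lambda>p. \<integral>w. (kls.remainder m p w)\<^sup>2 \<partial>M)"
        using kl.NM.integrable_fst'[OF remainder_square_integrable, of m] by simp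
      moreover have "integrable idx_measure (\<lambda>p. \<integral>w. (kls.remainder m p w)\<^sup>2 \<partial>M) \<longleftrightarrow> integrable idx_measure (\<lambda>p. kls.kres m p p)"
        by (rule Bochner_Integration.integrable_cong[OF refl kls.remainder_square])
      ultimately show "integrable idx_measure (\<lambda>p. kls.kres m p p)" by blast
      show "kls.kres m p p \<le> \<epsilon>" if "p \<in> space idx_measure" for p
        by (rule less_imp_le, rule m0[rule_format, OF m that])
    qed simp
    also have "\<dots> = \<epsilon> * \<mu>" by (simp add: \<mu>_def mult.commute)
    also have "\<dots> < r" using r \<mu> by (simp add: \<epsilon>_def pos_divide_less_eq distrib_left)
    finally show ?thesis by (simp add: sq_error_nonneg)
  qed
  then show "\<exists>no. \<forall>n\<ge>no. norm ((\<integral>w. norm (sq_error n w) \<partial>M) - 0) < r" by (intro exI[of _ m0] allI impI)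
qed

text \<open>Collects what holds on almost every path. The last clause asks for some \<open>m\<close>
  only, because the partial sums are known to converge along a subsequence; this is enough for
  approximation by a countable set.\<close>

definition good_path :: "'w \<Rightarrow> bool" where
  "good_path w \<longleftrightarrow> (\<lambda>t. X t w) \<in> sobolev \<Theta> k \<and> sq_integrable idx_measure (\<lambda>p. Zp p w) \<and>
    (\<forall>\<alpha>\<in>Idx. has_weak_deriv \<Theta> \<alpha> (\<lambda>t. X t w) (\<lambda>t. der \<alpha> t w)) \<and> (\<forall>\<epsilon>>0. \<exists>m. sq_error m w < \<epsilon>)"

lemma good_pathD:
  assumes "good_path w"
  shows "(\<lambda>t. X t w) \<in> sobolev \<Theta> k" "sq_integrable idx_measure (\<lambda>p. Zp p w)"
    "\<alpha> \<in> Idx \<Longrightarrow> has_weak_deriv \<Theta> \<alpha> (\<lambda>t. X t w) (\<lambda>t. der \<alpha> t w)" "0 < \<epsilon> \<Longrightarrow> \<exists>m. sq_error m w < \<epsilon>"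
proof -
  note d = assms[unfolded good_path_def]
  show "(\<lambda>t. X t w) \<in> sobolev \<Theta> k" by (rule conjunct1[OF d])
  note d = conjunct2[OF d]
  show "sq_integrable idx_measure (\<lambda>p. Zp p w)" by (rule conjunct1[OF d])
  note d = conjunct2[OF d]
  show "\<alpha> \<in> Idx \<Longrightarrow> has_weak_deriv \<Theta> \<alpha> (\<lambda>t. X t w) (\<lambda>t. der \<alpha> t w)" by (rule bspec[OF conjunct1[OF d]])
  show "0 < \<epsilon> \<Longrightarrow> \<exists>m. sq_error m w < \<epsilon>" by (rule conjunct2[OF d, rule_format])
qed

lemma sq_error_partial_path:
  "sq_error m w = (\<integral>p. (cder (partial_path m w) p - Zp p w)\<^sup>2 \<partial>idx_measure)"
  unfolding sq_error_def
proof (rule Bochner_Integration.integral_cong[OF refl])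
  fix p assume p: "p \<in> space idx_measure"
  show "(kls.remainder m p w)\<^sup>2 = (cder (partial_path m w) p - Zp p w)\<^sup>2"
    unfolding cder_partial_path[OF p] kls.remainder_def by (rule power2_commute)
qed

text \<open>The partial sums are smooth and their classical derivatives converge in
  \<open>L\<^sup>2\<close>, so closedness of weak differentiation makes the limits the weak
  derivatives of the path.\<close>

lemma good_pathI:
  assumes sqZ: "sq_integrable idx_measure (\<lambda>p. Zp p w)" and lim: "(\<lambda>n. sq_error (r n) w) \<longlonglongrightarrow> 0"
  shows "good_path w"
proof -
  have sq: "sq_integrable (lebesgue_on \<Theta>) (\<lambda>t. der \<alpha> t w)" if "\<alpha> \<in> Idx" for \<alpha>
    using sq_idxD[OF sqZ that] by (simp add: Zp_def)
  \<comment> \<open>The error in one component is at most the sum of the errors over all components,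
    which is \<open>sq_error\<close>.\<close>
  have limA: "(\<lambda>n. LINT x|lebesgue_on \<Theta>. (cderiv \<alpha> (partial_path (r n) w) x - der \<alpha> x w)\<^sup>2) \<longlonglongrightarrow> 0" if \<alpha>: "\<alpha> \<in> Idx" for \<alpha>
  proof (rule Lim_null_comparison[OF _ lim], intro always_eventually allI)
    fix n
    define D where "D p = cder (partial_path (r n) w) p - Zp p w" for p
    have sD: "sq_integrable idx_measure D"
      unfolding D_def by (rule sq_integrable_diff[OF sq_cder[OF partial_path_Ck] sqZ])
    have "(LINT x|lebesgue_on \<Theta>. (cderiv \<alpha> (partial_path (r n) w) x - der \<alpha> x w)\<^sup>2) = (LINT x|lebesgue_on \<Theta>. (D (\<alpha>, x))\<^sup>2)"
      by (simp add: D_def cder_def Zp_def)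
    also have "\<dots> \<le> (\<Sum>\<beta>\<in>Idx. LINT x|lebesgue_on \<Theta>. (D (\<beta>, x))\<^sup>2)"
      by (rule member_le_sum[OF \<alpha>]) simp_all
    also have "\<dots> = sq_error (r n) w"
      unfolding sq_error_partial_path D_def[symmetric] by (rule idx_integral[OF sq_integrable_square[OF sD], symmetric])
    finally show "norm (LINT x|lebesgue_on \<Theta>. (cderiv \<alpha> (partial_path (r n) w) x - der \<alpha> x w)\<^sup>2) \<le> sq_error (r n) w" by simp
  qed
  have wd: "has_weak_deriv \<Theta> \<alpha> (\<lambda>t. X t w) (\<lambda>t. der \<alpha> t w)" if \<alpha>: "\<alpha> \<in> Idx" for \<alpha>
  proof (rule has_weak_deriv_L2_limit[OF open_Theta bounded_Theta, where f = "\<lambda>n. partial_path (r n) w" and g = "\<lambda>n. cderiv \<alpha> (partial_path (r n) w)"])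
    have k: "mi_order \<alpha> \<le> k" using \<alpha> by (simp add: Idx_iff)
    show "has_weak_deriv \<Theta> \<alpha> (partial_path (r n) w) (cderiv \<alpha> (partial_path (r n) w))" for n
      by (rule Ck_unif_has_weak_deriv[OF open_Theta partial_path_Ck k])
    show "sq_integrable (lebesgue_on \<Theta>) (partial_path (r n) w)" for n
      using Ck_unif_sq_integrable[OF open_Theta bounded_Theta partial_path_Ck, of mi_zero] by simp
    show "sq_integrable (lebesgue_on \<Theta>) (cderiv \<alpha> (partial_path (r n) w))" for n
      by (rule Ck_unif_sq_integrable[OF open_Theta bounded_Theta partial_path_Ck k])
    show "sq_integrable (lebesgue_on \<Theta>) (\<lambda>t. X t w)" using sq[OF zero_Idx] by simp
    show "sq_integrable (lebesgue_on \<Theta>) (\<lambda>t. der \<alpha> t w)" by (rule sq[OF \<alpha>])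
    show "(\<lambda>n. LINT x|lebesgue_on \<Theta>. (partial_path (r n) w x - X x w)\<^sup>2) \<longlonglongrightarrow> 0" using limA[OF zero_Idx] by simp
    show "(\<lambda>n. LINT x|lebesgue_on \<Theta>. (cderiv \<alpha> (partial_path (r n) w) x - der \<alpha> x w)\<^sup>2) \<longlonglongrightarrow> 0" by (rule limA[OF \<alpha>])
  qed
  show ?thesis
    unfolding good_path_def
  proof (intro conjI ballI allI impI sqZ wd)
    show "(\<lambda>t. X t w) \<in> sobolev \<Theta> k"
    proof (rule sobolevI[where g = "\<lambda>\<alpha> t. der \<alpha> t w"])
      show "sq_integrable (lebesgue_on \<Theta>) (\<lambda>t. X t w)" using sq[OF zero_Idx] by simp
      show "has_weak_deriv \<Theta> \<alpha> (\<lambda>t. X t w) (\<lambda>t. der \<alpha> t w) \<and> sq_integrable (lebesgue_on \<Theta>) (\<lambda>t. der \<alpha> t w)"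
        if "mi_order \<alpha> \<le> k" for \<alpha>
        using that by (intro conjI wd sq) (simp_all add: Idx_iff)
    qed
    show "\<exists>m. sq_error m w < \<epsilon>" if "0 < \<epsilon>" for \<epsilon>
    proof -
      have "\<forall>\<^sub>F n in sequentially. sq_error (r n) w < \<epsilon>" by (rule order_tendstoD(2)[OF lim that])
      then obtain n where "sq_error (r n) w < \<epsilon>" unfolding eventually_sequentially by auto
      then show ?thesis by (rule exI[of _ "r n"])
    qed
  qed
qed

text \<open>The mean of \<open>sq_error\<close> is the integral of the diagonal of the residual
  kernel and tends to zero; convergence in \<open>L\<^sup>1\<close> yields an almost surely
  convergent subsequence.\<close>

lemma AE_good_path: "AE w in M. good_path w"
proof -
  obtain r :: "nat \<Rightarrow> nat" where "AE w in M. (\<lambda>n. sq_error (r n) w) \<longlonglongrightarrow> 0"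
    using tendsto_L1_AE_subseq[OF sq_error_integrable sq_error_mean_tendsto] by (elim exE conjE)
  with kl.AE_sq_Z show ?thesis
  proof eventually_elim
    case (elim w)
    then show ?case by (intro good_pathI[of w r])
  qed
qed

lemma good_wder: "good_path w \<Longrightarrow> AE p in idx_measure. wder (\<lambda>t. X t w) p = Zp p w"
  by (rule AE_wder[OF good_pathD(1,2)]) (simp_all add: Zp_def good_pathD(3))

lemma good_sob_path: "good_path w \<Longrightarrow> sob_path \<Theta> k X w = (\<lambda>t. X t w)"
  using good_pathD(1) by (simp add: sob_path_def)

text \<open>On a good path the weak derivatives of the path agree almost everywhere with the
  derivative fields, so the Sobolev inner product becomes the integral that defines
  \<open>xi\<close>.\<close>

lemma good_coef:
  assumes w: "good_path w" and j: "j \<in> J"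
  shows "sob_inner \<Theta> k (sob_path \<Theta> k X w) (e j) = kls.xi j w"
proof -
  have "sob_inner \<Theta> k (\<lambda>t. X t w) (e j) = (\<integral>p. wder (\<lambda>t. X t w) p * cder (e j) p \<partial>idx_measure)"
    by (rule sob_inner_Ck[OF good_pathD(1)[OF w] e_Ck[OF j]])
  also have "\<dots> = (\<integral>p. Zp p w * cder (e j) p \<partial>idx_measure)"
    by (rule L2_inner_cong_AE[OF sq_wder[OF good_pathD(1)[OF w]] good_pathD(2)[OF w] sq_cder[OF e_Ck[OF j]] sq_cder[OF e_Ck[OF j]] good_wder[OF w]]) simp
  finally show ?thesis unfolding good_sob_path[OF w] kls.xi_def kl.coef_def .
qed

text \<open>The rational combinations of the eigenfunctions form a countable set whose closure contains almost every path.\<close>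

definition rat_comb :: "rat list \<Rightarrow> real ^ 'n \<Rightarrow> real" where
  "rat_comb l x = (\<Sum>j | j \<in> J \<and> j < length l. of_rat (l ! j) * e j x)"

lemma rat_comb_Ck: "Ck_unif \<Theta> k (rat_comb l)"
  unfolding rat_comb_def by (rule Ck_unif_sum[OF open_Theta e_Ck]) simp

lemma cder_rat_comb:
  assumes "p \<in> space idx_measure"
  shows "cder (rat_comb l) p = (\<Sum>j | j \<in> J \<and> j < length l. of_rat (l ! j) * cder (e j) p)"
  unfolding rat_comb_def cder_def using assms
  by (intro cderiv_sum[OF open_Theta e_Ck]) (auto simp: Idx_iff)

lemma rat_comb_sobolev: "rat_comb l \<in> sobolev \<Theta> k"
  by (rule Ck_unif_sobolev[OF open_Theta bounded_Theta rat_comb_Ck])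

definition path_dist :: "rat list \<Rightarrow> 'w \<Rightarrow> real" where
  "path_dist l w = L2_norm_on idx_measure (\<lambda>p. Zp p w - cder (rat_comb l) p)"

lemma path_dist_eq: "good_path w \<Longrightarrow> sob_norm \<Theta> k (\<lambda>t. X t w - rat_comb l t) = path_dist l w"
  unfolding path_dist_def
  by (rule sob_dist_eq[OF good_pathD(1) rat_comb_sobolev good_pathD(2) good_wder sq_cder[OF rat_comb_Ck] AE_wder_cder[OF rat_comb_Ck]])

lemma path_dist_measurable: "path_dist l \<in> borel_measurable M"
proof -
  note [measurable] = sq_integrable_measurable[OF sq_cder[OF rat_comb_Ck[of l]]] kl.Z_measurable_pair
  show ?thesis unfolding path_dist_def L2_norm_on_def by measurable
qed

lemma path_dist_small:
  assumes w: "good_path w" and \<epsilon>: "0 < \<epsilon>"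
  shows "\<exists>l. path_dist l w < \<epsilon>"
proof -
  have "0 < (\<epsilon> / 2)\<^sup>2" using \<epsilon> by simp
  from good_pathD(4)[OF w this] obtain m where m: "sq_error m w < (\<epsilon> / 2)\<^sup>2" by (elim exE)
  \<comment> \<open>At most \<open>m + 1\<close> coefficients are rounded, each multiplying an
    eigenfunction of norm one, so rounding costs at most half of \<open>\<epsilon>\<close>;
    truncation at \<open>m\<close> costs the other half.\<close>
  define \<eta> where "\<eta> = \<epsilon> / (2 * (real m + 1))"
  have \<eta>: "0 < \<eta>" using \<epsilon> by (simp add: \<eta>_def)
  have "\<exists>q. \<bar>kls.xi j w - of_rat q\<bar> < \<eta>" for j
  proof -
    obtain q where "kls.xi j w - \<eta> < of_rat q" "of_rat q < kls.xi j w + \<eta>"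
      using of_rat_dense[of "kls.xi j w - \<eta>" "kls.xi j w + \<eta>"] \<eta> by auto
    then show ?thesis by (intro exI[of _ q]) (simp add: abs_less_iff)
  qed
  then have "\<forall>j. \<exists>q. \<bar>kls.xi j w - of_rat q\<bar> < \<eta>" by (rule allI)
  from choice[OF this] obtain q where q: "\<forall>j. \<bar>kls.xi j w - of_rat (q j)\<bar> < \<eta>" by (elim exE)
  define l where "l = map q [0..<Suc m]"
  have Jl: "{j. j \<in> J \<and> j < length l} = kls.Jm m" by (auto simp: l_def kls.Jm_def)
  have lj: "l ! j = q j" if "j \<in> kls.Jm m" for j
    using that unfolding l_def by (subst nth_map) (simp_all add: kls.Jm_def del: upt_Suc)
  have "path_dist l w \<le> L2_norm_on idx_measure (\<lambda>p. Zp p w - cder (partial_path m w) p)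
      + L2_norm_on idx_measure (\<lambda>p. cder (partial_path m w) p - cder (rat_comb l) p)"
    unfolding path_dist_def
    by (rule L2_norm_on_triangle_diff[OF good_pathD(2)[OF w] sq_cder[OF partial_path_Ck] sq_cder[OF rat_comb_Ck]])
  also have "L2_norm_on idx_measure (\<lambda>p. Zp p w - cder (partial_path m w) p) < \<epsilon> / 2"
    unfolding L2_norm_on_minus_commute[of _ "\<lambda>p. Zp p w"] unfolding L2_norm_on_def sq_error_partial_path[symmetric]
    using m \<epsilon> by (intro real_less_lsqrt) simp_all
  also have "L2_norm_on idx_measure (\<lambda>p. cder (partial_path m w) p - cder (rat_comb l) p)
      = L2_norm_on idx_measure (\<lambda>p. \<Sum>j\<in>kls.Jm m. (kls.xi j w - of_rat (q j)) * cder (e j) p)"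
    unfolding L2_norm_on_def
  proof (intro arg_cong[where f = sqrt] Bochner_Integration.integral_cong refl)
    fix p assume p: "p \<in> space idx_measure"
    have "cder (rat_comb l) p = (\<Sum>j\<in>kls.Jm m. of_rat (q j) * cder (e j) p)"
      unfolding cder_rat_comb[OF p] Jl by (intro sum.cong refl) (simp add: lj)
    then show "(cder (partial_path m w) p - cder (rat_comb l) p)\<^sup>2
        = (\<Sum>j\<in>kls.Jm m. (kls.xi j w - of_rat (q j)) * cder (e j) p)\<^sup>2"
      unfolding cder_partial_path[OF p] by (simp add: left_diff_distrib sum_subtractf)
  qed
  also have "\<dots> \<le> (\<Sum>j\<in>kls.Jm m. \<bar>kls.xi j w - of_rat (q j)\<bar> * L2_norm_on idx_measure (cder (e j)))"
    by (rule L2_norm_on_sum_le[OF kls.Jm_finite sq_cder[OF e_Ck_Jm]])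
  also have "\<dots> \<le> (\<Sum>j\<in>kls.Jm m. \<eta>)"
  proof (rule sum_mono)
    fix j assume "j \<in> kls.Jm m"
    then have j: "j \<in> J" by (rule kls.Jm_J)
    have "L2_norm_on idx_measure (cder (e j)) = 1" using sob_norm_Ck[OF e_Ck[OF j]] sob_norm_e[OF j] by simp
    then show "\<bar>kls.xi j w - of_rat (q j)\<bar> * L2_norm_on idx_measure (cder (e j)) \<le> \<eta>"
      using q[rule_format, of j] by simp
  qed
  also have "\<dots> \<le> (real m + 1) * \<eta>"
  proof -
    have "card (kls.Jm m) \<le> card {..m}" by (rule card_mono) (auto simp: kls.Jm_def)
    then have "real (card (kls.Jm m)) \<le> real m + 1" by simp
    then show ?thesis using \<eta> by (simp add: mult_right_mono)
  qed
  also have "(real m + 1) * \<eta> = \<epsilon> / 2" by (simp add: \<eta>_def field_simps)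
  finally have "path_dist l w < \<epsilon> / 2 + \<epsilon> / 2" by simp
  then show ?thesis by (intro exI[of _ l]) simp
qed

lemma zero_sobolev: "(\<lambda>_. 0) \<in> sobolev \<Theta> k"
  by (rule Ck_unif_sobolev[OF open_Theta bounded_Theta Ck_unif_zero[OF open_Theta]])

lemma sob_path_sobolev: "sob_path \<Theta> k X w \<in> sobolev \<Theta> k"
  using zero_sobolev by (simp add: sob_path_def)

text \<open>For good paths, lying in \<open>U\<close> means lying in one of countably many balls
  inside \<open>U\<close> with rational combinations as centres and rational radii; these events are
  measurable through \<open>path_dist\<close>. The other paths form a null set, which completeness
  of \<open>M\<close> absorbs.\<close>

lemma sob_path_vimage:
  assumes complete: "complete_measure M" and U: "U \<subseteq> sobolev \<Theta> k"
    and opn: "\<And>f. f \<in> U \<Longrightarrow> \<exists>\<epsilon>>0. \<forall>g\<in>sobolev \<Theta> k. sob_norm \<Theta> k (\<lambda>x. g x - f x) < \<epsilon> \<longrightarrow> g \<in> U"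
  shows "sob_path \<Theta> k X -` U \<inter> space M \<in> sets M"
proof -
  define C where "C = {(l, q :: rat). \<forall>g\<in>sobolev \<Theta> k. sob_norm \<Theta> k (\<lambda>x. g x - rat_comb l x) < of_rat q \<longrightarrow> g \<in> U}"
  define V where "V = (\<Union>c\<in>C. {w \<in> space M. path_dist (fst c) w < of_rat (snd c)})"
  have Vm: "V \<in> sets M"
    unfolding V_def
  proof (rule sets.countable_UN')
    show "countable C" by (rule countableI_type)
    show "(\<lambda>c. {w \<in> space M. path_dist (fst c) w < of_rat (snd c)}) ` C \<subseteq> sets M"
      using path_dist_measurable by (intro image_subsetI borel_measurable_less) simp_all
  qed
  have iff: "w \<in> V \<longleftrightarrow> w \<in> sob_path \<Theta> k X -` U \<inter> space M" if w: "good_path w" for w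
  proof
    assume "w \<in> V"
    then obtain c where c: "c \<in> C" "w \<in> space M" "path_dist (fst c) w < of_rat (snd c)" unfolding V_def by blast
    obtain l q where lq: "c = (l, q)" by (cases c)
    have "\<forall>g\<in>sobolev \<Theta> k. sob_norm \<Theta> k (\<lambda>x. g x - rat_comb l x) < of_rat q \<longrightarrow> g \<in> U"
      using c(1) unfolding C_def lq by simp
    from this[rule_format, OF good_pathD(1)[OF w]] have "(\<lambda>t. X t w) \<in> U"
      using c(3) unfolding path_dist_eq[OF w] lq by simp
    then show "w \<in> sob_path \<Theta> k X -` U \<inter> space M" using c(2) good_sob_path[OF w] by simp
  next
    assume a: "w \<in> sob_path \<Theta> k X -` U \<inter> space M"
    then have XU: "(\<lambda>t. X t w) \<in> U" using good_sob_path[OF w] by simp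
    obtain \<epsilon> where \<epsilon>: "0 < \<epsilon>" "\<forall>g\<in>sobolev \<Theta> k. sob_norm \<Theta> k (\<lambda>x. g x - X x w) < \<epsilon> \<longrightarrow> g \<in> U"
      using opn[OF XU] by (elim exE conjE)
    have "0 < \<epsilon> / 3" using \<epsilon>(1) by simp
    from path_dist_small[OF w this] obtain l where l: "path_dist l w < \<epsilon> / 3" by (elim exE)
    \<comment> \<open>Above \<open>\<epsilon> / 3\<close>, so that the ball around
      \<open>rat_comb l\<close> contains the path; below \<open>2 * \<epsilon> / 3\<close>, so that
      this ball stays within distance \<open>\<epsilon>\<close> of the path.\<close>
    obtain q where q: "\<epsilon> / 3 < of_rat q" "of_rat q < 2 * \<epsilon> / 3"
      using of_rat_dense[of "\<epsilon> / 3" "2 * \<epsilon> / 3"] \<epsilon>(1) by auto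
    have "(l, q) \<in> C"
      unfolding C_def
    proof (intro CollectI case_prodI ballI impI)
      fix g assume g: "g \<in> sobolev \<Theta> k" "sob_norm \<Theta> k (\<lambda>x. g x - rat_comb l x) < of_rat q"
      have "sob_norm \<Theta> k (\<lambda>x. g x - X x w)
          \<le> sob_norm \<Theta> k (\<lambda>x. g x - rat_comb l x) + sob_norm \<Theta> k (\<lambda>x. rat_comb l x - X x w)"
        by (rule sob_norm_triangle[OF g(1) rat_comb_sobolev good_pathD(1)[OF w]])
      also have "sob_norm \<Theta> k (\<lambda>x. rat_comb l x - X x w) = path_dist l w"
        unfolding path_dist_def L2_norm_on_minus_commute[of _ "\<lambda>p. Zp p w"]
        by (rule sob_dist_eq[OF rat_comb_sobolev good_pathD(1)[OF w] sq_cder[OF rat_comb_Ck] AE_wder_cder[OF rat_comb_Ck]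
            good_pathD(2)[OF w] good_wder[OF w]])
      finally have "sob_norm \<Theta> k (\<lambda>x. g x - X x w) < \<epsilon>" using g(2) l q(2) by linarith
      then show "g \<in> U" by (rule \<epsilon>(2)[rule_format, OF g(1)])
    qed
    moreover have "path_dist l w < of_rat q" using l q(1) by linarith
    ultimately show "w \<in> V" unfolding V_def using a by (intro UN_I[of "(l, q)"]) simp_all
  qed
  have "AE w in M. w \<in> V \<longleftrightarrow> w \<in> sob_path \<Theta> k X -` U \<inter> space M"
    using AE_good_path by eventually_elim (rule iff)
  then show ?thesis
    by (rule complete_measure.in_sets_AE[OF complete _ Vm]) (rule Int_lower2)
qed

theorem sob_random_element_field:
  assumes "complete_measure M"
  shows "sob_random_element \<Theta> k M X"
  unfolding sob_random_element_def
proof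
  show "AE w in M. (\<lambda>t. X t w) \<in> sobolev \<Theta> k"
    using AE_good_path by eventually_elim (rule good_pathD(1))
  show "sob_path \<Theta> k X \<in> M \<rightarrow>\<^sub>M sob_borel \<Theta> k"
    unfolding sob_borel_def
  proof (rule measurable_measure_of)
    show "{U. U \<subseteq> sobolev \<Theta> k \<and> (\<forall>f\<in>U. \<exists>\<epsilon>>0. \<forall>g\<in>sobolev \<Theta> k. sob_norm \<Theta> k (\<lambda>x. g x - f x) < \<epsilon> \<longrightarrow> g \<in> U)}
      \<subseteq> Pow (sobolev \<Theta> k)" by blast
    show "sob_path \<Theta> k X \<in> space M \<rightarrow> sobolev \<Theta> k" using sob_path_sobolev by (rule Pi_I)
    fix U assume "U \<in> {U. U \<subseteq> sobolev \<Theta> k \<and> (\<forall>f\<in>U. \<exists>\<epsilon>>0. \<forall>g\<in>sobolev \<Theta> k. sob_norm \<Theta> k (\<lambda>x. g x - f x) < \<epsilon> \<longrightarrow> g \<in> U)}"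
    then have U: "U \<subseteq> sobolev \<Theta> k \<and> (\<forall>f\<in>U. \<exists>\<epsilon>>0. \<forall>g\<in>sobolev \<Theta> k. sob_norm \<Theta> k (\<lambda>x. g x - f x) < \<epsilon> \<longrightarrow> g \<in> U)"
      by (rule CollectD)
    show "sob_path \<Theta> k X -` U \<inter> space M \<in> sets M"
      by (rule sob_path_vimage[OF assms conjunct1[OF U] bspec[OF conjunct2[OF U]]])
  qed
qed

subsection \<open>Mean-square continuous weak derivative processes\<close>

lemma ms_continuous_der:
  assumes \<alpha>: "mi_order \<alpha> \<le> k"
  shows "ms_continuous \<Theta> M (der \<alpha>)"
  unfolding ms_continuous_def
proof (intro ballI conjI)
  fix t assume t: "t \<in> \<Theta>"
  show "integrable M (\<lambda>w. (der \<alpha> t w)\<^sup>2)" by (rule sq_integrable_square[OF sq_der[OF \<alpha> t]])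
  show "((\<lambda>s. LINT w|M. (der \<alpha> s w - der \<alpha> t w)\<^sup>2) \<longlongrightarrow> 0) (at t within \<Theta>)"
  proof (rule tendstoI)
    fix \<epsilon> :: real assume \<epsilon>: "0 < \<epsilon>"
    obtain \<delta> where \<delta>: "0 < \<delta>" "\<forall>s\<in>\<Theta>. \<forall>t\<in>\<Theta>. dist s t < \<delta> \<longrightarrow> (\<integral>w. (der \<alpha> s w - der \<alpha> t w)\<^sup>2 \<partial>M) < \<epsilon>"
      using der_uniformly_ms_continuous[OF \<alpha> \<epsilon>] by (elim exE conjE)
    show "\<forall>\<^sub>F s in at t within \<Theta>. dist (LINT w|M. (der \<alpha> s w - der \<alpha> t w)\<^sup>2) 0 < \<epsilon>"
      unfolding eventually_at
    proof (intro exI[of _ \<delta>] conjI ballI impI \<delta>(1))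
      fix s assume "s \<in> \<Theta>" "s \<noteq> t \<and> dist s t < \<delta>"
      then have "(\<integral>w. (der \<alpha> s w - der \<alpha> t w)\<^sup>2 \<partial>M) < \<epsilon>" using \<delta>(2) t by blast
      then show "dist (LINT w|M. (der \<alpha> s w - der \<alpha> t w)\<^sup>2) 0 < \<epsilon>" by simp
    qed
  qed
qed

lemma ms_weak_deriv_process_der:
  assumes \<alpha>: "mi_order \<alpha> \<le> k"
  shows "ms_weak_deriv_process \<Theta> M \<alpha> X (der \<alpha>)"
  unfolding ms_weak_deriv_process_def weak_deriv_process_def
proof (intro conjI allI impI der_measurable[OF \<alpha>] ms_continuous_der[OF \<alpha>])
  have \<alpha>': "\<alpha> \<in> Idx" using \<alpha> by (simp add: Idx_iff)
  show "AE w in M. L2_fun \<Theta> (\<lambda>t. der \<alpha> t w)"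
    using AE_good_path
  proof eventually_elim
    case (elim w)
    then show ?case using sq_idxD[OF good_pathD(2)[OF elim] \<alpha>'] by (simp add: Zp_def L2_fun_sq)
  qed
  show "AE w in M. (LINT t|lebesgue_on \<Theta>. X t w * cderiv \<alpha> \<phi> t) = (-1) ^ mi_order \<alpha> * (LINT t|lebesgue_on \<Theta>. der \<alpha> t w * \<phi> t)"
    if \<phi>: "test_fun \<Theta> \<phi>" for \<phi>
    using AE_good_path by eventually_elim (rule has_weak_derivD(3)[OF good_pathD(3)[OF _ \<alpha>'] \<phi>])
qed

lemma field_section_measurable:
  assumes "measurable_field \<Theta> M Z" "t \<in> \<Theta>"
  shows "Z t \<in> borel_measurable M"
  using measurable_Pair2[OF assms(1)[unfolded measurable_field_def], of t] assms(2) by (simp add: space_restrict_space)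

lemma ms_continuous_sq:
  assumes "measurable_field \<Theta> M Z" "ms_continuous \<Theta> M Z" "t \<in> \<Theta>"
  shows "sq_integrable M (Z t)"
  using field_section_measurable[OF assms(1,3)] conjunct1[OF bspec[OF assms(2)[unfolded ms_continuous_def] assms(3)]]
  by (simp add: sq_integrable_def)

text \<open>Two mean-square continuous weak derivative processes have the same integrals against test functions almost surely.
  By Fubini's theorem and the fundamental lemma they agree at every point.\<close>

lemma ms_weak_deriv_process_unique:
  assumes Z: "ms_weak_deriv_process \<Theta> M \<alpha> X Z" and D: "ms_weak_deriv_process \<Theta> M \<alpha> X D" and t0: "t0 \<in> \<Theta>"
  shows "AE w in M. Z t0 w = D t0 w"
proof -
  note Z' = Z[unfolded ms_weak_deriv_process_def weak_deriv_process_def]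
  note D' = D[unfolded ms_weak_deriv_process_def weak_deriv_process_def]
  have Zm: "measurable_field \<Theta> M Z" and Zc: "ms_continuous \<Theta> M Z" and ZL: "AE w in M. L2_fun \<Theta> (\<lambda>t. Z t w)"
    and Zt: "\<And>\<phi>. test_fun \<Theta> \<phi> \<Longrightarrow> AE w in M. (LINT t|lebesgue_on \<Theta>. X t w * cderiv \<alpha> \<phi> t) = (-1) ^ mi_order \<alpha> * (LINT t|lebesgue_on \<Theta>. Z t w * \<phi> t)"
    using Z' by simp_all
  have Dm: "measurable_field \<Theta> M D" and Dc: "ms_continuous \<Theta> M D" and DL: "AE w in M. L2_fun \<Theta> (\<lambda>t. D t w)"
    and Dt: "\<And>\<phi>. test_fun \<Theta> \<phi> \<Longrightarrow> AE w in M. (LINT t|lebesgue_on \<Theta>. X t w * cderiv \<alpha> \<phi> t) = (-1) ^ mi_order \<alpha> * (LINT t|lebesgue_on \<Theta>. D t w * \<phi> t)"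
    using D' by simp_all
  note sqZ = ms_continuous_sq[OF Zm Zc] and sqD = ms_continuous_sq[OF Dm Dc]
  define W where "W t w = Z t w - D t w" for t w
  have sqW: "sq_integrable M (W t)" if "t \<in> \<Theta>" for t
    unfolding W_def by (rule sq_integrable_diff[OF sqZ[OF that] sqD[OF that]])
  define Y where "Y = W t0"
  have sqY: "sq_integrable M Y" unfolding Y_def by (rule sqW[OF t0])
  have near: "\<forall>\<^sub>F s in at t within \<Theta>. s \<in> \<Theta>" for t by (simp add: eventually_at_filter)
  have Wc: "((\<lambda>s. L2_norm_on M (\<lambda>w. W s w - W t w)) \<longlongrightarrow> 0) (at t within \<Theta>)" if t: "t \<in> \<Theta>" for t
  proof (rule Lim_null_comparison)
    have z: "((\<lambda>s. LINT w|M. (Z s w - Z t w)\<^sup>2) \<longlongrightarrow> 0) (at t within \<Theta>)"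
      by (rule conjunct2[OF bspec[OF Zc[unfolded ms_continuous_def] t]])
    have d: "((\<lambda>s. LINT w|M. (D s w - D t w)\<^sup>2) \<longlongrightarrow> 0) (at t within \<Theta>)"
      by (rule conjunct2[OF bspec[OF Dc[unfolded ms_continuous_def] t]])
    have "((\<lambda>s. sqrt (LINT w|M. (Z s w - Z t w)\<^sup>2) + sqrt (LINT w|M. (D s w - D t w)\<^sup>2)) \<longlongrightarrow> sqrt 0 + sqrt 0) (at t within \<Theta>)"
      by (rule tendsto_add[OF tendsto_real_sqrt[OF z] tendsto_real_sqrt[OF d]])
    then show "((\<lambda>s. sqrt (LINT w|M. (Z s w - Z t w)\<^sup>2) + sqrt (LINT w|M. (D s w - D t w)\<^sup>2)) \<longlongrightarrow> 0) (at t within \<Theta>)" by simp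
    show "\<forall>\<^sub>F s in at t within \<Theta>. norm (L2_norm_on M (\<lambda>w. W s w - W t w))
        \<le> sqrt (LINT w|M. (Z s w - Z t w)\<^sup>2) + sqrt (LINT w|M. (D s w - D t w)\<^sup>2)"
      using near
    proof eventually_elim
      case (elim s)
      have "(\<lambda>w. W s w - W t w) = (\<lambda>w. (Z s w - Z t w) + (D t w - D s w))" by (simp add: W_def fun_eq_iff)
      then have "L2_norm_on M (\<lambda>w. W s w - W t w) \<le> L2_norm_on M (\<lambda>w. Z s w - Z t w) + L2_norm_on M (\<lambda>w. D t w - D s w)"
        using L2_norm_on_triangle[OF sq_integrable_diff[OF sqZ[OF elim] sqZ[OF t]] sq_integrable_diff[OF sqD[OF t] sqD[OF elim]]] by simp
      also have "L2_norm_on M (\<lambda>w. D t w - D s w) = L2_norm_on M (\<lambda>w. D s w - D t w)" by (rule L2_norm_on_minus_commute)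
      finally show ?case by (simp add: L2_norm_on_def)
    qed
  qed
  have Wcont: "continuous_on \<Theta> (\<lambda>t. L2_norm_on M (W t))"
    unfolding continuous_on_def
  proof
    fix t assume t: "t \<in> \<Theta>"
    show "((\<lambda>s. L2_norm_on M (W s)) \<longlongrightarrow> L2_norm_on M (W t)) (at t within \<Theta>)"
    proof (rule LIM_zero_cancel, rule Lim_null_comparison[OF _ Wc[OF t]])
      show "\<forall>\<^sub>F s in at t within \<Theta>. norm (L2_norm_on M (W s) - L2_norm_on M (W t)) \<le> L2_norm_on M (\<lambda>w. W s w - W t w)"
        using near
      proof eventually_elim
        case (elim s)
        have "L2_norm_on M (W s) \<le> L2_norm_on M (\<lambda>w. W s w - W t w) + L2_norm_on M (W t)"
          using L2_norm_on_triangle[OF sq_integrable_diff[OF sqW[OF elim] sqW[OF t]] sqW[OF t]] by simp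
        moreover have "L2_norm_on M (W t) \<le> L2_norm_on M (\<lambda>w. W t w - W s w) + L2_norm_on M (W s)"
          using L2_norm_on_triangle[OF sq_integrable_diff[OF sqW[OF t] sqW[OF elim]] sqW[OF elim]] by simp
        moreover have "L2_norm_on M (\<lambda>w. W t w - W s w) = L2_norm_on M (\<lambda>w. W s w - W t w)" by (rule L2_norm_on_minus_commute)
        ultimately show ?case by simp
      qed
    qed
  qed
  \<comment> \<open>Correlating \<open>W t\<close> with its value \<open>Y\<close> at
    \<open>t0\<close> gives a continuous real function whose value at \<open>t0\<close> is the
    second moment that has to vanish.\<close>
  define u where "u t = (\<integral>w. Y w * W t w \<partial>M)" for t
  have ucont: "continuous_on \<Theta> u"
    unfolding continuous_on_def
  proof
    fix t assume t: "t \<in> \<Theta>"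
    show "(u \<longlongrightarrow> u t) (at t within \<Theta>)"
    proof (rule LIM_zero_cancel, rule Lim_null_comparison[OF _ tendsto_mult_right_zero[OF Wc[OF t], of "L2_norm_on M Y"]])
      show "\<forall>\<^sub>F s in at t within \<Theta>. norm (u s - u t) \<le> L2_norm_on M Y * L2_norm_on M (\<lambda>w. W s w - W t w)"
        using near
      proof eventually_elim
        case (elim s)
        have "u s - u t = (\<integral>w. Y w * (W s w - W t w) \<partial>M)"
          unfolding u_def using sq_integrable_mult[OF sqY sqW[OF elim]] sq_integrable_mult[OF sqY sqW[OF t]]
          by (simp add: right_diff_distrib)
        then show ?case using L2_Cauchy_Schwarz_norm[OF sqY sq_integrable_diff[OF sqW[OF elim] sqW[OF t]]] by simp
      qed
    qed
  qed
  interpret L: finite_measure "lebesgue_on \<Theta>" by (rule finite_measure_Theta)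
  interpret P: pair_sigma_finite "lebesgue_on \<Theta>" M by unfold_locales
  have "AE t in lebesgue_on \<Theta>. u t = 0"
  proof (rule fundamental_lemma[OF open_Theta loc_integrable_continuous[OF ucont]])
    fix \<phi> assume \<phi>: "test_fun \<Theta> \<phi>"
    define K where "K = closure {x. \<phi> x \<noteq> 0}"
    have K: "compact K" "K \<subseteq> \<Theta>" using test_funD[OF \<phi>] by (simp_all add: K_def)
    have z: "\<phi> x = 0" if "x \<notin> K" for x using cderiv_outside_support[of x \<phi> mi_zero] that by (simp add: K_def)
    have sq\<phi>: "sq_integrable (lebesgue_on \<Theta>) \<phi>" using sq_integrable_test_fun[OF open_Theta bounded_Theta \<phi>, of mi_zero] by simp
    \<comment> \<open>Mean-square continuity bounds the norms on compact sets; the support of the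
      test function is compact, and this bound makes Fubini's theorem applicable.\<close>
    have "bounded ((\<lambda>t. L2_norm_on M (W t)) ` K)"
      by (rule compact_imp_bounded[OF compact_continuous_image[OF continuous_on_subset[OF Wcont K(2)] K(1)]])
    then obtain C where C: "\<forall>x\<in>(\<lambda>t. L2_norm_on M (W t)) ` K. norm x \<le> C" unfolding bounded_iff by (elim exE)
    have CK: "L2_norm_on M (W t) \<le> C" if "t \<in> K" for t using bspec[OF C imageI[OF that]] by simp
    have m: "(\<lambda>(t, w). Y w * W t w * \<phi> t) \<in> borel_measurable (lebesgue_on \<Theta> \<Otimes>\<^sub>M M)"
    proof -
      have "(\<lambda>q. Y (snd q) * (Z (fst q) (snd q) - D (fst q) (snd q)) * \<phi> (fst q)) \<in> borel_measurable (lebesgue_on \<Theta> \<Otimes>\<^sub>M M)"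
      proof (intro borel_measurable_times borel_measurable_diff)
        show "(\<lambda>q. Y (snd q)) \<in> borel_measurable (lebesgue_on \<Theta> \<Otimes>\<^sub>M M)"
          by (rule measurable_compose[OF measurable_snd sq_integrable_measurable[OF sqY]])
        show "(\<lambda>q. \<phi> (fst q)) \<in> borel_measurable (lebesgue_on \<Theta> \<Otimes>\<^sub>M M)"
          by (rule measurable_compose[OF measurable_fst sq_integrable_measurable[OF sq\<phi>]])
        show "(\<lambda>q. Z (fst q) (snd q)) \<in> borel_measurable (lebesgue_on \<Theta> \<Otimes>\<^sub>M M)"
          using field_measurable_lebesgue[OF Zm] by (simp add: case_prod_beta')
        show "(\<lambda>q. D (fst q) (snd q)) \<in> borel_measurable (lebesgue_on \<Theta> \<Otimes>\<^sub>M M)"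
          using field_measurable_lebesgue[OF Dm] by (simp add: case_prod_beta')
      qed
      then show ?thesis by (simp add: W_def case_prod_beta')
    qed
    have i: "integrable (lebesgue_on \<Theta> \<Otimes>\<^sub>M M) (\<lambda>(t, w). Y w * W t w * \<phi> t)"
    proof (rule P.Fubini_integrable[OF m])
      show "AE t in lebesgue_on \<Theta>. integrable M (\<lambda>w. case (t, w) of (t, w) \<Rightarrow> Y w * W t w * \<phi> t)"
        by (rule AE_I2) (simp add: sq_integrable_mult[OF sqY sqW])
      show "integrable (lebesgue_on \<Theta>) (\<lambda>t. \<integral>w. norm (case (t, w) of (t, w) \<Rightarrow> Y w * W t w * \<phi> t) \<partial>M)"
      proof (rule Bochner_Integration.integrable_bound)
        show "integrable (lebesgue_on \<Theta>) (\<lambda>t. L2_norm_on M Y * C * \<phi> t)"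
          using L.sq_integrable_integrable[OF sq\<phi>] by simp
        have "(\<lambda>(t, w). norm (Y w * W t w * \<phi> t)) \<in> borel_measurable (lebesgue_on \<Theta> \<Otimes>\<^sub>M M)"
          using borel_measurable_abs[OF m] by (simp add: case_prod_beta')
        from borel_measurable_lebesgue_integral[OF this]
        show "(\<lambda>t. \<integral>w. norm (case (t, w) of (t, w) \<Rightarrow> Y w * W t w * \<phi> t) \<partial>M) \<in> borel_measurable (lebesgue_on \<Theta>)" by simp
        show "AE t in lebesgue_on \<Theta>. norm (\<integral>w. norm (case (t, w) of (t, w) \<Rightarrow> Y w * W t w * \<phi> t) \<partial>M)
            \<le> norm (L2_norm_on M Y * C * \<phi> t)"
        proof (rule AE_I2)
          fix t assume "t \<in> space (lebesgue_on \<Theta>)"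
          then have t: "t \<in> \<Theta>" by simp
          show "norm (\<integral>w. norm (case (t, w) of (t, w) \<Rightarrow> Y w * W t w * \<phi> t) \<partial>M) \<le> norm (L2_norm_on M Y * C * \<phi> t)"
          proof (cases "t \<in> K")
            case True
            have sqa: "sq_integrable M (\<lambda>w. \<bar>Y w\<bar>)" "sq_integrable M (\<lambda>w. \<bar>W t w\<bar>)"
              using borel_measurable_abs[OF sq_integrable_measurable[OF sqY]] sq_integrable_square[OF sqY]
                borel_measurable_abs[OF sq_integrable_measurable[OF sqW[OF t]]] sq_integrable_square[OF sqW[OF t]]
              by (simp_all add: sq_integrable_def)
            have e: "(\<integral>w. norm (case (t, w) of (t, w) \<Rightarrow> Y w * W t w * \<phi> t) \<partial>M) = (\<integral>w. \<bar>Y w\<bar> * \<bar>W t w\<bar> \<partial>M) * \<bar>\<phi> t\<bar>"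
              by (simp add: abs_mult)
            have c: "\<bar>\<integral>w. \<bar>Y w\<bar> * \<bar>W t w\<bar> \<partial>M\<bar> \<le> L2_norm_on M Y * L2_norm_on M (W t)"
              using L2_Cauchy_Schwarz_norm[OF sqa] by (simp add: L2_norm_on_def)
            also have "\<dots> \<le> L2_norm_on M Y * C" by (rule mult_left_mono[OF CK[OF True]]) simp
            also have "\<dots> \<le> \<bar>L2_norm_on M Y * C\<bar>" by (rule abs_ge_self)
            finally show ?thesis unfolding e by (simp only: real_norm_def abs_mult abs_abs mult_right_mono abs_ge_zero)
          qed (simp add: z)
        qed
      qed
    qed
    have "(LINT t|lebesgue_on \<Theta>. u t * \<phi> t) = (LINT t|lebesgue_on \<Theta>. \<integral>w. Y w * W t w * \<phi> t \<partial>M)"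
      by (simp add: u_def)
    also have "\<dots> = (\<integral>w. (LINT t|lebesgue_on \<Theta>. Y w * W t w * \<phi> t) \<partial>M)"
      by (rule P.Fubini_integral[OF i, symmetric])
    also have "\<dots> = (\<integral>w. 0 \<partial>M)"
    proof (rule integral_cong_AE)
      show "(\<lambda>w. LINT t|lebesgue_on \<Theta>. Y w * W t w * \<phi> t) \<in> borel_measurable M"
        by (rule borel_measurable_integrable[OF P.integrable_snd[OF i]])
      show "AE w in M. (LINT t|lebesgue_on \<Theta>. Y w * W t w * \<phi> t) = 0"
        using ZL DL Zt[OF \<phi>] Dt[OF \<phi>]
      proof eventually_elim
        case (elim w)
        have "(-1) ^ mi_order \<alpha> * (LINT t|lebesgue_on \<Theta>. Z t w * \<phi> t) = (-1) ^ mi_order \<alpha> * (LINT t|lebesgue_on \<Theta>. D t w * \<phi> t)"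
          by (rule trans[OF elim(3)[symmetric] elim(4)])
        then have e: "(LINT t|lebesgue_on \<Theta>. Z t w * \<phi> t) = (LINT t|lebesgue_on \<Theta>. D t w * \<phi> t)" by simp
        have "(LINT t|lebesgue_on \<Theta>. Y w * W t w * \<phi> t) = Y w * (LINT t|lebesgue_on \<Theta>. Z t w * \<phi> t - D t w * \<phi> t)"
          by (simp add: W_def left_diff_distrib mult.assoc flip: integral_mult_right_zero)
        also have "\<dots> = 0"
          using sq_integrable_mult[OF elim(1)[unfolded L2_fun_sq] sq\<phi>] sq_integrable_mult[OF elim(2)[unfolded L2_fun_sq] sq\<phi>] e by simp
        finally show ?case .
      qed
    qed simp
    finally show "(LINT t|lebesgue_on \<Theta>. u t * \<phi> t) = 0" by simp
  qed
  then have "u t0 = 0" by (rule AE_zero_continuous[OF open_Theta ucont _ t0])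
  then have "(\<integral>w. (Y w)\<^sup>2 \<partial>M) = 0" by (simp add: u_def Y_def power2_eq_square)
  then have "AE w in M. Y w = 0" by (rule iffD1[OF square_integral_zero_AE[OF sqY]])
  then show ?thesis by eventually_elim (simp add: Y_def W_def)
qed

text \<open>At each \<open>t\<close> the process \<open>Z\<close> agrees almost surely with the
  constructed derivative field, and the Sobolev coefficients agree with the \<open>xi j\<close>. The
  expectation is therefore the diagonal value of the residual kernel, to which
  \<open>kres_uniform\<close> applies.\<close>

theorem expansion_uniform:
  assumes Z: "ms_weak_deriv_process \<Theta> M \<alpha> X Z" and \<alpha>: "mi_order \<alpha> \<le> k"
  shows "(\<lambda>m::nat. SUP t\<in>\<Theta>. \<integral>\<^sup>+ w. ennreal (\<bar>Z t w -
            (\<Sum>j | j \<in> J \<and> j \<le> m. sob_inner \<Theta> k (sob_path \<Theta> k X w) (e j) * cderiv \<alpha> (e j) t)\<bar>\<^sup>2) \<partial>M) \<longlonglongrightarrow> 0"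
proof -
  have eq: "(\<integral>\<^sup>+ w. ennreal (\<bar>Z t w -
            (\<Sum>j | j \<in> J \<and> j \<le> m. sob_inner \<Theta> k (sob_path \<Theta> k X w) (e j) * cderiv \<alpha> (e j) t)\<bar>\<^sup>2) \<partial>M)
      = ennreal (kls.kres m (\<alpha>, t) (\<alpha>, t))" if t: "t \<in> \<Theta>" for t m
  proof -
    have p: "(\<alpha>, t) \<in> space idx_measure" using t \<alpha> by (simp add: Idx_iff)
    have "(\<integral>\<^sup>+ w. ennreal (\<bar>Z t w -
            (\<Sum>j | j \<in> J \<and> j \<le> m. sob_inner \<Theta> k (sob_path \<Theta> k X w) (e j) * cderiv \<alpha> (e j) t)\<bar>\<^sup>2) \<partial>M)
        = (\<integral>\<^sup>+ w. ennreal ((kls.remainder m (\<alpha>, t) w)\<^sup>2) \<partial>M)"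
    proof (rule nn_integral_cong_AE)
      show "AE w in M. ennreal (\<bar>Z t w -
            (\<Sum>j | j \<in> J \<and> j \<le> m. sob_inner \<Theta> k (sob_path \<Theta> k X w) (e j) * cderiv \<alpha> (e j) t)\<bar>\<^sup>2)
          = ennreal ((kls.remainder m (\<alpha>, t) w)\<^sup>2)"
        using ms_weak_deriv_process_unique[OF Z ms_weak_deriv_process_der[OF \<alpha>] t] AE_good_path
      proof eventually_elim
        case (elim w)
        have "(\<Sum>j | j \<in> J \<and> j \<le> m. sob_inner \<Theta> k (sob_path \<Theta> k X w) (e j) * cderiv \<alpha> (e j) t)
            = (\<Sum>j\<in>kls.Jm m. kls.xi j w * cder (e j) (\<alpha>, t))"
          unfolding kls.Jm_def by (intro sum.cong refl) (simp add: good_coef[OF elim(2)] cder_def)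
        then show ?case using elim(1) by (simp add: kls.remainder_def Zp_def)
      qed
    qed
    also have "\<dots> = ennreal (\<integral>w. (kls.remainder m (\<alpha>, t) w)\<^sup>2 \<partial>M)"
      by (rule nn_integral_eq_integral[OF sq_integrable_square[OF kls.sq_remainder[OF p]]]) simp
    also have "(\<integral>w. (kls.remainder m (\<alpha>, t) w)\<^sup>2 \<partial>M) = kls.kres m (\<alpha>, t) (\<alpha>, t)" by (rule kls.remainder_square[OF p])
    finally show ?thesis .
  qed
  have "(\<lambda>m. SUP t\<in>\<Theta>. ennreal (kls.kres m (\<alpha>, t) (\<alpha>, t))) \<longlonglongrightarrow> 0"
  proof (rule order_tendstoI)
    fix a :: ennreal assume a: "0 < a"
    \<comment> \<open>A supremum of values below \<open>\<epsilon>\<close> is only at most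
      \<open>\<epsilon>\<close>, so some room below \<open>a\<close> is kept; lying below
      \<open>a\<close>, the bound \<open>b\<close> is also finite.\<close>
    obtain b where b: "0 < b" "b < a" using dense[OF a] by (elim exE conjE)
    obtain \<epsilon> where \<epsilon>: "b = ennreal \<epsilon>" "0 \<le> \<epsilon>" using b(2) by (cases b) auto
    have \<epsilon>0: "0 < \<epsilon>" using b(1) \<epsilon> by simp
    obtain m0 where m0: "\<forall>m\<ge>m0. \<forall>p\<in>space idx_measure. kls.kres m p p < \<epsilon>"
      using kls.kres_uniform[OF \<epsilon>0] by (elim exE)
    show "\<forall>\<^sub>F m in sequentially. (SUP t\<in>\<Theta>. ennreal (kls.kres m (\<alpha>, t) (\<alpha>, t))) < a"
    proof (rule eventually_sequentiallyI[of m0])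
      fix m assume m: "m0 \<le> m"
      have "(SUP t\<in>\<Theta>. ennreal (kls.kres m (\<alpha>, t) (\<alpha>, t))) \<le> b"
        unfolding \<epsilon>(1)
      proof (rule SUP_least, rule ennreal_leI, rule less_imp_le)
        fix t assume t: "t \<in> \<Theta>"
        have "(\<alpha>, t) \<in> space idx_measure" using t \<alpha> by (simp add: Idx_iff)
        then show "kls.kres m (\<alpha>, t) (\<alpha>, t) < \<epsilon>" by (rule m0[rule_format, OF m])
      qed
      then show "(SUP t\<in>\<Theta>. ennreal (kls.kres m (\<alpha>, t) (\<alpha>, t))) < a" using b(2) by (rule order.strict_trans1)
    qed
  qed simp
  moreover have "(SUP t\<in>\<Theta>. \<integral>\<^sup>+ w. ennreal (\<bar>Z t w -
            (\<Sum>j | j \<in> J \<and> j \<le> m. sob_inner \<Theta> k (sob_path \<Theta> k X w) (e j) * cderiv \<alpha> (e j) t)\<bar>\<^sup>2) \<partial>M)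
      = (SUP t\<in>\<Theta>. ennreal (kls.kres m (\<alpha>, t) (\<alpha>, t)))" for m
    by (rule SUP_cong[OF refl eq])
  ultimately show ?thesis by simp
qed

end

theorem theorem4p8:
  fixes \<Theta> :: "(real ^ 'n::finite) set"
    and M :: "'w measure"
    and X :: "real ^ 'n \<Rightarrow> 'w \<Rightarrow> real"
    and k :: nat
    and J :: "nat set"
    and lam :: "nat \<Rightarrow> real"
    and e :: "nat \<Rightarrow> real ^ 'n \<Rightarrow> real"
  assumes "prob_space M" and "complete_measure M"
    and "open \<Theta>" and "bounded \<Theta>"
    and "measurable_field \<Theta> M X" and "second_order \<Theta> M X" and "centred \<Theta> M X"
    and "Ckk_unif \<Theta> k (cov_kernel M X)"
    and "eigensystem \<Theta> k (kernel_op \<Theta> k (cov_kernel M X)) J lam e"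
  shows "nuclear_op \<Theta> k (kernel_op \<Theta> k (cov_kernel M X)) \<and>
    sob_random_element \<Theta> k M X \<and>
    ms_weak_deriv_process \<Theta> M mi_zero X X \<and>
    (\<forall>\<alpha>. mi_order \<alpha> \<le> k \<longrightarrow>
      (\<exists>Z. ms_weak_deriv_process \<Theta> M \<alpha> X Z) \<and>
      (\<forall>Z. ms_weak_deriv_process \<Theta> M \<alpha> X Z \<longrightarrow>
        (\<lambda>m::nat. SUP t\<in>\<Theta>. \<integral>\<^sup>+ \<omega>. ennreal (\<bar>Z t \<omega> -
            (\<Sum>j | j \<in> J \<and> j \<le> m. sob_inner \<Theta> k (sob_path \<Theta> k X \<omega>) (e j) * cderiv \<alpha> (e j) t)\<bar>\<^sup>2) \<partial>M)
          \<longlonglongrightarrow> 0))"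
proof -
  have "ck_field M \<Theta> X k"
    by (rule ck_field.intro[OF assms(1) ck_field_axioms.intro[OF assms(3-8)]])
  then interpret ck_eigen M \<Theta> X k J lam e
    by (rule ck_eigen.intro[OF _ ck_eigen_axioms.intro[OF assms(9)]])
  have "ms_weak_deriv_process \<Theta> M mi_zero X X"
    using ms_weak_deriv_process_der[of mi_zero] by simp
  then show ?thesis
    using kernel_op_nuclear sob_random_element_field[OF assms(2)] ms_weak_deriv_process_der expansion_uniform
    by (intro conjI allI impI) blast+
qed

end
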